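(* Let $(M,\omega)$ be a compact Hermitian manifold (without boundary) of complex dimension $n$, let $1\le p\le n$, and let $X$ be the smooth real function on $M$ defined by $X\,\omega^n=\sqrt{-1}\,\partial\bar\partial\omega^{p-1}\wedge\omega^{n-p}$. Assume $X\le 0$ on $M$. Let $\psi>0$ be a smooth function on $M$, and let $\phi_0,\phi_1\in\mathcal V_p$ satisfy $n+nX\phi_i+\Delta\phi_i>0$ on $M$ for $i=0,1$. Then there is a constant $C$, depending only on the background data $(M,\omega)$, $p$, $\psi$, $\phi_0$, $\phi_1$, such that any real-valued solution $\phi\in C^4(M\times[0,1])$ of $$\begin{cases}\phi_{tt}\,(n+nX\phi+\Delta\phi)-|\nabla\phi_t|^2=\psi-\dfrac{nX\phi_t^2}{2} & \text{on } M\times[0,1],\\[4pt] \phi(z,0)=\phi_0(z),\quad \phi(z,1)=\phi_1(z) & \text{for } z\in M,\end{cases}$$ satisfies $$\sup_{M\times[0,1]}|\Delta\phi|+\sup_{M\times[0,1]}|\nabla\phi|_\omega\le C .$$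
   Context: $t\in[0,1]$ is the second variable of $M\times[0,1]$, and subscripts $t$ denote partial derivatives in $t$. $\Delta$ and $\nabla$ act in the $M$-variables only. $\Delta u=\mathrm{tr}_\omega(\sqrt{-1}\,\partial\bar\partial u)$ is the complex (Dolbeault) Laplacian; in local holomorphic coordinates that are unitary for $\omega$ at a point, $\Delta u=\sum_k u_{k\bar k}$ there. For a real function $u$, $|\nabla u|^2=|\nabla u|_\omega^2=\sum_k|u_k|^2$ in such coordinates, with $u_k=\partial u/\partial z_k$; in particular $|\nabla\phi_t|^2=\sum_k|\phi_{kt}|^2$. For $\phi\in C^\infty(M)$ real-valued put $\Omega_\phi=\omega^p+\sqrt{-1}\,\partial\bar\partial(\phi\,\omega^{p-1})$. The space of mixed volume forms is $\mathcal V_p=\{\phi\in C^\infty(M):\Omega_\phi\wedge\omega^{n-p}>0\}$, where positivity is that of a real top-degree form relative to $\omega^n$. The metric $\omega$ is not assumed to be balanced. *)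

theory Defs
  imports "HOL-Analysis.Analysis" "HOL-Combinatorics.Permutations"
begin

section \<open>Functions of class \<open>C^k\<close>\<close>

text \<open>Derivatives are taken within \<open>S\<close>. This is used for open sets \<open>S\<close> and for products of an
  open set with \<open>[0,1]\<close> (one-sided derivatives at the ends); in both cases they are unique.\<close>

primrec Ck_on :: "nat \<Rightarrow> 'a::real_normed_vector set \<Rightarrow> ('a \<Rightarrow> 'b::real_normed_vector) \<Rightarrow> bool" where
  "Ck_on 0 S f \<longleftrightarrow> continuous_on S f"
| "Ck_on (Suc k) S f \<longleftrightarrow>
     (\<exists>f'. (\<forall>x\<in>S. (f has_derivative f' x) (at x within S)) \<and> (\<forall>v. Ck_on k S (\<lambda>x. f' x v)))"

definition smooth_on :: "'a::real_normed_vector set \<Rightarrow> ('a \<Rightarrow> 'b::real_normed_vector) \<Rightarrow> bool" where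
  "smooth_on S f \<longleftrightarrow> (\<forall>k. Ck_on k S f)"

definition holomorphic_map_on :: "(complex^'n) set \<Rightarrow> (complex^'n \<Rightarrow> complex^'m) \<Rightarrow> bool" where
  "holomorphic_map_on S f \<longleftrightarrow>
     (\<forall>z\<in>S. \<exists>L. (f has_derivative L) (at z) \<and> (\<forall>c v. L (c *s v) = c *s L v))"


section \<open>Differential forms on open subsets of \<open>\<complex>\<^sup>n\<close>\<close>

text \<open>A complex-valued \<open>k\<close>-form assigns to a point an alternating real-multilinear function of
  \<open>k\<close> real tangent vectors, which are identified with elements of \<open>\<complex>\<^sup>n\<close>. The vectors are given as a
  sequence of which only the entries \<open>0, ..., k-1\<close> are used; the degrees of the arguments are
  passed explicitly to the operations below.\<close>

type_synonym 'n form = "complex^'n \<Rightarrow> (nat \<Rightarrow> complex^'n) \<Rightarrow> complex"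

text \<open>\<open>wirt f z v = \<Sum>\<^sub>j v\<^sub>j \<partial>f/\<partial>z\<^sub>j\<close> and \<open>wirt_bar f z v = \<Sum>\<^sub>j cnj v\<^sub>j \<partial>f/\<partial>(cnj z\<^sub>j)\<close>.\<close>

definition wirt :: "(complex^'n \<Rightarrow> complex) \<Rightarrow> complex^'n \<Rightarrow> complex^'n \<Rightarrow> complex" where
  "wirt f z v = (frechet_derivative f (at z) v - \<i> * frechet_derivative f (at z) (\<i> *s v)) / 2"

definition wirt_bar :: "(complex^'n \<Rightarrow> complex) \<Rightarrow> complex^'n \<Rightarrow> complex^'n \<Rightarrow> complex" where
  "wirt_bar f z v = (frechet_derivative f (at z) v + \<i> * frechet_derivative f (at z) (\<i> *s v)) / 2"

text \<open>The normalisation is the one with \<open>(\<alpha> \<and> \<beta>)(v, w) = \<alpha>(v) \<beta>(w) - \<alpha>(w) \<beta>(v)\<close> for 1-forms.\<close>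

definition wedge :: "nat \<Rightarrow> nat \<Rightarrow> 'n form \<Rightarrow> 'n form \<Rightarrow> 'n form" where
  "wedge k l \<alpha> \<beta> = (\<lambda>z v.
     (\<Sum>\<sigma> | \<sigma> permutes {..<k + l}.
        of_int (sign \<sigma>) * \<alpha> z (\<lambda>i. v (\<sigma> i)) * \<beta> z (\<lambda>i. v (\<sigma> (k + i)))) / (fact k * fact l))"

primrec wedge_power :: "'n form \<Rightarrow> nat \<Rightarrow> 'n form" \<comment> \<open>powers of a 2-form\<close> where
  "wedge_power \<alpha> 0 = (\<lambda>z v. 1)"
| "wedge_power \<alpha> (Suc m) = wedge 2 (2 * m) \<alpha> (wedge_power \<alpha> m)"

definition omit :: "nat \<Rightarrow> (nat \<Rightarrow> 'v) \<Rightarrow> nat \<Rightarrow> 'v" where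
  "omit i v = (\<lambda>j. if j < i then v j else v (Suc j))"

text \<open>\<open>del k \<alpha> = \<Sum>\<^sub>j dz\<^sub>j \<and> \<partial>\<alpha>/\<partial>z\<^sub>j\<close> for a \<open>k\<close>-form \<open>\<alpha>\<close> (differentiation of the coefficients),
  and likewise for \<open>delbar\<close>.\<close>

definition del :: "nat \<Rightarrow> 'n form \<Rightarrow> ('n::finite) form" where
  "del k \<alpha> = (\<lambda>z v. \<Sum>i\<le>k. (-1) ^ i * wirt (\<lambda>w. \<alpha> w (omit i v)) z (v i))"

definition delbar :: "nat \<Rightarrow> 'n form \<Rightarrow> ('n::finite) form" where
  "delbar k \<alpha> = (\<lambda>z v. \<Sum>i\<le>k. (-1) ^ i * wirt_bar (\<lambda>w. \<alpha> w (omit i v)) z (v i))"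

definition i_ddbar :: "nat \<Rightarrow> 'n form \<Rightarrow> ('n::finite) form" where
  "i_ddbar k \<alpha> = (\<lambda>z v. \<i> * del (Suc k) (delbar k \<alpha>) z v)"

definition dz :: "'n::finite \<Rightarrow> 'n form" where
  "dz j = (\<lambda>z v. v 0 $ j)"

definition dzbar :: "'n::finite \<Rightarrow> 'n form" where
  "dzbar j = (\<lambda>z v. cnj (v 0 $ j))"

text \<open>The (1,1)-form \<open>\<i> \<Sum> G\<^sub>j\<^sub>k dz\<^sub>j \<and> d(cnj z\<^sub>k)\<close>.\<close>

definition form11 :: "(complex^'n \<Rightarrow> complex^'n^'n) \<Rightarrow> ('n::finite) form" where
  "form11 G = (\<lambda>z v. \<i> * (\<Sum>j\<in>UNIV. \<Sum>k\<in>UNIV. G z $ j $ k * wedge 1 1 (dz j) (dzbar k) z v))"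


section \<open>Complex manifolds\<close>

text \<open>The manifold is the whole type \<open>'a\<close>. A chart is a domain with a coordinate map; the map is
  irrelevant outside of the domain.\<close>

type_synonym ('a, 'n) chart = "'a set \<times> ('a \<Rightarrow> complex^'n)"

definition chart_image :: "('a, 'n) chart \<Rightarrow> (complex^'n) set" where
  "chart_image c = snd c ` fst c"

definition chart_inv :: "('a, 'n) chart \<Rightarrow> complex^'n \<Rightarrow> 'a" where
  "chart_inv c = inv_into (fst c) (snd c)"

definition complex_atlas :: "('a::topological_space, 'n::finite) chart set \<Rightarrow> bool" where
  "complex_atlas A \<longleftrightarrow>
     (\<Union>c\<in>A. fst c) = UNIV \<and>
     (\<forall>c\<in>A. open (fst c) \<and> open (chart_image c) \<and>
        homeomorphism (fst c) (chart_image c) (snd c) (chart_inv c)) \<and>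
     (\<forall>c\<in>A. \<forall>d\<in>A. holomorphic_map_on (snd c ` (fst c \<inter> fst d)) (snd d \<circ> chart_inv c))"

definition smooth_fun :: "('a, 'n::finite) chart set \<Rightarrow> ('a \<Rightarrow> real) \<Rightarrow> bool" where
  "smooth_fun A u \<longleftrightarrow> (\<forall>c\<in>A. smooth_on (chart_image c) (u \<circ> chart_inv c))"

definition Ck_cylinder :: "nat \<Rightarrow> ('a, 'n::finite) chart set \<Rightarrow> ('a \<Rightarrow> real \<Rightarrow> real) \<Rightarrow> bool"
  \<comment> \<open>class \<open>C^k\<close> on \<open>M \<times> [0,1]\<close>\<close> where
  "Ck_cylinder k A \<phi> \<longleftrightarrow>
     (\<forall>c\<in>A. Ck_on k (chart_image c \<times> {0..1}) (\<lambda>(z, t). \<phi> (chart_inv c z) t))"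


section \<open>Hermitian metrics\<close>

text \<open>A metric is given by its coefficient matrices \<open>g\<^sub>j\<^sub>k = g(\<partial>/\<partial>z\<^sub>j, \<partial>/\<partial>(cnj z\<^sub>k))\<close> in the charts; the
  associated form is \<open>\<omega> = \<i> \<Sum> g\<^sub>j\<^sub>k dz\<^sub>j \<and> d(cnj z\<^sub>k)\<close>.\<close>

type_synonym ('a, 'n) metric = "('a, 'n) chart \<Rightarrow> 'a \<Rightarrow> complex^'n^'n"

definition sesq :: "complex^'n^'n \<Rightarrow> complex^'n \<Rightarrow> complex^'n \<Rightarrow> complex" where
  "sesq G v w = (\<Sum>j\<in>UNIV. \<Sum>k\<in>UNIV. G $ j $ k * v $ j * cnj (w $ k))"

definition hermitian_metric :: "('a, 'n::finite) chart set \<Rightarrow> ('a, 'n) metric \<Rightarrow> bool" where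
  "hermitian_metric A g \<longleftrightarrow>
     (\<forall>c\<in>A. smooth_on (chart_image c) (g c \<circ> chart_inv c)) \<and>
     (\<forall>c\<in>A. \<forall>x\<in>fst c. (\<forall>j k. g c x $ k $ j = cnj (g c x $ j $ k)) \<and>
        (\<forall>v. v \<noteq> 0 \<longrightarrow> Re (sesq (g c x) v v) > 0)) \<and>
     (\<forall>c\<in>A. \<forall>d\<in>A. \<forall>x\<in>fst c \<inter> fst d.
        let L = frechet_derivative (snd d \<circ> chart_inv c) (at (snd c x))
        in \<forall>v w. sesq (g c x) v w = sesq (g d x) (L v) (L w))"

text \<open>Second countability is automatic for compact manifolds.\<close>

definition compact_hermitian_manifold ::
  "('a::t2_space, 'n::finite) chart set \<Rightarrow> ('a, 'n) metric \<Rightarrow> bool" where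
  "compact_hermitian_manifold A g \<longleftrightarrow>
     compact (UNIV :: 'a set) \<and> complex_atlas A \<and> hermitian_metric A g"

definition omega :: "('a, 'n::finite) metric \<Rightarrow> ('a, 'n) chart \<Rightarrow> 'n form"
  \<comment> \<open>\<open>\<omega>\<close> in the coordinates of a chart\<close> where
  "omega g c = form11 (g c \<circ> chart_inv c)"

text \<open>The Laplacian and the norm of the gradient are computed in an arbitrary chart around the
  point; they do not depend on it.\<close>

definition chart_at :: "('a, 'n) chart set \<Rightarrow> 'a \<Rightarrow> ('a, 'n) chart" where
  "chart_at A x = (SOME c. c \<in> A \<and> x \<in> fst c)"

definition local_rep :: "('a, 'n) chart \<Rightarrow> ('a \<Rightarrow> real) \<Rightarrow> complex^'n \<Rightarrow> complex" where
  "local_rep c u = (\<lambda>z. of_real (u (chart_inv c z)))"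

text \<open>\<open>\<Delta>u = tr\<^sub>\<omega> (\<i> \<partial>\<partial>bar u) = \<Sum> (g\<^sup>-\<^sup>1)\<^sub>k\<^sub>j \<partial>\<^sup>2u/\<partial>z\<^sub>j\<partial>(cnj z\<^sub>k)\<close>.\<close>

definition laplacian ::
  "('a, 'n::finite) chart set \<Rightarrow> ('a, 'n) metric \<Rightarrow> ('a \<Rightarrow> real) \<Rightarrow> 'a \<Rightarrow> real" where
  "laplacian A g u x =
     (let c = chart_at A x;
          H = (\<chi> j k. wirt (\<lambda>w. wirt_bar (local_rep c u) w (axis k 1)) (snd c x) (axis j 1))
      in Re (trace (matrix_inv (g c x) ** H)))"

text \<open>\<open>|\<nabla>u|\<^sup>2 = \<Sum> (g\<^sup>-\<^sup>1)\<^sub>k\<^sub>j u\<^sub>j cnj u\<^sub>k\<close> with \<open>u\<^sub>j = \<partial>u/\<partial>z\<^sub>j\<close>.\<close>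

definition grad_norm_sq ::
  "('a, 'n::finite) chart set \<Rightarrow> ('a, 'n) metric \<Rightarrow> ('a \<Rightarrow> real) \<Rightarrow> 'a \<Rightarrow> real" where
  "grad_norm_sq A g u x =
     (let c = chart_at A x;
          D = (\<lambda>j. wirt (local_rep c u) (snd c x) (axis j 1))
      in Re (\<Sum>k\<in>UNIV. \<Sum>j\<in>UNIV. matrix_inv (g c x) $ k $ j * D j * cnj (D k)))"

definition grad_norm ::
  "('a, 'n::finite) chart set \<Rightarrow> ('a, 'n) metric \<Rightarrow> ('a \<Rightarrow> real) \<Rightarrow> 'a \<Rightarrow> real" where
  "grad_norm A g u x = sqrt (grad_norm_sq A g u x)"


section \<open>Mixed volume forms and the equation\<close>

text \<open>\<open>X \<omega>\<^sup>n = \<i> \<partial>\<partial>bar \<omega>\<^sup>p\<^sup>-\<^sup>1 \<and> \<omega>\<^sup>n\<^sup>-\<^sup>p\<close>.\<close>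

definition torsion_function ::
  "('a, 'n::finite) chart set \<Rightarrow> ('a, 'n) metric \<Rightarrow> nat \<Rightarrow> ('a \<Rightarrow> real) \<Rightarrow> bool" where
  "torsion_function A g p X \<longleftrightarrow> smooth_fun A X \<and>
     (\<forall>c\<in>A. \<forall>x\<in>fst c. let \<omega> = omega g c; n = CARD('n); z = snd c x in
        \<forall>v. of_real (X x) * wedge_power \<omega> n z v =
            wedge (2 * p) (2 * (n - p))
              (i_ddbar (2 * (p - 1)) (wedge_power \<omega> (p - 1))) (wedge_power \<omega> (n - p)) z v)"

definition Omega ::
  "('a, 'n::finite) metric \<Rightarrow> nat \<Rightarrow> ('a \<Rightarrow> real) \<Rightarrow> ('a, 'n) chart \<Rightarrow> 'n form" where
  "Omega g p \<phi> c = (\<lambda>z v. wedge_power (omega g c) p z v +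
     i_ddbar (2 * (p - 1)) (\<lambda>w u. local_rep c \<phi> w * wedge_power (omega g c) (p - 1) w u) z v)"

definition mixed_volume_forms ::
  "('a, 'n::finite) chart set \<Rightarrow> ('a, 'n) metric \<Rightarrow> nat \<Rightarrow> ('a \<Rightarrow> real) set" where
  "mixed_volume_forms A g p = {\<phi>. smooth_fun A \<phi> \<and>
     (\<forall>c\<in>A. \<forall>x\<in>fst c. let \<omega> = omega g c; n = CARD('n); z = snd c x in
        \<exists>F::real. F > 0 \<and>
          (\<forall>v. wedge (2 * p) (2 * (n - p)) (Omega g p \<phi> c) (wedge_power \<omega> (n - p)) z v =
               of_real F * wedge_power \<omega> n z v))}"

definition dt :: "('a \<Rightarrow> real \<Rightarrow> real) \<Rightarrow> 'a \<Rightarrow> real \<Rightarrow> real" where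
  "dt \<phi> x t = vector_derivative (\<phi> x) (at t within {0..1})"

definition is_solution ::
  "('a, 'n::finite) chart set \<Rightarrow> ('a, 'n) metric \<Rightarrow> ('a \<Rightarrow> real) \<Rightarrow> ('a \<Rightarrow> real) \<Rightarrow>
   ('a \<Rightarrow> real) \<Rightarrow> ('a \<Rightarrow> real) \<Rightarrow> ('a \<Rightarrow> real \<Rightarrow> real) \<Rightarrow> bool" where
  "is_solution A g X \<psi> \<phi>0 \<phi>1 \<phi> \<longleftrightarrow>
     (let n = real CARD('n) in
      (\<forall>x. \<forall>t\<in>{0..1}.
         dt (dt \<phi>) x t * (n + n * X x * \<phi> x t + laplacian A g (\<lambda>y. \<phi> y t) x)
           - grad_norm_sq A g (\<lambda>y. dt \<phi> y t) x
         = \<psi> x - n * X x * (dt \<phi> x t)\<^sup>2 / 2) \<and>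
      (\<forall>x. \<phi> x 0 = \<phi>0 x \<and> \<phi> x 1 = \<phi>1 x))"

end

theory Submission imports Defs "HOL-Complex_Analysis.Cauchy_Integral_Formula" begin

text \<open>
  Put \<open>u = \<phi>\<close>, \<open>v = u\<^sub>t\<close>, \<open>a = - n X / 2 \<ge> 0\<close>, \<open>A = n - 2 a u + \<Delta>u\<close> and \<open>F = \<psi> + a v\<^sup>2\<close>. The
  equation reads \<open>u\<^sub>t\<^sub>t A - |\<nabla>v|\<^sup>2 = F\<close> with \<open>F > 0\<close>. Hence \<open>A\<close> has no zero, and since it is positive for
  \<open>t = 0\<close>, both \<open>A\<close> and \<open>u\<^sub>t\<^sub>t\<close> are positive everywhere. Moreover \<open>|\<nabla>v|\<^sup>2 < u\<^sub>t\<^sub>t A\<close>, which says that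
  \<open>f \<mapsto> A f\<^sub>t\<^sub>t + u\<^sub>t\<^sub>t \<Delta>f - 2 \<langle>\<nabla>v, \<nabla>f\<^sub>t\<rangle>\<close>, the linearisation up to lower order terms, is elliptic. All
  bounds are therefore proved by evaluating this operator at the maximum of a well chosen function, and every
  maximum is either interior or lies on the two ends, where the data are known.

  Three kinds of functions occur. (1) \<open>\<phi>\<^sub>0 - \<theta>(t) - u\<close> with an explicit concave \<open>\<theta>\<close>: it is nonpositive, so \<open>u\<close> cannot
  start with a very negative slope, and symmetrically at \<open>t = 1\<close>. As \<open>u\<close> is convex in \<open>t\<close>, this bounds \<open>|v|\<close>, and
  then \<open>|u|\<close>. The sign of \<open>a\<close> is what makes the comparison work. (2) \<open>A exp (\<lambda> v\<^sup>2 / 2 + t\<^sup>2 / 4)\<close>: it bounds \<open>A\<close>,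
  hence \<open>|\<Delta>u|\<close>. (3) Now \<open>u\<^sub>t\<^sub>t \<ge> F / A\<close> is bounded below, and \<open>|\<nabla>u|\<^sup>2 + N u\<^sup>2 / 2\<close> bounds the gradient.

  In (2) and (3) there appear squares and derivatives of the Hessians of \<open>v\<close> and \<open>u\<close>. They are controlled by a
  Bochner inequality for \<open>\<Delta>\<close>, in a form that contains a second function \<open>w\<close> and a number \<open>c\<close>. Up to a multiple of
  \<open>|\<nabla>f|\<^sup>2\<close> that is independent of \<open>c\<close> and \<open>w\<close>, the expression in question is nonnegative because it contains
  the square of \<open>\<nabla>\<^sup>2f - c \<nabla>w \<otimes> \<nabla>w\<close>; the choice of \<open>c\<close> absorbs the terms that come from the first order
  conditions at the maximum. The operator \<open>\<Delta>\<close> of a Hermitian metric has no first order terms in holomorphic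
  coordinates. The derivatives of its coefficients, which include the torsion of the metric, contribute terms
  that are linear in that tensor, and these are absorbed by its square and by \<open>|\<nabla>f|\<^sup>2\<close>.

  The analytic part uses \<open>\<Delta>\<close> and \<open>\<langle>\<nabla>\<cdot>, \<nabla>\<cdot>\<rangle>\<close> only through formal rules (Leibniz and chain rules, the Bochner
  inequality, the conditions at a maximum), which are collected in the locale \<open>diffusion_cylinder\<close>; its result is
  \<open>a_priori_estimate\<close>. The remaining part shows that a compact Hermitian manifold satisfies these rules: the
  Laplacian and the gradient do not depend on the chart (\<open>levi_matrix_pullback\<close>, \<open>trace_inverse_pullback\<close>), in a chart
  they are given by a matrix of coefficients, without lower order terms (\<open>local_operator\<close>), the
  Bochner inequality holds near every point (\<open>local_bochner\<close>), and compactness makes its constant uniform.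
\<close>

section \<open>Diffusion operators on a cylinder\<close>

text \<open>
  \<open>C k\<close> stands for the functions of class \<open>C\<^sup>k\<close> on \<open>M \<times> (0, 1)\<close>, \<open>L\<close> for the Laplacian, \<open>\<Gamma>\<close> for the polarised square
  of the gradient. They concern \<open>0 < t < 1\<close>: the rules are applied at interior maxima, and
  the ends of the cylinder are reached by continuity. Since \<open>L\<close> and \<open>\<Gamma>\<close> act on functions of the space variable
  while smoothness is a property of functions on the cylinder, all rules are stated for slices \<open>\<lambda>y. f y t\<close>.

  The Bochner inequality is \<open>\<Gamma>\<^sub>2(f, f) \<ge> - K \<Gamma>(f, f)\<close> for \<open>c = 0\<close>. For general \<open>c\<close> the added terms are those of the
  expansion of \<open>|\<nabla>\<^sup>2f - c \<nabla>w \<otimes> \<nabla>w|\<^sup>2\<close>, since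
  \<open>2 \<Gamma>(w, \<Gamma>(f, w)) - \<Gamma>(f, \<Gamma>(w, w)) = 2 \<nabla>\<^sup>2f(\<nabla>w, \<nabla>w)\<close> in the Riemannian case; that \<open>K\<close> does not
  depend on \<open>c\<close> is essential. The last rule tests the nonpositive space-time Hessian of \<open>f\<close> at a maximum against
  the form \<open>S |\<xi>|\<^sup>2 - 2 \<tau> \<langle>\<nabla>w, \<xi>\<rangle> + B \<tau>\<^sup>2\<close>, which is nonnegative exactly if \<open>\<Gamma>(w, w) \<le> S B\<close>.
\<close>

locale diffusion_cylinder =
  fixes C :: "nat \<Rightarrow> ('a::t2_space \<Rightarrow> real \<Rightarrow> real) \<Rightarrow> bool"
    and L :: "('a \<Rightarrow> real) \<Rightarrow> 'a \<Rightarrow> real"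
    and \<Gamma> :: "('a \<Rightarrow> real) \<Rightarrow> ('a \<Rightarrow> real) \<Rightarrow> 'a \<Rightarrow> real"
    and K :: real
  assumes compact_space: "compact (UNIV :: 'a set)"
    and K_nonneg: "0 \<le> K"
    and C_Suc: "C (Suc k) f \<Longrightarrow> C k f"
    and C_const: "C k (\<lambda>x t. r)"
    and C_time: "C k (\<lambda>x t. t)"
    and C_add: "C k f \<Longrightarrow> C k h \<Longrightarrow> C k (\<lambda>x t. f x t + h x t)"
    and C_mult: "C k f \<Longrightarrow> C k h \<Longrightarrow> C k (\<lambda>x t. f x t * h x t)"
    and C_compose: "C 2 f \<Longrightarrow> (\<And>x t. 0 < t \<Longrightarrow> t < 1 \<Longrightarrow> f x t \<in> T) \<Longrightarrow>
        (\<And>y. y \<in> T \<Longrightarrow> (q has_real_derivative q' y) (at y)) \<Longrightarrow>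
        (\<And>y. y \<in> T \<Longrightarrow> (q' has_real_derivative q'' y) (at y)) \<Longrightarrow>
        continuous_on T q'' \<Longrightarrow> C 2 (\<lambda>x t. q (f x t))"
    and C_dt: "C (Suc k) f \<Longrightarrow> C k (dt f)"
    and C_L: "C (Suc (Suc k)) f \<Longrightarrow> C k (\<lambda>x t. L (\<lambda>y. f y t) x)"
    and C_\<Gamma>: "C (Suc k) f \<Longrightarrow> C (Suc k) h \<Longrightarrow> C k (\<lambda>x t. \<Gamma> (\<lambda>y. f y t) (\<lambda>y. h y t) x)"
    and has_dt: "C (Suc 0) f \<Longrightarrow> 0 < t \<Longrightarrow> t < 1 \<Longrightarrow> (f x has_real_derivative dt f x t) (at t)"
    and L_const: "L (\<lambda>y. r) x = 0"
    and L_add: "C 2 f \<Longrightarrow> C 2 h \<Longrightarrow> 0 < t \<Longrightarrow> t < 1 \<Longrightarrow>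
        L (\<lambda>y. f y t + h y t) x = L (\<lambda>y. f y t) x + L (\<lambda>y. h y t) x"
    and L_mult: "C 2 f \<Longrightarrow> C 2 h \<Longrightarrow> 0 < t \<Longrightarrow> t < 1 \<Longrightarrow>
        L (\<lambda>y. f y t * h y t) x = f x t * L (\<lambda>y. h y t) x + h x t * L (\<lambda>y. f y t) x
          + 2 * \<Gamma> (\<lambda>y. f y t) (\<lambda>y. h y t) x"
    and L_compose: "C 2 f \<Longrightarrow> 0 < t \<Longrightarrow> t < 1 \<Longrightarrow>
        (\<And>y. (q has_real_derivative q' y) (at y)) \<Longrightarrow>
        (\<And>y. (q' has_real_derivative q'' y) (at y)) \<Longrightarrow> continuous_on UNIV q'' \<Longrightarrow>
        L (\<lambda>y. q (f y t)) x
          = q' (f x t) * L (\<lambda>y. f y t) x + q'' (f x t) * \<Gamma> (\<lambda>y. f y t) (\<lambda>y. f y t) x"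
    and \<Gamma>_const: "\<Gamma> (\<lambda>y. r) v x = 0"
    and \<Gamma>_sym: "C 1 f \<Longrightarrow> C 1 h \<Longrightarrow> 0 < t \<Longrightarrow> t < 1 \<Longrightarrow>
        \<Gamma> (\<lambda>y. f y t) (\<lambda>y. h y t) x = \<Gamma> (\<lambda>y. h y t) (\<lambda>y. f y t) x"
    and \<Gamma>_add: "C 1 f \<Longrightarrow> C 1 h \<Longrightarrow> C 1 w \<Longrightarrow> 0 < t \<Longrightarrow> t < 1 \<Longrightarrow>
        \<Gamma> (\<lambda>y. f y t + h y t) (\<lambda>y. w y t) x
          = \<Gamma> (\<lambda>y. f y t) (\<lambda>y. w y t) x + \<Gamma> (\<lambda>y. h y t) (\<lambda>y. w y t) x"
    and \<Gamma>_mult: "C 1 f \<Longrightarrow> C 1 h \<Longrightarrow> C 1 w \<Longrightarrow> 0 < t \<Longrightarrow> t < 1 \<Longrightarrow>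
        \<Gamma> (\<lambda>y. f y t * h y t) (\<lambda>y. w y t) x
          = f x t * \<Gamma> (\<lambda>y. h y t) (\<lambda>y. w y t) x + h x t * \<Gamma> (\<lambda>y. f y t) (\<lambda>y. w y t) x"
    and \<Gamma>_compose: "C 1 f \<Longrightarrow> C 1 (\<lambda>x t. q (f x t)) \<Longrightarrow> C 1 w \<Longrightarrow> 0 < t \<Longrightarrow> t < 1 \<Longrightarrow>
        (q has_real_derivative d) (at (f x t)) \<Longrightarrow>
        \<Gamma> (\<lambda>y. q (f y t)) (\<lambda>y. w y t) x = d * \<Gamma> (\<lambda>y. f y t) (\<lambda>y. w y t) x"
    and \<Gamma>_nonneg: "C 1 f \<Longrightarrow> 0 < t \<Longrightarrow> t < 1 \<Longrightarrow> 0 \<le> \<Gamma> (\<lambda>y. f y t) (\<lambda>y. f y t) x"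
    and dt_L: "C 3 f \<Longrightarrow> 0 < t \<Longrightarrow> t < 1 \<Longrightarrow>
        dt (\<lambda>x t. L (\<lambda>y. f y t) x) x t = L (\<lambda>y. dt f y t) x"
    and dt_\<Gamma>: "C 2 f \<Longrightarrow> C 2 h \<Longrightarrow> 0 < t \<Longrightarrow> t < 1 \<Longrightarrow>
        dt (\<lambda>x t. \<Gamma> (\<lambda>y. f y t) (\<lambda>y. h y t) x) x t
          = \<Gamma> (\<lambda>y. dt f y t) (\<lambda>y. h y t) x + \<Gamma> (\<lambda>y. f y t) (\<lambda>y. dt h y t) x"
    and bochner: "C 3 f \<Longrightarrow> C 2 w \<Longrightarrow> 0 < t \<Longrightarrow> t < 1 \<Longrightarrow>
        - K * \<Gamma> (\<lambda>y. f y t) (\<lambda>y. f y t) x \<le>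
          L (\<lambda>z. \<Gamma> (\<lambda>y. f y t) (\<lambda>y. f y t) z) x / 2
          - \<Gamma> (\<lambda>y. f y t) (\<lambda>z. L (\<lambda>y. f y t) z) x
          - c * (2 * \<Gamma> (\<lambda>y. w y t) (\<lambda>z. \<Gamma> (\<lambda>y. f y t) (\<lambda>y. w y t) z) x
                 - \<Gamma> (\<lambda>y. f y t) (\<lambda>z. \<Gamma> (\<lambda>y. w y t) (\<lambda>y. w y t) z) x)
          + c\<^sup>2 * (\<Gamma> (\<lambda>y. w y t) (\<lambda>y. w y t) x)\<^sup>2"
    and \<Gamma>_at_max: "C 2 f \<Longrightarrow> 0 < t \<Longrightarrow> t < 1 \<Longrightarrow>
        (\<And>y s. 0 < s \<Longrightarrow> s < 1 \<Longrightarrow> f y s \<le> f x t) \<Longrightarrow> C 1 w \<Longrightarrow>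
        \<Gamma> (\<lambda>y. f y t) (\<lambda>y. w y t) x = 0"
    and second_order_at_max: "C 2 f \<Longrightarrow> 0 < t \<Longrightarrow> t < 1 \<Longrightarrow>
        (\<And>y s. 0 < s \<Longrightarrow> s < 1 \<Longrightarrow> f y s \<le> f x t) \<Longrightarrow> C 1 w \<Longrightarrow> 0 < S \<Longrightarrow>
        \<Gamma> (\<lambda>y. w y t) (\<lambda>y. w y t) x \<le> S * B \<Longrightarrow>
        B * dt (dt f) x t + S * L (\<lambda>y. f y t) x - 2 * \<Gamma> (\<lambda>y. w y t) (\<lambda>y. dt f y t) x \<le> 0"
begin

definition lp :: "('a \<Rightarrow> real \<Rightarrow> real) \<Rightarrow> 'a \<Rightarrow> real \<Rightarrow> real" where
  "lp f = (\<lambda>x t. L (\<lambda>y. f y t) x)"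

definition gm :: "('a \<Rightarrow> real \<Rightarrow> real) \<Rightarrow> ('a \<Rightarrow> real \<Rightarrow> real) \<Rightarrow> 'a \<Rightarrow> real \<Rightarrow> real" where
  "gm f h = (\<lambda>x t. \<Gamma> (\<lambda>y. f y t) (\<lambda>y. h y t) x)"

lemma C_mono: "j \<le> k \<Longrightarrow> C k f \<Longrightarrow> C j f"
  by (induction rule: inc_induct) (auto intro: C_Suc)

lemma C_lp: "C (Suc (Suc k)) f \<Longrightarrow> C k (lp f)"
  unfolding lp_def by (rule C_L)

lemma C_gm: "C (Suc k) f \<Longrightarrow> C (Suc k) h \<Longrightarrow> C k (gm f h)"
  unfolding gm_def by (rule C_\<Gamma>)

lemma C_uminus: "C k f \<Longrightarrow> C k (\<lambda>x t. - f x t)"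
  using C_mult[OF C_const[of k "-1"], of f] by simp

lemma C_diff: "C k f \<Longrightarrow> C k h \<Longrightarrow> C k (\<lambda>x t. f x t - h x t)"
  using C_add[of k f "\<lambda>x t. - h x t"] C_uminus[of k h] by simp

lemma C_power2: "C k f \<Longrightarrow> C k (\<lambda>x t. (f x t)\<^sup>2)"
  unfolding power2_eq_square by (rule C_mult)

lemmas C_intros = C_const C_time C_add C_mult C_uminus C_diff C_power2

lemma dt_eqI:
  assumes "(f x has_real_derivative d) (at t)" "0 < t" "t < 1"
  shows "dt f x t = d"
  using assms unfolding dt_def
  by (simp add: at_within_Icc_at has_real_derivative_iff_has_vector_derivative vector_derivative_at)

lemma dt_cong_deriv:
  assumes "\<And>s. 0 < s \<Longrightarrow> s < 1 \<Longrightarrow> f x s = h s" "(h has_real_derivative d) (at t)" "0 < t" "t < 1"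
  shows "dt f x t = d"
proof (rule dt_eqI)
  show "(f x has_real_derivative d) (at t)"
    using assms(2)
    by (rule has_field_derivative_transform_within_open[where S = "{0<..<1}"])
       (use assms in auto)
qed (use assms in auto)

lemma dt_mult: "C 1 f \<Longrightarrow> C 1 h \<Longrightarrow> 0 < t \<Longrightarrow> t < 1 \<Longrightarrow>
    dt (\<lambda>x t. f x t * h x t) x t = f x t * dt h x t + h x t * dt f x t"
  by (rule dt_eqI) (auto intro!: derivative_eq_intros has_dt)

lemma gm_sym: "C 1 f \<Longrightarrow> C 1 h \<Longrightarrow> 0 < t \<Longrightarrow> t < 1 \<Longrightarrow> gm f h x t = gm h f x t"
  unfolding gm_def by (rule \<Gamma>_sym)

lemma gm_add1: "C 1 f \<Longrightarrow> C 1 h \<Longrightarrow> C 1 w \<Longrightarrow> 0 < t \<Longrightarrow> t < 1 \<Longrightarrow>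
    gm (\<lambda>x t. f x t + h x t) w x t = gm f w x t + gm h w x t"
  unfolding gm_def by (rule \<Gamma>_add)

lemma gm_mult1: "C 1 f \<Longrightarrow> C 1 h \<Longrightarrow> C 1 w \<Longrightarrow> 0 < t \<Longrightarrow> t < 1 \<Longrightarrow>
    gm (\<lambda>x t. f x t * h x t) w x t = f x t * gm h w x t + h x t * gm f w x t"
  unfolding gm_def by (rule \<Gamma>_mult)

lemma gm_const1: "gm (\<lambda>x t. q t) w x t = 0"
  unfolding gm_def by (rule \<Gamma>_const)

lemma gm_const2: "C 1 (\<lambda>x t. q t) \<Longrightarrow> C 1 w \<Longrightarrow> 0 < t \<Longrightarrow> t < 1 \<Longrightarrow> gm w (\<lambda>x t. q t) x t = 0"
  using gm_sym[of w "\<lambda>x t. q t" t x] gm_const1[of q w x t] by simp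

lemma gm_add2: "C 1 f \<Longrightarrow> C 1 h \<Longrightarrow> C 1 w \<Longrightarrow> 0 < t \<Longrightarrow> t < 1 \<Longrightarrow>
    gm w (\<lambda>x t. f x t + h x t) x t = gm w f x t + gm w h x t"
  using gm_add1[of f h w t x] by (simp add: gm_sym C_add)

lemma gm_mult2: "C 1 f \<Longrightarrow> C 1 h \<Longrightarrow> C 1 w \<Longrightarrow> 0 < t \<Longrightarrow> t < 1 \<Longrightarrow>
    gm w (\<lambda>x t. f x t * h x t) x t = f x t * gm w h x t + h x t * gm w f x t"
  using gm_mult1[of f h w t x] by (simp add: gm_sym C_mult)

lemma lp_add: "C 2 f \<Longrightarrow> C 2 h \<Longrightarrow> 0 < t \<Longrightarrow> t < 1 \<Longrightarrow>
    lp (\<lambda>x t. f x t + h x t) x t = lp f x t + lp h x t"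
  unfolding lp_def by (rule L_add)

lemma lp_mult: "C 2 f \<Longrightarrow> C 2 h \<Longrightarrow> 0 < t \<Longrightarrow> t < 1 \<Longrightarrow>
    lp (\<lambda>x t. f x t * h x t) x t = f x t * lp h x t + h x t * lp f x t + 2 * gm f h x t"
  unfolding lp_def gm_def by (rule L_mult)

lemma lp_const: "lp (\<lambda>x t. q t) x t = 0"
  unfolding lp_def by (rule L_const)

lemma lp_cong: "(\<And>y. f y t = h y t) \<Longrightarrow> lp f x t = lp h x t"
  unfolding lp_def by simp

lemma gm_cong: "(\<And>y. f y t = f' y t) \<Longrightarrow> (\<And>y. h y t = h' y t) \<Longrightarrow> gm f h x t = gm f' h' x t"
  unfolding gm_def by simp

lemma gm_nonneg: "C 1 f \<Longrightarrow> 0 < t \<Longrightarrow> t < 1 \<Longrightarrow> 0 \<le> gm f f x t"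
  unfolding gm_def by (rule \<Gamma>_nonneg)

text \<open>Positivity of \<open>\<Gamma>(f \<plusminus> r h, f \<plusminus> r h)\<close>. The weighted form is the one that absorbs a cross term into \<open>\<Gamma>(f, f)\<close>.\<close>

lemma gm_Cauchy_Schwarz:
  assumes "C 1 f" "C 1 h" "0 < t" "t < 1"
  shows "2 * \<bar>r * gm f h x t\<bar> \<le> gm f f x t + r\<^sup>2 * gm h h x t"
proof -
  have *: "0 \<le> gm f f x t + 2 * (\<rho> * gm f h x t) + \<rho>\<^sup>2 * gm h h x t" for \<rho>
  proof -
    let ?k = "\<lambda>x t. \<rho> * h x t"
    have k: "C 1 ?k" using assms by (intro C_intros)
    have hk: "gm w ?k x t = \<rho> * gm w h x t" if "C 1 w" for w
      using gm_mult2[OF C_const[of 1 \<rho>] assms(2) that assms(3,4)] gm_const2[OF C_const[of 1 \<rho>] that assms(3,4)]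
      by simp
    have "gm (\<lambda>x t. f x t + ?k x t) (\<lambda>x t. f x t + ?k x t) x t
        = gm f f x t + gm f ?k x t + (gm ?k f x t + gm ?k ?k x t)"
      using assms k by (simp add: gm_add1 gm_add2 C_add)
    also have "\<dots> = gm f f x t + 2 * (\<rho> * gm f h x t) + \<rho>\<^sup>2 * gm h h x t"
      using assms k by (simp add: gm_sym[of ?k f] hk gm_sym[of ?k h] power2_eq_square)
    finally show ?thesis
      using gm_nonneg[of "\<lambda>x t. f x t + ?k x t" t x] assms k by (simp add: C_add)
  qed
  show ?thesis using *[of r] *[of "-r"] by (simp add: abs_if)
qed

lemma dt_lp: "C 3 f \<Longrightarrow> 0 < t \<Longrightarrow> t < 1 \<Longrightarrow> dt (lp f) x t = lp (dt f) x t"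
  unfolding lp_def by (rule dt_L)

lemma dt_gm: "C 2 f \<Longrightarrow> C 2 h \<Longrightarrow> 0 < t \<Longrightarrow> t < 1 \<Longrightarrow>
    dt (gm f h) x t = gm (dt f) h x t + gm f (dt h) x t"
  unfolding gm_def by (rule dt_\<Gamma>)

lemma gm_bochner: "C 3 f \<Longrightarrow> C 2 w \<Longrightarrow> 0 < t \<Longrightarrow> t < 1 \<Longrightarrow>
    - K * gm f f x t \<le> lp (gm f f) x t / 2 - gm f (lp f) x t
      - c * (2 * gm w (gm f w) x t - gm f (gm w w) x t) + c\<^sup>2 * (gm w w x t)\<^sup>2"
  unfolding gm_def lp_def by (rule bochner)

lemma at_interior_max:
  assumes "C 2 f" "0 < t" "t < 1" and max: "\<And>y s. 0 < s \<Longrightarrow> s < 1 \<Longrightarrow> f y s \<le> f x t"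
  shows "dt f x t = 0"
    and "C 1 w \<Longrightarrow> gm f w x t = 0"
    and "C 1 w \<Longrightarrow> 0 < S \<Longrightarrow> gm w w x t \<le> S * B \<Longrightarrow>
          B * dt (dt f) x t + S * lp f x t - 2 * gm w (dt f) x t \<le> 0"
proof -
  have "C (Suc 0) f" using C_Suc[of "Suc 0" f] assms by (simp add: numeral_2_eq_2)
  from has_dt[OF this \<open>0 < t\<close> \<open>t < 1\<close>, of x] show "dt f x t = 0"
  proof (rule DERIV_local_max)
    show "0 < min t (1 - t)" using assms by simp
    show "\<forall>s. \<bar>t - s\<bar> < min t (1 - t) \<longrightarrow> f x s \<le> f x t"
      using max by (auto simp: abs_if split: if_splits)
  qed
next
  show "gm f w x t = 0" if "C 1 w"
    unfolding gm_def by (rule \<Gamma>_at_max[OF assms that])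
  show "B * dt (dt f) x t + S * lp f x t - 2 * gm w (dt f) x t \<le> 0"
    if "C 1 w" "0 < S" "gm w w x t \<le> S * B"
    unfolding gm_def lp_def
    by (rule second_order_at_max[OF assms that(1,2)]) (use that in \<open>auto simp: gm_def\<close>)
qed

end

section \<open>Positivity and the maximum principle\<close>

locale mixed_geodesic = diffusion_cylinder +
  fixes n :: real and a \<psi> :: "'a \<Rightarrow> real" and u :: "'a \<Rightarrow> real \<Rightarrow> real"
  assumes C_a: "C k (\<lambda>x t. a x)" and C_\<psi>: "C k (\<lambda>x t. \<psi> x)" and C_u: "C 4 u"
    and a_nonneg: "0 \<le> a x" and \<psi>_pos: "0 < \<psi> x"
    and equation: "0 < t \<Longrightarrow> t < 1 \<Longrightarrow>
        dt (dt u) x t * (n - 2 * a x * u x t + L (\<lambda>y. u y t) x)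
          - \<Gamma> (\<lambda>y. dt u y t) (\<lambda>y. dt u y t) x = \<psi> x + a x * (dt u x t)\<^sup>2"
    and cont_u: "continuous_on (UNIV \<times> {0..1}) (\<lambda>(x, t). u x t)"
    and cont_v: "continuous_on (UNIV \<times> {0..1}) (\<lambda>(x, t). dt u x t)"
    and cont_A: "continuous_on (UNIV \<times> {0..1})
        (\<lambda>(x, t). n - 2 * a x * u x t + L (\<lambda>y. u y t) x)"
    and cont_grad: "continuous_on (UNIV \<times> {0..1}) (\<lambda>(x, t). \<Gamma> (\<lambda>y. u y t) (\<lambda>y. u y t) x)"
    and A_pos_0: "0 < n - 2 * a x * u x 0 + L (\<lambda>y. u y 0) x"
    and A_pos_1: "0 < n - 2 * a x * u x 1 + L (\<lambda>y. u y 1) x"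
begin

abbreviation v where "v \<equiv> dt u"
abbreviation utt where "utt \<equiv> dt (dt u)"

definition A :: "'a \<Rightarrow> real \<Rightarrow> real" where
  "A = (\<lambda>x t. n - 2 * a x * u x t + lp u x t)"

definition F :: "'a \<Rightarrow> real \<Rightarrow> real" where
  "F = (\<lambda>x t. \<psi> x + a x * (v x t)\<^sup>2)"

lemma C_u_le: "k \<le> 4 \<Longrightarrow> C k u"
  using C_mono C_u by blast

lemma C_v: "k \<le> 3 \<Longrightarrow> C k v"
  using C_dt[of 3 u] C_u C_mono[of k 3 v] by simp

lemma C_utt: "k \<le> 2 \<Longrightarrow> C k utt"
  using C_dt[of 2 v] C_v[of 3] C_mono[of k 2 utt] by simp

lemma C_lpu: "k \<le> 2 \<Longrightarrow> C k (lp u)"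
  using C_lp[of 2 u] C_u C_mono[of k 2 "lp u"] by (simp add: numeral_eq_Suc)

lemma C_A: "k \<le> 2 \<Longrightarrow> C k A"
  unfolding A_def by (intro C_intros C_a C_u_le C_lpu) auto

lemma C_gm_vv: "k \<le> 2 \<Longrightarrow> C k (gm v v)"
  using C_gm[of 2 v v] C_v[of 3] C_mono[of k 2 "gm v v"] by simp

lemma eq: "0 < t \<Longrightarrow> t < 1 \<Longrightarrow> utt x t * A x t - gm v v x t = F x t"
  unfolding A_def F_def gm_def lp_def by (rule equation)

lemma F_pos: "0 < F x t"
  unfolding F_def using \<psi>_pos[of x] a_nonneg[of x] by (simp add: add_pos_nonneg)

lemma cont_A': "continuous_on (UNIV \<times> {0..1}) (\<lambda>(x, t). A x t)"
  using cont_A by (simp add: A_def lp_def)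

lemma cont_slice:
  assumes "continuous_on (UNIV \<times> {0..1}) (\<lambda>(x, t). f x t :: real)"
  shows "continuous_on {0..1} (f x)"
proof -
  have "continuous_on {0..1} ((\<lambda>(x, t). f x t) \<circ> Pair x)"
    by (intro continuous_on_compose continuous_on_subset[OF assms])
       (auto intro!: continuous_intros)
  then show ?thesis by (simp add: o_def)
qed

text \<open>At a zero of \<open>A\<close> the left side of the equation is \<open>- |\<nabla>v|\<^sup>2 \<le> 0\<close>, but the right side is positive.\<close>

lemma A_pos:
  assumes "0 \<le> t" "t \<le> 1"
  shows "0 < A x t"
proof (rule ccontr)
  assume neg: "\<not> 0 < A x t"
  have A0: "0 < A x 0" and A1: "0 < A x 1"
    using A_pos_0 A_pos_1 by (auto simp: A_def lp_def)
  have "continuous_on {0..t} (A x)"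
    using cont_slice[OF cont_A', of x] by (rule continuous_on_subset) (use assms in auto)
  then obtain s where s: "0 \<le> s" "s \<le> t" "A x s = 0"
    using IVT2'[of "A x" t 0 0] neg A0 assms by force
  with A0 A1 assms have "0 < s" "s < 1" by (auto simp: less_le)
  with eq[of s x] s F_pos[of x s] gm_nonneg[of v s x] C_v[of 1] show False by simp
qed

lemma utt_pos:
  assumes "0 < t" "t < 1"
  shows "0 < utt x t"
proof -
  have "0 < utt x t * A x t"
    using eq[of t x] F_pos[of x t] gm_nonneg[of v t x] C_v[of 1] assms by simp
  then show ?thesis using A_pos[of t x] assms by (simp add: zero_less_mult_iff)
qed

lemma v_mono:
  assumes "0 \<le> s" "s \<le> t" "t \<le> 1"
  shows "v x s \<le> v x t"
proof (cases "s = t")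
  case False
  have "v x s < v x t"
  proof (rule DERIV_pos_imp_increasing_open[of s t "v x"])
    show "s < t" using False assms by simp
    show "\<exists>y. (v x has_real_derivative y) (at r) \<and> y > 0" if "s < r" "r < t" for r
      using that assms utt_pos[of r x] has_dt[of v r x] C_v[of 1] by (auto intro!: exI[of _ "utt x r"])
    show "continuous_on {s..t} (v x)"
      using cont_slice[OF cont_v, of x] by (rule continuous_on_subset) (use assms in auto)
  qed
  then show ?thesis by simp
qed simp

text \<open>The equation gives \<open>|\<nabla>v|\<^sup>2 \<le> u\<^sub>t\<^sub>t A\<close>, so the linearised operator may be tested against the Hessian at a
  maximum.\<close>

lemma maximum_principle:
  assumes "C 2 f" "0 < t" "t < 1" and max: "\<And>y s. 0 \<le> s \<Longrightarrow> s \<le> 1 \<Longrightarrow> f y s \<le> f x t"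
  shows "A x t * dt (dt f) x t + utt x t * lp f x t - 2 * gm v (dt f) x t \<le> 0"
    and "dt f x t = 0" and "\<And>w. C 1 w \<Longrightarrow> gm f w x t = 0"
proof -
  have "gm v v x t \<le> utt x t * A x t"
    using eq[OF assms(2,3), of x] F_pos[of x t] by simp
  then show "A x t * dt (dt f) x t + utt x t * lp f x t - 2 * gm v (dt f) x t \<le> 0"
    by (intro at_interior_max(3)) (use assms C_v[of 1] utt_pos in auto)
  show "dt f x t = 0" "\<And>w. C 1 w \<Longrightarrow> gm f w x t = 0"
    using at_interior_max[of f t x] assms by auto
qed

lemma attains_max:
  fixes f :: "'a \<Rightarrow> real \<Rightarrow> real"
  assumes "continuous_on (UNIV \<times> {0..1}) (\<lambda>(x, t). f x t)"
  shows "\<exists>x t. 0 \<le> t \<and> t \<le> 1 \<and> (\<forall>y s. 0 \<le> s \<longrightarrow> s \<le> 1 \<longrightarrow> f y s \<le> f x t)"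
proof -
  have "\<exists>p\<in>UNIV \<times> {0..1}. \<forall>q\<in>UNIV \<times> {0..1}. (\<lambda>(x, t). f x t) q \<le> (\<lambda>(x, t). f x t) p"
    by (rule continuous_attains_sup[OF compact_Times[OF compact_space compact_Icc] _ assms]) simp
  then show ?thesis by fastforce
qed

section \<open>Barriers and the time derivative\<close>

text \<open>A comparison principle. Suppose that \<open>h = \<xi> - \<theta> - u\<close> has a positive maximum. With \<open>b = - \<theta>''\<close> and
  \<open>P = n - 2 a \<xi> + \<Delta>\<xi> + 2 a \<theta>\<close> the maximum principle gives \<open>A b + u\<^sub>t\<^sub>t P \<le> 2 F\<close>; the zeroth order term
  \<open>2 a u\<^sub>t\<^sub>t h\<close> has the right sign because \<open>a \<ge> 0\<close>. But \<open>A u\<^sub>t\<^sub>t \<ge> F\<close> and \<open>b P > F\<close>, so that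
  \<open>A b + u\<^sub>t\<^sub>t P > 2 F\<close> by the inequality of arithmetic and geometric means.\<close>

lemma barrier:
  fixes \<theta> \<theta>' \<theta>'' :: "real \<Rightarrow> real"
  assumes C_\<xi>: "\<And>k. C k (\<lambda>x t. \<xi> x)" and cont_\<xi>: "continuous_on UNIV \<xi>"
    and d1: "\<And>t. t \<in> T \<Longrightarrow> (\<theta> has_real_derivative \<theta>' t) (at t)"
    and d2: "\<And>t. t \<in> T \<Longrightarrow> (\<theta>' has_real_derivative \<theta>'' t) (at t)"
    and T: "{0..1} \<subseteq> T" "continuous_on T \<theta>''"
    and \<theta>_nonneg: "\<And>t. 0 \<le> t \<Longrightarrow> t \<le> 1 \<Longrightarrow> 0 \<le> \<theta> t"
    and strict: "\<And>x t. 0 < t \<Longrightarrow> t < 1 \<Longrightarrow>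
       \<theta>'' t < 0 \<and> 0 < n - 2 * a x * \<xi> x + L \<xi> x \<and>
       \<psi> x + a x * (\<theta>' t)\<^sup>2 < - \<theta>'' t * (n - 2 * a x * \<xi> x + L \<xi> x + 2 * a x * \<theta> t)"
    and bd: "\<And>x. \<xi> x - \<theta> 0 \<le> u x 0" "\<And>x. \<xi> x - \<theta> 1 \<le> u x 1"
    and t: "0 \<le> t" "t \<le> 1"
  shows "\<xi> x - \<theta> t \<le> u x t"
proof -
  define h where "h = (\<lambda>x t. \<xi> x + (- u x t + (- \<theta> t)))"
  have C\<theta>: "C 2 (\<lambda>x t. \<theta> t)"
    by (rule C_compose[where T = T, OF C_time _ d1 d2]) (use T in auto)
  have Cn\<theta>: "C 2 (\<lambda>x t. - \<theta> t)" by (intro C_intros C\<theta>)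
  have Cnu: "C k (\<lambda>x t. - u x t)" if "k \<le> 4" for k by (intro C_intros C_u_le that)
  have Ch1: "C 2 (\<lambda>x t. - u x t + (- \<theta> t))" by (intro C_intros C_u_le C\<theta>) auto
  have Ch: "C 2 h" unfolding h_def by (intro C_intros C_\<xi> C_u_le C\<theta>) auto
  have "continuous_on {0..1} \<theta>"
  proof (rule DERIV_continuous_on)
    show "(\<theta> has_real_derivative \<theta>' t) (at t within {0..1})" if "t \<in> {0..1}" for t
      by (rule has_field_derivative_at_within, rule d1) (use T that in auto)
  qed
  then have "continuous_on (UNIV \<times> {0..1}) (\<lambda>p. \<theta> (snd p) :: real)"
    by (rule continuous_on_compose2) (auto intro!: continuous_intros)
  moreover have "continuous_on (UNIV \<times> {0..1}) (\<lambda>p. \<xi> (fst p))"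
    by (rule continuous_on_compose2[OF cont_\<xi>]) (auto intro!: continuous_intros)
  ultimately have cont_h: "continuous_on (UNIV \<times> {0..1}) (\<lambda>(x, t). h x t)"
    using cont_u unfolding h_def split_beta by (intro continuous_intros) auto
  obtain x0 t0 where
    x0: "0 \<le> t0" "t0 \<le> 1" and max': "\<forall>y s. 0 \<le> s \<longrightarrow> s \<le> 1 \<longrightarrow> h y s \<le> h x0 t0"
    using attains_max[OF cont_h] by blast
  have max: "h y s \<le> h x0 t0" if "0 \<le> s" "s \<le> 1" for y s using max' that by blast
  have "h x0 t0 \<le> 0"
  proof (rule ccontr)
    assume pos: "\<not> h x0 t0 \<le> 0"
    have "t0 \<noteq> 0" "t0 \<noteq> 1" using pos bd[of x0] by (auto simp: h_def)
    with x0 have t0: "0 < t0" "t0 < 1" by auto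
    note mp = maximum_principle[OF Ch t0 max]
    have der: "dt h y s = - v y s + (- \<theta>' s)" if "0 < s" "s < 1" for y s
    proof (rule dt_eqI)
      show "(h y has_real_derivative - v y s + (- \<theta>' s)) (at s)"
        unfolding h_def using that has_dt[of u s y] C_u_le[of 1] T
        by (auto intro!: derivative_eq_intros d1)
    qed (use that in auto)
    have htt: "dt (dt h) x0 t0 = - utt x0 t0 + (- \<theta>'' t0)"
    proof (rule dt_cong_deriv[where h = "\<lambda>s. - v x0 s + (- \<theta>' s)"])
      show "((\<lambda>s. - v x0 s + - \<theta>' s) has_real_derivative - utt x0 t0 + - \<theta>'' t0) (at t0)"
        using t0 has_dt[of v t0 x0] C_v[of 1] T by (auto intro!: derivative_eq_intros d2)
    qed (use der t0 in auto)
    have neg: "lp (\<lambda>x t. - u x t) x0 t0 = - lp u x0 t0" "gm v (\<lambda>x t. - v x t) x0 t0 = - gm v v x0 t0"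
      using lp_mult[OF C_const[of 2 "-1"] C_u_le[of 2] t0, of x0] lp_const[of "\<lambda>t. -1" x0 t0]
        gm_const1[of "\<lambda>t. -1" u x0 t0]
        gm_mult2[OF C_const[of 1 "-1"] C_v[of 1] C_v[of 1] t0, of x0]
        gm_const2[OF C_const[of 1 "-1"] C_v[of 1] t0, of x0] by auto
    have lph: "lp h x0 t0 = L \<xi> x0 - lp u x0 t0"
      unfolding h_def using lp_add[OF C_\<xi> Ch1 t0, of x0] lp_add[OF Cnu Cn\<theta> t0, of x0]
        lp_const[of "\<lambda>t. - \<theta> t" x0 t0] neg by (simp add: lp_def)
    have gmh: "gm v (dt h) x0 t0 = - gm v v x0 t0"
    proof -
      have "gm v (dt h) x0 t0 = gm v (\<lambda>x t. - v x t + (\<lambda>x t. - \<theta>' t0) x t) x0 t0"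
        by (rule gm_cong) (use der t0 in auto)
      also have "\<dots> = gm v (\<lambda>x t. - v x t) x0 t0 + gm v (\<lambda>x t. - \<theta>' t0) x0 t0"
        using t0 C_v[of 1] by (intro gm_add2) (auto intro!: C_intros)
      finally show ?thesis
        using neg gm_const2[OF C_const[of 1 "- \<theta>' t0"] C_v[of 1] t0, of x0] by simp
    qed
    \<comment> \<open>this turns the \<open>\<theta>'\<close> in the hypothesis on \<open>\<theta>\<close> into the \<open>v\<close> in \<open>F\<close>\<close>
    have vt: "v x0 t0 = - \<theta>' t0" using mp(2) der[OF t0, of x0] by simp
    define P where "P = n - 2 * a x0 * \<xi> x0 + L \<xi> x0 + 2 * a x0 * \<theta> t0"
    define b where "b = - \<theta>'' t0"
    have Fb: "F x0 t0 < b * P" and b: "b > 0" and "0 < n - 2 * a x0 * \<xi> x0 + L \<xi> x0"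
      using strict[OF t0, of x0] by (auto simp: F_def vt P_def b_def)
    then have P: "P > 0" using a_nonneg[of x0] \<theta>_nonneg[of t0] t0 by (simp add: P_def add_pos_nonneg)
    have Lc: "L \<xi> x0 - lp u x0 t0 = P - A x0 t0 + 2 * a x0 * h x0 t0"
      by (simp add: P_def A_def h_def algebra_simps)
    have s: "utt x0 t0 > 0" and A: "A x0 t0 > 0" using utt_pos[OF t0] A_pos[of t0] t0 by auto
    have "A x0 t0 * (b - utt x0 t0) + utt x0 t0 * (P - A x0 t0 + 2 * a x0 * h x0 t0)
        + 2 * gm v v x0 t0 \<le> 0"
      using mp(1) unfolding htt lph gmh Lc by (simp add: b_def algebra_simps)
    moreover have "0 \<le> utt x0 t0 * (2 * a x0 * h x0 t0)"
      using s a_nonneg[of x0] pos by (intro mult_nonneg_nonneg) auto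
    ultimately have le: "A x0 t0 * b + utt x0 t0 * P \<le> 2 * F x0 t0"
      using eq[OF t0, of x0] by (simp add: algebra_simps)
    have "F x0 t0 \<le> utt x0 t0 * A x0 t0"
      using eq[OF t0, of x0] gm_nonneg[of v t0 x0] C_v[of 1] t0 by simp
    then have "4 * (F x0 t0 * F x0 t0) < 4 * ((A x0 t0 * utt x0 t0) * (b * P))"
      using Fb F_pos[of x0 t0] by (intro mult_strict_left_mono mult_le_less_imp_less) (auto simp: mult.commute)
    also have "\<dots> = 4 * (A x0 t0 * b) * (utt x0 t0 * P)" by simp
    also have "\<dots> \<le> (A x0 t0 * b + utt x0 t0 * P)\<^sup>2"
      using zero_le_power2[of "A x0 t0 * b - utt x0 t0 * P"] by (simp add: power2_eq_square algebra_simps)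
    also have "\<dots> \<le> (2 * F x0 t0)\<^sup>2"
      using le A b s P by (intro power_mono) auto
    finally show False by (simp add: power2_eq_square)
  qed
  with max[OF t, of x] show ?thesis by (simp add: h_def)
qed

text \<open>The barrier is \<open>\<theta> = (w - c) / (2 abar)\<close> with \<open>w\<^sup>2 = c\<^sup>2 + k t (2 - t)\<close>, \<open>k = W\<^sup>2 - c\<^sup>2\<close>. If \<open>a\<close> is the constant \<open>abar\<close>,
  the inequality required of \<open>\<theta>\<close> becomes \<open>- w'' w > 2 abar \<Psi> + w'\<^sup>2 / 2\<close> for \<open>w = c + 2 abar \<theta>\<close>, and \<open>w\<close> solves
  \<open>- w'' w = k + w'\<^sup>2\<close>; a large \<open>k\<close> suffices. For \<open>0 \<le> a \<le> abar\<close> both sides are interpolated with the weight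
  \<open>p = a / abar\<close>. The three summands of \<open>W = w(1)\<close> ensure that \<open>k\<close> is comparable with \<open>W\<^sup>2\<close>, that
  \<open>\<theta>(1) \<ge> B\<close>, and that \<open>k\<close> dominates \<open>\<Psi>\<close>. The second inequality is the first one with time reversed.\<close>

lemma barrier_bound:
  assumes c: "0 < c" and abar: "1 \<le> abar" "\<And>x. a x \<le> abar" and Psi: "\<And>x. \<psi> x \<le> \<Psi>"
    and B: "0 \<le> B" "\<And>x. \<bar>u x 1 - u x 0\<bar> \<le> B"
    and Ac: "\<And>x. c \<le> A x 0" "\<And>x. c \<le> A x 1"
    and C0: "\<And>k. C k (\<lambda>x t. u x 0)" and C1: "\<And>k. C k (\<lambda>x t. u x 1)"
    and W_def: "W = 2 * c + 2 * abar * B + 4 * abar * \<Psi> / c"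
    and R_def: "R = (W\<^sup>2 - c\<^sup>2) / (2 * abar * c)"
    and t: "0 \<le> t" "t \<le> 1"
  shows "u x 0 - R * t \<le> u x t" "u x 1 - R * (1 - t) \<le> u x t"
proof -
  define k where "k = W\<^sup>2 - c\<^sup>2"
  define y where "y = (\<lambda>t::real. c\<^sup>2 + k * (t * (2 - t)))"
  define w where "w = (\<lambda>t. sqrt (y t))"
  define w1 where "w1 = (\<lambda>t. k * (1 - t) / w t)"
  define r where "r = (\<lambda>t. (w t - c) / (2 * abar))"
  define r1 where "r1 = (\<lambda>t. w1 t / (2 * abar))"
  define r2 where "r2 = (\<lambda>t. - (k + (w1 t)\<^sup>2) / (2 * abar * w t))"
  define T where "T = {t. 0 < y t}"
  have Psi_pos: "0 < \<Psi>" using \<psi>_pos[of undefined] Psi[of undefined] by simp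
  have W: "2 * c \<le> W" "c + 2 * abar * B \<le> W" "4 * abar * \<Psi> \<le> c * W"
    using c abar B Psi_pos by (auto simp: W_def algebra_simps)
  have "(2 * c)\<^sup>2 \<le> W\<^sup>2" using W c by (intro power_mono) auto
  then have "4 * c\<^sup>2 \<le> W\<^sup>2" by (simp add: power_mult_distrib)
  moreover have "0 < c\<^sup>2" using c by simp
  ultimately have k: "3 * W\<^sup>2 / 4 \<le> k" "0 < k" unfolding k_def by linarith+
  have kc: "2 * abar * \<Psi> * W < k * c"
  proof -
    have "2 * abar * \<Psi> * W < 3 * abar * \<Psi> * W"
    proof -
      have "0 < abar * \<Psi> * W" using abar Psi_pos W c by (intro mult_pos_pos) auto
      then show ?thesis by linarith
    qed
    also have "\<dots> \<le> 3 / 4 * (c * W) * W" using W c by (intro mult_right_mono) (auto simp: mult.commute mult.left_commute)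
    also have "\<dots> = 3 * W\<^sup>2 / 4 * c" by (simp add: power2_eq_square)
    also have "\<dots> \<le> k * c" using k c by (intro mult_right_mono) auto
    finally show ?thesis .
  qed
  have tt: "0 \<le> t * (2 - t)" "t * (2 - t) \<le> 1" if "0 \<le> t" "t \<le> 1" for t :: real
  proof -
    show "0 \<le> t * (2 - t)" using that by (intro mult_nonneg_nonneg) auto
    show "t * (2 - t) \<le> 1" using zero_le_power2[of "1 - t"] by (simp add: power2_eq_square algebra_simps)
  qed
  have y: "c\<^sup>2 \<le> y t" "y t \<le> W\<^sup>2" if "0 \<le> t" "t \<le> 1" for t
  proof -
    have "0 \<le> k * (t * (2 - t))" "k * (t * (2 - t)) \<le> k * 1"
      using tt[OF that] k by (auto intro!: mult_nonneg_nonneg mult_left_mono)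
    then show "c\<^sup>2 \<le> y t" "y t \<le> W\<^sup>2" by (auto simp: y_def k_def)
  qed
  have y_pos: "0 < y t" if "0 \<le> t" "t \<le> 1" for t
    using y[OF that] c zero_less_power[of c 2] by linarith
  have w: "c \<le> w t" "w t \<le> W" if "0 \<le> t" "t \<le> 1" for t
    using y[OF that] c W unfolding w_def by (auto intro: real_le_rsqrt real_le_lsqrt)
  have w_pos: "0 < w t" and w_sq: "w t * w t = y t" if "t \<in> T" for t
    using that unfolding T_def w_def by auto
  have Tsub: "{0..1} \<subseteq> T" using y_pos by (auto simp: T_def)
  have dy: "(y has_real_derivative 2 * k * (1 - t)) (at t)" for t
    unfolding y_def by (auto intro!: derivative_eq_intros simp: algebra_simps)
  have dw: "(w has_real_derivative w1 t) (at t)" if "t \<in> T" for t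
  proof -
    have "(w has_real_derivative inverse (sqrt (y t)) / 2 * (2 * k * (1 - t))) (at t)"
      unfolding w_def by (rule DERIV_chain2[OF DERIV_real_sqrt dy]) (use that in \<open>auto simp: T_def\<close>)
    moreover have "inverse (sqrt (y t)) / 2 * (2 * k * (1 - t)) = w1 t"
    proof -
      have "inverse z / 2 * (2 * q) = q / z" for z q :: real by (cases "z = 0") (auto simp: field_simps)
      from this[of "sqrt (y t)" "k * (1 - t)"] show ?thesis unfolding w1_def w_def by (simp only: mult.assoc)
    qed
    ultimately show ?thesis by simp
  qed
  have dw1: "(w1 has_real_derivative - (k + (w1 t)\<^sup>2) / w t) (at t)" if "t \<in> T" for t
  proof -
    have "(w1 has_real_derivative ((- k) * w t - k * (1 - t) * w1 t) / (w t * w t)) (at t)"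
    proof -
      have "((\<lambda>t. k * (1 - t)) has_real_derivative - k) (at t)"
        using DERIV_cmult[OF DERIV_diff[OF DERIV_const[of 1] DERIV_ident], of k t] by simp
      from DERIV_divide[OF this dw[OF that]] w_pos[OF that] show ?thesis
        unfolding w1_def by simp
    qed
    moreover have "((- k) * w t - k * (1 - t) * w1 t) / (w t * w t) = - (k + (w1 t)\<^sup>2) / w t"
    proof -
      have "k * (1 - t) = w1 t * w t" using w_pos[OF that] by (simp add: w1_def)
      then show ?thesis unfolding \<open>k * (1 - t) = w1 t * w t\<close>
        using w_pos[OF that] by (simp add: divide_simps power2_eq_square) (simp add: algebra_simps)
    qed
    ultimately show ?thesis by simp
  qed
  have dr: "(r has_real_derivative r1 t) (at t)" if "t \<in> T" for t
    unfolding r_def r1_def using DERIV_cdivide[OF DERIV_diff[OF dw[OF that] DERIV_const[of c]], of "2 * abar"] by simp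
  have dr1: "(r1 has_real_derivative r2 t) (at t)" if "t \<in> T" for t
    unfolding r1_def r2_def using DERIV_cdivide[OF dw1[OF that], of "2 * abar"] by (simp add: mult.commute)
  have cont_y: "continuous_on S y" for S unfolding y_def by (intro continuous_intros)
  have cont_r2: "continuous_on T r2"
    unfolding r2_def w1_def w_def using abar
    by (intro continuous_intros cont_y) (auto simp: T_def)
  have r_nonneg: "0 \<le> r t" if "0 \<le> t" "t \<le> 1" for t
    using w[OF that] abar by (simp add: r_def)
  have r_le: "r t \<le> R * t" if "0 \<le> t" "t \<le> 1" for t
  proof -
    have "(w t - c) * (2 * c) \<le> (w t - c) * (w t + c)"
      using w[OF that] by (intro mult_left_mono) auto
    also have "\<dots> = k * (t * (2 - t))"
      using w_sq[of t] Tsub that by (simp add: y_def algebra_simps power2_eq_square subset_iff)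
    also have "\<dots> \<le> k * (t * 2)" using k that by (intro mult_left_mono) auto
    finally have "w t - c \<le> k * t / c" using c by (simp add: field_simps)
    then have "r t \<le> (k * t / c) / (2 * abar)" unfolding r_def using abar by (intro divide_right_mono) auto
    also have "\<dots> = R * t" by (simp add: R_def k_def)
    finally show ?thesis .
  qed
  have strict: "r2 t < 0 \<and> 0 < A0 \<and> \<psi> x + a x * (r1 t)\<^sup>2 < - r2 t * (A0 + 2 * a x * r t)"
    if t: "0 \<le> t" "t \<le> 1" and A0: "c \<le> A0" for t x A0
  proof -
    have tT: "t \<in> T" using t Tsub by auto
    note wp = w_pos[OF tT]
    define p where "p = a x / abar"
    have p: "0 \<le> p" "p \<le> 1" using a_nonneg[of x] abar by (auto simp: p_def)
    have ap: "a x = p * abar" using abar by (simp add: p_def)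
    have "0 < k + (w1 t)\<^sup>2" using k by (intro add_pos_nonneg) auto
    then have r2neg: "r2 t < 0" using wp abar unfolding r2_def by (intro divide_neg_pos mult_pos_pos) linarith+
    have kW: "\<Psi> < k * c / (2 * abar * w t)" "\<Psi> < k / (2 * abar)"
    proof -
      have "2 * abar * \<Psi> * w t \<le> 2 * abar * \<Psi> * W"
        using w[OF t] abar Psi_pos by (intro mult_left_mono) auto
      with kc have *: "2 * abar * \<Psi> * w t < k * c" by linarith
      then show "\<Psi> < k * c / (2 * abar * w t)" using wp abar by (simp add: field_simps)
      have "2 * abar * \<Psi> * c \<le> 2 * abar * \<Psi> * w t"
        using w[OF t] abar Psi_pos by (intro mult_left_mono) auto
      with * have "(2 * abar * \<Psi>) * c < k * c" by linarith
      then have "2 * abar * \<Psi> < k" using c by simp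
      then show "\<Psi> < k / (2 * abar)" using abar by (simp add: field_simps)
    qed
    have "\<psi> x + a x * (r1 t)\<^sup>2 = \<psi> x + p * (w1 t)\<^sup>2 / (4 * abar)"
      using abar by (simp add: ap r1_def power2_eq_square field_simps)
    also have "\<dots> \<le> (1 - p) * \<Psi> + p * \<Psi> + p * (w1 t)\<^sup>2 / (2 * abar)"
    proof -
      have "p * (w1 t)\<^sup>2 / (4 * abar) \<le> p * (w1 t)\<^sup>2 / (2 * abar)"
        using p abar by (intro divide_left_mono) auto
      then show ?thesis using Psi[of x] by (simp add: algebra_simps)
    qed
    also have "\<dots> < (1 - p) * (k * c / (2 * abar * w t)) + p * (k / (2 * abar)) + p * (w1 t)\<^sup>2 / (2 * abar)"
    proof -
      have "(1 - p) * \<Psi> + p * \<Psi> < (1 - p) * (k * c / (2 * abar * w t)) + p * (k / (2 * abar))"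
      proof (cases "p = 0")
        case False
        with p have "p * \<Psi> < p * (k / (2 * abar))" using kW by (intro mult_strict_left_mono) auto
        moreover have "(1 - p) * \<Psi> \<le> (1 - p) * (k * c / (2 * abar * w t))"
          using kW p by (intro mult_left_mono) auto
        ultimately show ?thesis by linarith
      qed (use kW in simp)
      then show ?thesis by simp
    qed
    also have "\<dots> \<le> (1 - p) * ((k + (w1 t)\<^sup>2) * c / (2 * abar * w t)) + p * ((k + (w1 t)\<^sup>2) / (2 * abar))"
    proof -
      have "k * c / (2 * abar * w t) \<le> (k + (w1 t)\<^sup>2) * c / (2 * abar * w t)"
        using c wp abar by (intro divide_right_mono mult_right_mono) auto
      from mult_left_mono[OF this, of "1 - p"] p show ?thesis
        by (simp add: add_divide_distrib distrib_left)
    qed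
    also have "\<dots> = - r2 t * (c + p * (w t - c))"
      using wp abar by (simp add: r2_def field_simps)
    also have "\<dots> = - r2 t * (c + 2 * a x * r t)"
      using abar by (simp add: r_def ap)
    also have "\<dots> \<le> - r2 t * (A0 + 2 * a x * r t)"
      using A0 r2neg by (intro mult_left_mono) auto
    finally show ?thesis using r2neg A0 c by simp
  qed
  have A_at: "n - 2 * a x * u x s + L (\<lambda>y. u y s) x = A x s" for x s
    by (simp add: A_def lp_def)
  have cont_bd: "continuous_on UNIV (\<lambda>x. u x s)" if "0 \<le> s" "s \<le> 1" for s
  proof -
    have "continuous_on UNIV ((\<lambda>(x, t). u x t) \<circ> (\<lambda>x. (x, s)))"
      by (intro continuous_on_compose continuous_on_subset[OF cont_u])
         (use that in \<open>auto intro!: continuous_intros\<close>)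
    then show ?thesis by (simp add: o_def)
  qed
  have w01: "w 0 = c" "w 1 = W" using c W by (auto simp: w_def y_def k_def)
  have r01: "r 0 = 0" "B \<le> r 1"
    using W abar by (auto simp: r_def w01 field_simps)
  have "u x 0 - r t \<le> u x t"
  proof (rule barrier[where T = T and \<theta>' = r1 and \<theta>'' = r2])
    show "u x 0 - r 1 \<le> u x 1" for x using B(2)[of x] r01 by (simp add: abs_le_iff)
  qed (use C0 cont_bd Tsub cont_r2 r_nonneg r01 strict[OF _ _ Ac(1)] t in \<open>auto simp: A_at intro: dr dr1\<close>)
  then show "u x 0 - R * t \<le> u x t" using r_le[OF t] by simp
  have T1: "t \<in> (-) 1 ` T \<longleftrightarrow> 1 - t \<in> T" for t by force
  have "u x 1 - r (1 - t) \<le> u x t"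
  proof (rule barrier[where T = "(-) 1 ` T" and \<theta> = "\<lambda>t. r (1 - t)"
          and \<theta>' = "\<lambda>t. - r1 (1 - t)" and \<theta>'' = "\<lambda>t. r2 (1 - t)"])
    show "((\<lambda>t. r (1 - t)) has_real_derivative - r1 (1 - t)) (at t)" if "t \<in> (-) 1 ` T" for t
    proof -
      have "((\<lambda>t. r (1 - t)) has_real_derivative r1 (1 - t) * (0 - 1)) (at t)"
        by (rule DERIV_chain2[OF dr DERIV_diff[OF DERIV_const DERIV_ident]]) (use that in \<open>simp add: T1\<close>)
      then show ?thesis by simp
    qed
    show "((\<lambda>t. - r1 (1 - t)) has_real_derivative r2 (1 - t)) (at t)" if "t \<in> (-) 1 ` T" for t
    proof -
      have "((\<lambda>t. r1 (1 - t)) has_real_derivative r2 (1 - t) * (0 - 1)) (at t)"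
        by (rule DERIV_chain2[OF dr1 DERIV_diff[OF DERIV_const DERIV_ident]]) (use that in \<open>simp add: T1\<close>)
      then show ?thesis using DERIV_minus by fastforce
    qed
    show "continuous_on ((-) 1 ` T) (\<lambda>t. r2 (1 - t))"
      by (rule continuous_on_compose2[OF cont_r2]) (auto intro!: continuous_intros)
    show "{0..1} \<subseteq> (-) 1 ` T" by (auto simp: T1 intro!: subsetD[OF Tsub])
    show "u x 1 - r (1 - 0) \<le> u x 0" for x using B(2)[of x] r01 by (simp add: abs_le_iff)
    show "r2 (1 - t) < 0 \<and> 0 < n - 2 * a x * u x 1 + L (\<lambda>x. u x 1) x \<and>
        \<psi> x + a x * (- r1 (1 - t))\<^sup>2
          < - r2 (1 - t) * (n - 2 * a x * u x 1 + L (\<lambda>x. u x 1) x + 2 * a x * r (1 - t))"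
      if "0 < t" "t < 1" for x t
      using strict[of "1 - t", OF _ _ Ac(2)[of x]] that by (simp add: A_at)
  qed (use C1 cont_bd r_nonneg r01 t in auto)
  then show "u x 1 - R * (1 - t) \<le> u x t" using r_le[of "1 - t"] t by simp
qed

text \<open>As \<open>u\<close> is convex in \<open>t\<close>, \<open>v\<close> lies between the slopes of the chords to the two ends.\<close>

lemma velocity_bound:
  assumes low: "\<And>t x. 0 \<le> t \<Longrightarrow> t \<le> 1 \<Longrightarrow> u x 0 - R * t \<le> u x t"
      "\<And>t x. 0 \<le> t \<Longrightarrow> t \<le> 1 \<Longrightarrow> u x 1 - R * (1 - t) \<le> u x t"
    and t: "0 \<le> t" "t \<le> 1"
  shows "\<bar>v x t\<bar> \<le> R"
proof -
  have du: "(u x has_real_derivative v x s) (at s)" if "0 < s" "s < 1" for s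
    using has_dt[of u s x] C_u_le[of 1] that by simp
  have cu: "continuous_on {p..q} (u x)" if "0 \<le> p" "q \<le> 1" for p q
    using cont_slice[OF cont_u, of x] by (rule continuous_on_subset) (use that in auto)
  have int: "\<bar>v x s\<bar> \<le> R" if s: "0 < s" "s < 1" for s
  proof -
    have diff: "u x differentiable (at r)" if "0 < r" "r < 1" for r
      using du[OF that] real_differentiable_def by blast
    have "\<exists>l p. 0 < p \<and> p < s \<and> DERIV (u x) p :> l \<and> u x s - u x 0 = (s - 0) * l"
      by (rule MVT) (use s in \<open>auto intro: diff cu\<close>)
    then obtain l p where p: "0 < p" "p < s" "DERIV (u x) p :> l" "u x s - u x 0 = (s - 0) * l" by blast
    have "l = v x p" using DERIV_unique[OF p(3) du] p s by simp
    have "s * (- R) \<le> s * v x p" using low(1)[of s x] s p \<open>l = v x p\<close> by (simp add: algebra_simps)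
    then have "- R \<le> v x p" using s by (simp only: mult_le_cancel_left_pos)
    then have "- R \<le> v x s" using v_mono[of p s x] p s by simp
    have "\<exists>m q. s < q \<and> q < 1 \<and> DERIV (u x) q :> m \<and> u x 1 - u x s = (1 - s) * m"
      by (rule MVT) (use s in \<open>auto intro: diff cu\<close>)
    then obtain m q where q: "s < q" "q < 1" "DERIV (u x) q :> m" "u x 1 - u x s = (1 - s) * m" by blast
    have "m = v x q" using DERIV_unique[OF q(3) du] q s by simp
    have "(1 - s) * v x q \<le> (1 - s) * R" using low(2)[of s x] s q \<open>m = v x q\<close> by (simp add: algebra_simps)
    then have "v x q \<le> R" using s by (simp only: mult_le_cancel_left_pos)
    then have "v x s \<le> R" using v_mono[of s q x] q s by simp
    with \<open>- R \<le> v x s\<close> show ?thesis by simp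
  qed
  \<comment> \<open>the interior bound extends to the ends by continuity\<close>
  have "norm (v x t) \<le> R"
    by (rule continuous_on_closure_norm_le[of "{0<..<1}" "v x"])
       (use cont_slice[OF cont_v, of x] int t in auto)
  then show ?thesis by simp
qed

section \<open>The bound for the Laplacian\<close>

text \<open>The function \<open>A exp f\<close> with \<open>f = \<lambda> v\<^sup>2 / 2 + t\<^sup>2 / 4\<close> is examined at an interior maximum; \<open>s\<close>, \<open>g\<close>, \<open>V\<close> are the
  values of \<open>u\<^sub>t\<^sub>t\<close>, \<open>|\<nabla>v|\<^sup>2\<close>, \<open>v\<close> there. The Laplacian of the equation expresses
  \<open>A A\<^sub>t\<^sub>t + s \<Delta>A - 2 \<langle>\<nabla>v, \<nabla>A\<^sub>t\<rangle>\<close> through \<open>\<Delta>|\<nabla>v|\<^sup>2 - 2 \<langle>\<nabla>v, \<nabla>\<Delta>v\<rangle>\<close> and \<open>\<langle>\<nabla>u\<^sub>t\<^sub>t, \<nabla>A\<rangle>\<close>. In the latter,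
  \<open>\<nabla>A = - \<lambda> V A \<nabla>v\<close> by the first order condition, and the gradient of the equation replaces
  \<open>A \<langle>\<nabla>v, \<nabla>u\<^sub>t\<^sub>t\<rangle>\<close> by \<open>\<langle>\<nabla>v, \<nabla>|\<nabla>v|\<^sup>2\<rangle>\<close> and lower order terms: this is the Bochner expression for
  \<open>f = w = v\<close> and \<open>c = - \<lambda> V\<close>.

  The inequality that results is quadratic in \<open>A\<close>. The term \<open>\<lambda> v\<^sup>2 / 2\<close> contributes \<open>\<lambda> s A F \<ge> \<lambda> \<psi>\<^sub>0 g\<close>, and
  \<open>\<lambda> \<psi>\<^sub>0 = 2 K + 6\<close> absorbs \<open>2 K g\<close> from the Bochner inequality and \<open>6 g\<close> from three uses of the Cauchy-Schwarz
  inequality. The term \<open>t\<^sup>2 / 4\<close> contributes \<open>A\<^sup>2 (1 / 2 - t\<^sup>2 / 4) \<ge> A\<^sup>2 / 4\<close>, which dominates; \<open>c1\<close> and \<open>c2\<close> collect the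
  terms of degree zero and one in \<open>A\<close>.\<close>

lemma A_bound:
  assumes psi0: "0 < \<psi>0" "\<And>x. \<psi>0 \<le> \<psi> x" and Psi: "\<And>x. \<psi> x \<le> \<Psi>" and abar: "\<And>x. a x \<le> abar"
    and R: "\<And>x t. 0 \<le> t \<Longrightarrow> t \<le> 1 \<Longrightarrow> \<bar>v x t\<bar> \<le> R"
    and B: "\<And>x. \<bar>L \<psi> x\<bar> \<le> B" "\<And>x. \<bar>L a x\<bar> \<le> B" "\<And>x. \<Gamma> a a x \<le> B" "\<And>x. \<Gamma> \<psi> \<psi> x \<le> B"
    and bd: "\<And>x. A x 0 \<le> Ab" "\<And>x. A x 1 \<le> Ab"
    and lam_def: "lam = (2 * K + 6) / \<psi>0"
    and Fm_def: "Fm = \<Psi> + abar * R\<^sup>2"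
    and c1_def: "c1 = B * (1 + 5 * R\<^sup>2 + lam\<^sup>2 * R\<^sup>2 + lam\<^sup>2 * R ^ 6) + 2 * abar * Fm + lam\<^sup>2 * R\<^sup>2 * Fm\<^sup>2"
    and c2_def: "c2 = abar * R + lam * R * Fm"
    and t: "0 \<le> t" "t \<le> 1"
  shows "A x t \<le> exp (lam * R\<^sup>2 / 2 + 1 / 4) * max Ab (4 * (c1 + c2) + 1)"
proof -
  define f where "f = (\<lambda>x t. lam / 2 * (v x t * v x t) + 1 / 4 * (t * t))"
  have R0: "0 \<le> R" using R[of 0 undefined] by simp
  have abar0: "0 \<le> abar" using a_nonneg[of undefined] abar[of undefined] by simp
  have B0: "0 \<le> B" using B(1)[of undefined] by simp
  have lam0: "0 \<le> lam" using psi0 K_nonneg by (simp add: lam_def)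
  have v_sq: "(v y s)\<^sup>2 \<le> R\<^sup>2" if "0 \<le> s" "s \<le> 1" for y s
    using power_mono[OF R[OF that, of y] abs_ge_zero, of 2] by simp
  have F_le: "F y s \<le> Fm" if "0 \<le> s" "s \<le> 1" for y s
    unfolding F_def Fm_def using Psi[of y] mult_mono[OF abar[of y] v_sq[OF that, of y]] abar0 by simp
  have f_ge: "0 \<le> f y s" if "0 \<le> s" for y s using that lam0 by (simp add: f_def)
  have f_le: "f y s \<le> lam * R\<^sup>2 / 2 + 1 / 4" if "0 \<le> s" "s \<le> 1" for y s
    using mult_left_mono[OF v_sq[OF that, of y] lam0] mult_le_one[of s s] that
    by (simp add: f_def power2_eq_square)
  have cf: "continuous_on (UNIV \<times> {0..1}) (\<lambda>(x, t). f x t)"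
    using cont_v unfolding f_def split_beta by (intro continuous_intros) auto
  then have "continuous_on (UNIV \<times> {0..1}) (\<lambda>(x, t). A x t * exp (f x t))"
    using cont_A' unfolding split_beta by (intro continuous_intros) auto
  from attains_max[OF this] obtain x0 t0 where
    x0: "0 \<le> t0" "t0 \<le> 1" and
    max0: "\<forall>y s. 0 \<le> s \<longrightarrow> s \<le> 1 \<longrightarrow> A y s * exp (f y s) \<le> A x0 t0 * exp (f x0 t0)" by blast
  have "A x0 t0 \<le> max Ab (4 * (c1 + c2) + 1)"
  proof (cases "0 < t0 \<and> t0 < 1")
    case False
    then have "t0 = 0 \<or> t0 = 1" using x0 by auto
    then show ?thesis using bd[of x0] by auto
  next
    case True
    then have t0: "0 < t0" "t0 < 1" by auto
    define f0 where "f0 = f x0 t0"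
    \<comment> \<open>normalised to be 1 at the maximum, so that no exponential remains in the derivatives there\<close>
    define E where "E = (\<lambda>x t. exp (f x t + (- f0)))"
    have E1: "E x0 t0 = 1" by (simp add: E_def f0_def)
    define G where "G = (\<lambda>x t. A x t * E x t)"
    have Cf: "C 2 f" unfolding f_def by (intro C_intros C_v) auto
    have Cg: "C 2 (\<lambda>x t. f x t + (- f0))" by (intro C_intros Cf)
    have CE: "C 2 E" unfolding E_def
      by (rule C_compose[OF Cg, where T = UNIV]) (auto intro!: continuous_intros derivative_eq_intros)
    have CG: "C 2 G" unfolding G_def by (intro C_intros CE C_A) auto
    have low: "C 1 h" if "C 2 h" for h using C_mono[of 1 2 h] that by simp
    have Cft: "C 1 (dt f)" using C_dt[of 1 f] Cf by (simp add: numeral_2_eq_2)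
    have CAt: "C 1 (dt A)" using C_dt[of 1 A] C_A[of 2] by (simp add: numeral_2_eq_2)
    have C1: "C 1 f" "C 1 E" "C 1 (dt f)" "C 1 (dt A)" "C 1 v" "C 1 A"
        "C 1 (\<lambda>x t. f x t + (- f0))" "C 1 utt"
      by (intro low Cf CE Cft CAt C_v C_A Cg C_utt order_refl one_le_numeral)+
    have C2: "C 2 f" "C 2 E" "C 2 v" "C 2 A" "C 2 utt"
      by (intro Cf CE C_v C_A C_utt; simp)+
    have max: "G y s \<le> G x0 t0" if "0 \<le> s" "s \<le> 1" for y s
    proof -
      have "A y s * exp (f y s) * exp (- f0) \<le> A x0 t0 * exp (f x0 t0) * exp (- f0)"
        using max0 that by (intro mult_right_mono) auto
      then show ?thesis unfolding G_def E_def exp_add by (simp only: mult.assoc)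
    qed
    have mp: "A x0 t0 * dt (dt G) x0 t0 + utt x0 t0 * lp G x0 t0 - 2 * gm v (dt G) x0 t0 \<le> 0"
        "dt G x0 t0 = 0" "\<And>w. C 1 w \<Longrightarrow> gm G w x0 t0 = 0"
      by (rule maximum_principle[OF CG t0], erule (1) max, assumption?)+
    have Et: "dt E y s = E y s * dt f y s" if "0 < s" "s < 1" for y s
    proof (rule dt_eqI)
      show "(E y has_real_derivative E y s * dt f y s) (at s)"
        unfolding E_def using has_dt[of f s y] C1 that by (auto intro!: derivative_eq_intros)
    qed (use that in auto)
    have gmE: "gm E w y s = E y s * gm f w y s" if "C 1 w" "0 < s" "s < 1" for w y s
    proof -
      have "gm E w y s = exp (f y s + (- f0)) * gm (\<lambda>x t. f x t + (- f0)) w y s"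
        unfolding E_def gm_def
        by (rule \<Gamma>_compose[where f = "\<lambda>x t. f x t + (- f0)"])
           (use that C1 C1(2)[unfolded E_def] in \<open>auto intro!: derivative_eq_intros\<close>)
      also have "gm (\<lambda>x t. f x t + (- f0)) w y s = gm f w y s"
        using gm_add1[OF C1(1) C_const[of 1 "-f0"] that, of y] gm_const1[of "\<lambda>t. -f0" w y s] by simp
      finally show ?thesis by (simp add: E_def)
    qed
    have lpE: "lp E x0 t0 = lp f x0 t0 + gm f f x0 t0"
    proof -
      have "lp E x0 t0 = exp (f x0 t0 + (- f0)) * lp (\<lambda>x t. f x t + (- f0)) x0 t0
          + exp (f x0 t0 + (- f0)) * gm (\<lambda>x t. f x t + (- f0)) (\<lambda>x t. f x t + (- f0)) x0 t0"
        unfolding E_def gm_def lp_def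
        by (rule L_compose[OF Cg t0]) (auto intro!: continuous_intros derivative_eq_intros)
      moreover have "gm (\<lambda>x t. f x t + (- f0)) (\<lambda>x t. f x t + (- f0)) x0 t0 = gm f f x0 t0"
        using gm_add1[OF C1(1) C_const[of 1 "-f0"] C1(7) t0, of x0] gm_const1[of "\<lambda>t. -f0" _ x0 t0]
          gm_add2[OF C1(1) C_const[of 1 "-f0"] C1(1) t0, of x0] gm_const2[OF C_const[of 1 "-f0"] C1(1) t0, of x0]
        by simp
      moreover have "lp (\<lambda>x t. f x t + (- f0)) x0 t0 = lp f x0 t0"
        using lp_add[OF Cf C_const[of 2 "-f0"] t0, of x0] lp_const[of "\<lambda>t. -f0" x0 t0] by simp
      ultimately show ?thesis by (simp add: f0_def)
    qed
    have Gt: "dt G y s = dt A y s * E y s + A y s * (E y s * dt f y s)" if "0 < s" "s < 1" for y s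
      unfolding G_def using dt_mult[OF C1(6) C1(2) that, of y] Et[OF that] by (simp add: algebra_simps)
    define At Att ft ftt where "At = dt A x0 t0" and "Att = dt (dt A) x0 t0"
      and "ft = dt f x0 t0" and "ftt = dt (dt f) x0 t0"
    have dE: "(E x0 has_real_derivative ft) (at t0)"
      using has_dt[of E t0 x0] Et[OF t0, of x0] C1 t0 by (simp add: E1 ft_def)
    have dA: "(A x0 has_real_derivative At) (at t0)" and dAt: "(dt A x0 has_real_derivative Att) (at t0)"
      and dft: "(dt f x0 has_real_derivative ftt) (at t0)"
      using has_dt[of A t0 x0] has_dt[of "dt A" t0 x0] has_dt[of "dt f" t0 x0] C1 t0
      by (auto simp: At_def Att_def ftt_def)
    have Gtt: "dt (dt G) x0 t0 = Att + 2 * At * ft + A x0 t0 * (ftt + ft\<^sup>2)"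
    proof (rule dt_cong_deriv[where h = "\<lambda>s. dt A x0 s * E x0 s + A x0 s * (E x0 s * dt f x0 s)"])
      show "((\<lambda>s. dt A x0 s * E x0 s + A x0 s * (E x0 s * dt f x0 s)) has_real_derivative
          Att + 2 * At * ft + A x0 t0 * (ftt + ft\<^sup>2)) (at t0)"
        by (rule derivative_eq_intros dA dAt dft dE refl)+
           (simp add: E1 algebra_simps power2_eq_square At_def[symmetric] ft_def[symmetric])
    qed (use Gt t0 in auto)
    have gG: "gm G w x0 t0 = A x0 t0 * gm f w x0 t0 + gm A w x0 t0" if "C 1 w" for w
      unfolding G_def using gm_mult1[OF C1(6) C1(2) that t0, of x0] gmE[OF that t0] by (simp add: E1)
    have lG: "lp G x0 t0 = lp A x0 t0 + A x0 t0 * (lp f x0 t0 + gm f f x0 t0) + 2 * gm A f x0 t0"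
      unfolding G_def using lp_mult[OF C2(4) C2(2) t0, of x0] gm_sym[of A E t0 x0] gmE[OF C1(6) t0]
        gm_sym[of A f t0 x0] C1 t0 by (simp add: E1 lpE)
    have gvGt: "gm v (dt G) x0 t0 = gm v (dt A) x0 t0 + At * gm v f x0 t0 + ft * gm v A x0 t0
        + A x0 t0 * (gm v (dt f) x0 t0 + ft * gm v f x0 t0)"
    proof -
      have gvE: "gm v E x0 t0 = gm v f x0 t0"
        using gmE[OF C1(5) t0, of x0] gm_sym[of v E t0 x0] gm_sym[of v f t0 x0] C1 t0 by (simp add: E1)
      have "gm v (dt G) x0 t0 = gm v (\<lambda>y s. dt A y s * E y s + A y s * (E y s * dt f y s)) x0 t0"
        by (rule gm_cong) (use Gt t0 in auto)
      also have "\<dots> = gm v (\<lambda>y s. dt A y s * E y s) x0 t0 + gm v (\<lambda>y s. A y s * (E y s * dt f y s)) x0 t0"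
        by (rule gm_add2) (use t0 C1 in \<open>auto intro!: C_mult\<close>)
      also have "gm v (\<lambda>y s. dt A y s * E y s) x0 t0 = At * gm v f x0 t0 + gm v (dt A) x0 t0"
        using gm_mult2[OF CAt C1(2) C1(5) t0, of x0] by (simp add: E1 gvE At_def)
      also have "gm v (\<lambda>y s. A y s * (E y s * dt f y s)) x0 t0
          = A x0 t0 * (gm v (dt f) x0 t0 + ft * gm v f x0 t0) + ft * gm v A x0 t0"
        using gm_mult2[OF C1(6) C_mult[OF C1(2) Cft] C1(5) t0, of x0] gm_mult2[OF C1(2) Cft C1(5) t0, of x0]
        by (simp add: E1 gvE ft_def)
      finally show ?thesis by simp
    qed
    define V s g \<tau> a0 A0 F0 where "V = v x0 t0" and "s = utt x0 t0" and "g = gm v v x0 t0"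
      and "\<tau> = t0 / 2" and "a0 = a x0" and "A0 = A x0 t0" and "F0 = F x0 t0"
    have ft': "dt f y r = lam * (v y r * utt y r) + r / 2" if "0 < r" "r < 1" for y r
    proof (rule dt_eqI)
      show "(f y has_real_derivative lam * (v y r * utt y r) + r / 2) (at r)"
        unfolding f_def using has_dt[of v r y] C1 that by (auto intro!: derivative_eq_intros)
    qed (use that in auto)
    have ft: "ft = lam * V * s + \<tau>" using ft'[OF t0] by (simp add: ft_def V_def s_def \<tau>_def)
    have ftt: "ftt = lam * (s\<^sup>2 + V * dt utt x0 t0) + 1 / 2"
      unfolding ftt_def
    proof (rule dt_cong_deriv[where h = "\<lambda>r. lam * (v x0 r * utt x0 r) + r / 2"])
      show "((\<lambda>r. lam * (v x0 r * utt x0 r) + r / 2) has_real_derivative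
          lam * (s\<^sup>2 + V * dt utt x0 t0) + 1 / 2) (at t0)"
        using has_dt[of v t0 x0] has_dt[of utt t0 x0] C1 t0
        by (auto intro!: derivative_eq_intros simp: V_def s_def power2_eq_square algebra_simps)
    qed (use ft' t0 in auto)
    have Cvv: "C k (\<lambda>x t. v x t * v x t)" if "k \<le> 3" for k by (intro C_intros C_v that)
    have Ctt: "C k (\<lambda>x t. 1 / 4 * (t * t))" for k by (intro C_intros)
    have gf: "gm f w x0 t0 = lam * V * gm v w x0 t0" if w: "C 1 w" for w
    proof -
      have "gm f w x0 t0 = gm (\<lambda>x t. lam / 2 * (v x t * v x t)) w x0 t0"
        unfolding f_def using gm_add1[OF C_mult[OF C_const Cvv[of 1]] Ctt[of 1] w t0, of "lam / 2" x0]
          gm_const1[of "\<lambda>t. 1 / 4 * (t * t)" w x0 t0] by simp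
      also have "\<dots> = lam / 2 * gm (\<lambda>x t. v x t * v x t) w x0 t0"
        using gm_mult1[OF C_const[of 1 "lam / 2"] Cvv[of 1] w t0, of x0] gm_const1[of "\<lambda>t. lam / 2" w x0 t0] by simp
      also have "\<dots> = lam * V * gm v w x0 t0"
        using gm_mult1[OF C1(5) C1(5) w t0, of x0] by (simp add: V_def)
      finally show ?thesis .
    qed
    define lv where "lv = lp v x0 t0"
    have lf: "lp f x0 t0 = lam * (V * lv + g)"
    proof -
      have "lp f x0 t0 = lp (\<lambda>x t. lam / 2 * (v x t * v x t)) x0 t0"
        unfolding f_def using lp_add[OF C_mult[OF C_const Cvv[of 2]] Ctt[of 2] t0, of "lam / 2" x0]
          lp_const[of "\<lambda>t. 1 / 4 * (t * t)" x0 t0] by simp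
      also have "\<dots> = lam / 2 * lp (\<lambda>x t. v x t * v x t) x0 t0"
        using lp_mult[OF C_const[of 2 "lam / 2"] Cvv[of 2] t0, of x0] lp_const[of "\<lambda>t. lam / 2" x0 t0]
          gm_const1[of "\<lambda>t. lam / 2" _ x0 t0] by simp
      also have "\<dots> = lam * (V * lv + g)"
        using lp_mult[OF C2(3) C2(3) t0, of x0] by (simp add: V_def lv_def g_def algebra_simps)
      finally show ?thesis .
    qed
    have gvft: "gm v (dt f) x0 t0 = lam * (V * gm v utt x0 t0 + s * g)"
    proof -
      have "gm v (dt f) x0 t0 = gm v (\<lambda>y r. lam * (v y r * utt y r) + (\<lambda>x t. t0 / 2) y r) x0 t0"
        by (rule gm_cong) (use ft' t0 in auto)
      also have "\<dots> = gm v (\<lambda>y r. lam * (v y r * utt y r)) x0 t0"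
        using gm_add2[OF C_mult[OF C_const C_mult[OF C1(5) C1(8)]] C_const[of 1 "t0 / 2"] C1(5) t0, of lam x0]
          gm_const2[OF C_const[of 1 "t0 / 2"] C1(5) t0, of x0] by simp
      also have "\<dots> = lam * gm v (\<lambda>y r. v y r * utt y r) x0 t0"
        using gm_mult2[OF C_const[of 1 lam] C_mult[OF C1(5) C1(8)] C1(5) t0, of x0]
          gm_const2[OF C_const[of 1 lam] C1(5) t0, of x0] by simp
      also have "\<dots> = lam * (V * gm v utt x0 t0 + s * g)"
        using gm_mult2[OF C1(5) C1(8) C1(5) t0, of x0] by (simp add: V_def s_def g_def)
      finally show ?thesis .
    qed
    have gvf: "gm v f x0 t0 = lam * V * g"
      using gf[OF C1(5)] gm_sym[of v f t0 x0] C1 t0 by (simp add: g_def)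
    have gff: "gm f f x0 t0 = lam\<^sup>2 * V\<^sup>2 * g"
      using gf[OF C1(1)] gvf by (simp add: power2_eq_square)
    \<comment> \<open>the vanishing of the gradient and of the time derivative of \<open>A exp f\<close>\<close>
    have gA: "gm A w x0 t0 = - A0 * (lam * V * gm v w x0 t0)" if "C 1 w" for w
      using mp(3)[OF that] gG[OF that] gf[OF that] by (simp add: A0_def)
    have gAf: "gm A f x0 t0 = - A0 * gm f f x0 t0"
      using mp(3)[OF C1(1)] gG[OF C1(1)] by (simp add: A0_def)
    have gvA: "gm v A x0 t0 = - A0 * (lam * V * g)"
      using gA[OF C1(5)] gm_sym[of v A t0 x0] C1 t0 by (simp add: g_def)
    have At: "At = - A0 * ft"
      using mp(2) Gt[OF t0, of x0] by (simp add: E1 At_def A0_def ft_def)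
    have sA: "s > 0" "A0 > 0" using utt_pos[OF t0] A_pos[of t0 x0] t0 by (auto simp: s_def A0_def)
    have mp1: "A0 * (Att + 2 * At * ft + A0 * (ftt + ft\<^sup>2))
        + s * (lp A x0 t0 + A0 * (lp f x0 t0 + gm f f x0 t0) + 2 * gm A f x0 t0)
        - 2 * (gm v (dt A) x0 t0 + At * gm v f x0 t0 + ft * gm v A x0 t0
        + A0 * (gm v (dt f) x0 t0 + ft * gm v f x0 t0)) \<le> 0"
      using mp(1) unfolding Gtt lG gvGt by (simp add: A0_def s_def)
    have mp2: "A0 * Att + s * lp A x0 t0 - 2 * gm v (dt A) x0 t0
        + A0 * (A0 * ftt + s * lp f x0 t0 - 2 * gm v (dt f) x0 t0)
        - A0 * (A0 * ft\<^sup>2 + s * gm f f x0 t0 - 2 * ft * gm v f x0 t0) \<le> 0"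
      using mp1 unfolding At gAf gvA gvf by (simp add: algebra_simps power2_eq_square)
    define W where "W = dt utt x0 t0"
    define gvs where "gvs = gm v utt x0 t0"
    define ls lA where "ls = lp utt x0 t0" and "lA = lp A x0 t0"
    define gva gvpsi gvF gvG where "gva = gm v (\<lambda>x t. a x) x0 t0" and "gvpsi = gm v (\<lambda>x t. \<psi> x) x0 t0"
      and "gvF = gm v F x0 t0" and "gvG = gm v (gm v v) x0 t0"
    define lG0 gvlv where "lG0 = lp (gm v v) x0 t0" and "gvlv = gm v (lp v) x0 t0"
    have eq0: "s * A0 - g = F0" using eq[OF t0, of x0] by (simp add: s_def A0_def g_def F0_def)
    have sA0: "s * A0 = F0 + g" using eq0 by simp
    have eqf: "F y r = utt y r * A y r + (-1) * gm v v y r" if "0 < r" "r < 1" for y r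
      using eq[OF that, of y] by simp
    have CsA: "C 2 (\<lambda>x t. utt x t * A x t)" by (intro C_intros C_utt C_A) auto
    have Cmg: "C 2 (\<lambda>x t. (-1) * gm v v x t)" by (intro C_intros C_gm_vv) auto
    have At': "dt A y r = (-2) * (a y * v y r) + lp v y r" if "0 < r" "r < 1" for y r
    proof (rule dt_eqI)
      show "(A y has_real_derivative (-2) * (a y * v y r) + lp v y r) (at r)"
        unfolding A_def using has_dt[of u r y] has_dt[of "lp u" r y] C_u_le[of 1] C_lpu[of 1] that
          dt_lp[OF C_u_le[of 3] that, of y]
        by (auto intro!: derivative_eq_intros)
    qed (use that in auto)
    have Clv: "C 1 (lp v)" using C_lp[of 1 v] C_v[of 3] by (simp add: numeral_3_eq_3)
    have At1: "At = - 2 * a0 * V + lv" using At'[OF t0] by (simp add: At_def a0_def V_def lv_def)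
    have Att1: "Att = - 2 * a0 * s + ls"
      unfolding Att_def
    proof (rule dt_cong_deriv[where h = "\<lambda>r. (-2) * (a x0 * v x0 r) + lp v x0 r"])
      show "((\<lambda>r. (-2) * (a x0 * v x0 r) + lp v x0 r) has_real_derivative - 2 * a0 * s + ls) (at t0)"
        using has_dt[of v t0 x0] has_dt[of "lp v" t0 x0] C1 Clv t0 dt_lp[OF C_v[of 3] t0, of x0]
        by (auto intro!: derivative_eq_intros simp: a0_def s_def ls_def)
    qed (use At' t0 in auto)
    have gvAt: "gm v (dt A) x0 t0 = - 2 * (a0 * g + V * gva) + gvlv"
    proof -
      have "gm v (dt A) x0 t0 = gm v (\<lambda>y r. (-2) * (a y * v y r) + lp v y r) x0 t0"
        by (rule gm_cong) (use At' t0 in auto)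
      also have "\<dots> = gm v (\<lambda>y r. (-2) * (a y * v y r)) x0 t0 + gvlv"
        unfolding gvlv_def by (rule gm_add2) (use t0 C1 Clv C_a in \<open>auto intro!: C_intros\<close>)
      also have "gm v (\<lambda>y r. (-2) * (a y * v y r)) x0 t0 = (-2) * gm v (\<lambda>y r. a y * v y r) x0 t0"
        using gm_mult2[OF C_const[of 1 "-2"] C_mult[OF C_a C1(5)] C1(5) t0, of x0]
          gm_const2[OF C_const[of 1 "-2"] C1(5) t0, of x0] by simp
      also have "gm v (\<lambda>y r. a y * v y r) x0 t0 = a0 * g + V * gva"
        using gm_mult2[OF C_a[of 1] C1(5) C1(5) t0, of x0] by (simp add: a0_def V_def g_def gva_def)
      finally show ?thesis by simp
    qed
    \<comment> \<open>each derivative of \<open>F\<close> is computed twice, from \<open>F = \<psi> + a v\<^sup>2\<close> and from the equation\<close>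
    have eqt: "A0 * W + s * At - 2 * gvs = 2 * a0 * V * s"
    proof -
      have "dt F x0 t0 = W * A0 + s * At + (-1) * (2 * gvs)"
      proof (rule dt_cong_deriv[where h = "\<lambda>r. utt x0 r * A x0 r + (-1) * gm v v x0 r"])
        have "dt (gm v v) x0 t0 = 2 * gvs"
          using dt_gm[OF C2(3) C2(3) t0, of x0] gm_sym[of utt v t0 x0] C1 t0 by (simp add: gvs_def)
        then show "((\<lambda>r. utt x0 r * A x0 r + (-1) * gm v v x0 r) has_real_derivative
            W * A0 + s * At + (-1) * (2 * gvs)) (at t0)"
          using has_dt[of utt t0 x0] has_dt[of A t0 x0] has_dt[of "gm v v" t0 x0] C1 C_gm_vv[of 1] t0
          by (auto intro!: derivative_eq_intros simp: W_def A0_def s_def At_def)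
      qed (use eqf t0 in auto)
      moreover have "dt F x0 t0 = 2 * a0 * V * s"
      proof (rule dt_eqI)
        show "(F x0 has_real_derivative 2 * a0 * V * s) (at t0)"
          unfolding F_def using has_dt[of v t0 x0] C1 t0
          by (auto intro!: derivative_eq_intros simp: a0_def V_def s_def)
      qed (use t0 in auto)
      ultimately show ?thesis by (simp add: algebra_simps)
    qed
    have Fprod: "F = (\<lambda>x t. \<psi> x + a x * (v x t * v x t))" by (simp add: F_def power2_eq_square)
    have gvF1: "gvF = gvpsi + V\<^sup>2 * gva + 2 * a0 * V * g"
      unfolding gvF_def Fprod
      using gm_add2[OF C_\<psi>[of 1] C_mult[OF C_a Cvv[of 1]] C1(5) t0, of x0]
        gm_mult2[OF C_a[of 1] Cvv[of 1] C1(5) t0, of x0] gm_mult2[OF C1(5) C1(5) C1(5) t0, of x0]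
      by (simp add: gvpsi_def gva_def V_def a0_def g_def power2_eq_square algebra_simps)
    have gvF2: "gvF = A0 * gvs + s * gm v A x0 t0 - gvG"
    proof -
      have "gvF = gm v (\<lambda>y r. utt y r * A y r + (-1) * gm v v y r) x0 t0"
        unfolding gvF_def by (rule gm_cong) (use eqf t0 in auto)
      also have "\<dots> = gm v (\<lambda>y r. utt y r * A y r) x0 t0 + gm v (\<lambda>y r. (-1) * gm v v y r) x0 t0"
        by (rule gm_add2) (use t0 C1 low[OF CsA] low[OF Cmg] in auto)
      also have "gm v (\<lambda>y r. (-1) * gm v v y r) x0 t0 = - gvG"
        using gm_mult2[OF C_const[of 1 "-1"] C_gm_vv[of 1] C1(5) t0, of x0]
          gm_const2[OF C_const[of 1 "-1"] C1(5) t0, of x0] by (simp add: gvG_def)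
      also have "gm v (\<lambda>y r. utt y r * A y r) x0 t0 = s * gm v A x0 t0 + A0 * gvs"
        using gm_mult2[OF C1(8) C1(6) C1(5) t0, of x0] by (simp add: s_def A0_def gvs_def)
      finally show ?thesis by simp
    qed
    define LF where "LF = lp F x0 t0"
    have LF1: "LF = L \<psi> x0 + V\<^sup>2 * L a x0 + 4 * V * gva + 2 * a0 * V * lv + 2 * a0 * g"
    proof -
      have lvv: "lp (\<lambda>x t. v x t * v x t) x0 t0 = 2 * V * lv + 2 * g"
        using lp_mult[OF C2(3) C2(3) t0, of x0] by (simp add: V_def lv_def g_def)
      have gavv: "gm (\<lambda>x t. a x) (\<lambda>x t. v x t * v x t) x0 t0 = 2 * V * gva"
        using gm_mult2[OF C1(5) C1(5) C_a[of 1] t0, of x0] gm_sym[OF C_a[of 1] C1(5) t0, of x0]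
        by (simp add: V_def gva_def)
      have "LF = lp (\<lambda>x t. \<psi> x) x0 t0 + lp (\<lambda>x t. a x * (v x t * v x t)) x0 t0"
        unfolding LF_def Fprod by (rule lp_add) (use t0 C_\<psi> C_a C2 in \<open>auto intro!: C_mult\<close>)
      also have "lp (\<lambda>x t. a x * (v x t * v x t)) x0 t0
          = a0 * (2 * V * lv + 2 * g) + V\<^sup>2 * lp (\<lambda>x t. a x) x0 t0 + 2 * (2 * V * gva)"
        using lp_mult[OF C_a[of 2] Cvv[of 2] t0, of x0]
        by (simp add: lvv gavv a0_def V_def power2_eq_square)
      finally show ?thesis by (simp add: lp_def algebra_simps)
    qed
    have LF2: "LF = s * lA + A0 * ls + 2 * gm utt A x0 t0 - lG0"
    proof -
      have "LF = lp (\<lambda>y r. utt y r * A y r + (-1) * gm v v y r) x0 t0"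
        unfolding LF_def by (rule lp_cong) (use eqf t0 in auto)
      also have "\<dots> = lp (\<lambda>y r. utt y r * A y r) x0 t0 + lp (\<lambda>y r. (-1) * gm v v y r) x0 t0"
        by (rule lp_add[OF CsA Cmg t0])
      also have "lp (\<lambda>y r. (-1) * gm v v y r) x0 t0 = - lG0"
        using lp_mult[OF C_const[of 2 "-1"] C_gm_vv[of 2] t0, of x0] lp_const[of "\<lambda>t. -1" x0 t0]
          gm_const1[of "\<lambda>t. -1" _ x0 t0] by (simp add: lG0_def)
      also have "lp (\<lambda>y r. utt y r * A y r) x0 t0 = s * lA + A0 * ls + 2 * gm utt A x0 t0"
        using lp_mult[OF C2(5) C2(4) t0, of x0] by (simp add: s_def A0_def lA_def ls_def)
      finally show ?thesis by simp
    qed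
    have gsA: "gm utt A x0 t0 = - A0 * (lam * V * gvs)"
      using gA[OF C1(8)] gm_sym[of utt A t0 x0] C1 t0 by (simp add: gvs_def)
    have g0: "0 \<le> g" unfolding g_def by (rule gm_nonneg) (use C1 t0 in auto)
    \<comment> \<open>the choice \<open>c = - \<lambda> V\<close> reproduces the term with \<open>gvG\<close> that \<open>\<nabla>A = - \<lambda> V A \<nabla>v\<close> creates below\<close>
    have boch: "- K * g \<le> lG0 / 2 - gvlv + lam * V * gvG + lam\<^sup>2 * V\<^sup>2 * g\<^sup>2"
      using gm_bochner[OF C_v[of 3] C_v[of 2] t0, of x0 "- (lam * V)"]
      by (simp add: g_def lG0_def gvlv_def gvG_def power2_eq_square algebra_simps)
    have CSa: "2 * \<bar>r * gva\<bar> \<le> g + r\<^sup>2 * \<Gamma> a a x0" for r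
      using gm_Cauchy_Schwarz[OF C1(5) C_a[of 1] t0, of r x0] by (simp add: g_def gva_def gm_def)
    have CSp: "2 * \<bar>r * gvpsi\<bar> \<le> g + r\<^sup>2 * \<Gamma> \<psi> \<psi> x0" for r
      using gm_Cauchy_Schwarz[OF C1(5) C_\<psi>[of 1] t0, of r x0] by (simp add: g_def gvpsi_def gm_def)
    have LA: "A0 * Att + s * lA - 2 * gm v (dt A) x0 t0 \<ge>
        LF + 2 * lam * V * (gvpsi + V\<^sup>2 * gva + 2 * a0 * V * g) + 2 * lam\<^sup>2 * V\<^sup>2 * g * F0
        - 2 * K * g - 2 * a0 * s * A0 + 4 * a0 * g + 4 * V * gva"
    proof -
      have As: "A0 * gvs = gvpsi + V\<^sup>2 * gva + 2 * a0 * V * g + gvG + s * A0 * lam * V * g"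
        using gvF1 gvF2 gvA by (simp add: algebra_simps)
      have "A0 * Att + s * lA - 2 * gm v (dt A) x0 t0
          = LF + 2 * lam * V * (A0 * gvs) + lG0 - 2 * gvlv - 2 * a0 * s * A0 + 4 * a0 * g + 4 * V * gva"
        using LF2 unfolding Att1 gvAt gsA by (simp add: algebra_simps)
      also have "\<dots> = LF + 2 * lam * V * (gvpsi + V\<^sup>2 * gva + 2 * a0 * V * g)
          + 2 * lam\<^sup>2 * V\<^sup>2 * g * (s * A0) + 2 * (lG0 / 2 - gvlv + lam * V * gvG)
          - 2 * a0 * s * A0 + 4 * a0 * g + 4 * V * gva"
        unfolding As by (simp add: algebra_simps power2_eq_square)
      also have "\<dots> \<ge> LF + 2 * lam * V * (gvpsi + V\<^sup>2 * gva + 2 * a0 * V * g)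
          + 2 * lam\<^sup>2 * V\<^sup>2 * g * (s * A0) + 2 * (- K * g - lam\<^sup>2 * V\<^sup>2 * g\<^sup>2)
          - 2 * a0 * s * A0 + 4 * a0 * g + 4 * V * gva"
        using boch by simp
      finally show ?thesis unfolding sA0 by (simp add: algebra_simps power2_eq_square)
    qed
    have Lf: "A0 * ftt + s * lp f x0 t0 - 2 * gm v (dt f) x0 t0
        = 4 * a0 * lam * V\<^sup>2 * s + lam * s * F0 + A0 / 2"
    proof -
      have e: "A0 * W + s * lv - 2 * gvs = 4 * a0 * V * s" using eqt At1 by (simp add: algebra_simps)
      have "A0 * ftt + s * lp f x0 t0 - 2 * gm v (dt f) x0 t0
          = lam * V * (A0 * W + s * lv - 2 * gvs) + lam * s * (s * A0 - g) + A0 / 2"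
        unfolding ftt lf gvft W_def[symmetric] gvs_def[symmetric] by (simp add: algebra_simps power2_eq_square)
      then show ?thesis unfolding e eq0 by (simp add: power2_eq_square)
    qed
    have Ef: "A0 * ft\<^sup>2 + s * gm f f x0 t0 - 2 * ft * gm v f x0 t0
        = lam\<^sup>2 * V\<^sup>2 * s * F0 + 2 * lam * V * \<tau> * F0 + A0 * \<tau>\<^sup>2"
      unfolding ft gff gvf eq0[symmetric] by (simp add: algebra_simps power2_eq_square)
    have lv: "lv = - A0 * (lam * V * s + \<tau>) + 2 * a0 * V" using At At1 ft by simp
    \<comment> \<open>no derivatives of \<open>u\<close> of order three or more are left, and \<open>s\<close> occurs only in the product \<open>s A = F + g\<close>\<close>
    have key: "L \<psi> x0 + V\<^sup>2 * L a x0 + 8 * V * gva + 2 * lam * V * gvpsi + 2 * lam * V * (V\<^sup>2 * gva)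
        + 4 * a0\<^sup>2 * V\<^sup>2 + 4 * a0 * g - 2 * a0 * F0 - 2 * K * g + 4 * lam * a0 * V\<^sup>2 * g
        + 2 * lam * a0 * V\<^sup>2 * (s * A0) - 2 * a0 * V * \<tau> * A0
        + lam\<^sup>2 * V\<^sup>2 * F0 * (g - F0) + lam * (s * A0) * F0
        + A0\<^sup>2 * (1 / 2 - \<tau>\<^sup>2) - 2 * lam * V * \<tau> * F0 * A0 \<le> 0"
    proof -
      have "LF + 2 * lam * V * (gvpsi + V\<^sup>2 * gva + 2 * a0 * V * g) + 2 * lam\<^sup>2 * V\<^sup>2 * g * F0
        - 2 * K * g - 2 * a0 * s * A0 + 4 * a0 * g + 4 * V * gva
        + A0 * (4 * a0 * lam * V\<^sup>2 * s + lam * s * F0 + A0 / 2)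
        - A0 * (lam\<^sup>2 * V\<^sup>2 * s * F0 + 2 * lam * V * \<tau> * F0 + A0 * \<tau>\<^sup>2) \<le> 0"
        using mp2 LA unfolding Lf Ef lA_def by linarith
      moreover have "LF = L \<psi> x0 + V\<^sup>2 * L a x0 + 4 * V * gva
          - 2 * a0 * lam * V\<^sup>2 * (s * A0) - 2 * a0 * V * \<tau> * A0 + 4 * a0\<^sup>2 * V\<^sup>2 + 2 * a0 * g"
        unfolding LF1 lv by (simp add: algebra_simps power2_eq_square)
      moreover have "A0 * (lam\<^sup>2 * V\<^sup>2 * s * F0) = lam\<^sup>2 * V\<^sup>2 * F0 * (g + F0)"
        "2 * a0 * s * A0 = 2 * a0 * (g + F0)"
      proof -
        have "A0 * (lam\<^sup>2 * V\<^sup>2 * s * F0) = lam\<^sup>2 * V\<^sup>2 * F0 * (s * A0)" "2 * a0 * s * A0 = 2 * a0 * (s * A0)"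
          by simp_all
        then show "A0 * (lam\<^sup>2 * V\<^sup>2 * s * F0) = lam\<^sup>2 * V\<^sup>2 * F0 * (g + F0)"
            "2 * a0 * s * A0 = 2 * a0 * (g + F0)" unfolding sA0 by (simp_all add: add.commute)
      qed
      ultimately show ?thesis by (simp add: algebra_simps power2_eq_square)
    qed
    have V: "\<bar>V\<bar> \<le> R" "V\<^sup>2 \<le> R\<^sup>2" using R[of t0 x0] v_sq[of t0 x0] t0 by (auto simp: V_def)
    have V6: "V ^ 6 \<le> R ^ 6" using power_mono[OF V(1), of 6] by simp
    have F0b: "0 \<le> F0" "F0 \<le> Fm" "\<psi>0 \<le> F0"
      using F_pos[of x0 t0] F_le[of t0 x0] psi0(2)[of x0] a_nonneg[of x0] t0
      by (auto simp: F0_def F_def intro: add_increasing2)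
    have a0: "0 \<le> a0" "a0 \<le> abar" using a_nonneg abar by (auto simp: a0_def)
    have tau: "0 \<le> \<tau>" "\<tau> \<le> 1 / 2" using t0 by (auto simp: \<tau>_def)
    have tau2: "\<tau>\<^sup>2 \<le> 1 / 4" using power_mono[OF tau(2) tau(1), of 2] by (simp add: power_divide)
    have b1: "- B \<le> L \<psi> x0" using B(1)[of x0] by linarith
    have b2: "- (B * R\<^sup>2) \<le> V\<^sup>2 * L a x0"
    proof -
      have "\<bar>V\<^sup>2 * L a x0\<bar> \<le> R\<^sup>2 * B" unfolding abs_mult using V B(2)[of x0] by (intro mult_mono) auto
      then show ?thesis by (simp add: mult.commute)
    qed
    have b3: "- 4 * g - 4 * (B * R\<^sup>2) \<le> 8 * V * gva"
    proof -
      have "V\<^sup>2 * \<Gamma> a a x0 \<le> R\<^sup>2 * B" using V B(3)[of x0] B0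
        by (meson mult_left_mono mult_right_mono order_trans zero_le_power2)
      then show ?thesis using CSa[of V] by (simp add: abs_le_iff algebra_simps)
    qed
    have b4: "- g - B * (lam\<^sup>2 * R\<^sup>2) \<le> 2 * lam * V * gvpsi"
    proof -
      have "lam\<^sup>2 * V\<^sup>2 * \<Gamma> \<psi> \<psi> x0 \<le> lam\<^sup>2 * R\<^sup>2 * B"
        using V B(4)[of x0] B0 by (meson mult_left_mono mult_right_mono order_trans zero_le_power2 zero_le_mult_iff)
      then show ?thesis using CSp[of "lam * V"] by (simp add: abs_le_iff power_mult_distrib algebra_simps)
    qed
    have b5: "- g - B * (lam\<^sup>2 * R ^ 6) \<le> 2 * lam * V * (V\<^sup>2 * gva)"
    proof -
      have "lam\<^sup>2 * V ^ 6 * \<Gamma> a a x0 \<le> lam\<^sup>2 * V ^ 6 * B" using B(3)[of x0] by (intro mult_left_mono) auto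
      also have "\<dots> \<le> lam\<^sup>2 * R ^ 6 * B" using V6 B0 by (intro mult_right_mono mult_left_mono) auto
      finally have 1: "lam\<^sup>2 * V ^ 6 * \<Gamma> a a x0 \<le> lam\<^sup>2 * R ^ 6 * B" .
      define r where "r = lam * V * V\<^sup>2"
      have "r\<^sup>2 = lam\<^sup>2 * V ^ 6" by (simp add: r_def power_mult_distrib power2_eq_square eval_nat_numeral)
      with CSa[of r] 1 have "2 * \<bar>r * gva\<bar> \<le> g + lam\<^sup>2 * R ^ 6 * B" by simp
      then have "- g - lam\<^sup>2 * R ^ 6 * B \<le> 2 * (r * gva)" by linarith
      then show ?thesis by (simp add: r_def ac_simps)
    qed
    have b6: "- 2 * abar * Fm \<le> - 2 * a0 * F0"
      using mult_mono[OF a0(2) F0b(2)] a0 F0b abar0 by simp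
    have b7: "- abar * R * A0 \<le> - 2 * a0 * V * \<tau> * A0"
    proof -
      have "\<bar>a0 * V * (2 * \<tau>)\<bar> \<le> abar * R * 1"
        unfolding abs_mult using V a0 tau R0 abar0 by (intro mult_mono) auto
      then have "a0 * V * (2 * \<tau>) \<le> abar * R" by simp
      from mult_right_mono[OF this, of A0] sA show ?thesis by (simp add: algebra_simps)
    qed
    have b8: "- (lam\<^sup>2 * R\<^sup>2 * Fm\<^sup>2) \<le> lam\<^sup>2 * V\<^sup>2 * F0 * (g - F0)"
    proof -
      have "V\<^sup>2 * F0\<^sup>2 \<le> R\<^sup>2 * Fm\<^sup>2" using mult_mono[OF V(2) power_mono[OF F0b(2,1), of 2]] by simp
      from mult_left_mono[OF this, of "lam\<^sup>2"] have "lam\<^sup>2 * V\<^sup>2 * F0\<^sup>2 \<le> lam\<^sup>2 * R\<^sup>2 * Fm\<^sup>2" by (simp add: mult.assoc)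
      moreover have "0 \<le> lam\<^sup>2 * V\<^sup>2 * F0 * g" using F0b g0 by simp
      ultimately show ?thesis by (simp add: algebra_simps power2_eq_square)
    qed
    have b9: "(2 * K + 6) * g \<le> lam * (s * A0) * F0"
    proof -
      have "(2 * K + 6) * g \<le> (2 * K + 6) * (s * A0)" using eq0 F0b K_nonneg by (intro mult_left_mono) auto
      also have "\<dots> = lam * (s * A0) * \<psi>0" using psi0 by (simp add: lam_def)
      also have "\<dots> \<le> lam * (s * A0) * F0" using lam0 sA F0b by (intro mult_left_mono) auto
      finally show ?thesis .
    qed
    have b10: "A0\<^sup>2 / 4 \<le> A0\<^sup>2 * (1 / 2 - \<tau>\<^sup>2)"
    proof -
      have "A0\<^sup>2 * (1 / 4) \<le> A0\<^sup>2 * (1 / 2 - \<tau>\<^sup>2)" using tau2 by (intro mult_left_mono) auto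
      then show ?thesis by simp
    qed
    have b11: "- (lam * R * Fm * A0) \<le> - 2 * lam * V * \<tau> * F0 * A0"
    proof -
      have "\<bar>V * (2 * \<tau>) * F0\<bar> \<le> R * 1 * Fm"
        unfolding abs_mult using V tau R0 F0b by (intro mult_mono) auto
      then have "V * (2 * \<tau>) * F0 \<le> R * Fm" by simp
      from mult_left_mono[OF this, of "lam * A0"] lam0 sA show ?thesis by (simp add: algebra_simps)
    qed
    have b12: "0 \<le> 4 * a0\<^sup>2 * V\<^sup>2" "0 \<le> 4 * a0 * g" "0 \<le> 4 * lam * a0 * V\<^sup>2 * g"
      "0 \<le> 2 * lam * a0 * V\<^sup>2 * (s * A0)" using a0 g0 lam0 sA by auto
    have c1e: "c1 = B + 5 * (B * R\<^sup>2) + B * (lam\<^sup>2 * R\<^sup>2) + B * (lam\<^sup>2 * R ^ 6)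
        + 2 * abar * Fm + lam\<^sup>2 * R\<^sup>2 * Fm\<^sup>2"
      by (simp add: c1_def algebra_simps)
    have c2e: "c2 * A0 = abar * R * A0 + lam * R * Fm * A0" by (simp add: c2_def algebra_simps)
    have "A0\<^sup>2 / 4 \<le> c1 + c2 * A0"
      using key b1 b2 b3 b4 b5 b6 b7 b8 b9[unfolded distrib_right] b10 b11 b12 unfolding c1e c2e by linarith
    moreover have "0 \<le> c1" "0 \<le> c2"
      using B0 R0 abar0 lam0 order_trans[OF F0b(1,2)] by (auto simp: c1_def c2_def intro!: add_nonneg_nonneg mult_nonneg_nonneg)
    ultimately have "A0 \<le> 4 * (c1 + c2) + 1"
    proof (cases "A0 \<le> 1")
      case False
      then have "A0 * A0 \<le> 4 * (c1 * A0 + c2 * A0)"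
        using \<open>A0\<^sup>2 / 4 \<le> c1 + c2 * A0\<close> mult_left_mono[of 1 A0 c1] \<open>0 \<le> c1\<close>
        by (simp add: power2_eq_square)
      then have "A0 * A0 \<le> (4 * (c1 + c2)) * A0" by (simp add: algebra_simps)
      then show ?thesis using False by (simp add: mult_le_cancel_right)
    qed simp
    then show ?thesis by (simp add: A0_def)
  qed
  moreover have "A x t \<le> A x0 t0 * exp (f x0 t0)"
  proof -
    have "A x t * 1 \<le> A x t * exp (f x t)"
      using f_ge[OF t(1), of x] A_pos[OF t, of x] by (intro mult_left_mono) auto
    then show ?thesis using max0[rule_format, OF t, of x] by linarith
  qed
  moreover have "A x0 t0 * exp (f x0 t0) \<le> exp (lam * R\<^sup>2 / 2 + 1 / 4) * A x0 t0"
    using mult_left_mono[of "exp (f x0 t0)" _ "A x0 t0"] f_le[OF x0, of x0] A_pos[OF x0, of x0] by (simp add: mult.commute)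
  ultimately show ?thesis
    by (meson exp_ge_zero mult_left_mono order_trans)
qed

section \<open>The gradient bound\<close>

text \<open>The function \<open>G = |\<nabla>u|\<^sup>2 + N u\<^sup>2 / 2\<close> is examined at an interior maximum; \<open>s\<close>, \<open>g\<close>, \<open>\<tau>\<close> are the values of
  \<open>u\<^sub>t\<^sub>t\<close>, \<open>|\<nabla>v|\<^sup>2\<close>, \<open>|\<nabla>u|\<^sup>2\<close> there. The gradient of the equation, paired with \<open>\<nabla>u\<close>, reduces the linearised operator
  applied to \<open>|\<nabla>u|\<^sup>2\<close> to \<open>2 s\<close> times the Bochner expression for \<open>f = u\<close>, \<open>w = v\<close>, \<open>c = 1 / s\<close>, up to \<open>2 g\<^sup>2 / s\<close>;
  since \<open>g \<le> s A\<close>, this is at most \<open>2 A g\<close> and is compensated by the term \<open>2 A |\<nabla>u\<^sub>t|\<^sup>2\<close> of the second time derivative.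

  The term \<open>N u\<^sup>2 / 2\<close> contributes \<open>N s \<tau>\<close>. With \<open>N = 2 K + 3 + 2 / m\<^sub>0\<close> it absorbs \<open>2 K s \<tau>\<close>, \<open>2 s \<tau>\<close> and, because
  \<open>s \<ge> m\<^sub>0\<close>, also \<open>2 \<tau>\<close>, and leaves \<open>s \<tau> \<le> d + s e\<close>.\<close>

lemma gradient_bound:
  assumes psi0: "0 < \<psi>0" "\<And>x. \<psi>0 \<le> \<psi> x" and Psi: "\<And>x. \<psi> x \<le> \<Psi>" and abar: "\<And>x. a x \<le> abar"
    and R: "\<And>x t. 0 \<le> t \<Longrightarrow> t \<le> 1 \<Longrightarrow> \<bar>v x t\<bar> \<le> R"
    and U: "\<And>x t. 0 \<le> t \<Longrightarrow> t \<le> 1 \<Longrightarrow> \<bar>u x t\<bar> \<le> U"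
    and AM: "\<And>x t. 0 \<le> t \<Longrightarrow> t \<le> 1 \<Longrightarrow> A x t \<le> AM" "0 < AM"
    and B: "\<And>x. \<Gamma> a a x \<le> B" "\<And>x. \<Gamma> \<psi> \<psi> x \<le> B"
    and bd: "\<And>x. gm u u x 0 \<le> Gb" "\<And>x. gm u u x 1 \<le> Gb"
    and m0_def: "m0 = \<psi>0 / AM"
    and N_def: "N = 2 * K + 3 + 2 / m0"
    and Fm_def: "Fm = \<Psi> + abar * R\<^sup>2"
    and d_def: "d = B + R ^ 4 * B + 2 * abar * N * U * R\<^sup>2 + N * (2 * U * Fm + N * U * R\<^sup>2)"
    and e_def: "e = 2 * U\<^sup>2 * B + N * (U * (\<bar>n\<bar> + 2 * abar * U))"
    and t: "0 \<le> t" "t \<le> 1"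
  shows "gm u u x t \<le> max Gb (d / m0 + e) + N * U\<^sup>2 / 2"
proof -
  define G where "G = (\<lambda>x t. gm u u x t + N / 2 * (u x t * u x t))"
  have R0: "0 \<le> R" using R[of 0 undefined] by simp
  have U0: "0 \<le> U" using U[of 0 undefined] by simp
  have abar0: "0 \<le> abar" using a_nonneg[of undefined] abar[of undefined] by simp
  have m0: "0 < m0" using psi0 AM by (simp add: m0_def)
  have N0: "0 \<le> N" using m0 K_nonneg by (simp add: N_def)
  have v_sq: "(v y s)\<^sup>2 \<le> R\<^sup>2" if "0 \<le> s" "s \<le> 1" for y s
    using power_mono[OF R[OF that, of y] abs_ge_zero, of 2] by simp
  have u_sq: "(u y s)\<^sup>2 \<le> U\<^sup>2" if "0 \<le> s" "s \<le> 1" for y s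
    using power_mono[OF U[OF that, of y] abs_ge_zero, of 2] by simp
  have F_le: "F y s \<le> Fm" if "0 \<le> s" "s \<le> 1" for y s
    unfolding F_def Fm_def using Psi[of y] mult_mono[OF abar[of y] v_sq[OF that, of y]] abar0 by simp
  have "continuous_on (UNIV \<times> {0..1}) (\<lambda>(x, t). G x t)"
    using cont_u cont_grad unfolding G_def split_beta gm_def by (intro continuous_intros) auto
  from attains_max[OF this] obtain x0 t0 where
    x0: "0 \<le> t0" "t0 \<le> 1" and max0: "\<forall>y s. 0 \<le> s \<longrightarrow> s \<le> 1 \<longrightarrow> G y s \<le> G x0 t0" by blast
  have "gm u u x0 t0 \<le> max Gb (d / m0 + e)"
  proof (cases "0 < t0 \<and> t0 < 1")
    case False
    then have "t0 = 0 \<or> t0 = 1" using x0 by auto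
    then show ?thesis using bd[of x0] by auto
  next
    case True
    then have t0: "0 < t0" "t0 < 1" by auto
    have Cguu: "C k (gm u u)" if "k \<le> 3" for k
      using C_mono[OF that] C_gm[of 3 u u] C_u by simp
    have Cguv: "C k (gm u v)" if "k \<le> 2" for k
      using C_mono[OF that] C_gm[of 2 u v] C_u_le[of 3] C_v[of 3] by simp
    have CG: "C 2 G" unfolding G_def by (intro C_intros C_u_le Cguu) auto
    have max: "G y s \<le> G x0 t0" if "0 \<le> s" "s \<le> 1" for y s using max0 that by blast
    have mp: "A x0 t0 * dt (dt G) x0 t0 + utt x0 t0 * lp G x0 t0 - 2 * gm v (dt G) x0 t0 \<le> 0"
        "dt G x0 t0 = 0" "\<And>w. C 1 w \<Longrightarrow> gm G w x0 t0 = 0"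
      by (rule maximum_principle[OF CG t0], erule (1) max, assumption?)+
    have C1: "C 1 u" "C 1 v" "C 1 A" "C 1 utt" "C 1 (gm u v)" "C 1 (gm u u)" "C 1 (gm v v)"
      by (intro C_u_le C_v C_A C_utt Cguv Cguu C_gm_vv; simp)+
    have C2: "C 2 u" "C 2 v" "C 2 A" "C 2 utt" "C 2 (gm u u)"
      by (intro C_u_le C_v C_A C_utt Cguu; simp)+
    have Clu: "C 1 (lp u)" by (rule C_lpu) simp
    define V s g \<tau> a0 A0 F0 where "V = v x0 t0" and "s = utt x0 t0" and "g = gm v v x0 t0"
      and "\<tau> = gm u u x0 t0" and "a0 = a x0" and "A0 = A x0 t0" and "F0 = F x0 t0"
    define U0 guv gus where "U0 = u x0 t0" and "guv = gm u v x0 t0" and "gus = gm u utt x0 t0"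
    have Gt: "dt G y r = 2 * gm u v y r + N * (u y r * v y r)" if "0 < r" "r < 1" for y r
    proof (rule dt_eqI)
      have "dt (gm u u) y r = 2 * gm u v y r"
        using dt_gm[OF C2(1) C2(1) that, of y] gm_sym[of v u r y] C1 that by simp
      then show "(G y has_real_derivative 2 * gm u v y r + N * (u y r * v y r)) (at r)"
        unfolding G_def using has_dt[of u r y] has_dt[of "gm u u" r y] C1 that
        by (auto intro!: derivative_eq_intros)
    qed (use that in auto)
    have Gtt: "dt (dt G) x0 t0 = 2 * (g + gus) + N * (V\<^sup>2 + U0 * s)"
    proof (rule dt_cong_deriv[where h = "\<lambda>r. 2 * gm u v x0 r + N * (u x0 r * v x0 r)"])
      have "dt (gm u v) x0 t0 = g + gus"
        using dt_gm[OF C2(1) C2(2) t0, of x0] by (simp add: g_def gus_def)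
      then show "((\<lambda>r. 2 * gm u v x0 r + N * (u x0 r * v x0 r)) has_real_derivative
          2 * (g + gus) + N * (V\<^sup>2 + U0 * s)) (at t0)"
        using has_dt[of u t0 x0] has_dt[of v t0 x0] has_dt[of "gm u v" t0 x0] C1 t0
        by (auto intro!: derivative_eq_intros simp: V_def U0_def s_def power2_eq_square algebra_simps)
    qed (use Gt t0 in auto)
    define lg where "lg = lp (gm u u) x0 t0"
    define lu where "lu = lp u x0 t0"
    have Cuu: "C k (\<lambda>x t. u x t * u x t)" if "k \<le> 4" for k by (intro C_intros C_u_le that)
    have lG: "lp G x0 t0 = lg + N * (U0 * lu + \<tau>)"
    proof -
      have "lp G x0 t0 = lg + lp (\<lambda>x t. N / 2 * (u x t * u x t)) x0 t0"
        unfolding G_def lg_def by (rule lp_add[OF C2(5) C_mult[OF C_const Cuu] t0]) simp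
      also have "lp (\<lambda>x t. N / 2 * (u x t * u x t)) x0 t0 = N / 2 * lp (\<lambda>x t. u x t * u x t) x0 t0"
        using lp_mult[OF C_const[of 2 "N / 2"] Cuu[of 2] t0, of x0] lp_const[of "\<lambda>t. N / 2" x0 t0]
          gm_const1[of "\<lambda>t. N / 2" _ x0 t0] by simp
      also have "lp (\<lambda>x t. u x t * u x t) x0 t0 = 2 * (U0 * lu + \<tau>)"
        using lp_mult[OF C2(1) C2(1) t0, of x0] by (simp add: U0_def lu_def \<tau>_def)
      finally show ?thesis by simp
    qed
    define gvguv where "gvguv = gm v (gm u v) x0 t0"
    have gvGt: "gm v (dt G) x0 t0 = 2 * gvguv + N * (U0 * g + V * guv)"
    proof -
      have "gm v (dt G) x0 t0 = gm v (\<lambda>y r. 2 * gm u v y r + N * (u y r * v y r)) x0 t0"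
        by (rule gm_cong) (use Gt t0 in auto)
      also have "\<dots> = gm v (\<lambda>y r. 2 * gm u v y r) x0 t0 + gm v (\<lambda>y r. N * (u y r * v y r)) x0 t0"
        by (rule gm_add2) (use t0 C1 in \<open>auto intro!: C_intros\<close>)
      also have "gm v (\<lambda>y r. 2 * gm u v y r) x0 t0 = 2 * gvguv"
        using gm_mult2[OF C_const[of 1 2] C1(5) C1(2) t0, of x0] gm_const2[OF C_const[of 1 2] C1(2) t0, of x0]
        by (simp add: gvguv_def)
      also have "gm v (\<lambda>y r. N * (u y r * v y r)) x0 t0 = N * gm v (\<lambda>y r. u y r * v y r) x0 t0"
        using gm_mult2[OF C_const[of 1 N] C_mult[OF C1(1,2)] C1(2) t0, of x0]
          gm_const2[OF C_const[of 1 N] C1(2) t0, of x0] by simp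
      also have "gm v (\<lambda>y r. u y r * v y r) x0 t0 = U0 * g + V * guv"
        using gm_mult2[OF C1(1,2) C1(2) t0, of x0] gm_sym[OF C1(2,1) t0, of x0]
        by (simp add: U0_def g_def V_def guv_def)
      finally show ?thesis .
    qed
    have guv: "2 * guv = - N * U0 * V"
      using mp(2) Gt[OF t0, of x0] by (simp add: guv_def U0_def V_def)
    have sA: "s > 0" "A0 > 0" using utt_pos[OF t0] A_pos[of t0 x0] t0 by (auto simp: s_def A0_def)
    have g0: "0 \<le> g" "0 \<le> \<tau>" unfolding g_def \<tau>_def by (rule gm_nonneg; use C1 t0 in auto)+
    have mp1: "A0 * (2 * (g + gus) + N * (V\<^sup>2 + U0 * s)) + s * (lg + N * (U0 * lu + \<tau>))
        - 2 * (2 * gvguv + N * (U0 * g + V * guv)) \<le> 0"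
      using mp(1) unfolding Gtt lG gvGt by (simp add: A0_def s_def)
    have eq0: "s * A0 - g = F0" using eq[OF t0, of x0] by (simp add: s_def A0_def g_def F0_def)
    have sA0: "s * A0 = F0 + g" using eq0 by simp
    have eqf: "F y r = utt y r * A y r + (-1) * gm v v y r" if "0 < r" "r < 1" for y r
      using eq[OF that, of y] by simp
    define gua gupsi guF guG gulu guA where "gua = gm u (\<lambda>x t. a x) x0 t0" and "gupsi = gm u (\<lambda>x t. \<psi> x) x0 t0"
      and "guF = gm u F x0 t0" and "guG = gm u (gm v v) x0 t0" and "gulu = gm u (lp u) x0 t0"
      and "guA = gm u A x0 t0"
    have CsA: "C 2 (\<lambda>x t. utt x t * A x t)" by (intro C_intros C_utt C_A) auto
    have Cmg: "C 2 (\<lambda>x t. (-1) * gm v v x t)" by (intro C_intros C_gm_vv) auto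
    have Cvv: "C 1 (\<lambda>x t. v x t * v x t)" by (intro C_intros C1)
    have low: "C 1 h" if "C 2 h" for h using C_mono[of 1 2 h] that by simp
    have Fprod: "F = (\<lambda>x t. \<psi> x + a x * (v x t * v x t))" by (simp add: F_def power2_eq_square)
    have guF1: "guF = gupsi + V\<^sup>2 * gua + 2 * a0 * V * guv"
      unfolding guF_def Fprod
      using gm_add2[OF C_\<psi>[of 1] C_mult[OF C_a Cvv] C1(1) t0, of x0]
        gm_mult2[OF C_a[of 1] Cvv C1(1) t0, of x0] gm_mult2[OF C1(2) C1(2) C1(1) t0, of x0]
      by (simp add: gupsi_def gua_def V_def a0_def guv_def power2_eq_square algebra_simps)
    have guF2: "guF = A0 * gus + s * guA - guG"
    proof -
      have "guF = gm u (\<lambda>y r. utt y r * A y r + (-1) * gm v v y r) x0 t0"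
        unfolding guF_def by (rule gm_cong) (use eqf t0 in auto)
      also have "\<dots> = gm u (\<lambda>y r. utt y r * A y r) x0 t0 + gm u (\<lambda>y r. (-1) * gm v v y r) x0 t0"
        by (rule gm_add2) (use t0 C1 low[OF CsA] low[OF Cmg] in auto)
      also have "gm u (\<lambda>y r. (-1) * gm v v y r) x0 t0 = - guG"
        using gm_mult2[OF C_const[of 1 "-1"] C1(7) C1(1) t0, of x0]
          gm_const2[OF C_const[of 1 "-1"] C1(1) t0, of x0] by (simp add: guG_def)
      also have "gm u (\<lambda>y r. utt y r * A y r) x0 t0 = s * guA + A0 * gus"
        using gm_mult2[OF C1(4) C1(3) C1(1) t0, of x0] by (simp add: s_def A0_def gus_def guA_def)
      finally show ?thesis by simp
    qed
    have guA: "guA = - 2 * (a0 * \<tau> + U0 * gua) + gulu"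
    proof -
      have "A = (\<lambda>y r. (n + (-2) * (a y * u y r)) + lp u y r)" by (simp add: A_def mult.assoc)
      then have "guA = gm u (\<lambda>y r. (n + (-2) * (a y * u y r)) + lp u y r) x0 t0" by (simp add: guA_def)
      also have "\<dots> = gm u (\<lambda>y r. n + (-2) * (a y * u y r)) x0 t0 + gulu"
        unfolding gulu_def by (rule gm_add2) (use t0 C1 Clu C_a in \<open>auto intro!: C_intros\<close>)
      also have "gm u (\<lambda>y r. n + (-2) * (a y * u y r)) x0 t0 = gm u (\<lambda>y r. (-2) * (a y * u y r)) x0 t0"
        using gm_add2[OF C_const[of 1 n] C_mult[OF C_const C_mult[OF C_a C1(1)]] C1(1) t0, of "-2" x0]
          gm_const2[OF C_const[of 1 n] C1(1) t0, of x0] by simp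
      also have "\<dots> = (-2) * gm u (\<lambda>y r. a y * u y r) x0 t0"
        using gm_mult2[OF C_const[of 1 "-2"] C_mult[OF C_a C1(1)] C1(1) t0, of x0]
          gm_const2[OF C_const[of 1 "-2"] C1(1) t0, of x0] by simp
      also have "gm u (\<lambda>y r. a y * u y r) x0 t0 = a0 * \<tau> + U0 * gua"
        using gm_mult2[OF C_a[of 1] C1(1) C1(1) t0, of x0] by (simp add: a0_def U0_def \<tau>_def gua_def)
      finally show ?thesis by simp
    qed
    have lu: "lu = A0 - n + 2 * a0 * U0" by (simp add: lu_def A0_def A_def a0_def U0_def)
    have F0b: "0 \<le> F0" "F0 \<le> Fm" "\<psi>0 \<le> F0"
      using F_pos[of x0 t0] F_le[of t0 x0] psi0(2)[of x0] a_nonneg[of x0] t0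
      by (auto simp: F0_def F_def intro: add_increasing2)
    have "- K * \<tau> \<le> lg / 2 - gulu - 1 / s * (2 * gvguv - guG) + (1 / s)\<^sup>2 * g\<^sup>2"
      using gm_bochner[OF C_u_le[of 3] C2(2) t0, of x0 "1 / s"]
      by (simp add: \<tau>_def lg_def gulu_def gvguv_def guG_def g_def)
    then have "s * (- K * \<tau>) \<le> s * (lg / 2 - gulu - 1 / s * (2 * gvguv - guG) + (1 / s)\<^sup>2 * g\<^sup>2)"
      using sA by (intro mult_left_mono) auto
    also have "\<dots> = s * lg / 2 - s * gulu - (2 * gvguv - guG) + g\<^sup>2 / s"
      using sA by (simp add: field_simps power2_eq_square)
    also have "s * (- K * \<tau>) = - (K * s * \<tau>)" by simp
    finally have boch: "- 2 * K * s * \<tau> - 2 * (g\<^sup>2 / s) \<le> s * lg - 2 * s * gulu - 4 * gvguv + 2 * guG"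
      by linarith
    have "g\<^sup>2 / s \<le> A0 * g"
    proof -
      have "g * g \<le> g * (s * A0)" using F0b g0 unfolding sA0 by (intro mult_left_mono) auto
      then show ?thesis using sA by (simp add: field_simps power2_eq_square)
    qed
    have Lg: "A0 * (2 * (g + gus)) + s * lg - 4 * gvguv
        \<ge> 2 * guF + 4 * s * (a0 * \<tau> + U0 * gua) - 2 * K * s * \<tau>"
    proof -
      have "A0 * (2 * (g + gus)) + s * lg - 4 * gvguv
          = 2 * (A0 * gus + s * guA - guG) + 2 * A0 * g + (s * lg - 2 * s * gulu - 4 * gvguv + 2 * guG)
            + 4 * s * (a0 * \<tau> + U0 * gua)"
        unfolding guA by (simp add: algebra_simps)
      then show ?thesis unfolding guF2[symmetric] using boch \<open>g\<^sup>2 / s \<le> A0 * g\<close> by linarith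
    qed
    have Lu: "A0 * (V\<^sup>2 + U0 * s) + s * (U0 * lu + \<tau>) - 2 * (U0 * g + V * guv)
        \<ge> 2 * U0 * F0 + s * (U0 * (2 * a0 * U0 - n)) + s * \<tau> + N * U0 * V\<^sup>2"
    proof -
      have "A0 * (V\<^sup>2 + U0 * s) + s * (U0 * lu + \<tau>) - 2 * (U0 * g + V * guv)
          = A0 * V\<^sup>2 + 2 * U0 * (s * A0 - g) + s * (U0 * (2 * a0 * U0 - n)) + s * \<tau> - V * (2 * guv)"
        unfolding lu by (simp add: algebra_simps)
      moreover have "V * (- N * U0 * V) = - (N * U0 * V\<^sup>2)" by (simp add: power2_eq_square)
      moreover have "0 \<le> A0 * V\<^sup>2" using sA by simp
      ultimately show ?thesis unfolding eq0 guv by linarith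
    qed
    have CSa: "2 * \<bar>r * gua\<bar> \<le> \<tau> + r\<^sup>2 * \<Gamma> a a x0" for r
      using gm_Cauchy_Schwarz[OF C1(1) C_a[of 1] t0, of r x0] by (simp add: \<tau>_def gua_def gm_def)
    have CSp: "2 * \<bar>r * gupsi\<bar> \<le> \<tau> + r\<^sup>2 * \<Gamma> \<psi> \<psi> x0" for r
      using gm_Cauchy_Schwarz[OF C1(1) C_\<psi>[of 1] t0, of r x0] by (simp add: \<tau>_def gupsi_def gm_def)
    have key: "2 * guF + 4 * s * (a0 * \<tau> + U0 * gua) - 2 * K * s * \<tau>
        + N * (2 * U0 * F0 + s * (U0 * (2 * a0 * U0 - n)) + s * \<tau> + N * U0 * V\<^sup>2) \<le> 0"
    proof -
      have "A0 * (2 * (g + gus)) + s * lg - 4 * gvguv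
        + N * (A0 * (V\<^sup>2 + U0 * s) + s * (U0 * lu + \<tau>) - 2 * (U0 * g + V * guv)) \<le> 0"
        using mp1 by (simp add: algebra_simps)
      moreover have "N * (2 * U0 * F0 + s * (U0 * (2 * a0 * U0 - n)) + s * \<tau> + N * U0 * V\<^sup>2)
          \<le> N * (A0 * (V\<^sup>2 + U0 * s) + s * (U0 * lu + \<tau>) - 2 * (U0 * g + V * guv))"
        using Lu N0 by (rule mult_left_mono)
      ultimately show ?thesis using Lg by linarith
    qed
    have V: "\<bar>V\<bar> \<le> R" "V\<^sup>2 \<le> R\<^sup>2" using R[of t0 x0] v_sq[of t0 x0] t0 by (auto simp: V_def)
    have Ub: "\<bar>U0\<bar> \<le> U" "U0\<^sup>2 \<le> U\<^sup>2" using U[of t0 x0] u_sq[of t0 x0] t0 by (auto simp: U0_def)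
    have a0: "0 \<le> a0" "a0 \<le> abar" using a_nonneg abar by (auto simp: a0_def)
    have B0: "0 \<le> B" using gm_nonneg[OF C_a[of 1] t0, of x0] B(1)[of x0] by (simp add: gm_def)
    have b1: "- \<tau> - B \<le> 2 * gupsi" using CSp[of 1] B(2)[of x0] by (simp add: abs_le_iff)
    have b2: "- \<tau> - R ^ 4 * B \<le> 2 * (V\<^sup>2 * gua)"
    proof -
      have "V ^ 4 \<le> R ^ 4" using power_mono[OF V(1), of 4] by simp
      then have "V ^ 4 * \<Gamma> a a x0 \<le> R ^ 4 * B"
        using B(1)[of x0] B0 R0 by (intro order_trans[OF mult_left_mono mult_right_mono]) auto
      moreover have "(V\<^sup>2)\<^sup>2 = V ^ 4" by simp
      ultimately have "2 * \<bar>V\<^sup>2 * gua\<bar> \<le> \<tau> + R ^ 4 * B" using CSa[of "V\<^sup>2"] by simp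
      then show ?thesis by linarith
    qed
    have b3: "- (2 * abar * N * U * R\<^sup>2) \<le> 4 * a0 * V * guv"
    proof -
      have "4 * a0 * V * guv = 2 * a0 * V * (2 * guv)" by simp
      also have "\<dots> = - (2 * N * (a0 * U0 * V\<^sup>2))" unfolding guv by (simp add: power2_eq_square)
      finally have "4 * a0 * V * guv = - (2 * N * (a0 * U0 * V\<^sup>2))" .
      moreover have "\<bar>a0 * U0 * V\<^sup>2\<bar> \<le> abar * U * R\<^sup>2"
        unfolding abs_mult using a0 Ub V abar0 U0 by (intro mult_mono) auto
      then have "2 * N * (a0 * U0 * V\<^sup>2) \<le> 2 * N * (abar * U * R\<^sup>2)"
        using N0 by (intro mult_left_mono) auto
      ultimately show ?thesis by (simp only: mult.assoc mult.left_commute neg_le_iff_le)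
    qed
    have b4: "- 2 * (s * \<tau>) - s * (2 * U\<^sup>2 * B) \<le> 4 * s * (a0 * \<tau> + U0 * gua)"
    proof -
      have "U0\<^sup>2 * \<Gamma> a a x0 \<le> U\<^sup>2 * B"
        using Ub B(1)[of x0] B0 by (intro order_trans[OF mult_left_mono mult_right_mono]) auto
      then have "2 * \<bar>U0 * gua\<bar> \<le> \<tau> + U\<^sup>2 * B" using CSa[of U0] by simp
      then have "- (2 * \<tau>) - 2 * U\<^sup>2 * B \<le> 4 * (U0 * gua)" by linarith
      moreover have "0 \<le> 4 * (a0 * \<tau>)" using a0 g0 by simp
      ultimately have "- (2 * \<tau>) - 2 * U\<^sup>2 * B \<le> 4 * (a0 * \<tau> + U0 * gua)"
        unfolding distrib_left by linarith
      from mult_left_mono[OF this, of s] sA show ?thesis by (simp add: algebra_simps)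
    qed
    have b5: "- (N * (2 * U * Fm + N * U * R\<^sup>2)) - s * (N * (U * (\<bar>n\<bar> + 2 * abar * U))) + s * (N * \<tau>)
        \<le> N * (2 * U0 * F0 + s * (U0 * (2 * a0 * U0 - n)) + s * \<tau> + N * U0 * V\<^sup>2)"
    proof -
      have "\<bar>U0 * F0\<bar> \<le> U * Fm" unfolding abs_mult using Ub F0b U0 by (intro mult_mono) auto
      then have 1: "- (2 * U * Fm) \<le> 2 * U0 * F0" by linarith
      have "\<bar>a0 * U0\<bar> \<le> abar * U" unfolding abs_mult using a0 Ub U0 abar0 by (intro mult_mono) auto
      then have "\<bar>2 * a0 * U0 - n\<bar> \<le> \<bar>n\<bar> + 2 * abar * U" by (simp add: abs_le_iff) linarith
      then have "\<bar>U0 * (2 * a0 * U0 - n)\<bar> \<le> U * (\<bar>n\<bar> + 2 * abar * U)"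
        unfolding abs_mult using Ub U0 by (intro mult_mono) auto
      then have "- (U * (\<bar>n\<bar> + 2 * abar * U)) \<le> U0 * (2 * a0 * U0 - n)" by linarith
      from mult_left_mono[OF this, of s] sA
      have 2: "- (s * (U * (\<bar>n\<bar> + 2 * abar * U))) \<le> s * (U0 * (2 * a0 * U0 - n))" by simp
      have "\<bar>U0 * V\<^sup>2\<bar> \<le> U * R\<^sup>2" unfolding abs_mult using Ub V U0 by (intro mult_mono) auto
      then have "- (U * R\<^sup>2) \<le> U0 * V\<^sup>2" by linarith
      from mult_left_mono[OF this N0] have 3: "- (N * U * R\<^sup>2) \<le> N * U0 * V\<^sup>2" by (simp add: ac_simps)
      have "- (2 * U * Fm + N * U * R\<^sup>2) - s * (U * (\<bar>n\<bar> + 2 * abar * U)) + s * \<tau>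
          \<le> 2 * U0 * F0 + s * (U0 * (2 * a0 * U0 - n)) + s * \<tau> + N * U0 * V\<^sup>2"
        using 1 2 3 by linarith
      from mult_left_mono[OF this N0] show ?thesis by (simp add: algebra_simps)
    qed
    have guFe: "2 * guF = 2 * gupsi + 2 * (V\<^sup>2 * gua) + 4 * a0 * V * guv"
      unfolding guF1 by simp
    have low1: "s * (N * \<tau>) - 2 * K * s * \<tau> - 2 * (s * \<tau>) - 2 * \<tau> - d - s * e \<le> 0"
      using key b1 b2 b3 b4 b5 unfolding guFe d_def e_def distrib_left[of s] by linarith
    have ms: "m0 \<le> s"
    proof -
      have "\<psi>0 \<le> s * A0" using F0b g0 unfolding sA0 by linarith
      also have "\<dots> \<le> s * AM" using sA AM(1)[of t0 x0] t0 by (intro mult_left_mono) (auto simp: A0_def)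
      finally show ?thesis using AM(2) by (simp add: m0_def field_simps)
    qed
    have tau: "2 * \<tau> \<le> s * (2 / m0) * \<tau>"
    proof -
      have "2 \<le> s * (2 / m0)" using ms m0 by (simp add: field_simps)
      then show ?thesis using g0 by (intro mult_right_mono)
    qed
    have Fm0: "0 \<le> Fm" using F0b by simp
    have d0: "0 \<le> d" using B0 R0 abar0 N0 U0 Fm0
      by (auto simp: d_def intro!: add_nonneg_nonneg mult_nonneg_nonneg)
    have dd: "d \<le> s * (d / m0)"
      using mult_right_mono[OF ms, of "d / m0"] d0 m0 by simp
    have "s * \<tau> = s * (N * \<tau>) - 2 * K * s * \<tau> - 2 * (s * \<tau>) - s * (2 / m0) * \<tau>"
      unfolding N_def by (simp add: algebra_simps)
    also have "\<dots> \<le> s * (d / m0 + e)" using low1 tau dd by (simp add: distrib_left)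
    finally have "\<tau> \<le> d / m0 + e" using sA by simp
    then show ?thesis by (simp add: \<tau>_def)
  qed
  moreover have "gm u u x t \<le> G x t" using N0 by (simp add: G_def)
  moreover have "G x t \<le> G x0 t0" using max0 t by blast
  moreover have "G x0 t0 \<le> gm u u x0 t0 + N * U\<^sup>2 / 2"
    using mult_left_mono[OF u_sq[OF x0, of x0], of "N / 2"] N0 by (simp add: G_def power2_eq_square)
  ultimately show ?thesis by linarith
qed

end

section \<open>The a priori estimate\<close>

context diffusion_cylinder begin

text \<open>The constants are defined before the solution is introduced: each bound enters only into the later ones,
  \<open>R\<close> for \<open>|v|\<close>, \<open>U\<close> for \<open>|u|\<close>, \<open>AM\<close> for \<open>A\<close>, \<open>m0\<close> for \<open>u\<^sub>t\<^sub>t\<close> from below.\<close>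

lemma a_priori_estimate:
  fixes a \<psi> \<phi>0 \<phi>1 :: "'a \<Rightarrow> real" and n :: real
  assumes psi: "0 < \<psi>0" "\<And>x. \<psi>0 \<le> \<psi> x" "\<And>x. \<psi> x \<le> \<Psi>"
    and abar: "1 \<le> abar" "\<And>x. a x \<le> abar"
    and c: "0 < c" "\<And>x. c \<le> n - 2 * a x * \<phi>0 x + L \<phi>0 x" "\<And>x. c \<le> n - 2 * a x * \<phi>1 x + L \<phi>1 x"
    and B: "\<And>x. \<bar>\<phi>0 x\<bar> \<le> B" "\<And>x. \<bar>\<phi>1 x\<bar> \<le> B" "\<And>x. \<bar>L \<psi> x\<bar> \<le> B" "\<And>x. \<bar>L a x\<bar> \<le> B"
      "\<And>x. \<Gamma> a a x \<le> B" "\<And>x. \<Gamma> \<psi> \<psi> x \<le> B" "\<And>x. \<Gamma> \<phi>0 \<phi>0 x \<le> B" "\<And>x. \<Gamma> \<phi>1 \<phi>1 x \<le> B"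
      "\<And>x. n - 2 * a x * \<phi>0 x + L \<phi>0 x \<le> B" "\<And>x. n - 2 * a x * \<phi>1 x + L \<phi>1 x \<le> B"
    and C\<phi>: "\<And>k. C k (\<lambda>x t. \<phi>0 x)" "\<And>k. C k (\<lambda>x t. \<phi>1 x)"
  shows "\<exists>M1 M2. \<forall>u. mixed_geodesic C L \<Gamma> K n a \<psi> u \<and> (\<forall>x. u x 0 = \<phi>0 x \<and> u x 1 = \<phi>1 x) \<longrightarrow>
    (\<forall>x. \<forall>t\<in>{0..1}. \<bar>L (\<lambda>y. u y t) x\<bar> \<le> M1 \<and> \<Gamma> (\<lambda>y. u y t) (\<lambda>y. u y t) x \<le> M2)"
proof -
  define W where "W = 2 * c + 2 * abar * (2 * B) + 4 * abar * \<Psi> / c"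
  define R where "R = (W\<^sup>2 - c\<^sup>2) / (2 * abar * c)"
  define U where "U = B + R"
  define lam where "lam = (2 * K + 6) / \<psi>0"
  define Fm where "Fm = \<Psi> + abar * R\<^sup>2"
  define c1 where "c1 = B * (1 + 5 * R\<^sup>2 + lam\<^sup>2 * R\<^sup>2 + lam\<^sup>2 * R ^ 6) + 2 * abar * Fm + lam\<^sup>2 * R\<^sup>2 * Fm\<^sup>2"
  define c2 where "c2 = abar * R + lam * R * Fm"
  define AM where "AM = exp (lam * R\<^sup>2 / 2 + 1 / 4) * max B (4 * (c1 + c2) + 1)"
  define m0 where "m0 = \<psi>0 / AM"
  define N where "N = 2 * K + 3 + 2 / m0"
  define d where "d = B + R ^ 4 * B + 2 * abar * N * U * R\<^sup>2 + N * (2 * U * Fm + N * U * R\<^sup>2)"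
  define e where "e = 2 * U\<^sup>2 * B + N * (U * (\<bar>n\<bar> + 2 * abar * U))"
  define M1 where "M1 = AM + \<bar>n\<bar> + 2 * abar * U"
  define M2 where "M2 = max B (d / m0 + e) + N * U\<^sup>2 / 2"
  have B0: "0 \<le> B" using B(1)[of undefined] by simp
  have "\<bar>L (\<lambda>y. u y t) x\<bar> \<le> M1 \<and> \<Gamma> (\<lambda>y. u y t) (\<lambda>y. u y t) x \<le> M2"
    if geo: "mixed_geodesic C L \<Gamma> K n a \<psi> u" and bd: "\<And>x. u x 0 = \<phi>0 x" "\<And>x. u x 1 = \<phi>1 x"
      and t: "0 \<le> t" "t \<le> 1" for u x t
  proof -
    interpret mixed_geodesic C L \<Gamma> K n a \<psi> u by (rule geo)
    have A01: "A x 0 = n - 2 * a x * \<phi>0 x + L \<phi>0 x" "A x 1 = n - 2 * a x * \<phi>1 x + L \<phi>1 x" for x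
      by (simp_all add: A_def lp_def bd)
    have diff: "\<bar>u x 1 - u x 0\<bar> \<le> 2 * B" for x
      using B(1)[of x] B(2)[of x] by (simp add: bd abs_le_iff)
    have Cb: "C k (\<lambda>x t. u x 0)" "C k (\<lambda>x t. u x 1)" for k using C\<phi> by (simp_all add: bd)
    have low: "u x 0 - R * t \<le> u x t" "u x 1 - R * (1 - t) \<le> u x t" if "0 \<le> t" "t \<le> 1" for x t
    proof -
      have Ac: "c \<le> A x 0" "c \<le> A x 1" for x using c by (auto simp: A01)
      have B2: "0 \<le> 2 * B" using B0 by simp
      show "u x 0 - R * t \<le> u x t" "u x 1 - R * (1 - t) \<le> u x t"
        using barrier_bound[OF c(1) abar psi(3) B2 diff Ac Cb W_def R_def that] by auto
    qed
    have v: "\<bar>dt u x t\<bar> \<le> R" if "0 \<le> t" "t \<le> 1" for x t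
      by (rule velocity_bound[OF low that]) auto
    have R0: "0 \<le> R" using v[of 0 undefined] by simp
    have ub: "\<bar>u x t\<bar> \<le> U" if "0 \<le> t" "t \<le> 1" for x t
    proof (rule abs_leI)
      show "- u x t \<le> U" using low(1)[OF that, of x] B(1)[of x] mult_left_mono[of t 1 R] R0 that
        by (auto simp: bd U_def abs_le_iff)
      have "u x t - u x 0 \<le> R"
      proof (cases "t = 0")
        case False
        have "\<exists>l p. 0 < p \<and> p < t \<and> DERIV (u x) p :> l \<and> u x t - u x 0 = (t - 0) * l"
        proof (rule MVT)
          show "continuous_on {0..t} (u x)"
            using cont_slice[OF cont_u, of x] by (rule continuous_on_subset) (use that in auto)
          show "u x differentiable (at p)" if "0 < p" "p < t" for p
            using has_dt[of u p x] C_u_le[of 1] that \<open>t \<le> 1\<close> real_differentiable_def by auto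
        qed (use False that in auto)
        then obtain l p where p: "0 < p" "p < t" "DERIV (u x) p :> l" "u x t - u x 0 = (t - 0) * l" by blast
        have "l = dt u x p" using DERIV_unique[OF p(3) has_dt[of u p x]] C_u_le[of 1] p that by simp
        then have "l \<le> R" using v[of p x] p that by simp
        then have "t * l \<le> t * R" "t * R \<le> 1 * R"
          using that R0 by (intro mult_left_mono mult_right_mono; simp)+
        moreover have "u x t - u x 0 = t * l" using p(4) by simp
        ultimately show ?thesis by linarith
      qed (use R0 in simp)
      then show "u x t \<le> U" using B(1)[of x] by (simp add: bd U_def abs_le_iff)
    qed
    have Ab: "A x 0 \<le> B" "A x 1 \<le> B" for x using B by (auto simp: A01)
    have AM: "A x t \<le> AM" if "0 \<le> t" "t \<le> 1" for x t
      unfolding AM_def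
      by (rule A_bound[OF psi abar(2) v B(3-6) Ab lam_def Fm_def c1_def c2_def that])
    have AM0: "0 < AM" using A_pos[of 0 undefined] AM[of 0 undefined] by simp
    have G: "gm u u x 0 \<le> B" "gm u u x 1 \<le> B" for x using B by (auto simp: gm_def bd)
    have "gm u u x t \<le> M2" unfolding M2_def
      by (rule gradient_bound[OF psi abar(2) v ub AM AM0 B(5,6) G m0_def N_def Fm_def d_def e_def t])
    moreover have "\<bar>lp u x t\<bar> \<le> M1"
    proof -
      have "\<bar>a x * u x t\<bar> \<le> abar * U"
        unfolding abs_mult using a_nonneg[of x] abar ub[OF t, of x] by (intro mult_mono) auto
      moreover have "lp u x t = A x t - n + 2 * (a x * u x t)" by (simp add: A_def)
      ultimately show ?thesis
        using A_pos[OF t, of x] AM[OF t, of x] unfolding M1_def by linarith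
    qed
    ultimately show ?thesis by (simp add: gm_def lp_def)
  qed
  then show ?thesis by (intro exI[of _ M1] exI[of _ M2]) auto
qed

end

section \<open>Calculus of \<open>C^k\<close> functions\<close>

declare Ck_on.simps(2) [simp del]

lemma Ck_on_cong:
  "(\<And>x. x \<in> S \<Longrightarrow> f x = h x) \<Longrightarrow> Ck_on k S f \<longleftrightarrow> Ck_on k S h"
proof (induction k arbitrary: f h)
  case 0 then show ?case by (simp cong: continuous_on_cong)
next
  case (Suc k)
  have "(f has_derivative F) (at x within S) \<longleftrightarrow> (h has_derivative F) (at x within S)" if "x \<in> S" for F x
    using has_derivative_transform[of x S f h F] has_derivative_transform[of x S h f F] Suc.prems that by auto
  then show ?case by (simp add: Ck_on.simps(2))
qed

lemma Ck_on_subset: "Ck_on k S f \<Longrightarrow> T \<subseteq> S \<Longrightarrow> Ck_on k T f"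
proof (induction k arbitrary: f)
  case 0 then show ?case by (auto intro: continuous_on_subset)
next
  case (Suc k)
  then obtain f' where f': "\<And>x. x \<in> S \<Longrightarrow> (f has_derivative f' x) (at x within S)"
    "\<And>v. Ck_on k S (\<lambda>x. f' x v)" by (auto simp: Ck_on.simps(2))
  have "\<And>x. x \<in> T \<Longrightarrow> (f has_derivative f' x) (at x within T)"
    using f'(1) Suc.prems(2) has_derivative_subset by blast
  moreover have "\<And>v. Ck_on k T (\<lambda>x. f' x v)" using Suc.IH f'(2) Suc.prems(2) by blast
  ultimately show ?case by (auto simp: Ck_on.simps(2))
qed

lemma Ck_on_Suc_imp: "Ck_on (Suc k) S f \<Longrightarrow> Ck_on k S f"
proof (induction k arbitrary: f)
  case 0
  then show ?case
    by (auto simp: Ck_on.simps(2) continuous_on_eq_continuous_within intro: has_derivative_continuous)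
next
  case (Suc k)
  then obtain f' where "\<forall>x\<in>S. (f has_derivative f' x) (at x within S)" "\<forall>v. Ck_on (Suc k) S (\<lambda>x. f' x v)"
    by (auto simp: Ck_on.simps(2)[of "Suc k"])
  then show ?case using Suc.IH by (auto simp: Ck_on.simps(2)[of k])
qed

lemma Ck_on_mono: "j \<le> k \<Longrightarrow> Ck_on k S f \<Longrightarrow> Ck_on j S f"
  by (induction rule: inc_induct) (auto intro: Ck_on_Suc_imp)

lemma Ck_on_imp_continuous: "Ck_on k S f \<Longrightarrow> continuous_on S f"
  using Ck_on_mono[of 0 k S f] by simp

lemma Ck_on_const [intro]: "Ck_on k S (\<lambda>x. r)"
proof (induction k arbitrary: r)
  case (Suc k)
  show ?case unfolding Ck_on.simps by (rule exI[of _ "\<lambda>x v. 0"]) (use Suc in auto)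
qed auto

lemma Ck_on_linear: "bounded_linear L \<Longrightarrow> Ck_on k S L"
proof (cases k)
  case 0
  assume "bounded_linear L"
  then show ?thesis using 0 by (simp add: linear_continuous_on)
next
  case (Suc j)
  assume L: "bounded_linear L"
  show ?thesis unfolding Suc Ck_on.simps
    by (rule exI[of _ "\<lambda>x. L"]) (use L in \<open>auto intro: bounded_linear_imp_has_derivative\<close>)
qed

lemma Ck_on_bounded_linear:
  assumes L: "bounded_linear L" shows "Ck_on k S f \<Longrightarrow> Ck_on k S (\<lambda>x. L (f x))"
proof (induction k arbitrary: f)
  case 0 then show ?case using bounded_linear.continuous_on[OF L] by simp
next
  case (Suc k)
  then obtain f' where "\<forall>x\<in>S. (f has_derivative f' x) (at x within S)" "\<forall>v. Ck_on k S (\<lambda>x. f' x v)"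
    by (auto simp: Ck_on.simps(2))
  then show ?case unfolding Ck_on.simps
    by (intro exI[of _ "\<lambda>x v. L (f' x v)"]) (auto intro: bounded_linear.has_derivative[OF L] Suc.IH)
qed

lemma Ck_on_add: "Ck_on k S f \<Longrightarrow> Ck_on k S h \<Longrightarrow> Ck_on k S (\<lambda>x. f x + h x)"
proof (induction k arbitrary: f h)
  case 0 then show ?case by (auto intro: continuous_intros)
next
  case (Suc k)
  then obtain f' h' where "\<forall>x\<in>S. (f has_derivative f' x) (at x within S)" "\<forall>v. Ck_on k S (\<lambda>x. f' x v)"
    "\<forall>x\<in>S. (h has_derivative h' x) (at x within S)" "\<forall>v. Ck_on k S (\<lambda>x. h' x v)"
    by (auto simp: Ck_on.simps(2))
  then show ?case unfolding Ck_on.simps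
    by (intro exI[of _ "\<lambda>x v. f' x v + h' x v"]) (auto intro!: has_derivative_add Suc.IH)
qed

lemma Ck_on_mult:
  fixes f h :: "_ \<Rightarrow> 'b::real_normed_algebra"
  shows "Ck_on k S f \<Longrightarrow> Ck_on k S h \<Longrightarrow> Ck_on k S (\<lambda>x. f x * h x)"
proof (induction k arbitrary: f h)
  case 0 then show ?case by (auto intro: continuous_intros)
next
  case (Suc k)
  then obtain f' h' where "\<forall>x\<in>S. (f has_derivative f' x) (at x within S)" "\<forall>v. Ck_on k S (\<lambda>x. f' x v)"
    "\<forall>x\<in>S. (h has_derivative h' x) (at x within S)" "\<forall>v. Ck_on k S (\<lambda>x. h' x v)"
    by (auto simp: Ck_on.simps(2))
  then show ?case using Suc.prems[THEN Ck_on_Suc_imp] unfolding Ck_on.simps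
    by (intro exI[of _ "\<lambda>x v. f x * h' x v + f' x v * h x"])
       (auto intro!: has_derivative_mult Suc.IH Ck_on_add)
qed

lemma Ck_on_sum: "finite I \<Longrightarrow> (\<And>i. i \<in> I \<Longrightarrow> Ck_on k S (f i)) \<Longrightarrow> Ck_on k S (\<lambda>x. \<Sum>i\<in>I. f i x)"
  by (induction I rule: finite_induct) (auto intro!: Ck_on_add)

lemma Ck_on_prod:
  fixes f :: "'i \<Rightarrow> _ \<Rightarrow> 'b::real_normed_field"
  shows "finite I \<Longrightarrow> (\<And>i. i \<in> I \<Longrightarrow> Ck_on k S (f i)) \<Longrightarrow> Ck_on k S (\<lambda>x. \<Prod>i\<in>I. f i x)"
  by (induction I rule: finite_induct) (auto intro!: Ck_on_mult)

lemma Ck_on_cmult: 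
  fixes f :: "_ \<Rightarrow> 'b::real_normed_algebra"
  shows "Ck_on k S f \<Longrightarrow> Ck_on k S (\<lambda>x. r * f x)"
  by (rule Ck_on_mult) auto

lemma Ck_on_uminus: "Ck_on k S f \<Longrightarrow> Ck_on k S (\<lambda>x. - f x)"
  by (rule Ck_on_bounded_linear[OF bounded_linear_minus[OF bounded_linear_ident]])

lemma Ck_on_inverse:
  fixes f :: "_ \<Rightarrow> 'b::real_normed_field"
  shows "Ck_on k S f \<Longrightarrow> (\<And>x. x \<in> S \<Longrightarrow> f x \<noteq> 0) \<Longrightarrow> Ck_on k S (\<lambda>x. inverse (f x))"
proof (induction k arbitrary: f)
  case 0 then show ?case by (auto intro: continuous_intros)
next
  case (Suc k)
  then obtain f' where "\<forall>x\<in>S. (f has_derivative f' x) (at x within S)" "\<forall>v. Ck_on k S (\<lambda>x. f' x v)"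
    by (auto simp: Ck_on.simps(2))
  then show ?case using Suc.prems Suc.prems(1)[THEN Ck_on_Suc_imp] unfolding Ck_on.simps
    by (intro exI[of _ "\<lambda>x v. - (inverse (f x) * f' x v * inverse (f x))"])
       (auto intro!: derivative_eq_intros Suc.IH Ck_on_mult Ck_on_uminus)
qed

lemma Ck_on_affine:
  assumes L: "bounded_linear L" and sub: "(\<lambda>x. L x + b) ` T \<subseteq> S"
  shows "Ck_on k S f \<Longrightarrow> Ck_on k T (\<lambda>x. f (L x + b))"
proof (induction k arbitrary: f)
  case 0
  have "continuous_on T (\<lambda>x. L x + b)" using L by (intro continuous_intros linear_continuous_on)
  then show ?case using 0 sub by (auto intro: continuous_on_compose2)
next
  case (Suc k)
  then obtain f' where f': "\<forall>x\<in>S. (f has_derivative f' x) (at x within S)" "\<forall>v. Ck_on k S (\<lambda>x. f' x v)"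
    by (auto simp: Ck_on.simps(2))
  have "((\<lambda>x. f (L x + b)) has_derivative (\<lambda>v. f' (L x + b) (L v))) (at x within T)" if "x \<in> T" for x
  proof (rule has_derivative_in_compose2[of S f f' "\<lambda>x. L x + b" T x L])
    show "((\<lambda>x. L x + b) has_derivative L) (at x within T)"
      using bounded_linear_imp_has_derivative[OF L] by (auto intro!: derivative_eq_intros)
  qed (use f' sub that in auto)
  then show ?case using f'(2) Suc.IH unfolding Ck_on.simps
    by (intro exI[of _ "\<lambda>x v. f' (L x + b) (L v)"]) auto
qed

lemma Ck_on_2_compose:
  fixes f :: "_ \<Rightarrow> real"
  assumes f: "Ck_on 2 S f" and T: "\<And>x. x \<in> S \<Longrightarrow> f x \<in> T"
    and q: "\<And>y. y \<in> T \<Longrightarrow> (q has_real_derivative q' y) (at y)"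
      "\<And>y. y \<in> T \<Longrightarrow> (q' has_real_derivative q'' y) (at y)"
    and cont: "continuous_on T q''"
  shows "Ck_on 2 S (\<lambda>x. q (f x))"
proof -
  have c0: "Ck_on 0 S (\<lambda>x. q'' (f x))"
    using cont Ck_on_imp_continuous[OF f] T by (auto intro: continuous_on_compose2)
  have step: "Ck_on (Suc k) S (\<lambda>x. p (f x))"
    if p: "\<And>y. y \<in> T \<Longrightarrow> (p has_real_derivative p' y) (at y)" and C: "Ck_on k S (\<lambda>x. p' (f x))"
      and fk: "Ck_on (Suc k) S f" for p p' k
  proof -
    obtain f' where f': "\<forall>x\<in>S. (f has_derivative f' x) (at x within S)" "\<forall>v. Ck_on k S (\<lambda>x. f' x v)"
      using fk by (auto simp: Ck_on.simps(2))
    have "((\<lambda>x. p (f x)) has_derivative (\<lambda>v. f' x v * p' (f x))) (at x within S)" if "x \<in> S" for x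
      by (rule DERIV_compose_FDERIV[where f = p and g = f]) (use p T f' that in auto)
    then show ?thesis unfolding Ck_on.simps using f' C
      by (intro exI[of _ "\<lambda>x v. f' x v * p' (f x)"]) (auto intro!: Ck_on_mult)
  qed
  have f2: "Ck_on (Suc (Suc 0)) S f" using f by (simp only: numeral_2_eq_2)
  have c1: "Ck_on (Suc 0) S (\<lambda>x. q' (f x))"
    by (rule step[where p = q' and p' = q'']) (fact q(2) c0 Ck_on_Suc_imp[OF f2])+
  have "Ck_on (Suc (Suc 0)) S (\<lambda>x. q (f x))"
    by (rule step[where p = q and p' = q']) (fact q(1) c1 f2)+
  then show ?thesis by (simp only: numeral_2_eq_2)
qed

subsection \<open>Directional derivatives\<close>

definition dir_deriv :: "'a::real_normed_vector \<Rightarrow> ('a \<Rightarrow> 'b::real_normed_vector) \<Rightarrow> 'a \<Rightarrow> 'b" where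
  "dir_deriv v f = (\<lambda>p. frechet_derivative f (at p) v)"

lemma dir_deriv_eq: "(f has_derivative f') (at p) \<Longrightarrow> dir_deriv v f p = f' v"
  unfolding dir_deriv_def using frechet_derivative_at by metis

lemma Ck_on_Suc_open:
  assumes "open S"
  shows "Ck_on (Suc k) S f \<longleftrightarrow> (\<forall>x\<in>S. f differentiable at x) \<and> (\<forall>v. Ck_on k S (dir_deriv v f))"
proof
  assume "Ck_on (Suc k) S f"
  then obtain f' where f': "\<And>x. x \<in> S \<Longrightarrow> (f has_derivative f' x) (at x within S)"
    "\<And>v. Ck_on k S (\<lambda>x. f' x v)" by (auto simp: Ck_on.simps(2))
  have der: "(f has_derivative f' x) (at x)" if "x \<in> S" for x
    using f'(1)[OF that] unfolding at_within_open[OF that assms] .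
  have eq: "dir_deriv v f x = f' x v" if "x \<in> S" for x v using dir_deriv_eq[OF der[OF that]] .
  have "Ck_on k S (dir_deriv v f)" for v by (rule iffD2[OF Ck_on_cong[OF eq] f'(2)[of v]])
  then show "(\<forall>x\<in>S. f differentiable at x) \<and> (\<forall>v. Ck_on k S (dir_deriv v f))"
    using der differentiableI by blast
next
  assume *: "(\<forall>x\<in>S. f differentiable at x) \<and> (\<forall>v. Ck_on k S (dir_deriv v f))"
  have "(f has_derivative frechet_derivative f (at x)) (at x within S)" if "x \<in> S" for x
    by (rule has_derivative_at_withinI, rule iffD1[OF frechet_derivative_works]) (use * that in blast)
  moreover have "Ck_on k S (\<lambda>x. frechet_derivative f (at x) v)" for v
    using * by (simp only: dir_deriv_def)
  ultimately show "Ck_on (Suc k) S f" unfolding Ck_on.simps by (intro exI conjI ballI allI)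
qed

lemma Ck_on_dir_deriv: "open S \<Longrightarrow> Ck_on (Suc k) S f \<Longrightarrow> Ck_on k S (dir_deriv v f)"
  by (simp add: Ck_on_Suc_open)

lemma has_dir_deriv:
  "open S \<Longrightarrow> Ck_on (Suc k) S f \<Longrightarrow> p \<in> S \<Longrightarrow> (f has_derivative (\<lambda>v. dir_deriv v f p)) (at p)"
  using frechet_derivative_works[of f "at p"] by (simp add: Ck_on_Suc_open dir_deriv_def)

lemma dir_deriv_cong:
  assumes "open S" "p \<in> S" "Ck_on 1 S h" "\<And>x. x \<in> S \<Longrightarrow> f x = h x"
  shows "dir_deriv v f p = dir_deriv v h p"
proof (rule dir_deriv_eq)
  have "(h has_derivative (\<lambda>v. dir_deriv v h p)) (at p)"
    using has_dir_deriv[of S 0 h p] assms by simp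
  then show "(f has_derivative (\<lambda>v. dir_deriv v h p)) (at p)"
    by (rule has_derivative_transform_within_open[OF _ assms(1,2)]) (use assms in auto)
qed

lemma dir_deriv_const: "dir_deriv v (\<lambda>x. r) p = 0"
  by (rule dir_deriv_eq) simp

lemma dir_deriv_add:
  assumes "open S" "p \<in> S" "Ck_on 1 S f" "Ck_on 1 S h"
  shows "dir_deriv v (\<lambda>x. f x + h x) p = dir_deriv v f p + dir_deriv v h p"
  using has_dir_deriv[of S 0 f p] has_dir_deriv[of S 0 h p] assms
  by (intro dir_deriv_eq) (auto intro!: derivative_eq_intros)

lemma dir_deriv_mult:
  fixes f h :: "_ \<Rightarrow> real"
  assumes "open S" "p \<in> S" "Ck_on 1 S f" "Ck_on 1 S h"
  shows "dir_deriv v (\<lambda>x. f x * h x) p = f p * dir_deriv v h p + h p * dir_deriv v f p"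
proof -
  have "((\<lambda>x. f x * h x) has_derivative (\<lambda>v. f p * dir_deriv v h p + dir_deriv v f p * h p)) (at p)"
    using has_dir_deriv[of S 0 f p] has_dir_deriv[of S 0 h p] assms
    by (intro has_derivative_mult) auto
  from dir_deriv_eq[OF this] show ?thesis by (simp add: mult.commute)
qed

lemma dir_deriv_sum:
  assumes "open S" "p \<in> S" "finite I" "\<And>i. i \<in> I \<Longrightarrow> Ck_on 1 S (f i)"
  shows "dir_deriv v (\<lambda>x. \<Sum>i\<in>I. f i x) p = (\<Sum>i\<in>I. dir_deriv v (f i) p)"
  by (intro dir_deriv_eq has_derivative_sum has_dir_deriv[of S 0]) (use assms in auto)

lemma dir_deriv_compose:
  fixes f :: "_ \<Rightarrow> real"
  assumes "open S" "p \<in> S" "Ck_on 1 S f" "(q has_real_derivative d) (at (f p))"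
  shows "dir_deriv v (\<lambda>x. q (f x)) p = d * dir_deriv v f p"
proof -
  have "((\<lambda>x. q (f x)) has_derivative (\<lambda>v. dir_deriv v f p * d)) (at p)"
    using has_dir_deriv[of S 0 f p] assms by (intro DERIV_compose_FDERIV) auto
  from dir_deriv_eq[OF this] show ?thesis by (simp add: mult.commute)
qed

lemma dir_deriv_linear:
  assumes "open S" "p \<in> S" "Ck_on 1 S f"
  shows "linear (\<lambda>v. dir_deriv v f p)"
  using has_dir_deriv[of S 0 f p] assms has_derivative_linear by auto

lemma has_real_derivative_along_line:
  fixes f :: "'a::real_normed_vector \<Rightarrow> real"
  assumes "open S" "p + s *\<^sub>R v \<in> S" "Ck_on 1 S f"
  shows "((\<lambda>s. f (p + s *\<^sub>R v)) has_real_derivative dir_deriv v f (p + s *\<^sub>R v)) (at s)"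
proof -
  have f: "(f has_derivative (\<lambda>w. dir_deriv w f (p + s *\<^sub>R v))) (at (p + s *\<^sub>R v))"
    using has_dir_deriv[of S 0 f] assms by simp
  have "((\<lambda>s. p + s *\<^sub>R v) has_derivative (\<lambda>h. h *\<^sub>R v)) (at s)"
    by (auto intro!: derivative_eq_intros)
  from has_derivative_compose[OF this f]
  have "((\<lambda>s. f (p + s *\<^sub>R v)) has_derivative (\<lambda>h. dir_deriv (h *\<^sub>R v) f (p + s *\<^sub>R v))) (at s)" .
  moreover have "(\<lambda>h. dir_deriv (h *\<^sub>R v) f (p + s *\<^sub>R v)) = (*) (dir_deriv v f (p + s *\<^sub>R v))"
    using linear_scale[OF dir_deriv_linear[OF assms]] by (auto simp: mult.commute)
  ultimately show ?thesis by (simp add: has_field_derivative_def)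
qed

text \<open>Two applications of the mean value theorem. Exchanging \<open>v\<close> and \<open>w\<close> does not change the left side; this is what
  makes second derivatives commute.\<close>

lemma second_difference:
  fixes f :: "'a::real_normed_vector \<Rightarrow> real"
  assumes S: "open S" and f: "Ck_on 2 S f" and h: "0 < h"
    and seg: "\<And>a b. 0 \<le> a \<Longrightarrow> a \<le> h \<Longrightarrow> 0 \<le> b \<Longrightarrow> b \<le> h \<Longrightarrow> p + a *\<^sub>R v + b *\<^sub>R w \<in> S"
  shows "\<exists>a b. 0 < a \<and> a < h \<and> 0 < b \<and> b < h \<and>
    f (p + h *\<^sub>R v + h *\<^sub>R w) - f (p + h *\<^sub>R v) - f (p + h *\<^sub>R w) + f p
      = h * h * dir_deriv w (dir_deriv v f) (p + a *\<^sub>R v + b *\<^sub>R w)"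
proof -
  have f1: "Ck_on 1 S f" using Ck_on_mono[OF _ f, of 1] by simp
  have f2: "Ck_on 1 S (dir_deriv v f)" using Ck_on_dir_deriv[OF S, of 1 f v] f by (simp add: numeral_2_eq_2)
  define g where "g = (\<lambda>a. f ((p + h *\<^sub>R w) + a *\<^sub>R v) - f (p + a *\<^sub>R v))"
  have "\<exists>a>0. a < h \<and> g h - g 0 =
      (h - 0) * (dir_deriv v f ((p + h *\<^sub>R w) + a *\<^sub>R v) - dir_deriv v f (p + a *\<^sub>R v))"
  proof (rule MVT2)
    show "(g has_real_derivative dir_deriv v f ((p + h *\<^sub>R w) + a *\<^sub>R v) - dir_deriv v f (p + a *\<^sub>R v)) (at a)"
      if "0 \<le> a" "a \<le> h" for a
      unfolding g_def using seg[of a h] seg[of a 0] that h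
      by (intro derivative_intros has_real_derivative_along_line[OF S _ f1]) (auto simp: algebra_simps)
  qed (use h in auto)
  then obtain a where a: "0 < a" "a < h" and ga: "g h - g 0 =
      h * (dir_deriv v f ((p + h *\<^sub>R w) + a *\<^sub>R v) - dir_deriv v f (p + a *\<^sub>R v))" by auto
  define k where "k = (\<lambda>b. dir_deriv v f ((p + a *\<^sub>R v) + b *\<^sub>R w))"
  have "\<exists>b>0. b < h \<and> k h - k 0 = (h - 0) * dir_deriv w (dir_deriv v f) ((p + a *\<^sub>R v) + b *\<^sub>R w)"
  proof (rule MVT2)
    show "(k has_real_derivative dir_deriv w (dir_deriv v f) ((p + a *\<^sub>R v) + b *\<^sub>R w)) (at b)"
      if "0 \<le> b" "b \<le> h" for b
      unfolding k_def using seg[of a b] a that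
      by (intro has_real_derivative_along_line[OF S _ f2]) (auto simp: algebra_simps)
  qed (use h in auto)
  then obtain b where b: "0 < b" "b < h" "k h - k 0 = h * dir_deriv w (dir_deriv v f) ((p + a *\<^sub>R v) + b *\<^sub>R w)"
    by auto
  have "g h - g 0 = h * (k h - k 0)" using ga by (simp add: k_def algebra_simps)
  then show ?thesis using a b by (intro exI[of _ a] exI[of _ b]) (simp add: g_def algebra_simps)
qed

lemma dir_deriv_commute:
  fixes f :: "'a::real_normed_vector \<Rightarrow> real"
  assumes S: "open S" and p: "p \<in> S" and f: "Ck_on 2 S f"
  shows "dir_deriv v (dir_deriv w f) p = dir_deriv w (dir_deriv v f) p"
proof (rule ccontr)
  define F where "F = dir_deriv v (dir_deriv w f)"
  define G where "G = dir_deriv w (dir_deriv v f)"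
  assume "dir_deriv v (dir_deriv w f) p \<noteq> dir_deriv w (dir_deriv v f) p"
  then have e: "0 < \<bar>F p - G p\<bar> / 2" by (simp add: F_def G_def)
  have C2: "Ck_on (Suc (Suc 0)) S f" using f by (simp only: numeral_2_eq_2)
  have "continuous_on S F" "continuous_on S G" unfolding F_def G_def
    using Ck_on_dir_deriv[OF S Ck_on_dir_deriv[OF S C2]] by (auto intro: Ck_on_imp_continuous)
  then have "isCont F p" "isCont G p" using S p by (auto simp: continuous_on_eq_continuous_at)
  then have contF: "\<forall>e>0. \<exists>d>0. \<forall>x. dist x p < d \<longrightarrow> dist (F x) (F p) < e"
      and contG: "\<forall>e>0. \<exists>d>0. \<forall>x. dist x p < d \<longrightarrow> dist (G x) (G p) < e"
    by (simp_all only: continuous_at_eps_delta)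
  obtain d1 where d1: "d1 > 0" "\<And>x. dist x p < d1 \<Longrightarrow> dist (F x) (F p) < \<bar>F p - G p\<bar> / 2"
    using contF[rule_format, OF e] by auto
  obtain d2 where d2: "d2 > 0" "\<And>x. dist x p < d2 \<Longrightarrow> dist (G x) (G p) < \<bar>F p - G p\<bar> / 2"
    using contG[rule_format, OF e] by auto
  obtain d3 where d3: "d3 > 0" "ball p d3 \<subseteq> S" using S p by (meson open_contains_ball)
  define d where "d = min d1 (min d2 d3)"
  have d0: "0 < d" using d1 d2 d3 by (simp add: d_def)
  define m where "m = norm v + norm w + 1"
  have m: "0 < m" unfolding m_def by (intro add_nonneg_pos) auto
  define h where "h = d / (2 * m)"
  have h: "0 < h" and hm: "h * m = d / 2" unfolding h_def using d0 m by auto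
  have near: "dist (p + a *\<^sub>R v + b *\<^sub>R w) p < d" if "0 \<le> a" "a \<le> h" "0 \<le> b" "b \<le> h" for a b
  proof -
    have "dist (p + a *\<^sub>R v + b *\<^sub>R w) p = norm (a *\<^sub>R v + b *\<^sub>R w)" by (simp add: dist_norm)
    also have "\<dots> \<le> a * norm v + b * norm w" using norm_triangle_ineq[of "a *\<^sub>R v" "b *\<^sub>R w"] that by simp
    also have "\<dots> \<le> h * norm v + h * norm w" using that by (intro add_mono mult_right_mono) auto
    also have "\<dots> \<le> h * m" using h by (simp add: m_def algebra_simps)
    finally show ?thesis using d0 hm by simp
  qed
  have seg: "p + a *\<^sub>R v + b *\<^sub>R w \<in> S" if "0 \<le> a" "a \<le> h" "0 \<le> b" "b \<le> h" for a b
    using near[OF that] d3 by (auto simp: d_def dist_commute subset_iff)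
  have seg': "p + b *\<^sub>R w + a *\<^sub>R v \<in> S" if "0 \<le> b" "b \<le> h" "0 \<le> a" "a \<le> h" for a b
    using seg[OF that(3,4,1,2)] by (simp add: algebra_simps)
  obtain a b where ab: "0 < a" "a < h" "0 < b" "b < h"
    "f (p + h *\<^sub>R v + h *\<^sub>R w) - f (p + h *\<^sub>R v) - f (p + h *\<^sub>R w) + f p = h * h * G (p + a *\<^sub>R v + b *\<^sub>R w)"
    using second_difference[OF S f h seg] unfolding G_def by auto
  obtain a' b' where ab': "0 < a'" "a' < h" "0 < b'" "b' < h"
    "f (p + h *\<^sub>R w + h *\<^sub>R v) - f (p + h *\<^sub>R w) - f (p + h *\<^sub>R v) + f p = h * h * F (p + a' *\<^sub>R w + b' *\<^sub>R v)"
    using second_difference[OF S f h seg'] unfolding F_def by auto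
  have c: "p + h *\<^sub>R w + h *\<^sub>R v = p + h *\<^sub>R v + h *\<^sub>R w" "p + a' *\<^sub>R w + b' *\<^sub>R v = p + b' *\<^sub>R v + a' *\<^sub>R w"
    by (simp_all add: algebra_simps)
  have "h * h * F (p + b' *\<^sub>R v + a' *\<^sub>R w) = h * h * G (p + a *\<^sub>R v + b *\<^sub>R w)"
    using ab(5) ab'(5)[unfolded c] by linarith
  then have "F (p + b' *\<^sub>R v + a' *\<^sub>R w) = G (p + a *\<^sub>R v + b *\<^sub>R w)" using h by simp
  moreover have "dist (F (p + b' *\<^sub>R v + a' *\<^sub>R w)) (F p) < \<bar>F p - G p\<bar> / 2"
    using d1(2) near[of b' a'] ab' by (simp add: d_def)
  moreover have "dist (G (p + a *\<^sub>R v + b *\<^sub>R w)) (G p) < \<bar>F p - G p\<bar> / 2"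
    using d2(2) near[of a b] ab by (simp add: d_def)
  ultimately show False by (simp add: dist_real_def abs_if split: if_splits)
qed

section \<open>Quadratic forms\<close>

text \<open>Otherwise the form would be linear and not constant along a line in the plane of the coordinates \<open>k\<close> and \<open>l\<close>.\<close>

lemma psd_zero_diagonal:
  fixes a :: "'m::finite \<Rightarrow> 'm \<Rightarrow> real"
  assumes sym: "\<And>i j. a i j = a j i" and psd: "\<And>x. 0 \<le> (\<Sum>i\<in>UNIV. \<Sum>j\<in>UNIV. a i j * x i * x j)"
    and zero: "a k k = 0"
  shows "a k l = 0"
proof (cases "l = k")
  case False
  have *: "0 \<le> 2 * r * a k l + a l l" for r
  proof -
    define x where "x = (\<lambda>i. (if i = k then r else 0) + (if i = l then 1 else 0))"
    have inner: "(\<Sum>j\<in>UNIV. a i j * x i * x j) = x i * (r * a i k + a i l)" for i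
    proof -
      have "(\<Sum>j\<in>UNIV. a i j * x i * x j)
          = (\<Sum>j\<in>UNIV. (if j = k then a i j * x i * r else 0) + (if j = l then a i j * x i else 0))"
        by (rule sum.cong) (auto simp: x_def distrib_left)
      then show ?thesis by (simp add: sum.distrib algebra_simps)
    qed
    have "(\<Sum>i\<in>UNIV. \<Sum>j\<in>UNIV. a i j * x i * x j) = (\<Sum>i\<in>UNIV. x i * (r * a i k + a i l))"
      by (simp add: inner)
    also have "\<dots> = (\<Sum>i\<in>UNIV. (if i = k then r * (r * a i k + a i l) else 0)
        + (if i = l then r * a i k + a i l else 0))"
      by (rule sum.cong) (auto simp: x_def distrib_right)
    also have "\<dots> = r * (r * a k k + a k l) + (r * a l k + a l l)" by (simp add: sum.distrib)
    finally show ?thesis using psd[of x] sym[of l k] by (simp add: zero algebra_simps)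
  qed
  show ?thesis
  proof (rule ccontr)
    assume "a k l \<noteq> 0"
    then have "2 * (- (a l l + 1) / (2 * a k l)) * a k l = - (a l l + 1)" by simp
    then show False using *[of "- (a l l + 1) / (2 * a k l)"] by linarith
  qed
qed (use zero in simp)

text \<open>Gram decomposition by completing squares: a coordinate with \<open>a k k > 0\<close> is split off, and the form that remains
  (the Schur complement) is again nonnegative, as one sees by minimising the original form over that coordinate.\<close>

lemma psd_gram_supported:
  fixes a :: "'m::finite \<Rightarrow> 'm \<Rightarrow> real"
  assumes "finite F" "\<And>i j. a i j = a j i" "\<And>x. 0 \<le> (\<Sum>i\<in>UNIV. \<Sum>j\<in>UNIV. a i j * x i * x j)"
    and "\<And>i j. i \<notin> F \<Longrightarrow> a i j = 0"
  shows "\<exists>P :: 'm \<Rightarrow> 'm \<Rightarrow> real. \<forall>i j. a i j = (\<Sum>k\<in>F. P k i * P k j)"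
  using assms
proof (induction F arbitrary: a rule: finite_induct)
  case empty
  then show ?case by simp
next
  case (insert k F)
  note sym = insert.prems(1) and psd = insert.prems(2) and supp = insert.prems(3)
  show ?case
  proof (cases "a k k = 0")
    case True
    have "\<exists>P. \<forall>i j. a i j = (\<Sum>k\<in>F. P k i * P k j)"
    proof (rule insert.IH[OF sym psd])
      show "a i j = 0" if "i \<notin> F" for i j
        using supp[of i j] psd_zero_diagonal[OF sym psd True, of j] that by (cases "i = k") auto
    qed
    then obtain P where P: "\<And>i j. a i j = (\<Sum>k\<in>F. P k i * P k j)" by blast
    define Q where "Q = P(k := \<lambda>i. 0)"
    have "(\<Sum>l\<in>F. Q l i * Q l j) = (\<Sum>l\<in>F. P l i * P l j)" for i j
      by (rule sum.cong) (use insert.hyps in \<open>auto simp: Q_def\<close>)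
    then show ?thesis using P insert.hyps by (intro exI[of _ Q]) (simp add: Q_def)
  next
    case False
    define d where "d = a k k"
    have "0 \<le> (\<Sum>i\<in>UNIV. \<Sum>j\<in>UNIV. a i j * (if i = k then 1 else 0) * (if j = k then 1 else 0))"
      by (rule psd)
    also have "\<dots> = a k k"
    proof -
      have "(\<Sum>j\<in>UNIV. a i j * (if i = k then 1 else 0) * (if j = k then 1 else 0)) = (if i = k then a k k else 0)" for i
      proof -
        have "(\<Sum>j\<in>UNIV. a i j * (if i = k then 1 else 0) * (if j = k then 1 else 0))
            = (\<Sum>j\<in>UNIV. if j = k then a i k * (if i = k then 1 else 0) else 0)"
          by (rule sum.cong) auto
        then show ?thesis by simp
      qed
      then show ?thesis by simp
    qed
    finally have d: "0 < d" using False by (simp add: d_def)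
    define b where "b = (\<lambda>i j. a i j - a i k * a j k / d)"
    have "\<exists>P. \<forall>i j. b i j = (\<Sum>k\<in>F. P k i * P k j)"
    proof (rule insert.IH)
      show "b i j = b j i" for i j using sym[of i j] by (simp add: b_def mult.commute)
      show "b i j = 0" if "i \<notin> F" for i j
        using supp[of i] sym[of k j] that d by (cases "i = k") (auto simp: b_def d_def)
      fix x :: "'m \<Rightarrow> real"
      define r where "r = (\<Sum>j\<in>UNIV. a j k * x j)"
      define y where "y = (\<lambda>i. x i - (if i = k then r / d else 0))"
      have "(\<Sum>j\<in>UNIV. a i j * y i * y j) = y i * ((\<Sum>j\<in>UNIV. a i j * x j) - a i k * r / d)" for i
      proof -
        have "(\<Sum>j\<in>UNIV. a i j * y i * y j)
            = (\<Sum>j\<in>UNIV. y i * (a i j * x j) - (if j = k then y i * (a i k * r / d) else 0))"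
          by (rule sum.cong) (auto simp: y_def algebra_simps)
        also have "\<dots> = y i * (\<Sum>j\<in>UNIV. a i j * x j) - y i * (a i k * r / d)"
          by (simp add: sum_subtractf sum_distrib_left)
        finally show ?thesis by (simp only: right_diff_distrib)
      qed
      then have "(\<Sum>i\<in>UNIV. \<Sum>j\<in>UNIV. a i j * y i * y j)
          = (\<Sum>i\<in>UNIV. y i * ((\<Sum>j\<in>UNIV. a i j * x j) - a i k * r / d))" by simp
      also have "\<dots> = (\<Sum>i\<in>UNIV. x i * (\<Sum>j\<in>UNIV. a i j * x j) - (a i k * x i) * (r / d)
          - (if i = k then r / d * ((\<Sum>j\<in>UNIV. a k j * x j) - a k k * r / d) else 0))"
        by (rule sum.cong) (auto simp: y_def algebra_simps)
      also have "\<dots> = (\<Sum>i\<in>UNIV. x i * (\<Sum>j\<in>UNIV. a i j * x j)) - r * (r / d)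
          - r / d * ((\<Sum>j\<in>UNIV. a k j * x j) - a k k * r / d)"
      proof -
        have "(\<Sum>i\<in>UNIV. (a i k * x i) * (r / d)) = r * (r / d)"
          by (simp only: sum_distrib_right[symmetric] r_def)
        then show ?thesis by (simp only: sum_subtractf) simp
      qed
      also have "(\<Sum>j\<in>UNIV. a k j * x j) = r" unfolding r_def using sym[of k] by simp
      also have "a k k * r / d = r" using d by (simp add: d_def)
      also have "(\<Sum>i\<in>UNIV. x i * (\<Sum>j\<in>UNIV. a i j * x j)) - r * (r / d) - r / d * (r - r)
          = (\<Sum>i\<in>UNIV. \<Sum>j\<in>UNIV. b i j * x i * x j)"
      proof -
        have "(\<Sum>i\<in>UNIV. \<Sum>j\<in>UNIV. b i j * x i * x j)
            = (\<Sum>i\<in>UNIV. \<Sum>j\<in>UNIV. x i * (a i j * x j)) - (\<Sum>i\<in>UNIV. \<Sum>j\<in>UNIV. (a i k * x i) * (a j k * x j)) / d"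
          by (simp add: b_def sum_subtractf[symmetric] sum_divide_distrib algebra_simps)
        also have "(\<Sum>i\<in>UNIV. \<Sum>j\<in>UNIV. (a i k * x i) * (a j k * x j)) = r * r"
          by (simp add: r_def sum_product)
        finally show ?thesis by (simp add: sum_distrib_left)
      qed
      finally show "0 \<le> (\<Sum>i\<in>UNIV. \<Sum>j\<in>UNIV. b i j * x i * x j)" using psd[of y] by simp
    qed
    then obtain P where P: "\<And>i j. b i j = (\<Sum>k\<in>F. P k i * P k j)" by blast
    define Q where "Q = P(k := \<lambda>i. a i k / sqrt d)"
    have "(\<Sum>l\<in>F. Q l i * Q l j) = (\<Sum>l\<in>F. P l i * P l j)" for i j
      by (rule sum.cong) (use insert.hyps in \<open>auto simp: Q_def\<close>)
    then have "(\<Sum>l\<in>insert k F. Q l i * Q l j) = a i k / sqrt d * (a j k / sqrt d) + b i j" for i j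
      using insert.hyps by (simp add: P) (simp add: Q_def)
    also have "a i k / sqrt d * (a j k / sqrt d) + b i j = a i j" for i j
      using d by (simp add: b_def)
    finally have "\<forall>i j. a i j = (\<Sum>l\<in>insert k F. Q l i * Q l j)" by simp
    then show ?thesis by (rule exI[where x = Q])
  qed
qed

lemma psd_gram:
  fixes a :: "'m::finite \<Rightarrow> 'm \<Rightarrow> real"
  assumes "\<And>i j. a i j = a j i" "\<And>x. 0 \<le> (\<Sum>i\<in>UNIV. \<Sum>j\<in>UNIV. a i j * x i * x j)"
  shows "\<exists>P :: 'm \<Rightarrow> 'm \<Rightarrow> real. \<forall>i j. a i j = (\<Sum>k\<in>UNIV. P k i * P k j)"
  by (rule psd_gram_supported[of UNIV a, OF finite assms]) simp

lemma gram_contraction: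
  fixes a :: "'m::finite \<Rightarrow> 'm \<Rightarrow> real"
  assumes "\<And>i j. a i j = (\<Sum>k\<in>UNIV. P k i * P k j)"
  shows "(\<Sum>i\<in>UNIV. \<Sum>j\<in>UNIV. a i j * B i j) = (\<Sum>k\<in>UNIV. \<Sum>i\<in>UNIV. \<Sum>j\<in>UNIV. P k i * P k j * B i j)"
proof -
  have "(\<Sum>i\<in>UNIV. \<Sum>j\<in>UNIV. a i j * B i j) = (\<Sum>i\<in>UNIV. \<Sum>j\<in>UNIV. \<Sum>k\<in>UNIV. P k i * P k j * B i j)"
    by (simp add: assms sum_distrib_right)
  also have "\<dots> = (\<Sum>i\<in>UNIV. \<Sum>k\<in>UNIV. \<Sum>j\<in>UNIV. P k i * P k j * B i j)"
    by (intro sum.cong refl sum.swap)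
  also have "\<dots> = (\<Sum>k\<in>UNIV. \<Sum>i\<in>UNIV. \<Sum>j\<in>UNIV. P k i * P k j * B i j)" by (rule sum.swap)
  finally show ?thesis .
qed

lemma gram_quadratic:
  fixes a :: "'m::finite \<Rightarrow> 'm \<Rightarrow> real"
  assumes "\<And>i j. a i j = (\<Sum>k\<in>UNIV. P k i * P k j)"
  shows "(\<Sum>i\<in>UNIV. \<Sum>j\<in>UNIV. a i j * x i * y j) = (\<Sum>k\<in>UNIV. (\<Sum>i\<in>UNIV. P k i * x i) * (\<Sum>j\<in>UNIV. P k j * y j))"
proof -
  have "(\<Sum>i\<in>UNIV. \<Sum>j\<in>UNIV. a i j * x i * y j) = (\<Sum>i\<in>UNIV. \<Sum>j\<in>UNIV. a i j * (x i * y j))"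
    by (simp add: mult.assoc)
  also have "\<dots> = (\<Sum>k\<in>UNIV. \<Sum>i\<in>UNIV. \<Sum>j\<in>UNIV. P k i * P k j * (x i * y j))"
    by (rule gram_contraction[OF assms])
  also have "\<dots> = (\<Sum>k\<in>UNIV. (\<Sum>i\<in>UNIV. P k i * x i) * (\<Sum>j\<in>UNIV. P k j * y j))"
    by (simp add: sum_product ac_simps)
  finally show ?thesis .
qed

text \<open>Ellipticity is used twice, once in each pair of indices; after the first step the Gram vectors of \<open>a\<close> reduce the
  second one to the form itself.\<close>

lemma tensor_norm_lower_bound:
  fixes a :: "'m::finite \<Rightarrow> 'm \<Rightarrow> real" and N :: "'m \<Rightarrow> 'm \<Rightarrow> real"
  assumes sym: "\<And>i j. a i j = a j i" and lam: "0 \<le> lam"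
    and ell: "\<And>x. lam * (\<Sum>i\<in>UNIV. (x i)\<^sup>2) \<le> (\<Sum>i\<in>UNIV. \<Sum>j\<in>UNIV. a i j * x i * x j)"
  shows "lam\<^sup>2 * (\<Sum>k\<in>UNIV. \<Sum>i\<in>UNIV. (N k i)\<^sup>2)
    \<le> (\<Sum>k\<in>UNIV. \<Sum>l\<in>UNIV. \<Sum>i\<in>UNIV. \<Sum>j\<in>UNIV. a k l * a i j * N k i * N l j)"
proof -
  have "0 \<le> lam * (\<Sum>i\<in>UNIV. (x i)\<^sup>2)" for x :: "'m \<Rightarrow> real" using lam by (simp add: sum_nonneg)
  then have psd: "0 \<le> (\<Sum>i\<in>UNIV. \<Sum>j\<in>UNIV. a i j * x i * x j)" for x using ell[of x] order_trans by blast
  obtain P :: "'m \<Rightarrow> 'm \<Rightarrow> real" where P': "\<forall>i j. a i j = (\<Sum>k\<in>UNIV. P k i * P k j)"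
    using psd_gram[of a, OF sym psd] by (elim exE)
  have P: "a i j = (\<Sum>k\<in>UNIV. P k i * P k j)" for i j by (rule P'[rule_format])
  define y where "y = (\<lambda>g k. \<Sum>i\<in>UNIV. P g i * N k i)"
  have sq: "(\<Sum>i\<in>UNIV. \<Sum>j\<in>UNIV. a i j * N k i * N l j) = (\<Sum>g\<in>UNIV. y g k * y g l)" for k l
    unfolding y_def by (rule gram_quadratic[OF P])
  have "lam\<^sup>2 * (\<Sum>k\<in>UNIV. \<Sum>i\<in>UNIV. (N k i)\<^sup>2) = lam * (\<Sum>k\<in>UNIV. lam * (\<Sum>i\<in>UNIV. (N k i)\<^sup>2))"
    by (simp add: power2_eq_square sum_distrib_left mult.assoc)
  also have "\<dots> \<le> lam * (\<Sum>k\<in>UNIV. \<Sum>i\<in>UNIV. \<Sum>j\<in>UNIV. a i j * N k i * N k j)"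
    by (intro mult_left_mono sum_mono ell lam)
  also have "\<dots> = lam * (\<Sum>k\<in>UNIV. \<Sum>g\<in>UNIV. y g k * y g k)" by (simp add: sq)
  also have "\<dots> = lam * (\<Sum>g\<in>UNIV. \<Sum>k\<in>UNIV. y g k * y g k)"
    by (rule arg_cong[where f = "(*) lam"], rule sum.swap)
  also have "\<dots> = (\<Sum>g\<in>UNIV. lam * (\<Sum>k\<in>UNIV. (y g k)\<^sup>2))" by (simp add: sum_distrib_left power2_eq_square)
  also have "\<dots> \<le> (\<Sum>g\<in>UNIV. \<Sum>k\<in>UNIV. \<Sum>l\<in>UNIV. a k l * y g k * y g l)"
    by (intro sum_mono ell)
  also have "\<dots> = (\<Sum>k\<in>UNIV. \<Sum>l\<in>UNIV. \<Sum>g\<in>UNIV. a k l * (y g k * y g l))"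
  proof -
    have "(\<Sum>g\<in>UNIV. \<Sum>k\<in>UNIV. \<Sum>l\<in>UNIV. a k l * y g k * y g l)
        = (\<Sum>k\<in>UNIV. \<Sum>g\<in>UNIV. \<Sum>l\<in>UNIV. a k l * y g k * y g l)" by (rule sum.swap)
    also have "\<dots> = (\<Sum>k\<in>UNIV. \<Sum>l\<in>UNIV. \<Sum>g\<in>UNIV. a k l * y g k * y g l)"
      by (intro sum.cong refl sum.swap)
    finally show ?thesis by (simp add: mult.assoc)
  qed
  also have "\<dots> = (\<Sum>k\<in>UNIV. \<Sum>l\<in>UNIV. a k l * (\<Sum>i\<in>UNIV. \<Sum>j\<in>UNIV. a i j * N k i * N l j))"
    by (simp add: sq sum_distrib_left)
  also have "\<dots> = (\<Sum>k\<in>UNIV. \<Sum>l\<in>UNIV. \<Sum>i\<in>UNIV. \<Sum>j\<in>UNIV. a k l * a i j * N k i * N l j)"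
    by (simp add: sum_distrib_left mult.assoc)
  finally show ?thesis .
qed

text \<open>The hypothesis on \<open>H\<close>, \<open>h\<close>, \<open>\<tau>\<close> says that a space-time Hessian is nonpositive. With Gram vectors \<open>P k\<close> of \<open>a\<close>, it
  is evaluated at \<open>(P k, - y k / S)\<close> where \<open>y k = \<langle>P k, w\<rangle>\<close>, and the results are added. The coefficient of \<open>\<tau>\<close> that
  arises is \<open>a(w, w) / S \<le> B\<close>, and \<open>\<tau> \<le> 0\<close>.\<close>

lemma mixed_hessian_nonpos:
  fixes a :: "'m::finite \<Rightarrow> 'm \<Rightarrow> real"
  assumes sym: "\<And>i j. a i j = a j i" and psd: "\<And>x. 0 \<le> (\<Sum>i\<in>UNIV. \<Sum>j\<in>UNIV. a i j * x i * x j)"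
    and hess: "\<And>x r. (\<Sum>i\<in>UNIV. \<Sum>j\<in>UNIV. H i j * x i * x j) + 2 * r * (\<Sum>i\<in>UNIV. h i * x i) + r\<^sup>2 * \<tau> \<le> 0"
    and S: "0 < S" and w: "(\<Sum>i\<in>UNIV. \<Sum>j\<in>UNIV. a i j * w i * w j) \<le> S * B"
  shows "B * \<tau> + S * (\<Sum>i\<in>UNIV. \<Sum>j\<in>UNIV. a i j * H i j) - 2 * (\<Sum>i\<in>UNIV. \<Sum>j\<in>UNIV. a i j * w i * h j) \<le> 0"
proof -
  obtain P :: "'m \<Rightarrow> 'm \<Rightarrow> real" where P': "\<forall>i j. a i j = (\<Sum>k\<in>UNIV. P k i * P k j)"
    using psd_gram[of a, OF sym psd] by (elim exE)
  have P: "a i j = (\<Sum>k\<in>UNIV. P k i * P k j)" for i j by (rule P'[rule_format])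
  define y where "y = (\<lambda>k. \<Sum>i\<in>UNIV. P k i * w i)"
  define z where "z = (\<lambda>k. \<Sum>j\<in>UNIV. P k j * h j)"
  define Q where "Q = (\<lambda>k. \<Sum>i\<in>UNIV. \<Sum>j\<in>UNIV. H i j * P k i * P k j)"
  have "(\<Sum>i\<in>UNIV. \<Sum>j\<in>UNIV. a i j * H i j) = (\<Sum>k\<in>UNIV. Q k)"
    unfolding gram_contraction[OF P] Q_def by (simp add: ac_simps)
  moreover have "(\<Sum>i\<in>UNIV. \<Sum>j\<in>UNIV. a i j * w i * h j) = (\<Sum>k\<in>UNIV. y k * z k)"
    unfolding gram_quadratic[OF P] y_def z_def ..
  moreover have yy: "(\<Sum>k\<in>UNIV. y k * y k) \<le> S * B" using w unfolding gram_quadratic[OF P] y_def .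
  moreover have "S * Q k - 2 * (y k * z k) + (y k)\<^sup>2 / S * \<tau> \<le> 0" for k
  proof -
    have "Q k + 2 * (- y k / S) * z k + (- y k / S)\<^sup>2 * \<tau> \<le> 0"
      using hess[of "P k" "- y k / S"] unfolding Q_def z_def by (simp add: mult.commute)
    then have "S * (Q k + 2 * (- y k / S) * z k + (- y k / S)\<^sup>2 * \<tau>) \<le> 0"
      using S by (simp add: mult_nonneg_nonpos)
    moreover have "S * (Q k + 2 * (- y k / S) * z k + (- y k / S)\<^sup>2 * \<tau>) = S * Q k - 2 * (y k * z k) + (y k)\<^sup>2 / S * \<tau>"
      using S by (simp add: field_simps power2_eq_square)
    ultimately show ?thesis by simp
  qed
  then have "(\<Sum>k\<in>UNIV. S * Q k - 2 * (y k * z k) + (y k)\<^sup>2 / S * \<tau>) \<le> 0" by (intro sum_nonpos)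
  then have "S * (\<Sum>k\<in>UNIV. Q k) - 2 * (\<Sum>k\<in>UNIV. y k * z k) + (\<Sum>k\<in>UNIV. y k * y k) / S * \<tau> \<le> 0"
    by (simp add: sum.distrib sum_subtractf sum_distrib_left sum_distrib_right sum_divide_distrib power2_eq_square)
  moreover have "B * \<tau> \<le> (\<Sum>k\<in>UNIV. y k * y k) / S * \<tau>"
  proof -
    have "\<tau> \<le> 0" using hess[of "\<lambda>i. 0" 1] by simp
    moreover have "(\<Sum>k\<in>UNIV. y k * y k) / S \<le> B" using yy S by (simp add: field_simps)
    ultimately show ?thesis by (rule mult_right_mono_neg[rotated])
  qed
  ultimately show ?thesis by simp
qed

section \<open>Second order operators without first order terms\<close>

text \<open>The vectors \<open>e i\<close> may span a proper subspace: on a cylinder they span only the space directions, and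
  time is a further direction in which the coefficients are constant.\<close>

definition loc_grad :: "('m::finite \<Rightarrow> 'e::real_normed_vector) \<Rightarrow> ('m \<Rightarrow> 'm \<Rightarrow> 'e \<Rightarrow> real) \<Rightarrow>
    ('e \<Rightarrow> real) \<Rightarrow> ('e \<Rightarrow> real) \<Rightarrow> 'e \<Rightarrow> real" where
  "loc_grad e a f h p = (\<Sum>i\<in>UNIV. \<Sum>j\<in>UNIV. a i j p * dir_deriv (e i) f p * dir_deriv (e j) h p)"

definition loc_lap :: "('m::finite \<Rightarrow> 'e::real_normed_vector) \<Rightarrow> ('m \<Rightarrow> 'm \<Rightarrow> 'e \<Rightarrow> real) \<Rightarrow>
    ('e \<Rightarrow> real) \<Rightarrow> 'e \<Rightarrow> real" where
  "loc_lap e a f p = (\<Sum>i\<in>UNIV. \<Sum>j\<in>UNIV. a i j p * dir_deriv (e i) (dir_deriv (e j) f) p)"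

locale local_operator =
  fixes S :: "'e::real_normed_vector set" and e :: "'m::finite \<Rightarrow> 'e" and a :: "'m \<Rightarrow> 'm \<Rightarrow> 'e \<Rightarrow> real"
  assumes open_S: "open S"
    and a_sym: "p \<in> S \<Longrightarrow> a i j p = a j i p"
    and Ck_a: "Ck_on k S (a i j)"
    and a_psd: "p \<in> S \<Longrightarrow> 0 \<le> (\<Sum>i\<in>UNIV. \<Sum>j\<in>UNIV. a i j p * x i * x j)"
begin

abbreviation D where "D i f \<equiv> dir_deriv (e i) f"

lemma Ck_D: "Ck_on (Suc k) S f \<Longrightarrow> Ck_on k S (D i f)"
  by (rule Ck_on_dir_deriv[OF open_S])

lemma Ck_D2: "Ck_on 2 S f \<Longrightarrow> Ck_on 1 S (D i f)"
  using Ck_D[of 1 f i] by (simp add: numeral_2_eq_2)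

lemma Ck_21: "Ck_on 2 S f \<Longrightarrow> Ck_on 1 S f"
  using Ck_on_mono[of 1 2 S f] by simp

lemma Ck_loc_grad: "Ck_on (Suc k) S f \<Longrightarrow> Ck_on (Suc k) S h \<Longrightarrow> Ck_on k S (loc_grad e a f h)"
  unfolding loc_grad_def by (intro Ck_on_sum Ck_on_mult Ck_a Ck_D finite)

lemma Ck_loc_lap: "Ck_on (Suc (Suc k)) S f \<Longrightarrow> Ck_on k S (loc_lap e a f)"
  unfolding loc_lap_def by (intro Ck_on_sum Ck_on_mult Ck_a Ck_D finite)

lemma loc_grad_sym: "p \<in> S \<Longrightarrow> loc_grad e a f h p = loc_grad e a h f p"
  unfolding loc_grad_def by (subst sum.swap) (simp add: a_sym ac_simps)

lemma loc_grad_nonneg: "p \<in> S \<Longrightarrow> 0 \<le> loc_grad e a f f p"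
  unfolding loc_grad_def by (rule a_psd)

lemma loc_lap_const: "loc_lap e a (\<lambda>x. r) p = 0"
proof -
  have "D j (\<lambda>x. r) = (\<lambda>x. 0)" for j by (simp add: fun_eq_iff dir_deriv_const)
  then show ?thesis by (simp add: loc_lap_def dir_deriv_const)
qed

lemma loc_grad_add:
  "p \<in> S \<Longrightarrow> Ck_on 1 S f \<Longrightarrow> Ck_on 1 S h \<Longrightarrow>
    loc_grad e a (\<lambda>x. f x + h x) w p = loc_grad e a f w p + loc_grad e a h w p"
  by (simp add: loc_grad_def dir_deriv_add[OF open_S] sum.distrib[symmetric] algebra_simps)

lemma loc_grad_mult:
  "p \<in> S \<Longrightarrow> Ck_on 1 S f \<Longrightarrow> Ck_on 1 S h \<Longrightarrow>
    loc_grad e a (\<lambda>x. f x * h x) w p = f p * loc_grad e a h w p + h p * loc_grad e a f w p"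
  by (simp add: loc_grad_def dir_deriv_mult[OF open_S] sum.distrib[symmetric] sum_distrib_left algebra_simps)

lemma loc_grad_compose:
  "p \<in> S \<Longrightarrow> Ck_on 1 S f \<Longrightarrow> (q has_real_derivative d) (at (f p)) \<Longrightarrow>
    loc_grad e a (\<lambda>x. q (f x)) w p = d * loc_grad e a f w p"
  by (simp add: loc_grad_def dir_deriv_compose[OF open_S] sum_distrib_left ac_simps)

lemma D_D_add:
  fixes f h :: "'e \<Rightarrow> real"
  assumes p: "p \<in> S" and f: "Ck_on 2 S f" and h: "Ck_on 2 S h"
  shows "dir_deriv v (dir_deriv w (\<lambda>x. f x + h x)) p = dir_deriv v (dir_deriv w f) p + dir_deriv v (dir_deriv w h) p"
proof -
  note f1 = Ck_21[OF f] and h1 = Ck_21[OF h]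
  have C: "Ck_on 1 S (dir_deriv w f)" "Ck_on 1 S (dir_deriv w h)"
    using Ck_on_dir_deriv[OF open_S, of 1 _ w] f h by (simp_all add: numeral_2_eq_2)
  have "dir_deriv v (dir_deriv w (\<lambda>x. f x + h x)) p = dir_deriv v (\<lambda>x. dir_deriv w f x + dir_deriv w h x) p"
    by (rule dir_deriv_cong[OF open_S p Ck_on_add[OF C]]) (rule dir_deriv_add[OF open_S _ f1 h1])
  also have "\<dots> = dir_deriv v (dir_deriv w f) p + dir_deriv v (dir_deriv w h) p"
    by (rule dir_deriv_add[OF open_S p C])
  finally show ?thesis .
qed

lemma D_D_mult:
  fixes f h :: "'e \<Rightarrow> real"
  assumes p: "p \<in> S" and f: "Ck_on 2 S f" and h: "Ck_on 2 S h"
  shows "dir_deriv v (dir_deriv w (\<lambda>x. f x * h x)) p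
    = f p * dir_deriv v (dir_deriv w h) p + dir_deriv v f p * dir_deriv w h p
      + (h p * dir_deriv v (dir_deriv w f) p + dir_deriv v h p * dir_deriv w f p)"
proof -
  note f1 = Ck_21[OF f] and h1 = Ck_21[OF h]
  have C: "Ck_on 1 S (dir_deriv w f)" "Ck_on 1 S (dir_deriv w h)"
    using Ck_on_dir_deriv[OF open_S, of 1 _ w] f h by (simp_all add: numeral_2_eq_2)
  note M = Ck_on_mult[OF f1 C(2)] Ck_on_mult[OF h1 C(1)]
  have "dir_deriv v (dir_deriv w (\<lambda>x. f x * h x)) p
      = dir_deriv v (\<lambda>x. f x * dir_deriv w h x + h x * dir_deriv w f x) p"
    by (rule dir_deriv_cong[OF open_S p Ck_on_add[OF M]]) (rule dir_deriv_mult[OF open_S _ f1 h1])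
  also have "\<dots> = dir_deriv v (\<lambda>x. f x * dir_deriv w h x) p + dir_deriv v (\<lambda>x. h x * dir_deriv w f x) p"
    by (rule dir_deriv_add[OF open_S p M])
  finally show ?thesis
    unfolding dir_deriv_mult[OF open_S p f1 C(2)] dir_deriv_mult[OF open_S p h1 C(1)] by (simp add: mult.commute)
qed

lemma loc_lap_add:
  "p \<in> S \<Longrightarrow> Ck_on 2 S f \<Longrightarrow> Ck_on 2 S h \<Longrightarrow>
    loc_lap e a (\<lambda>x. f x + h x) p = loc_lap e a f p + loc_lap e a h p"
  by (simp add: loc_lap_def D_D_add sum.distrib[symmetric] algebra_simps)

lemma loc_lap_mult:
  assumes "p \<in> S" "Ck_on 2 S f" "Ck_on 2 S h"
  shows "loc_lap e a (\<lambda>x. f x * h x) p = f p * loc_lap e a h p + h p * loc_lap e a f p + 2 * loc_grad e a f h p"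
proof -
  have "loc_lap e a (\<lambda>x. f x * h x) p
      = f p * loc_lap e a h p + h p * loc_lap e a f p + (loc_grad e a f h p + loc_grad e a h f p)"
    by (simp add: loc_lap_def loc_grad_def D_D_mult[OF assms] sum.distrib[symmetric] sum_distrib_left algebra_simps)
  then show ?thesis using loc_grad_sym[OF assms(1), of h f] by simp
qed

lemma loc_lap_compose:
  assumes p: "p \<in> S" and f: "Ck_on 2 S f" and T: "open T" "\<And>x. x \<in> S \<Longrightarrow> f x \<in> T"
    and q: "\<And>y. y \<in> T \<Longrightarrow> (q has_real_derivative q' y) (at y)"
      "\<And>y. y \<in> T \<Longrightarrow> (q' has_real_derivative q'' y) (at y)"
  shows "loc_lap e a (\<lambda>x. q (f x)) p = q' (f p) * loc_lap e a f p + q'' (f p) * loc_grad e a f f p"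
proof -
  note f1 = Ck_21[OF f]
  have "dir_deriv v (dir_deriv w (\<lambda>x. q (f x))) p
      = q' (f p) * dir_deriv v (dir_deriv w f) p + q'' (f p) * dir_deriv v f p * dir_deriv w f p" for v w
  proof (rule dir_deriv_eq)
    have w: "Ck_on 1 S (dir_deriv w f)"
      using Ck_on_dir_deriv[OF open_S, of 1 f w] f by (simp add: numeral_2_eq_2)
    have "((\<lambda>x. q' (f x) * dir_deriv w f x) has_derivative
        (\<lambda>v. q' (f p) * dir_deriv v (dir_deriv w f) p + (dir_deriv v f p * q'' (f p)) * dir_deriv w f p)) (at p)"
      using has_dir_deriv[OF open_S, of 0 f p] has_dir_deriv[OF open_S, of 0 "dir_deriv w f" p] f1 w p q(2) T
      by (intro has_derivative_mult DERIV_compose_FDERIV) auto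
    moreover have "q' (f x) * dir_deriv w f x = dir_deriv w (\<lambda>x. q (f x)) x" if "x \<in> S" for x
      using dir_deriv_compose[OF open_S that f1 q(1)] T that by simp
    ultimately have "(dir_deriv w (\<lambda>x. q (f x)) has_derivative
        (\<lambda>v. q' (f p) * dir_deriv v (dir_deriv w f) p + (dir_deriv v f p * q'' (f p)) * dir_deriv w f p)) (at p)"
      by (rule has_derivative_transform_within_open[OF _ open_S p])
    then show "(dir_deriv w (\<lambda>x. q (f x)) has_derivative
        (\<lambda>v. q' (f p) * dir_deriv v (dir_deriv w f) p + q'' (f p) * dir_deriv v f p * dir_deriv w f p)) (at p)"
      by (simp add: ac_simps)
  qed
  then show ?thesis
    by (simp add: loc_lap_def loc_grad_def sum.distrib[symmetric] sum_distrib_left algebra_simps)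
qed

lemma dir_deriv_loc_grad:
  fixes f h :: "'e \<Rightarrow> real"
  assumes p: "p \<in> S" and f: "Ck_on 2 S f" and h: "Ck_on 2 S h"
  shows "dir_deriv v (loc_grad e a f h) p
    = (\<Sum>i\<in>UNIV. \<Sum>j\<in>UNIV. dir_deriv v (a i j) p * D i f p * D j h p)
      + (\<Sum>i\<in>UNIV. \<Sum>j\<in>UNIV. a i j p * dir_deriv v (D i f) p * D j h p)
      + (\<Sum>i\<in>UNIV. \<Sum>j\<in>UNIV. a i j p * D i f p * dir_deriv v (D j h) p)"
proof -
  have "loc_grad e a f h = (\<lambda>p. \<Sum>i\<in>UNIV. \<Sum>j\<in>UNIV. a i j p * D i f p * D j h p)"
    by (simp add: loc_grad_def fun_eq_iff)
  then show ?thesis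
    using Ck_D2[OF f] Ck_D2[OF h] Ck_a
    by (simp add: dir_deriv_sum[OF open_S p] Ck_on_sum Ck_on_mult dir_deriv_mult[OF open_S p]
        sum.distrib[symmetric] algebra_simps)
qed

lemma dir_deriv_loc_grad_parallel:
  assumes p: "p \<in> S" and f: "Ck_on 2 S f" and h: "Ck_on 2 S h"
    and par: "\<And>i j. dir_deriv v (a i j) p = 0"
  shows "dir_deriv v (loc_grad e a f h) p = loc_grad e a (dir_deriv v f) h p + loc_grad e a f (dir_deriv v h) p"
  unfolding dir_deriv_loc_grad[OF p f h] loc_grad_def
  by (simp add: par dir_deriv_commute[OF open_S p f] dir_deriv_commute[OF open_S p h])

lemma dir_deriv_loc_lap:
  assumes p: "p \<in> S" and f: "Ck_on 3 S f"
  shows "dir_deriv v (loc_lap e a f) p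
    = (\<Sum>i\<in>UNIV. \<Sum>j\<in>UNIV. dir_deriv v (a i j) p * D i (D j f) p)
      + (\<Sum>i\<in>UNIV. \<Sum>j\<in>UNIV. a i j p * dir_deriv v (D i (D j f)) p)"
proof -
  have C: "Ck_on 1 S (D i (D j f))" for i j
    using Ck_D[OF Ck_D, of 1 f] f by (simp add: numeral_3_eq_3)
  have "loc_lap e a f = (\<lambda>p. \<Sum>i\<in>UNIV. \<Sum>j\<in>UNIV. a i j p * D i (D j f) p)"
    by (simp add: loc_lap_def fun_eq_iff)
  then show ?thesis
    using C Ck_a
    by (simp add: dir_deriv_sum[OF open_S p] Ck_on_sum Ck_on_mult dir_deriv_mult[OF open_S p]
        sum.distrib[symmetric] algebra_simps)
qed

lemma dir_deriv_D_D:
  fixes f :: "'e \<Rightarrow> real"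
  assumes p: "p \<in> S" and f: "Ck_on 3 S f"
  shows "dir_deriv v (D i (D j f)) p = D i (D j (dir_deriv v f)) p"
proof -
  have C2: "Ck_on 2 S (dir_deriv w f)" for w
    using Ck_on_dir_deriv[OF open_S, of 2 f w] f by (simp add: numeral_3_eq_3 numeral_2_eq_2)
  have f2: "Ck_on 2 S f" using Ck_on_mono[of 2 3 S f] f by simp
  have "dir_deriv v (D i (D j f)) p = D i (dir_deriv v (D j f)) p"
    by (rule dir_deriv_commute[OF open_S p C2])
  also have "\<dots> = D i (D j (dir_deriv v f)) p"
    by (rule dir_deriv_cong[OF open_S p]) (use C2 Ck_D2 dir_deriv_commute[OF open_S _ f2] in auto)
  finally show ?thesis .
qed

lemma dir_deriv_loc_lap_parallel:
  assumes p: "p \<in> S" and f: "Ck_on 3 S f" and par: "\<And>i j. dir_deriv v (a i j) p = 0"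
  shows "dir_deriv v (loc_lap e a f) p = loc_lap e a (dir_deriv v f) p"
  unfolding dir_deriv_loc_lap[OF p f] loc_lap_def by (simp add: par dir_deriv_D_D[OF p f])

subsection \<open>Maxima\<close>

lemma dir_deriv_at_max:
  fixes f :: "'e \<Rightarrow> real"
  assumes p: "p \<in> S" and f: "Ck_on 2 S f" and max: "\<And>x. x \<in> S \<Longrightarrow> f x \<le> f p"
  shows "dir_deriv v f p = 0" "dir_deriv v (dir_deriv v f) p \<le> 0"
proof -
  note f1 = Ck_21[OF f]
  have w: "Ck_on 1 S (dir_deriv v f)"
    using Ck_on_dir_deriv[OF open_S, of 1 f v] f by (simp add: numeral_2_eq_2)
  define g where "g = (\<lambda>s. f (p + s *\<^sub>R v))"
  define g1 where "g1 = (\<lambda>s. dir_deriv v f (p + s *\<^sub>R v))"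
  define I where "I = (\<lambda>s. p + s *\<^sub>R v) -` S"
  have I: "open I" "0 \<in> I" unfolding I_def using p by (auto intro!: open_vimage open_S continuous_intros)
  then obtain d where d: "0 < d" "ball 0 d \<subseteq> I" by (meson open_contains_ball)
  have g: "(g has_real_derivative g1 s) (at s)" if "s \<in> I" for s
    unfolding g_def g1_def using has_real_derivative_along_line[OF open_S _ f1, of p s v] that by (simp add: I_def)
  have g1: "(g1 has_real_derivative dir_deriv v (dir_deriv v f) p) (at 0)"
    unfolding g1_def using has_real_derivative_along_line[OF open_S _ w, of p 0 v] p by simp
  have gmax: "g s \<le> g 0" if "s \<in> I" for s using max that by (simp add: g_def I_def)
  have "g1 0 = 0"
  proof (rule DERIV_local_max[OF g[OF I(2)] d(1)])
    show "\<forall>y. \<bar>0 - y\<bar> < d \<longrightarrow> g y \<le> g 0" using gmax d by (auto simp: subset_iff dist_real_def)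
  qed
  then show "dir_deriv v f p = 0" by (simp add: g1_def)
  show "dir_deriv v (dir_deriv v f) p \<le> 0"
  proof (rule ccontr)
    assume "\<not> dir_deriv v (dir_deriv v f) p \<le> 0"
    then obtain d' where d': "0 < d'" "\<And>h. 0 < h \<Longrightarrow> h < d' \<Longrightarrow> g1 0 < g1 (0 + h)"
      using DERIV_pos_inc_right[OF g1] by auto
    define r where "r = min d d' / 2"
    have r: "0 < r" "r < d" "r < d'" using d d' by (auto simp: r_def)
    have sub: "s \<in> I" if "0 \<le> s" "s \<le> r" for s using d(2) that r by (auto simp: subset_iff)
    have "g 0 < g r"
    proof (rule DERIV_pos_imp_increasing_open[OF r(1)])
      show "\<exists>y. (g has_real_derivative y) (at s) \<and> 0 < y" if "0 < s" "s < r" for s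
        using g[OF sub] d'(2)[of s] that r \<open>g1 0 = 0\<close> by (intro exI[of _ "g1 s"]) auto
      show "continuous_on {0..r} g"
        using g sub by (intro continuous_at_imp_continuous_on ballI DERIV_isCont[of _ "g1 _"]) auto
    qed
    then show False using gmax[OF sub[of r]] r by simp
  qed
qed

lemma loc_second_order_at_max:
  assumes p: "p \<in> S" and f: "Ck_on 2 S f" and max: "\<And>x. x \<in> S \<Longrightarrow> f x \<le> f p"
    and R: "0 < R" and w: "loc_grad e a w w p \<le> R * B"
  shows "B * dir_deriv v (dir_deriv v f) p + R * loc_lap e a f p - 2 * loc_grad e a w (dir_deriv v f) p \<le> 0"
  unfolding loc_lap_def loc_grad_def
proof (rule mixed_hessian_nonpos[OF a_sym[OF p] a_psd[OF p] _ R w[unfolded loc_grad_def]])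
  fix x :: "'m \<Rightarrow> real" and r :: real
  note f1 = Ck_21[OF f]
  have C1: "Ck_on 1 S (dir_deriv y f)" for y
    using Ck_on_dir_deriv[OF open_S, of 1 f y] f by (simp add: numeral_2_eq_2)
  define y where "y = (\<Sum>i\<in>UNIV. x i *\<^sub>R e i) + r *\<^sub>R v"
  have lin: "dir_deriv y h q = (\<Sum>i\<in>UNIV. x i * D i h q) + r * dir_deriv v h q"
    if "Ck_on 1 S h" "q \<in> S" for h :: "'e \<Rightarrow> real" and q
  proof -
    note L = dir_deriv_linear[OF open_S that(2,1)]
    show ?thesis unfolding y_def
      by (simp add: linear_add[OF L] linear_sum[OF L] linear_scale[OF L])
  qed
  have "dir_deriv y (dir_deriv y f) p = dir_deriv y (\<lambda>q. (\<Sum>i\<in>UNIV. x i * D i f q) + r * dir_deriv v f q) p"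
    by (rule dir_deriv_cong[OF open_S p]) (use lin[OF f1] C1 in \<open>auto intro!: Ck_on_add Ck_on_sum Ck_on_cmult\<close>)
  also have "\<dots> = (\<Sum>i\<in>UNIV. x i * dir_deriv y (D i f) p) + r * dir_deriv y (dir_deriv v f) p"
    using C1 by (simp add: dir_deriv_add[OF open_S p] dir_deriv_sum[OF open_S p] Ck_on_sum Ck_on_cmult
        dir_deriv_mult[OF open_S p] dir_deriv_const Ck_on_const)
  also have "\<dots> = (\<Sum>i\<in>UNIV. x i * ((\<Sum>j\<in>UNIV. x j * D j (D i f) p) + r * D i (dir_deriv v f) p))
      + r * ((\<Sum>i\<in>UNIV. x i * D i (dir_deriv v f) p) + r * dir_deriv v (dir_deriv v f) p)"
    by (simp only: lin[OF C1 p] dir_deriv_commute[OF open_S p f, of v "e _"])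
  also have "\<dots> = (\<Sum>i\<in>UNIV. \<Sum>j\<in>UNIV. D i (D j f) p * x i * x j)
      + 2 * r * (\<Sum>i\<in>UNIV. D i (dir_deriv v f) p * x i) + r\<^sup>2 * dir_deriv v (dir_deriv v f) p"
  proof -
    have "(\<Sum>i\<in>UNIV. x i * (\<Sum>j\<in>UNIV. x j * D j (D i f) p)) = (\<Sum>i\<in>UNIV. \<Sum>j\<in>UNIV. D i (D j f) p * x i * x j)"
      unfolding sum_distrib_left
      by (intro sum.cong refl) (simp add: dir_deriv_commute[OF open_S p f, of "e _" "e _"])
    moreover have "(\<Sum>i\<in>UNIV. x i * (r * D i (dir_deriv v f) p)) = r * (\<Sum>i\<in>UNIV. D i (dir_deriv v f) p * x i)"
      unfolding sum_distrib_left by (intro sum.cong refl) simp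
    moreover have "(\<Sum>i\<in>UNIV. x i * D i (dir_deriv v f) p) = (\<Sum>i\<in>UNIV. D i (dir_deriv v f) p * x i)"
      by (simp only: mult.commute)
    ultimately show ?thesis
      by (simp only: distrib_left sum.distrib) (simp add: power2_eq_square)
  qed
  finally show "(\<Sum>i\<in>UNIV. \<Sum>j\<in>UNIV. D i (D j f) p * x i * x j)
      + 2 * r * (\<Sum>i\<in>UNIV. D i (dir_deriv v f) p * x i) + r\<^sup>2 * dir_deriv v (dir_deriv v f) p \<le> 0"
    using dir_deriv_at_max(2)[OF p f max, of y] by simp
qed

end

section \<open>The Bochner inequality in coordinates\<close>

text \<open>Fourfold sums and their index permutations. The terms of the Bochner inequality are compared by bringing each
  of them to a normal form under these permutations and the symmetries of the coefficients.\<close>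

definition sum4 :: "('m::finite \<Rightarrow> 'm \<Rightarrow> 'm \<Rightarrow> 'm \<Rightarrow> real) \<Rightarrow> real" where
  "sum4 f = (\<Sum>k\<in>UNIV. \<Sum>l\<in>UNIV. \<Sum>i\<in>UNIV. \<Sum>j\<in>UNIV. f k l i j)"

lemma sum4_add: "sum4 (\<lambda>k l i j. f k l i j + h k l i j) = sum4 f + sum4 h"
  by (simp add: sum4_def sum.distrib)

lemma sum4_diff: "sum4 (\<lambda>k l i j. f k l i j - h k l i j) = sum4 f - sum4 h"
  by (simp add: sum4_def sum_subtractf)

lemma sum4_cmult: "sum4 (\<lambda>k l i j. c * f k l i j) = c * sum4 f"
  by (simp add: sum4_def sum_distrib_left)

lemma sum4_mono: "(\<And>k l i j. f k l i j \<le> h k l i j) \<Longrightarrow> sum4 f \<le> sum4 h"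
  by (simp add: sum4_def sum_mono)

lemma sum4_cong: "(\<And>k l i j. f k l i j = h k l i j) \<Longrightarrow> sum4 f = sum4 h"
  by (simp add: sum4_def)

lemma sum4_swap_kl: "sum4 f = sum4 (\<lambda>k l i j. f l k i j)"
  unfolding sum4_def by (rule sum.swap)

lemma sum4_swap_ij: "sum4 f = sum4 (\<lambda>k l i j. f k l j i)"
  unfolding sum4_def by (intro sum.cong refl sum.swap)

lemma sum4_swap_li: "sum4 f = sum4 (\<lambda>k l i j. f k i l j)"
  unfolding sum4_def by (intro sum.cong refl sum.swap)

lemma sum4_swap_pairs: "sum4 f = sum4 (\<lambda>k l i j. f i j k l)"
proof -
  have "sum4 f = sum4 (\<lambda>k l i j. f k i l j)" by (rule sum4_swap_li)
  also have "\<dots> = sum4 (\<lambda>k l i j. f l i k j)" by (rule sum4_swap_kl)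
  also have "\<dots> = sum4 (\<lambda>k l i j. f l j k i)" by (rule sum4_swap_ij)
  also have "\<dots> = sum4 (\<lambda>k l i j. f i j k l)" by (rule sum4_swap_li)
  finally show ?thesis .
qed

lemma sum4_li: "sum4 (\<lambda>k l i j. f l i :: real) = (real CARD('m::finite))\<^sup>2 * (\<Sum>l\<in>UNIV. \<Sum>i\<in>(UNIV::'m set). f l i)"
  by (simp add: sum4_def power2_eq_square sum_distrib_left mult.assoc)

lemma sum4_kl: "sum4 (\<lambda>k l i j. f k l :: real) = (real CARD('m::finite))\<^sup>2 * (\<Sum>l\<in>UNIV. \<Sum>i\<in>(UNIV::'m set). f l i)"
  by (simp add: sum4_def power2_eq_square sum_distrib_left mult.assoc)

lemma sum4_j: "sum4 (\<lambda>k l i j. f j :: real) = real CARD('m::finite) ^ 3 * (\<Sum>i\<in>(UNIV::'m set). f i)"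
  by (simp add: sum4_def power3_eq_cube mult.assoc)

lemma sum4_i: "sum4 (\<lambda>k l i j. f i :: real) = real CARD('m::finite) ^ 3 * (\<Sum>i\<in>(UNIV::'m set). f i)"
  by (subst sum4_swap_ij) (rule sum4_j)

text \<open>The algebra of the Bochner inequality at one point. \<open>A\<close> and \<open>AA\<close> are the first and second derivatives of the
  coefficients \<open>a\<close>; \<open>U\<close>, \<open>UU\<close>, \<open>UUU\<close> and \<open>W\<close>, \<open>WW\<close> are those of \<open>f\<close> and \<open>w\<close>. The third derivatives of \<open>f\<close> and the
  second derivatives of \<open>w\<close> cancel, and the rest depends on \<open>UU\<close> only through \<open>N = UU - c W \<otimes> W\<close>: it is
  \<open>|N|\<^sup>2\<close>, a term \<open>SN\<close> linear in \<open>N\<close> with coefficients of the form \<open>a A U\<close>, and the term \<open>q\<close> quadratic in \<open>U\<close>. Young's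
  inequality absorbs \<open>SN\<close> in \<open>|N|\<^sup>2 \<ge> lam\<^sup>2 \<Sum> N\<^sup>2\<close>. As \<open>c\<close> has been hidden in \<open>N\<close>, the constant does not depend on it.\<close>

lemma bochner_tensor_inequality:
  fixes a :: "'m::finite \<Rightarrow> 'm \<Rightarrow> real" and A :: "'m \<Rightarrow> 'm \<Rightarrow> 'm \<Rightarrow> real"
    and AA UUU :: "_ \<Rightarrow> _" and U W :: "'m \<Rightarrow> real" and UU WW :: "'m \<Rightarrow> 'm \<Rightarrow> real"
  assumes a_sym: "\<And>i j. a i j = a j i" and A_sym: "\<And>k i j. A k i j = A k j i"
    and UU_sym: "\<And>i j. UU i j = UU j i" and WW_sym: "\<And>i j. WW i j = WW j i"
    and lam: "0 < lam" and ell: "\<And>x. lam * (\<Sum>i\<in>UNIV. (x i)\<^sup>2) \<le> (\<Sum>i\<in>UNIV. \<Sum>j\<in>UNIV. a i j * x i * x j)"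
    and B: "\<And>i j. \<bar>a i j\<bar> \<le> B" "\<And>k i j. \<bar>A k i j\<bar> \<le> B" "\<And>k l i j. \<bar>AA k l i j\<bar> \<le> B"
    and T1: "T1 = sum4 (\<lambda>k l i j. a k l * (AA k l i j * U i * U j
        + A l i j * UU k i * U j + A l i j * U i * UU k j + A k i j * UU l i * U j + A k i j * U i * UU l j
        + a i j * UUU k l i * U j + a i j * U i * UUU k l j
        + a i j * UU l i * UU k j + a i j * UU k i * UU l j))"
    and T2: "T2 = sum4 (\<lambda>k l i j. a i j * U i * (A j k l * UU k l + a k l * UUU k l j))"
    and T3: "T3 = sum4 (\<lambda>k l i j. a k l * W k * (A l i j * U i * W j + a i j * UU l i * W j + a i j * U i * WW l j))"
    and T4: "T4 = sum4 (\<lambda>k l i j. a k l * U k * (A l i j * W i * W j + a i j * WW l i * W j + a i j * W i * WW l j))"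
    and T5: "T5 = (\<Sum>i\<in>UNIV. \<Sum>j\<in>UNIV. a i j * W i * W j)"
    and K: "K = (9 / 4 * B ^ 4 * real CARD('m) ^ 5 / lam\<^sup>2 + B\<^sup>2 * real CARD('m) ^ 3 / 2) / lam"
  shows "- K * (\<Sum>i\<in>UNIV. \<Sum>j\<in>UNIV. a i j * U i * U j) \<le> T1 / 2 - T2 - c * (2 * T3 - T4) + c\<^sup>2 * T5\<^sup>2"
proof -
  define m where "m = real CARD('m)"
  have m: "1 \<le> m" by (simp add: m_def Suc_leI)
  define N where "N = (\<lambda>k i. UU k i - c * W k * W i)"
  define Z where "Z = sum4 (\<lambda>k l i j. a k l * A k i j * UU l i * U j)"
  define Zw where "Zw = sum4 (\<lambda>k l i j. a k l * A k i j * (W l * W i) * U j)"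
  define Y where "Y = sum4 (\<lambda>k l i j. a i j * U i * A j k l * UU k l)"
  define Yw where "Yw = sum4 (\<lambda>k l i j. a i j * U i * A j k l * (W k * W l))"
  define QQ where "QQ = sum4 (\<lambda>k l i j. a k l * a i j * UU k i * UU l j)"
  define Cr where "Cr = sum4 (\<lambda>k l i j. a k l * a i j * UU k i * (W l * W j))"
  define q where "q = sum4 (\<lambda>k l i j. a k l * AA k l i j * U i * U j)"
  define X3 where "X3 = sum4 (\<lambda>k l i j. a i j * a k l * UUU k l j * U i)"
  define WW3 where "WW3 = sum4 (\<lambda>k l i j. a k l * U k * a i j * W i * WW l j)"
  define U2 N2 where "U2 = (\<Sum>i\<in>UNIV. (U i)\<^sup>2)" and "N2 = (\<Sum>k\<in>UNIV. \<Sum>i\<in>UNIV. (N k i)\<^sup>2)"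
  note sy = a_sym A_sym UU_sym WW_sym
  have t1: "sum4 (\<lambda>k l i j. a k l * A l i j * UU k i * U j) = Z"
    unfolding Z_def by (subst sum4_swap_kl) (rule sum4_cong, simp add: sy)
  have t2: "sum4 (\<lambda>k l i j. a k l * A l i j * U i * UU k j) = Z"
    unfolding Z_def by (subst sum4_swap_kl, subst sum4_swap_ij) (rule sum4_cong, simp add: sy)
  have t4: "sum4 (\<lambda>k l i j. a k l * A k i j * U i * UU l j) = Z"
    unfolding Z_def by (subst sum4_swap_ij) (rule sum4_cong, simp add: sy)
  have u1: "sum4 (\<lambda>k l i j. a k l * a i j * UUU k l i * U j) = X3"
    unfolding X3_def by (subst sum4_swap_ij) (rule sum4_cong, simp add: sy)
  have u2: "sum4 (\<lambda>k l i j. a k l * a i j * U i * UUU k l j) = X3"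
    unfolding X3_def by (rule sum4_cong) simp
  have qq1: "sum4 (\<lambda>k l i j. a k l * a i j * UU l i * UU k j) = QQ"
    unfolding QQ_def by (subst sum4_swap_ij) (rule sum4_cong, simp add: sy)
  have "T1 = q + sum4 (\<lambda>k l i j. a k l * A l i j * UU k i * U j)
      + sum4 (\<lambda>k l i j. a k l * A l i j * U i * UU k j) + Z
      + sum4 (\<lambda>k l i j. a k l * A k i j * U i * UU l j)
      + sum4 (\<lambda>k l i j. a k l * a i j * UUU k l i * U j)
      + sum4 (\<lambda>k l i j. a k l * a i j * U i * UUU k l j)
      + sum4 (\<lambda>k l i j. a k l * a i j * UU l i * UU k j) + QQ"
    unfolding T1 q_def Z_def QQ_def sum4_add[symmetric] by (rule sum4_cong) (simp add: algebra_simps)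
  then have T1': "T1 = q + 4 * Z + 2 * X3 + 2 * QQ" unfolding t1 t2 t4 u1 u2 qq1 by simp
  have T2': "T2 = Y + X3"
    unfolding T2 Y_def X3_def sum4_add[symmetric] by (rule sum4_cong) (simp add: algebra_simps)
  have zw: "sum4 (\<lambda>k l i j. a k l * W k * A l i j * U i * W j) = Zw"
    unfolding Zw_def by (subst sum4_swap_kl, subst sum4_swap_ij) (rule sum4_cong, simp add: sy)
  have cr: "sum4 (\<lambda>k l i j. a k l * W k * a i j * UU l i * W j) = Cr"
    unfolding Cr_def by (subst sum4_swap_kl) (rule sum4_cong, simp add: sy)
  have ww1: "sum4 (\<lambda>k l i j. a k l * W k * a i j * U i * WW l j) = WW3"
    unfolding WW3_def by (subst sum4_swap_pairs) (rule sum4_cong, simp add: sy)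
  have "T3 = sum4 (\<lambda>k l i j. a k l * W k * A l i j * U i * W j)
      + sum4 (\<lambda>k l i j. a k l * W k * a i j * UU l i * W j)
      + sum4 (\<lambda>k l i j. a k l * W k * a i j * U i * WW l j)"
    unfolding T3 sum4_add[symmetric] by (rule sum4_cong) (simp add: algebra_simps)
  then have T3': "T3 = Zw + Cr + WW3" unfolding zw cr ww1 .
  have yw: "sum4 (\<lambda>k l i j. a k l * U k * A l i j * W i * W j) = Yw"
    unfolding Yw_def by (subst sum4_swap_pairs) (rule sum4_cong, simp)
  have ww2: "sum4 (\<lambda>k l i j. a k l * U k * a i j * WW l i * W j) = WW3"
    unfolding WW3_def by (subst sum4_swap_ij) (rule sum4_cong, simp add: sy)
  have "T4 = sum4 (\<lambda>k l i j. a k l * U k * A l i j * W i * W j)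
      + sum4 (\<lambda>k l i j. a k l * U k * a i j * WW l i * W j) + WW3"
    unfolding T4 WW3_def sum4_add[symmetric] by (rule sum4_cong) (simp add: algebra_simps)
  then have T4': "T4 = Yw + 2 * WW3" unfolding yw ww2 by simp
  have T5': "T5\<^sup>2 = sum4 (\<lambda>k l i j. a k l * a i j * (W k * W i * W l * W j))"
  proof -
    have "T5\<^sup>2 = (\<Sum>k\<in>UNIV. \<Sum>l\<in>UNIV. (a k l * W k * W l) * (\<Sum>i\<in>UNIV. \<Sum>j\<in>UNIV. a i j * W i * W j))"
      by (simp add: T5 power2_eq_square sum_distrib_right)
    then show ?thesis by (simp add: sum4_def sum_distrib_left ac_simps)
  qed
  define NN where "NN = sum4 (\<lambda>k l i j. a k l * a i j * N k i * N l j)"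
  define SN where "SN = sum4 (\<lambda>k l i j. 2 * (a k l * A k i j * N l i * U j) - a i j * U i * A j k l * N k l)"
  have cr2: "sum4 (\<lambda>k l i j. a k l * a i j * (W k * W i) * UU l j) = Cr"
    unfolding Cr_def by (subst sum4_swap_kl, subst sum4_swap_ij) (rule sum4_cong, simp add: sy)
  have "NN = QQ - c * Cr - c * sum4 (\<lambda>k l i j. a k l * a i j * (W k * W i) * UU l j) + c\<^sup>2 * T5\<^sup>2"
    unfolding NN_def QQ_def Cr_def T5' sum4_cmult[symmetric] sum4_add[symmetric] sum4_diff[symmetric]
    by (rule sum4_cong) (simp add: N_def algebra_simps power2_eq_square)
  then have NN': "NN = QQ - 2 * (c * Cr) + c\<^sup>2 * T5\<^sup>2" unfolding cr2 by simp
  have SN': "SN = 2 * Z - 2 * c * Zw - (Y - c * Yw)"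
    unfolding SN_def Z_def Zw_def Y_def Yw_def sum4_cmult[symmetric] sum4_add[symmetric] sum4_diff[symmetric]
    by (rule sum4_cong) (simp add: N_def algebra_simps)
  have total: "T1 / 2 - T2 - c * (2 * T3 - T4) + c\<^sup>2 * T5\<^sup>2 = q / 2 + NN + SN"
    unfolding T1' T2' T3' T4' NN' SN' by (simp add: algebra_simps)
  have B0: "0 \<le> B" using B(1)[of undefined undefined] by linarith
  have U2: "0 \<le> U2" and N2: "0 \<le> N2" by (simp_all add: U2_def N2_def sum_nonneg)
  have NN_ge: "lam\<^sup>2 * N2 \<le> NN"
    unfolding NN_def N2_def sum4_def
    by (rule tensor_norm_lower_bound[OF a_sym _ ell]) (use lam in simp)
  have q_ge: "- (B\<^sup>2 * m ^ 3 * U2) \<le> q"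
  proof -
    have le: "- (B\<^sup>2 / 2 * (U i)\<^sup>2 + B\<^sup>2 / 2 * (U j)\<^sup>2) \<le> a k l * AA k l i j * U i * U j" for k l i j
    proof -
      have "\<bar>a k l * AA k l i j * (U i * U j)\<bar> \<le> B * B * \<bar>U i * U j\<bar>"
        unfolding abs_mult[of "a k l * AA k l i j"] abs_mult[of "a k l"]
        using B B0 by (intro mult_right_mono mult_mono) auto
      moreover have "B * B * (2 * \<bar>U i * U j\<bar>) \<le> B * B * ((U i)\<^sup>2 + (U j)\<^sup>2)"
      proof (intro mult_left_mono)
        show "2 * \<bar>U i * U j\<bar> \<le> (U i)\<^sup>2 + (U j)\<^sup>2"
          using zero_le_power2[of "\<bar>U i\<bar> - \<bar>U j\<bar>"] by (simp add: power2_diff abs_mult)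
      qed (use B0 in simp)
      ultimately show ?thesis by (simp add: power2_eq_square algebra_simps abs_le_iff)
    qed
    have "- (B\<^sup>2 * m ^ 3 * U2) = sum4 (\<lambda>k l i j. (-1) * ((B\<^sup>2 / 2) * (U i)\<^sup>2 + (B\<^sup>2 / 2) * (U j)\<^sup>2))"
      unfolding sum4_cmult sum4_add sum4_i sum4_j m_def U2_def by simp
    also have "\<dots> \<le> q" unfolding q_def by (rule sum4_mono) (use le in simp)
    finally show ?thesis .
  qed
  \<comment> \<open>chosen such that the \<open>N\<close>-part of the Young inequalities adds up to exactly \<open>lam\<^sup>2 * N2\<close>\<close>
  define ep where "ep = 2 * lam\<^sup>2 / (3 * m\<^sup>2)"
  have ep: "0 < ep" using lam m by (simp add: ep_def)
  have SN_ge: "- (lam\<^sup>2 * N2 + 9 / 4 * B ^ 4 * m ^ 5 / lam\<^sup>2 * U2) \<le> SN"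
  proof -
    have young: "2 * \<bar>x * y * n * u\<bar> \<le> ep * n\<^sup>2 + B ^ 4 / ep * u\<^sup>2" if "\<bar>x\<bar> \<le> B" "\<bar>y\<bar> \<le> B" for x y n u
    proof -
      have "\<bar>x * y * (n * u)\<bar> \<le> B * B * \<bar>n * u\<bar>"
        unfolding abs_mult[of "x * y"] abs_mult[of x] using that B0 by (intro mult_right_mono mult_mono) auto
      moreover have "2 * (B * B * \<bar>n * u\<bar>) \<le> ep * n\<^sup>2 + B ^ 4 / ep * u\<^sup>2"
      proof -
        have "0 \<le> (ep * \<bar>n\<bar> - B\<^sup>2 * \<bar>u\<bar>)\<^sup>2 / ep" using ep by simp
        also have "\<dots> = ep * n\<^sup>2 + B ^ 4 / ep * u\<^sup>2 - 2 * (B * B * \<bar>n * u\<bar>)"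
          using ep by (simp add: power2_diff field_simps abs_mult power_mult_distrib)
            (simp add: power2_eq_square eval_nat_numeral)
        finally show ?thesis by simp
      qed
      ultimately show ?thesis by (simp add: ac_simps)
    qed
    define be where "be = B ^ 4 / ep"
    have le: "(-1) * ((ep * (N l i)\<^sup>2 + be * (U j)\<^sup>2) + 1 / 2 * (ep * (N k l)\<^sup>2 + be * (U i)\<^sup>2))
        \<le> 2 * (a k l * A k i j * N l i * U j) - a i j * U i * A j k l * N k l" for k l i j
    proof -
      have "2 * \<bar>a k l * A k i j * N l i * U j\<bar> \<le> ep * (N l i)\<^sup>2 + be * (U j)\<^sup>2"
        "2 * \<bar>a i j * A j k l * N k l * U i\<bar> \<le> ep * (N k l)\<^sup>2 + be * (U i)\<^sup>2"
        unfolding be_def by (rule young[OF B(1,2)])+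
      moreover have "(-1) * (P + 1 / 2 * Q) \<le> 2 * x - y" if "2 * \<bar>x\<bar> \<le> P" "2 * \<bar>y\<bar> \<le> Q" for x y P Q :: real
        using that by (simp add: abs_le_iff)
      moreover have "a i j * U i * A j k l * N k l = a i j * A j k l * N k l * U i" by simp
      ultimately show ?thesis by (simp only:)
    qed
    have "sum4 (\<lambda>k l i j. (-1) * ((ep * (N l i)\<^sup>2 + be * (U j)\<^sup>2)
          + 1 / 2 * (ep * (N k l)\<^sup>2 + be * (U i)\<^sup>2))) \<le> SN"
      unfolding SN_def by (rule sum4_mono) (rule le)
    moreover have "sum4 (\<lambda>k l i j. (-1) * ((ep * (N l i)\<^sup>2 + be * (U j)\<^sup>2)
          + 1 / 2 * (ep * (N k l)\<^sup>2 + be * (U i)\<^sup>2)))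
        = - ((3 / 2 * ep * m\<^sup>2) * N2 + (3 / 2 * be * m ^ 3) * U2)"
      unfolding sum4_cmult sum4_add sum4_i sum4_j sum4_li sum4_kl m_def[symmetric] U2_def[symmetric] N2_def[symmetric]
      by (simp add: algebra_simps)
    moreover have "3 / 2 * ep * m\<^sup>2 = lam\<^sup>2" using m by (simp add: ep_def)
    moreover have "3 / 2 * be * m ^ 3 = 9 / 4 * B ^ 4 * m ^ 5 / lam\<^sup>2"
      using m lam by (simp add: be_def ep_def field_simps eval_nat_numeral)
    ultimately show ?thesis by (simp only:)
  qed
  have K': "K * lam = 9 / 4 * B ^ 4 * m ^ 5 / lam\<^sup>2 + B\<^sup>2 * m ^ 3 / 2"
    using lam by (simp add: K m_def)
  have K0: "0 \<le> K" using lam B0 by (simp add: K)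
  have "K * (lam * U2) \<le> K * (\<Sum>i\<in>UNIV. \<Sum>j\<in>UNIV. a i j * U i * U j)"
    unfolding U2_def by (intro mult_left_mono ell K0)
  moreover have "- (K * lam * U2) \<le> q / 2 + NN + SN"
  proof -
    have "B\<^sup>2 * m ^ 3 / 2 * U2 = (B\<^sup>2 * m ^ 3 * U2) / 2" by simp
    then show ?thesis unfolding K' distrib_right using q_ge NN_ge SN_ge by linarith
  qed
  ultimately show ?thesis unfolding total by simp
qed

context local_operator begin

lemma D_D_sum:
  fixes f :: "'i \<Rightarrow> 'e \<Rightarrow> real"
  assumes p: "p \<in> S" and f: "\<And>i. i \<in> I \<Longrightarrow> Ck_on 2 S (f i)" and I: "finite I"
  shows "dir_deriv v (dir_deriv w (\<lambda>x. \<Sum>i\<in>I. f i x)) p = (\<Sum>i\<in>I. dir_deriv v (dir_deriv w (f i)) p)"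
proof -
  have C: "Ck_on 1 S (dir_deriv w (f i))" if "i \<in> I" for i
    using Ck_on_dir_deriv[OF open_S, of 1 "f i" w] f[OF that] by (simp add: numeral_2_eq_2)
  have "dir_deriv v (dir_deriv w (\<lambda>x. \<Sum>i\<in>I. f i x)) p = dir_deriv v (\<lambda>x. \<Sum>i\<in>I. dir_deriv w (f i) x) p"
    by (rule dir_deriv_cong[OF open_S p Ck_on_sum[OF I C]]) (auto intro!: dir_deriv_sum[OF open_S _ I] Ck_21 f)
  also have "\<dots> = (\<Sum>i\<in>I. dir_deriv v (dir_deriv w (f i)) p)"
    by (rule dir_deriv_sum[OF open_S p I C])
  finally show ?thesis .
qed

lemma local_bochner:
  assumes p: "p \<in> S" and f: "Ck_on 3 S f" and w: "Ck_on 2 S w"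
    and lam: "0 < lam" and ell: "\<And>x. lam * (\<Sum>i\<in>UNIV. (x i)\<^sup>2) \<le> (\<Sum>i\<in>UNIV. \<Sum>j\<in>UNIV. a i j p * x i * x j)"
    and B: "\<And>i j. \<bar>a i j p\<bar> \<le> B" "\<And>k i j. \<bar>D k (a i j) p\<bar> \<le> B" "\<And>k l i j. \<bar>D k (D l (a i j)) p\<bar> \<le> B"
    and K: "K = (9 / 4 * B ^ 4 * real CARD('m) ^ 5 / lam\<^sup>2 + B\<^sup>2 * real CARD('m) ^ 3 / 2) / lam"
  shows "- K * loc_grad e a f f p \<le> loc_lap e a (loc_grad e a f f) p / 2 - loc_grad e a f (loc_lap e a f) p
    - c * (2 * loc_grad e a w (loc_grad e a f w) p - loc_grad e a f (loc_grad e a w w) p)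
    + c\<^sup>2 * (loc_grad e a w w p)\<^sup>2"
proof -
  have f2: "Ck_on 2 S f" using Ck_on_mono[of 2 3 S f] f by simp
  have Df: "Ck_on 2 S (D i f)" for i using Ck_D[of 2 f i] f by (simp add: numeral_3_eq_3 numeral_2_eq_2)
  define A AA U W UU WW UUU where "A = (\<lambda>k i j. D k (a i j) p)" and "AA = (\<lambda>k l i j. D k (D l (a i j)) p)"
    and "U = (\<lambda>i. D i f p)" and "W = (\<lambda>i. D i w p)" and "UU = (\<lambda>i j. D i (D j f) p)"
    and "WW = (\<lambda>i j. D i (D j w) p)" and "UUU = (\<lambda>k l i. D k (D l (D i f)) p)"
  have A_sym: "A k i j = A k j i" for k i j
    unfolding A_def by (rule dir_deriv_cong[OF open_S p Ck_a]) (rule a_sym)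
  have UU_sym: "UU i j = UU j i" for i j unfolding UU_def by (rule dir_deriv_commute[OF open_S p f2])
  have WW_sym: "WW i j = WW j i" for i j unfolding WW_def by (rule dir_deriv_commute[OF open_S p w])
  have T1: "loc_lap e a (loc_grad e a f f) p = sum4 (\<lambda>k l i j. a k l p * (AA k l i j * U i * U j
        + A l i j * UU k i * U j + A l i j * U i * UU k j + A k i j * UU l i * U j + A k i j * U i * UU l j
        + a i j p * UUU k l i * U j + a i j p * U i * UUU k l j
        + a i j p * UU l i * UU k j + a i j p * UU k i * UU l j))"
  proof -
    have g: "loc_grad e a f f = (\<lambda>q. \<Sum>i\<in>UNIV. \<Sum>j\<in>UNIV. a i j q * (D i f q * D j f q))"
      by (simp add: loc_grad_def fun_eq_iff mult.assoc)
    have M: "Ck_on 2 S (\<lambda>q. D i f q * D j f q)" for i j by (rule Ck_on_mult[OF Df Df])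
    have deriv2: "D k (D l (\<lambda>q. a i j q * (D i f q * D j f q))) p = AA k l i j * U i * U j
        + A l i j * UU k i * U j + A l i j * U i * UU k j + A k i j * UU l i * U j + A k i j * U i * UU l j
        + a i j p * UUU k l i * U j + a i j p * U i * UUU k l j
        + a i j p * UU l i * UU k j + a i j p * UU k i * UU l j" for k l i j
      unfolding D_D_mult[OF p Ck_a M] D_D_mult[OF p Df Df]
        dir_deriv_mult[OF open_S p Ck_21[OF Df] Ck_21[OF Df]] A_def AA_def U_def UU_def UUU_def
      by (simp add: algebra_simps)
    have "D k (D l (loc_grad e a f f)) p = (\<Sum>i\<in>UNIV. \<Sum>j\<in>UNIV. D k (D l (\<lambda>q. a i j q * (D i f q * D j f q))) p)" for k l
    proof -
      have "D k (D l (loc_grad e a f f)) p = (\<Sum>i\<in>UNIV. D k (D l (\<lambda>q. \<Sum>j\<in>UNIV. a i j q * (D i f q * D j f q))) p)"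
        unfolding g by (rule D_D_sum[OF p _ finite]) (intro Ck_on_sum finite Ck_on_mult[OF Ck_a M])
      also have "\<dots> = (\<Sum>i\<in>UNIV. \<Sum>j\<in>UNIV. D k (D l (\<lambda>q. a i j q * (D i f q * D j f q))) p)"
        by (intro sum.cong refl D_D_sum[OF p _ finite] Ck_on_mult[OF Ck_a M])
      finally show ?thesis .
    qed
    then show ?thesis unfolding loc_lap_def sum4_def deriv2 by (simp only: sum_distrib_left)
  qed
  have T2: "loc_grad e a f (loc_lap e a f) p
      = sum4 (\<lambda>k l i j. a i j p * U i * (A j k l * UU k l + a k l p * UUU k l j))"
  proof -
    have "D j (loc_lap e a f) p = (\<Sum>k\<in>UNIV. \<Sum>l\<in>UNIV. A j k l * UU k l + a k l p * UUU k l j)" for j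
      unfolding dir_deriv_loc_lap[OF p f] dir_deriv_D_D[OF p f, of "e j"] A_def UU_def UUU_def
      by (simp only: sum.distrib)
    then have "loc_grad e a f (loc_lap e a f) p
        = sum4 (\<lambda>i j k l. a i j p * U i * (A j k l * UU k l + a k l p * UUU k l j))"
      unfolding loc_grad_def sum4_def U_def by (simp only: sum_distrib_left)
    then show ?thesis by (subst (asm) sum4_swap_pairs)
  qed
  have T3: "loc_grad e a w (loc_grad e a f w) p
      = sum4 (\<lambda>k l i j. a k l p * W k * (A l i j * U i * W j + a i j p * UU l i * W j + a i j p * U i * WW l j))"
    unfolding loc_grad_def[of e a w "loc_grad e a f w"] dir_deriv_loc_grad[OF p f2 w] sum4_def
      A_def U_def UU_def W_def WW_def
    by (simp only: sum.distrib[symmetric] sum_distrib_left)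
  have T4: "loc_grad e a f (loc_grad e a w w) p
      = sum4 (\<lambda>k l i j. a k l p * U k * (A l i j * W i * W j + a i j p * WW l i * W j + a i j p * W i * WW l j))"
    unfolding loc_grad_def[of e a f "loc_grad e a w w"] dir_deriv_loc_grad[OF p w w] sum4_def
      A_def U_def UU_def W_def WW_def
    by (simp only: sum.distrib[symmetric] sum_distrib_left)
  have T5: "loc_grad e a w w p = (\<Sum>i\<in>UNIV. \<Sum>j\<in>UNIV. a i j p * W i * W j)"
    by (simp add: loc_grad_def W_def)
  have "- K * (\<Sum>i\<in>UNIV. \<Sum>j\<in>UNIV. a i j p * U i * U j) \<le> loc_lap e a (loc_grad e a f f) p / 2
    - loc_grad e a f (loc_lap e a f) p
    - c * (2 * loc_grad e a w (loc_grad e a f w) p - loc_grad e a f (loc_grad e a w w) p)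
    + c\<^sup>2 * (loc_grad e a w w p)\<^sup>2"
    by (rule bochner_tensor_inequality[OF a_sym[OF p] A_sym UU_sym WW_sym lam ell B(1) _ _ T1 T2 T3 T4 T5 K])
       (use B in \<open>auto simp: A_def AA_def\<close>)
  then show ?thesis by (simp add: loc_grad_def U_def)
qed

end

section \<open>Hermitian matrices\<close>

definition cnj_mat :: "complex^'n^'m \<Rightarrow> complex^'n^'m" where
  "cnj_mat J = (\<chi> i j. cnj (J $ i $ j))"

definition cnj_vec :: "complex^'n \<Rightarrow> complex^'n" where
  "cnj_vec v = (\<chi> i. cnj (v $ i))"

lemma cnj_vec_cnj_vec [simp]: "cnj_vec (cnj_vec v) = v"
  by (simp add: cnj_vec_def vec_eq_iff)

lemma cnj_vec_eq_0 [simp]: "cnj_vec v = 0 \<longleftrightarrow> v = 0"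
  by (simp add: cnj_vec_def vec_eq_iff)

lemma sesq_axis: "sesq G (axis j 1) (axis k 1) = G $ j $ k"
proof -
  have "sesq G (axis j 1) (axis k 1)
      = (\<Sum>j'\<in>UNIV. \<Sum>k'\<in>UNIV. if k' = k then (if j' = j then G $ j' $ k' else 0) else 0)"
    unfolding sesq_def by (intro sum.cong refl) (auto simp: axis_def)
  then show ?thesis by simp
qed

lemma sesq_mult_vec: "sesq G v w = (\<Sum>j\<in>UNIV. v $ j * (G *v cnj_vec w) $ j)"
  by (simp add: sesq_def matrix_vector_mult_def cnj_vec_def sum_distrib_left ac_simps)

lemma sesq_matrix: "sesq G (J *v v) (J *v w) = sesq (transpose J ** G ** cnj_mat J) v w"
proof -
  have cv: "cnj_vec (J *v w) = cnj_mat J *v cnj_vec w"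
    by (simp add: cnj_vec_def cnj_mat_def matrix_vector_mult_def vec_eq_iff)
  have dot: "(\<Sum>l\<in>UNIV. (J *v v) $ l * y $ l) = (\<Sum>j\<in>UNIV. v $ j * (transpose J *v y) $ j)" for y
  proof -
    have "(\<Sum>l\<in>UNIV. (J *v v) $ l * y $ l) = (\<Sum>l\<in>UNIV. \<Sum>j\<in>UNIV. v $ j * (J $ l $ j * y $ l))"
      unfolding matrix_vector_mult_def vec_lambda_beta sum_distrib_right
      by (intro sum.cong refl) (simp only: ac_simps)
    also have "\<dots> = (\<Sum>j\<in>UNIV. \<Sum>l\<in>UNIV. v $ j * (J $ l $ j * y $ l))" by (rule sum.swap)
    also have "\<dots> = (\<Sum>j\<in>UNIV. v $ j * (transpose J *v y) $ j)"
      by (simp add: matrix_vector_mult_def transpose_def sum_distrib_left)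
    finally show ?thesis .
  qed
  show ?thesis
    unfolding sesq_mult_vec cv dot by (simp add: matrix_vector_mul_assoc matrix_mul_assoc)
qed

lemma sesq_linear:
  "sesq G (u + v) w = sesq G u w + sesq G v w" "sesq G w (u + v) = sesq G w u + sesq G w v"
  "sesq G (c *s v) w = c * sesq G v w" "sesq G v (c *s w) = cnj c * sesq G v w"
  by (simp_all add: sesq_def sum.distrib distrib_left distrib_right sum_distrib_left ac_simps)

text \<open>A sesquilinear form is determined by its diagonal; this reduces identities between complex Hessians to second
  derivatives along complex lines.\<close>

lemma sesq_polarization:
  "4 * sesq G v w = sesq G (v + w) (v + w) - sesq G (v + (-1) *s w) (v + (-1) *s w)
    + \<i> * sesq G (v + \<i> *s w) (v + \<i> *s w) - \<i> * sesq G (v + (-\<i>) *s w) (v + (-\<i>) *s w)"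
  by (simp only: sesq_linear) (simp add: algebra_simps)

lemma sesq_eq_imp_matrix_eq:
  assumes "\<And>v w. sesq G v w = sesq H v w" shows "G = H"
  using assms[of "axis _ 1" "axis _ 1"] by (simp add: sesq_axis vec_eq_iff)

lemma complex_linear_matrix:
  fixes L :: "complex^'n \<Rightarrow> complex^'m"
  assumes "linear L" "\<And>c v. L (c *s v) = c *s L v"
  shows "L v = (\<chi> l j. L (axis j 1) $ l) *v v"
proof -
  have "v = (\<Sum>j\<in>UNIV. v $ j *s axis j 1)"
    by (simp add: vec_eq_iff axis_def if_distrib[of "\<lambda>x. _ * x"] cong: if_cong)
  then have "L v = (\<Sum>j\<in>UNIV. v $ j *s L (axis j 1))"
    using linear_sum[OF assms(1), of "\<lambda>j. v $ j *s axis j 1" UNIV] assms(2) by simp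
  then show ?thesis by (simp add: vec_eq_iff matrix_vector_mult_def mult.commute)
qed

lemma matrix_inv_both:
  fixes G :: "complex^'n^'n"
  assumes "invertible G"
  shows matrix_inv_right: "G ** matrix_inv G = mat 1" and matrix_inv_left: "matrix_inv G ** G = mat 1"
  using someI_ex[OF assms[unfolded invertible_def]] unfolding matrix_inv_def by auto

text \<open>With \<open>C = cnj_mat J\<close> one has \<open>C G'\<^sup>-\<^sup>1 J\<^sup>T = G\<^sup>-\<^sup>1\<close>, and the trace is cyclic. Applied to a change of coordinates, this
  makes \<open>tr\<^sub>\<omega>\<close> independent of the chart.\<close>

lemma trace_inverse_pullback:
  fixes G H G' H' J :: "complex^'n^'n"
  assumes G': "G' = transpose J ** G ** cnj_mat J" and H': "H' = transpose J ** H ** cnj_mat J"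
    and inv: "invertible G" "invertible G'"
  shows "trace (matrix_inv G' ** H') = trace (matrix_inv G ** H)"
proof -
  define C where "C = cnj_mat J"
  define T where "T = transpose J"
  define Y where "Y = C ** matrix_inv G' ** T"
  have inv': "matrix_inv G' ** G' = mat 1" using inv(2) by (rule matrix_inv_left)
  have "(matrix_inv G' ** T ** G) ** C = mat 1"
    using inv' by (simp add: G' C_def T_def matrix_mul_assoc)
  then have C: "C ** (matrix_inv G' ** T ** G) = mat 1" by (rule matrix_left_right_inverse[THEN iffD1])
  then have "Y ** G = mat 1" by (simp add: Y_def matrix_mul_assoc)
  then have "Y = matrix_inv G" using matrix_inv_right[OF inv(1)]
    by (metis matrix_mul_assoc matrix_mul_lid matrix_mul_rid)
  have "trace (matrix_inv G' ** H') = trace ((matrix_inv G' ** T ** H) ** C)"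
    by (simp add: H' C_def T_def matrix_mul_assoc)
  also have "\<dots> = trace (C ** (matrix_inv G' ** T ** H))" by (rule trace_mul_sym)
  also have "\<dots> = trace (Y ** H)" by (simp add: Y_def matrix_mul_assoc)
  finally show ?thesis by (simp add: \<open>Y = matrix_inv G\<close>)
qed

definition pos_hermitian :: "complex^'n^'n \<Rightarrow> bool" where
  "pos_hermitian G \<longleftrightarrow> (\<forall>j k. G $ k $ j = cnj (G $ j $ k)) \<and> (\<forall>v. v \<noteq> 0 \<longrightarrow> 0 < Re (sesq G v v))"

lemma pos_hermitian_invertible:
  fixes G :: "complex^'n^'n"
  assumes "pos_hermitian G" shows "invertible G"
proof -
  have "x = 0" if "G *v x = 0" for x
  proof (rule ccontr)
    assume "x \<noteq> 0"
    then have "0 < Re (sesq G (cnj_vec x) (cnj_vec x))" using assms by (simp add: pos_hermitian_def)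
    then show False by (simp add: sesq_mult_vec that)
  qed
  then have "\<exists>B. B ** G = mat 1" by (simp add: matrix_left_invertible_ker)
  then show ?thesis by (simp add: invertible_left_inverse)
qed

lemma pos_hermitian_inverse_hermitian:
  fixes G :: "complex^'n^'n"
  assumes G: "pos_hermitian G"
  shows "matrix_inv G $ k $ j = cnj (matrix_inv G $ j $ k)"
proof -
  note inv = pos_hermitian_invertible[OF G]
  define h where "h = matrix_inv G"
  have Gh: "G ** h = mat 1" unfolding h_def by (rule matrix_inv_right[OF inv])
  have Gt: "transpose (cnj_mat G) = G"
  proof -
    have "\<forall>j k. G $ k $ j = cnj (G $ j $ k)" using G unfolding pos_hermitian_def by (rule conjunct1)
    then have "cnj (G $ j $ k) = G $ k $ j" for j k by (metis complex_cnj_cnj)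
    then show ?thesis by (simp only: vec_eq_iff transpose_def cnj_mat_def vec_lambda_beta) simp
  qed
  have cm: "cnj_mat (A ** B) = cnj_mat A ** cnj_mat B" for A B :: "complex^'n^'n"
    by (simp add: cnj_mat_def matrix_matrix_mult_def vec_eq_iff)
  have "transpose (cnj_mat h) ** G = transpose (cnj_mat (G ** h))"
    by (simp add: cm matrix_transpose_mul Gt)
  also have "\<dots> = mat 1" by (simp add: Gh cnj_mat_def mat_def transpose_def vec_eq_iff)
  finally have "transpose (cnj_mat h) ** G ** h = h" by (simp only: matrix_mul_lid)
  then have "transpose (cnj_mat h) = h" by (simp only: matrix_mul_assoc[symmetric] Gh matrix_mul_rid)
  then have "transpose (cnj_mat h) $ k $ j = h $ k $ j" by simp
  then show ?thesis by (simp add: h_def transpose_def cnj_mat_def)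
qed

lemma pos_hermitian_inverse_pos:
  fixes G :: "complex^'n^'n" and D :: "complex^'n"
  assumes G: "pos_hermitian G" and D: "D \<noteq> 0"
  shows "0 < Re (\<Sum>k\<in>UNIV. \<Sum>j\<in>UNIV. matrix_inv G $ k $ j * D $ j * cnj (D $ k))"
proof -
  note inv = pos_hermitian_invertible[OF G]
  define y where "y = matrix_inv G *v D"
  have Gy: "G *v y = D" unfolding y_def
    by (simp add: matrix_vector_mul_assoc matrix_inv_right[OF inv])
  then have "y \<noteq> 0" using D by auto
  then have "0 < Re (sesq G (cnj_vec y) (cnj_vec y))" using G by (simp add: pos_hermitian_def)
  also have "sesq G (cnj_vec y) (cnj_vec y) = (\<Sum>k\<in>UNIV. cnj (y $ k) * D $ k)"
    by (simp add: sesq_mult_vec Gy) (simp add: cnj_vec_def)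
  also have "Re \<dots> = Re (\<Sum>k\<in>UNIV. y $ k * cnj (D $ k))"
    by (simp add: mult.commute)
  also have "(\<Sum>k\<in>UNIV. y $ k * cnj (D $ k)) = (\<Sum>k\<in>UNIV. \<Sum>j\<in>UNIV. matrix_inv G $ k $ j * D $ j * cnj (D $ k))"
    by (simp add: y_def matrix_vector_mult_def sum_distrib_right)
  finally show ?thesis .
qed

section \<open>Real coordinates\<close>

text \<open>The index \<open>(j, False)\<close> stands for the real coordinate \<open>x\<^sub>j\<close> and \<open>(j, True)\<close> for \<open>y\<^sub>j\<close>, where \<open>z\<^sub>j = x\<^sub>j + \<i> y\<^sub>j\<close>. The
  numbers \<open>eps b / 2\<close> are the coefficients of \<open>\<partial>/\<partial>z\<^sub>j\<close> in these directions.\<close>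

definition cdir :: "'n \<times> bool \<Rightarrow> complex^'n" where
  "cdir = (\<lambda>(j, b). axis j (if b then \<i> else 1))"

definition eps :: "bool \<Rightarrow> complex" where "eps b = (if b then - \<i> else 1)"

text \<open>The coefficients of \<open>Re (\<Sum> h\<^sub>k\<^sub>j \<partial>\<^sup>2/\<partial>z\<^sub>j\<partial>(cnj z\<^sub>k))\<close> in real coordinates.\<close>

definition hcoef :: "complex^'n^'n \<Rightarrow> 'n \<times> bool \<Rightarrow> 'n \<times> bool \<Rightarrow> real" where
  "hcoef h = (\<lambda>(j, s) (k, r). Re (h $ k $ j * eps s * cnj (eps r)) / 4)"

definition rcoord :: "complex^'n \<Rightarrow> 'n \<times> bool \<Rightarrow> real" where
  "rcoord v = (\<lambda>(j, b). if b then Im (v $ j) else Re (v $ j))"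

lemma sum_idx: "(\<Sum>i\<in>(UNIV :: ('n::finite \<times> bool) set). f i) = (\<Sum>j\<in>UNIV. f (j, False) + f (j, True))"
proof -
  have "(\<Sum>i\<in>(UNIV :: ('n \<times> bool) set). f i) = (\<Sum>j\<in>UNIV. \<Sum>b\<in>UNIV. f (j, b))"
    unfolding sum.cartesian_product by (simp add: UNIV_Times_UNIV)
  then show ?thesis by (simp add: UNIV_bool add.commute)
qed

lemma rcoord_expansion: "v = (\<Sum>i\<in>UNIV. rcoord v i *\<^sub>R cdir i)"
proof -
  have "(\<Sum>i\<in>UNIV. rcoord v i *\<^sub>R cdir i) $ l = v $ l" for l
  proof -
    have "(\<Sum>i\<in>UNIV. rcoord v i *\<^sub>R cdir i) $ l = (\<Sum>j\<in>UNIV. if l = j then v $ j else 0)"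
      unfolding sum_component sum_idx
      by (intro sum.cong refl) (auto simp: rcoord_def cdir_def axis_def complex_eq_iff)
    then show ?thesis by simp
  qed
  then show ?thesis by (simp add: vec_eq_iff)
qed

lemma hcoef_quadratic:
  "(\<Sum>i\<in>UNIV. \<Sum>l\<in>UNIV. hcoef h i l * x i * y l)
    = Re (\<Sum>k\<in>UNIV. \<Sum>j\<in>UNIV. h $ k $ j * ((of_real (x (j, False)) - \<i> * of_real (x (j, True))) / 2)
        * cnj ((of_real (y (k, False)) - \<i> * of_real (y (k, True))) / 2))"
proof -
  have "(\<Sum>i\<in>UNIV. \<Sum>l\<in>UNIV. hcoef h i l * x i * y l)
      = (\<Sum>j\<in>UNIV. \<Sum>k\<in>UNIV. Re (h $ k $ j * ((of_real (x (j, False)) - \<i> * of_real (x (j, True))) / 2)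
        * cnj ((of_real (y (k, False)) - \<i> * of_real (y (k, True))) / 2)))"
    unfolding sum_idx sum.distrib[symmetric]
    by (intro sum.cong refl) (simp add: hcoef_def eps_def algebra_simps add_divide_distrib diff_divide_distrib)
  also have "\<dots> = (\<Sum>k\<in>UNIV. \<Sum>j\<in>UNIV. Re (h $ k $ j * ((of_real (x (j, False)) - \<i> * of_real (x (j, True))) / 2)
        * cnj ((of_real (y (k, False)) - \<i> * of_real (y (k, True))) / 2)))" by (rule sum.swap)
  finally show ?thesis by simp
qed

lemma hcoef_sym: "(\<And>j k. h $ k $ j = cnj (h $ j $ k)) \<Longrightarrow> hcoef h i l = hcoef h l i"
proof -
  assume h: "\<And>j k. h $ k $ j = cnj (h $ j $ k)"
  obtain j s k r where il: "i = (j, s)" "l = (k, r)" by (metis surj_pair)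
  have "h $ k $ j * eps s * cnj (eps r) = cnj (h $ j $ k * eps r * cnj (eps s))"
    by (subst h) simp
  then show ?thesis unfolding il hcoef_def by (metis (no_types, lifting) case_prod_conv cnj.sel(1))
qed

lemma hcoef_pos:
  fixes G :: "complex^'n^'n"
  assumes G: "pos_hermitian G" and x: "x \<noteq> (\<lambda>i. 0)"
  shows "0 < (\<Sum>i\<in>UNIV. \<Sum>l\<in>UNIV. hcoef (matrix_inv G) i l * x i * x l)"
proof -
  define D :: "complex^'n" where "D = (\<chi> j. (of_real (x (j, False)) - \<i> * of_real (x (j, True))) / 2)"
  have "D \<noteq> 0"
  proof
    assume "D = 0"
    then have "D $ j = 0" for j by simp
    then have "x (j, b) = 0" for j b
      by (cases b) (auto simp: D_def complex_eq_iff)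
    then show False using x by (auto simp: fun_eq_iff)
  qed
  from pos_hermitian_inverse_pos[OF G this] show ?thesis unfolding hcoef_quadratic by (simp add: D_def)
qed

lemma hcoef_nonneg:
  fixes G :: "complex^'n^'n"
  assumes G: "pos_hermitian G"
  shows "0 \<le> (\<Sum>i\<in>UNIV. \<Sum>l\<in>UNIV. hcoef (matrix_inv G) i l * x i * x l)"
proof (cases "x = (\<lambda>i. 0)")
  case False
  then show ?thesis using hcoef_pos[OF G] less_imp_le by blast
qed simp

section \<open>Holomorphic changes of coordinates\<close>

lemma dir_deriv_rcoord:
  fixes U :: "complex^'n \<Rightarrow> real"
  assumes "open S" "p \<in> S" "Ck_on 1 S U"
  shows "dir_deriv v U p = (\<Sum>i\<in>UNIV. rcoord v i * dir_deriv (cdir i) U p)"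
proof -
  note L = dir_deriv_linear[OF assms]
  have "dir_deriv v U p = dir_deriv (\<Sum>i\<in>UNIV. rcoord v i *\<^sub>R cdir i) U p"
    by (simp add: rcoord_expansion[symmetric])
  then show ?thesis by (simp add: linear_sum[OF L] linear_scale[OF L])
qed

lemma has_derivative_rcoord_curve:
  fixes \<gamma> :: "complex \<Rightarrow> complex^'n"
  assumes "\<And>l. ((\<lambda>\<zeta>. \<gamma> \<zeta> $ l) has_field_derivative d $ l) (at (of_real s))"
  shows "((\<lambda>s. rcoord (\<gamma> (of_real s)) i) has_real_derivative rcoord d i) (at s)"
    and "((\<lambda>s. \<gamma> (of_real s)) has_derivative (\<lambda>h. h *\<^sub>R d)) (at s)"
proof -
  have v: "((\<lambda>s. \<gamma> (of_real s) $ l) has_vector_derivative d $ l) (at s)" for l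
    by (rule has_vector_derivative_real_field[OF assms])
  have rc: "((\<lambda>s. rcoord (\<gamma> (of_real s)) i) has_real_derivative rcoord d i) (at s)" for i
    using v[of "fst i"] by (cases i) (auto simp: rcoord_def has_vector_derivative_complex_iff)
  show "((\<lambda>s. rcoord (\<gamma> (of_real s)) i) has_real_derivative rcoord d i) (at s)" by (rule rc)
  have "((\<lambda>s. \<Sum>i\<in>UNIV. rcoord (\<gamma> (of_real s)) i *\<^sub>R cdir i) has_derivative
      (\<lambda>h. \<Sum>i\<in>UNIV. (rcoord d i * h) *\<^sub>R cdir i)) (at s)"
    by (intro has_derivative_sum has_derivative_scaleR_left)
       (use rc in \<open>auto simp: has_field_derivative_def\<close>)
  moreover have "(\<Sum>i\<in>UNIV. (rcoord d i * h) *\<^sub>R cdir i) = h *\<^sub>R d" for h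
    by (subst (2) rcoord_expansion[of d]) (simp add: scaleR_sum_right mult.commute)
  ultimately show "((\<lambda>s. \<gamma> (of_real s)) has_derivative (\<lambda>h. h *\<^sub>R d)) (at s)"
    by (simp add: rcoord_expansion[symmetric])
qed

text \<open>The second derivative of \<open>U\<close> along a curve is the Hessian of \<open>U\<close> in the velocity plus the derivative of \<open>U\<close> in the
  acceleration \<open>\<gamma>2\<close>. Curves are given with a complex parameter since they will be images of complex lines.\<close>

lemma second_derivative_along_curve:
  fixes \<gamma> \<gamma>1 :: "complex \<Rightarrow> complex^'n" and U :: "complex^'n \<Rightarrow> real"
  assumes S: "open S" and U: "Ck_on 2 S U" and d: "0 < d"
    and g: "\<And>\<zeta> l. norm \<zeta> < d \<Longrightarrow> ((\<lambda>\<zeta>. \<gamma> \<zeta> $ l) has_field_derivative \<gamma>1 \<zeta> $ l) (at \<zeta>)"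
    and g1: "\<And>l. ((\<lambda>\<zeta>. \<gamma>1 \<zeta> $ l) has_field_derivative \<gamma>2 $ l) (at 0)"
    and mem: "\<And>\<zeta>. norm \<zeta> < d \<Longrightarrow> \<gamma> \<zeta> \<in> S"
  shows "\<bar>s\<bar> < d \<Longrightarrow> ((\<lambda>s. U (\<gamma> (of_real s))) has_real_derivative
      dir_deriv (\<gamma>1 (of_real s)) U (\<gamma> (of_real s))) (at s)"
    and "((\<lambda>s. dir_deriv (\<gamma>1 (of_real s)) U (\<gamma> (of_real s))) has_real_derivative
      dir_deriv (\<gamma>1 0) (dir_deriv (\<gamma>1 0) U) (\<gamma> 0) + dir_deriv \<gamma>2 U (\<gamma> 0)) (at 0)"
proof -
  have U1: "Ck_on 1 S U" using Ck_on_mono[of 1 2 S U] U by simp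
  have DU: "Ck_on 1 S (dir_deriv v U)" for v
    using Ck_on_dir_deriv[OF S, of 1 U v] U by (simp add: numeral_2_eq_2)
  have comp: "((\<lambda>s. F (\<gamma> (of_real s))) has_real_derivative dir_deriv (\<gamma>1 (of_real s)) F (\<gamma> (of_real s))) (at s)"
    if F: "Ck_on 1 S F" and s: "\<bar>s\<bar> < d" for F :: "complex^'n \<Rightarrow> real" and s
  proof -
    have m: "\<gamma> (of_real s) \<in> S" using mem s by simp
    have 1: "((\<lambda>s. \<gamma> (of_real s)) has_derivative (\<lambda>h. h *\<^sub>R \<gamma>1 (of_real s))) (at s)"
      by (rule has_derivative_rcoord_curve(2)) (use g s in simp)
    have 2: "(F has_derivative (\<lambda>v. dir_deriv v F (\<gamma> (of_real s)))) (at (\<gamma> (of_real s)))"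
      using has_dir_deriv[OF S, of 0 F] F m by simp
    have "(\<lambda>h. dir_deriv (h *\<^sub>R \<gamma>1 (of_real s)) F (\<gamma> (of_real s))) = (*) (dir_deriv (\<gamma>1 (of_real s)) F (\<gamma> (of_real s)))"
      using linear_scale[OF dir_deriv_linear[OF S m F]] by (auto simp: mult.commute)
    with has_derivative_compose[OF 1 2] show ?thesis by (simp add: has_field_derivative_def)
  qed
  show "((\<lambda>s. U (\<gamma> (of_real s))) has_real_derivative
      dir_deriv (\<gamma>1 (of_real s)) U (\<gamma> (of_real s))) (at s)" if "\<bar>s\<bar> < d" for s
    by (rule comp[OF U1 that])
  have m0: "\<gamma> 0 \<in> S" using mem[of 0] d by simp
  have rc: "((\<lambda>s. rcoord (\<gamma>1 (of_real s)) i) has_real_derivative rcoord \<gamma>2 i) (at 0)" for i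
    by (rule has_derivative_rcoord_curve(1)) (use g1 in simp)
  have cD: "((\<lambda>s. dir_deriv v U (\<gamma> (of_real s))) has_real_derivative
      dir_deriv (\<gamma>1 (of_real 0)) (dir_deriv v U) (\<gamma> (of_real 0))) (at 0)" for v
    by (rule comp[OF DU]) (use d in simp)
  have "((\<lambda>s. \<Sum>i\<in>UNIV. rcoord (\<gamma>1 (of_real s)) i * dir_deriv (cdir i) U (\<gamma> (of_real s))) has_real_derivative
      (\<Sum>i\<in>UNIV. rcoord (\<gamma>1 (of_real 0)) i * dir_deriv (\<gamma>1 (of_real 0)) (dir_deriv (cdir i) U) (\<gamma> (of_real 0))
        + rcoord \<gamma>2 i * dir_deriv (cdir i) U (\<gamma> (of_real 0)))) (at 0)"
    by (intro DERIV_sum DERIV_mult' rc cD)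
  then have "((\<lambda>s. \<Sum>i\<in>UNIV. rcoord (\<gamma>1 (of_real s)) i * dir_deriv (cdir i) U (\<gamma> (of_real s))) has_real_derivative
      (\<Sum>i\<in>UNIV. rcoord (\<gamma>1 0) i * dir_deriv (\<gamma>1 0) (dir_deriv (cdir i) U) (\<gamma> 0)
        + rcoord \<gamma>2 i * dir_deriv (cdir i) U (\<gamma> 0))) (at 0)" by (simp only: of_real_0)
  moreover have "(\<Sum>i\<in>UNIV. rcoord (\<gamma>1 0) i * dir_deriv (\<gamma>1 0) (dir_deriv (cdir i) U) (\<gamma> 0)
        + rcoord \<gamma>2 i * dir_deriv (cdir i) U (\<gamma> 0))
      = dir_deriv (\<gamma>1 0) (dir_deriv (\<gamma>1 0) U) (\<gamma> 0) + dir_deriv \<gamma>2 U (\<gamma> 0)"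
  proof -
    have "dir_deriv (\<gamma>1 0) (dir_deriv (\<gamma>1 0) U) (\<gamma> 0)
        = dir_deriv (\<gamma>1 0) (\<lambda>p. \<Sum>i\<in>UNIV. rcoord (\<gamma>1 0) i * dir_deriv (cdir i) U p) (\<gamma> 0)"
      by (rule dir_deriv_cong[OF S m0]) (intro Ck_on_sum Ck_on_cmult DU finite, rule dir_deriv_rcoord[OF S _ U1])
    also have "\<dots> = (\<Sum>i\<in>UNIV. dir_deriv (\<gamma>1 0) (\<lambda>p. rcoord (\<gamma>1 0) i * dir_deriv (cdir i) U p) (\<gamma> 0))"
      by (intro dir_deriv_sum[OF S m0 finite] Ck_on_cmult DU)
    also have "\<dots> = (\<Sum>i\<in>UNIV. rcoord (\<gamma>1 0) i * dir_deriv (\<gamma>1 0) (dir_deriv (cdir i) U) (\<gamma> 0))"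
      by (intro sum.cong refl) (simp add: dir_deriv_mult[OF S m0 Ck_on_const DU] dir_deriv_const)
    finally show ?thesis using dir_deriv_rcoord[OF S m0 U1, of \<gamma>2] by (simp add: sum.distrib)
  qed
  ultimately have "((\<lambda>s. \<Sum>i\<in>UNIV. rcoord (\<gamma>1 (of_real s)) i * dir_deriv (cdir i) U (\<gamma> (of_real s))) has_real_derivative
      dir_deriv (\<gamma>1 0) (dir_deriv (\<gamma>1 0) U) (\<gamma> 0) + dir_deriv \<gamma>2 U (\<gamma> 0)) (at 0)" by simp
  then show "((\<lambda>s. dir_deriv (\<gamma>1 (of_real s)) U (\<gamma> (of_real s))) has_real_derivative
      dir_deriv (\<gamma>1 0) (dir_deriv (\<gamma>1 0) U) (\<gamma> 0) + dir_deriv \<gamma>2 U (\<gamma> 0)) (at 0)"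
    by (rule has_field_derivative_transform_within_open[where S = "{-d<..<d}"])
       (use d mem U1 in \<open>auto simp: dir_deriv_rcoord[OF S]\<close>)
qed

text \<open>The image of a complex line is a holomorphic curve \<open>\<gamma>\<close>. Its acceleration is \<open>\<gamma>2\<close> in the direction \<open>v\<close> and
  \<open>\<i>\<^sup>2 \<gamma>2 = - \<gamma>2\<close> in the direction \<open>\<i> v\<close>, so that the second derivatives of \<open>T\<close> drop out of the sum. A map that is complex
  differentiable at every point has second derivatives along complex lines by Cauchy's integral formula.\<close>

lemma second_derivative_holomorphic_compose:
  fixes T :: "complex^'n \<Rightarrow> complex^'n" and U :: "complex^'n \<Rightarrow> real"
  assumes O: "open O'" "z \<in> O'" and T: "holomorphic_map_on O' T" and S: "open S" "T ` O' \<subseteq> S"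
    and U: "Ck_on 2 S U" and UT: "Ck_on 2 O' (\<lambda>z. U (T z))"
    and L: "(T has_derivative L) (at z)"
  shows "dir_deriv v (dir_deriv v (\<lambda>z. U (T z))) z + dir_deriv (\<i> *s v) (dir_deriv (\<i> *s v) (\<lambda>z. U (T z))) z
    = dir_deriv (L v) (dir_deriv (L v) U) (T z) + dir_deriv (L (\<i> *s v)) (dir_deriv (L (\<i> *s v)) U) (T z)"
proof -
  obtain DT where DT: "\<And>w. w \<in> O' \<Longrightarrow> (T has_derivative DT w) (at w)"
    "\<And>w c v. w \<in> O' \<Longrightarrow> DT w (c *s v) = c *s DT w v"
    using T unfolding holomorphic_map_on_def by metis
  have Lz: "L = DT z" using has_derivative_unique[OF L DT(1)[OF O(2)]] .
  have smul: "bounded_linear (\<lambda>h. h *s w)" for w :: "complex^'n"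
    by (rule linear_conv_bounded_linear[THEN iffD1], rule linearI)
       (auto simp: vec_eq_iff algebra_simps)
  define I where "I = (\<lambda>\<zeta>. z + \<zeta> *s v) -` O'"
  have "continuous_on UNIV (\<lambda>\<zeta>. z + \<zeta> *s v)"
    by (intro continuous_intros linear_continuous_on[OF smul])
  then have "open I" "0 \<in> I" unfolding I_def using O by (auto intro: open_vimage)
  then obtain d where d: "0 < d" "ball 0 d \<subseteq> I" by (meson open_contains_ball)
  have mem: "z + \<zeta> *s v \<in> O'" if "norm \<zeta> < d" for \<zeta> using d that by (auto simp: I_def subset_iff)
  define \<gamma> where "\<gamma> = (\<lambda>\<zeta>. T (z + \<zeta> *s v))"
  define \<gamma>1 where "\<gamma>1 = (\<lambda>\<zeta>. DT (z + \<zeta> *s v) v)"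
  have g: "((\<lambda>\<zeta>. \<gamma> \<zeta> $ l) has_field_derivative \<gamma>1 \<zeta> $ l) (at \<zeta>)" if "norm \<zeta> < d" for \<zeta> l
  proof -
    have 1: "((\<lambda>\<zeta>. z + \<zeta> *s v) has_derivative (\<lambda>h. h *s v)) (at \<zeta>)"
      by (auto intro!: derivative_eq_intros bounded_linear_imp_has_derivative[OF smul])
    have "(\<gamma> has_derivative (\<lambda>h. DT (z + \<zeta> *s v) (h *s v))) (at \<zeta>)"
      unfolding \<gamma>_def by (rule has_derivative_compose[OF 1 DT(1)[OF mem[OF that]]])
    from bounded_linear.has_derivative[OF bounded_linear_vec_nth this]
    have "((\<lambda>\<zeta>. \<gamma> \<zeta> $ l) has_derivative (\<lambda>h. (h *s \<gamma>1 \<zeta>) $ l)) (at \<zeta>)"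
      using DT(2)[OF mem[OF that]] by (simp add: \<gamma>1_def)
    then show ?thesis by (simp add: has_field_derivative_def mult.commute[of _ "\<gamma>1 \<zeta> $ l"])
  qed
  define \<gamma>2 where "\<gamma>2 = (\<chi> l. deriv (\<lambda>\<zeta>. \<gamma>1 \<zeta> $ l) 0)"
  have g1: "((\<lambda>\<zeta>. \<gamma>1 \<zeta> $ l) has_field_derivative \<gamma>2 $ l) (at 0)" for l
  proof -
    have hol: "(\<lambda>\<zeta>. \<gamma> \<zeta> $ l) holomorphic_on ball 0 d"
      unfolding holomorphic_on_open[OF open_ball] by (intro ballI exI) (rule g, simp)
    have "deriv (\<lambda>\<zeta>. \<gamma> \<zeta> $ l) holomorphic_on ball 0 d" by (rule holomorphic_deriv[OF hol]) simp
    moreover have "deriv (\<lambda>\<zeta>. \<gamma> \<zeta> $ l) \<zeta> = \<gamma>1 \<zeta> $ l" if "\<zeta> \<in> ball 0 d" for \<zeta>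
      using g[of \<zeta> l] that by (auto intro: DERIV_imp_deriv)
    ultimately have "(\<lambda>\<zeta>. \<gamma>1 \<zeta> $ l) holomorphic_on ball 0 d" by (metis (no_types, lifting) holomorphic_transform)
    from holomorphic_derivI[OF this, of 0 UNIV] show ?thesis using d by (simp add: \<gamma>2_def)
  qed
  have memS: "\<gamma> \<zeta> \<in> S" if "norm \<zeta> < d" for \<zeta> using mem[OF that] S(2) by (auto simp: \<gamma>_def)
  have UT1: "Ck_on 1 O' (\<lambda>z. U (T z))" using Ck_on_mono[of 1 2 O'] UT by simp
  have DUT: "Ck_on 1 O' (dir_deriv w (\<lambda>z. U (T z)))" for w
    using Ck_on_dir_deriv[OF O(1), of 1 _ w] UT by (simp add: numeral_2_eq_2)
  have real_smul: "of_real s *s w = s *\<^sub>R w" for s and w :: "complex^'n"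
    unfolding vec_eq_iff vector_smult_component vector_scaleR_component by (simp add: scaleR_conv_of_real)
  \<comment> \<open>the second derivative along the line \<open>z + s w\<close> is that of \<open>U\<close> along the image curve \<open>\<delta>\<close>\<close>
  have main: "dir_deriv w (dir_deriv w (\<lambda>z. U (T z))) z
      = dir_deriv (\<delta>1 0) (dir_deriv (\<delta>1 0) U) (T z) + dir_deriv \<delta>2 U (T z)"
    if del: "\<And>\<zeta> l. norm \<zeta> < d \<Longrightarrow> ((\<lambda>\<zeta>. \<delta> \<zeta> $ l) has_field_derivative \<delta>1 \<zeta> $ l) (at \<zeta>)"
      "\<And>l. ((\<lambda>\<zeta>. \<delta>1 \<zeta> $ l) has_field_derivative \<delta>2 $ l) (at 0)"
      "\<And>\<zeta>. norm \<zeta> < d \<Longrightarrow> \<delta> \<zeta> \<in> S" and eq: "\<And>\<zeta>. norm \<zeta> < d \<Longrightarrow> \<delta> \<zeta> = T (z + \<zeta> *s w)"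
      and memw: "\<And>\<zeta>. norm \<zeta> < d \<Longrightarrow> z + \<zeta> *s w \<in> O'" for w \<delta> \<delta>1 \<delta>2
  proof -
    have curve1: "((\<lambda>s. U (\<delta> (of_real s))) has_real_derivative
        dir_deriv (\<delta>1 (of_real s)) U (\<delta> (of_real s))) (at s)" if "\<bar>s\<bar> < d" for s
      by (rule second_derivative_along_curve(1)[where d = d and ?\<gamma>2.0 = \<delta>2, OF S(1) U d(1)]) (use del that in auto)
    have curve2: "((\<lambda>s. dir_deriv (\<delta>1 (of_real s)) U (\<delta> (of_real s))) has_real_derivative
        dir_deriv (\<delta>1 0) (dir_deriv (\<delta>1 0) U) (\<delta> 0) + dir_deriv \<delta>2 U (\<delta> 0)) (at 0)"
      by (rule second_derivative_along_curve(2)[where d = d, OF S(1) U d(1)]) (use del in auto)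
    have memr: "z + s *\<^sub>R w \<in> O'" if "\<bar>s\<bar> < d" for s using memw[of "of_real s"] that by (simp add: real_smul)
    have first: "dir_deriv (\<delta>1 (of_real s)) U (\<delta> (of_real s)) = dir_deriv w (\<lambda>z. U (T z)) (z + s *\<^sub>R w)"
      if s: "\<bar>s\<bar> < d" for s
    proof -
      have "((\<lambda>s. U (T (z + s *\<^sub>R w))) has_real_derivative dir_deriv w (\<lambda>z. U (T z)) (z + s *\<^sub>R w)) (at s)"
        by (rule has_real_derivative_along_line[OF O(1) memr[OF s] UT1])
      then have "((\<lambda>s. U (\<delta> (of_real s))) has_real_derivative dir_deriv w (\<lambda>z. U (T z)) (z + s *\<^sub>R w)) (at s)"
        by (rule has_field_derivative_transform_within_open[where S = "{-d<..<d}"])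
           (use s eq in \<open>auto simp: real_smul\<close>)
      with curve1[OF s] show ?thesis by (rule DERIV_unique)
    qed
    have "((\<lambda>s. dir_deriv w (\<lambda>z. U (T z)) (z + s *\<^sub>R w)) has_real_derivative
        dir_deriv w (dir_deriv w (\<lambda>z. U (T z))) (z + 0 *\<^sub>R w)) (at 0)"
      by (rule has_real_derivative_along_line[OF O(1) _ DUT]) (use O in simp)
    then have "((\<lambda>s. dir_deriv (\<delta>1 (of_real s)) U (\<delta> (of_real s))) has_real_derivative
        dir_deriv w (dir_deriv w (\<lambda>z. U (T z))) (z + 0 *\<^sub>R w)) (at 0)"
      by (rule has_field_derivative_transform_within_open[where S = "{-d<..<d}"])
         (use first d in auto)
    from DERIV_unique[OF this curve2] show ?thesis using eq[of 0] d by simp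
  qed
  have 1: "dir_deriv v (dir_deriv v (\<lambda>z. U (T z))) z = dir_deriv (L v) (dir_deriv (L v) U) (T z) + dir_deriv \<gamma>2 U (T z)"
    using main[OF g g1 memS _ mem] by (simp add: \<gamma>_def \<gamma>1_def Lz)
  have "dir_deriv (\<i> *s v) (dir_deriv (\<i> *s v) (\<lambda>z. U (T z))) z
      = dir_deriv (\<i> *s \<gamma>1 (\<i> * 0)) (dir_deriv (\<i> *s \<gamma>1 (\<i> * 0)) U) (T z) + dir_deriv (- \<gamma>2) U (T z)"
  proof (rule main[where \<delta> = "\<lambda>\<zeta>. \<gamma> (\<i> * \<zeta>)"])
    show "((\<lambda>\<zeta>. \<gamma> (\<i> * \<zeta>) $ l) has_field_derivative (\<i> *s \<gamma>1 (\<i> * \<zeta>)) $ l) (at \<zeta>)" if "norm \<zeta> < d" for \<zeta> l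
    proof -
      have "((\<lambda>\<zeta>. \<gamma> (\<i> * \<zeta>) $ l) has_field_derivative \<gamma>1 (\<i> * \<zeta>) $ l * \<i>) (at \<zeta>)"
        by (rule DERIV_chain2[OF g]) (use that in \<open>auto simp: norm_mult intro!: derivative_eq_intros\<close>)
      then show ?thesis by (simp add: mult.commute)
    qed
    show "((\<lambda>\<zeta>. (\<i> *s \<gamma>1 (\<i> * \<zeta>)) $ l) has_field_derivative (- \<gamma>2) $ l) (at 0)" for l
    proof -
      have "((\<lambda>\<zeta>. \<gamma>1 (\<i> * \<zeta>) $ l) has_field_derivative \<gamma>2 $ l * \<i>) (at 0)"
        by (rule DERIV_chain2) (use g1[of l] in \<open>auto intro!: derivative_eq_intros\<close>)
      from DERIV_cmult[OF this, of \<i>] show ?thesis by (simp add: algebra_simps)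
    qed
  qed (use memS mem in \<open>auto simp: norm_mult \<gamma>_def mult.commute vector_smult_assoc\<close>)
  then have 2: "dir_deriv (\<i> *s v) (dir_deriv (\<i> *s v) (\<lambda>z. U (T z))) z
      = dir_deriv (L (\<i> *s v)) (dir_deriv (L (\<i> *s v)) U) (T z) + dir_deriv (- \<gamma>2) U (T z)"
    using DT(2)[OF O(2)] by (simp add: \<gamma>1_def Lz)
  have U1: "Ck_on 1 S U" using Ck_on_mono[of 1 2 S U] U by simp
  have Tz: "T z \<in> S" using O S(2) by auto
  have "dir_deriv (- \<gamma>2) U (T z) = - dir_deriv \<gamma>2 U (T z)"
    by (rule linear_neg[OF dir_deriv_linear[OF S(1) Tz U1]])
  with 1 2 show ?thesis by simp
qed

section \<open>The complex Hessian and the gradient in a chart\<close>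

definition dolb :: "(complex^'n::finite \<Rightarrow> real) \<Rightarrow> complex^'n \<Rightarrow> complex^'n \<Rightarrow> complex" where
  "dolb U = wirt (\<lambda>z. of_real (U z))"

definition levi_matrix :: "(complex^'n::finite \<Rightarrow> real) \<Rightarrow> complex^'n \<Rightarrow> complex^'n^'n" where
  "levi_matrix U z = (\<chi> j k. wirt (\<lambda>w. wirt_bar (\<lambda>z. of_real (U z)) w (axis k 1)) z (axis j 1))"

definition grad_matrix :: "(complex^'n::finite \<Rightarrow> real) \<Rightarrow> (complex^'n \<Rightarrow> real) \<Rightarrow> complex^'n \<Rightarrow> complex^'n^'n" where
  "grad_matrix U W z = (\<chi> j k. dolb U z (axis j 1) * cnj (dolb W z (axis k 1)))"

lemma i_axis: "\<i> *s axis k 1 = (axis k \<i> :: complex^'n)"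
  by (simp add: vec_eq_iff axis_def)

lemma cdir_simps: "cdir (j, False) = axis j 1" "cdir (j, True) = axis j \<i>"
  by (simp_all add: cdir_def)

lemma frechet_derivative_of_real:
  assumes "open S" "z \<in> S" "Ck_on 1 S U"
  shows "frechet_derivative (\<lambda>z. complex_of_real (U z)) (at z) v = of_real (dir_deriv v U z)"
proof -
  have "(U has_derivative (\<lambda>v. dir_deriv v U z)) (at z)" using has_dir_deriv[of S 0 U z] assms by simp
  then have "((\<lambda>z. complex_of_real (U z)) has_derivative (\<lambda>v. of_real (dir_deriv v U z))) (at z)"
    by (rule has_derivative_of_real)
  from frechet_derivative_at[OF this] show ?thesis by (metis (no_types, lifting))
qed

lemma dolb_eq:
  assumes "open S" "z \<in> S" "Ck_on 1 S U"
  shows "dolb U z v = (of_real (dir_deriv v U z) - \<i> * of_real (dir_deriv (\<i> *s v) U z)) / 2"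
  unfolding dolb_def wirt_def frechet_derivative_of_real[OF assms] ..

lemma levi_matrix_eq:
  fixes U :: "complex^'n::finite \<Rightarrow> real"
  assumes S: "open S" and z: "z \<in> S" and U: "Ck_on 2 S U"
  defines "H \<equiv> \<lambda>i l. dir_deriv (cdir i) (dir_deriv (cdir l) U) z"
  shows "levi_matrix U z $ j $ k
    = (of_real (H (j, False) (k, False) + H (j, True) (k, True))
       + \<i> * of_real (H (j, False) (k, True) - H (j, True) (k, False))) / 4"
proof -
  have U1: "Ck_on 1 S U" using Ck_on_mono[of 1 2 S U] U by simp
  have DU: "Ck_on 1 S (dir_deriv v U)" for v
    using Ck_on_dir_deriv[OF S, of 1 U v] U by (simp add: numeral_2_eq_2)
  define g where "g = (\<lambda>w. (complex_of_real (dir_deriv (cdir (k, False)) U w) + \<i> * of_real (dir_deriv (cdir (k, True)) U w)) / 2)"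
  have g: "wirt_bar (\<lambda>z. of_real (U z)) w (axis k 1) = g w" if "w \<in> S" for w
    unfolding wirt_bar_def frechet_derivative_of_real[OF S that U1] g_def by (simp add: cdir_simps i_axis)
  have der: "(g has_derivative (\<lambda>v. (complex_of_real (dir_deriv v (dir_deriv (cdir (k, False)) U) z)
      + \<i> * of_real (dir_deriv v (dir_deriv (cdir (k, True)) U) z)) / 2)) (at z)"
  proof -
    have "((\<lambda>w. complex_of_real (dir_deriv u U w)) has_derivative (\<lambda>v. of_real (dir_deriv v (dir_deriv u U) z))) (at z)" for u
      using has_dir_deriv[of S 0 "dir_deriv u U" z] DU S z by (intro has_derivative_of_real) simp
    then show ?thesis unfolding g_def divide_inverse
      by (intro has_derivative_mult_left has_derivative_add has_derivative_mult_right)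
  qed
  have "((\<lambda>w. wirt_bar (\<lambda>z. of_real (U z)) w (axis k 1)) has_derivative
      (\<lambda>v. (complex_of_real (dir_deriv v (dir_deriv (cdir (k, False)) U) z)
      + \<i> * of_real (dir_deriv v (dir_deriv (cdir (k, True)) U) z)) / 2)) (at z)"
    by (rule has_derivative_transform_within_open[OF der S z]) (use g in auto)
  from frechet_derivative_at[OF this, symmetric]
  show ?thesis unfolding levi_matrix_def vec_lambda_beta wirt_def H_def i_axis
    by (simp add: cdir_simps[symmetric] field_simps)
qed

lemma Re_trace_levi:
  fixes U :: "complex^'n::finite \<Rightarrow> real"
  assumes S: "open S" and z: "z \<in> S" and U: "Ck_on 2 S U" and h: "\<And>i l. a i l z = hcoef h i l"
  shows "Re (trace (h ** levi_matrix U z)) = loc_lap cdir a U z"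
proof -
  have "loc_lap cdir a U z = (\<Sum>j\<in>UNIV. \<Sum>k\<in>UNIV. Re (h $ k $ j * levi_matrix U z $ j $ k))"
    unfolding loc_lap_def sum_idx sum.distrib[symmetric] h levi_matrix_eq[OF S z U]
    by (intro sum.cong refl) (simp add: hcoef_def eps_def algebra_simps add_divide_distrib diff_divide_distrib)
  also have "\<dots> = (\<Sum>k\<in>UNIV. \<Sum>j\<in>UNIV. Re (h $ k $ j * levi_matrix U z $ j $ k))" by (rule sum.swap)
  finally show ?thesis by (simp add: trace_def matrix_matrix_mult_def)
qed

lemma Re_trace_grad:
  fixes U W :: "complex^'n::finite \<Rightarrow> real"
  assumes S: "open S" and z: "z \<in> S" and U: "Ck_on 1 S U" and W: "Ck_on 1 S W"
    and h: "\<And>i l. a i l z = hcoef h i l"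
  shows "Re (trace (h ** grad_matrix U W z)) = loc_grad cdir a U W z"
proof -
  have "loc_grad cdir a U W z = Re (\<Sum>k\<in>UNIV. \<Sum>j\<in>UNIV. h $ k $ j * dolb U z (axis j 1) * cnj (dolb W z (axis k 1)))"
    unfolding loc_grad_def h hcoef_quadratic dolb_eq[OF S z U] dolb_eq[OF S z W] i_axis cdir_simps ..
  then show ?thesis by (simp add: trace_def matrix_matrix_mult_def grad_matrix_def mult.assoc)
qed

lemma levi_hermitian:
  fixes U :: "complex^'n::finite \<Rightarrow> real"
  assumes S: "open S" and z: "z \<in> S" and U: "Ck_on 2 S U"
  shows "levi_matrix U z $ k $ j = cnj (levi_matrix U z $ j $ k)"
proof -
  have c: "dir_deriv (cdir (k, s)) (dir_deriv (cdir (j, r)) U) z = dir_deriv (cdir (j, r)) (dir_deriv (cdir (k, s)) U) z" for s r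
    by (rule dir_deriv_commute[OF S z U])
  show ?thesis
    unfolding levi_matrix_eq[OF S z U] c[of False False] c[of True True] c[of False True] c[of True False]
    by (simp only: complex_eq_iff) simp
qed

text \<open>On the diagonal the complex Hessian is a quarter of the Laplacian of the restriction to a complex line.\<close>

lemma sesq_levi_diagonal:
  fixes U :: "complex^'n::finite \<Rightarrow> real"
  assumes S: "open S" and z: "z \<in> S" and U: "Ck_on 2 S U"
  shows "sesq (levi_matrix U z) v v
    = of_real ((dir_deriv v (dir_deriv v U) z + dir_deriv (\<i> *s v) (dir_deriv (\<i> *s v) U) z) / 4)"
proof -
  define H where "H = (\<lambda>i l. dir_deriv (cdir i) (dir_deriv (cdir l) U) z)"
  have U1: "Ck_on 1 S U" using Ck_on_mono[of 1 2 S U] U by simp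
  have DU: "Ck_on 1 S (dir_deriv v U)" for v
    using Ck_on_dir_deriv[OF S, of 1 U v] U by (simp add: numeral_2_eq_2)
  have quad: "dir_deriv w (dir_deriv w U) z = (\<Sum>l\<in>UNIV. \<Sum>i\<in>UNIV. rcoord w l * rcoord w i * H i l)" for w
  proof -
    have "dir_deriv w (dir_deriv w U) z = dir_deriv w (\<lambda>p. \<Sum>l\<in>UNIV. rcoord w l * dir_deriv (cdir l) U p) z"
      by (rule dir_deriv_cong[OF S z]) (intro Ck_on_sum Ck_on_cmult DU finite, rule dir_deriv_rcoord[OF S _ U1])
    also have "\<dots> = (\<Sum>l\<in>UNIV. dir_deriv w (\<lambda>p. rcoord w l * dir_deriv (cdir l) U p) z)"
      by (intro dir_deriv_sum[OF S z finite] Ck_on_cmult DU)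
    also have "\<dots> = (\<Sum>l\<in>UNIV. rcoord w l * dir_deriv w (dir_deriv (cdir l) U) z)"
      by (intro sum.cong refl) (simp add: dir_deriv_mult[OF S z Ck_on_const DU] dir_deriv_const)
    also have "\<dots> = (\<Sum>l\<in>UNIV. rcoord w l * (\<Sum>i\<in>UNIV. rcoord w i * H i l))"
      unfolding H_def by (intro sum.cong refl arg_cong2[where f = "(*)"] dir_deriv_rcoord[OF S z DU])
    finally show ?thesis by (simp add: sum_distrib_left mult.assoc)
  qed
  have re: "Re (sesq (levi_matrix U z) v v)
      = (dir_deriv v (dir_deriv v U) z + dir_deriv (\<i> *s v) (dir_deriv (\<i> *s v) U) z) / 4"
  proof -
    have "(\<Sum>l\<in>UNIV. \<Sum>i\<in>UNIV. rcoord v l * rcoord v i * H i l)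
        + (\<Sum>l\<in>UNIV. \<Sum>i\<in>UNIV. rcoord (\<i> *s v) l * rcoord (\<i> *s v) i * H i l)
      = (\<Sum>k\<in>UNIV. \<Sum>j\<in>UNIV. 4 * Re (levi_matrix U z $ j $ k * v $ j * cnj (v $ k)))"
      unfolding sum_idx sum.distrib[symmetric] levi_matrix_eq[OF S z U] H_def[symmetric]
      by (intro sum.cong refl) (simp add: rcoord_def algebra_simps add_divide_distrib diff_divide_distrib H_def)
    also have "\<dots> = (\<Sum>j\<in>UNIV. \<Sum>k\<in>UNIV. 4 * Re (levi_matrix U z $ j $ k * v $ j * cnj (v $ k)))"
      by (rule sum.swap)
    also have "\<dots> = 4 * Re (sesq (levi_matrix U z) v v)"
      by (simp add: sesq_def sum_distrib_left)
    finally show ?thesis unfolding quad by simp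
  qed
  have "cnj (sesq (levi_matrix U z) v v)
      = (\<Sum>j\<in>UNIV. \<Sum>k\<in>UNIV. levi_matrix U z $ k $ j * v $ k * cnj (v $ j))"
  proof -
    have "cnj (levi_matrix U z $ j $ k) = levi_matrix U z $ k $ j" for j k
      by (rule levi_hermitian[OF S z U, symmetric])
    then show ?thesis by (simp add: sesq_def ac_simps)
  qed
  also have "\<dots> = sesq (levi_matrix U z) v v" unfolding sesq_def by (rule sum.swap)
  finally have "Im (sesq (levi_matrix U z) v v) = 0" by (metis complex_cnj_cancel_iff Reals_cnj_iff complex_is_Real_iff)
  with re show ?thesis by (simp add: complex_eq_iff)
qed

text \<open>Both sides are sesquilinear forms, so they need only be compared on the diagonal, where the transformation rule
  is that of second derivatives along complex lines.\<close>

lemma levi_matrix_pullback: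
  fixes T :: "complex^'n::finite \<Rightarrow> complex^'n" and U :: "complex^'n \<Rightarrow> real"
  assumes O: "open O'" "z \<in> O'" and T: "holomorphic_map_on O' T" and S: "open S" "T ` O' \<subseteq> S"
    and U: "Ck_on 2 S U" and UT: "Ck_on 2 O' (\<lambda>z. U (T z))"
    and L: "(T has_derivative (\<lambda>v. J *v v)) (at z)"
  shows "levi_matrix (\<lambda>z. U (T z)) z = transpose J ** levi_matrix U (T z) ** cnj_mat J"
proof (rule sesq_eq_imp_matrix_eq)
  have Tz: "T z \<in> S" using O S by auto
  have diag: "sesq (levi_matrix (\<lambda>z. U (T z)) z) v v = sesq (transpose J ** levi_matrix U (T z) ** cnj_mat J) v v" for v
    unfolding sesq_matrix[symmetric] sesq_levi_diagonal[OF O UT] sesq_levi_diagonal[OF S(1) Tz U]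
      second_derivative_holomorphic_compose[OF O T S U UT L]
    by (simp add: vector_scalar_commute)
  show "sesq (levi_matrix (\<lambda>z. U (T z)) z) v w = sesq (transpose J ** levi_matrix U (T z) ** cnj_mat J) v w" for v w
  proof -
    have "4 * sesq (levi_matrix (\<lambda>z. U (T z)) z) v w = 4 * sesq (transpose J ** levi_matrix U (T z) ** cnj_mat J) v w"
      unfolding sesq_polarization diag ..
    then show ?thesis by simp
  qed
qed

lemma dolb_complex_linear:
  fixes U :: "complex^'n::finite \<Rightarrow> real"
  assumes S: "open S" "z \<in> S" "Ck_on 1 S U"
  shows "dolb U z v = (\<Sum>j\<in>UNIV. v $ j * dolb U z (axis j 1))"
proof -
  have "(\<Sum>j\<in>UNIV. v $ j * dolb U z (axis j 1))
      = (\<Sum>j\<in>UNIV. ((of_real (rcoord v (j, False)) * of_real (dir_deriv (cdir (j, False)) U z)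
          + of_real (rcoord v (j, True)) * of_real (dir_deriv (cdir (j, True)) U z))
        - \<i> * (of_real (rcoord (\<i> *s v) (j, False)) * of_real (dir_deriv (cdir (j, False)) U z)
          + of_real (rcoord (\<i> *s v) (j, True)) * of_real (dir_deriv (cdir (j, True)) U z))) / 2)"
    unfolding dolb_eq[OF S] i_axis unfolding cdir_simps[symmetric]
    by (intro sum.cong refl) (simp add: complex_eq_iff rcoord_def algebra_simps)
  also have "\<dots> = dolb U z v"
    unfolding dolb_eq[OF S] dir_deriv_rcoord[OF S, of v] dir_deriv_rcoord[OF S, of "\<i> *s v"] sum_idx
    by (simp add: sum_divide_distrib[symmetric] sum_subtractf sum_distrib_left[symmetric])
  finally show ?thesis ..
qed

lemma sesq_grad_matrix:
  fixes U W :: "complex^'n::finite \<Rightarrow> real"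
  assumes S: "open S" "z \<in> S" and U: "Ck_on 1 S U" and W: "Ck_on 1 S W"
  shows "sesq (grad_matrix U W z) v w = dolb U z v * cnj (dolb W z w)"
  unfolding dolb_complex_linear[OF S U, of v] dolb_complex_linear[OF S W, of w]
  by (simp add: sesq_def grad_matrix_def sum_product ac_simps)

lemma dir_deriv_compose_map:
  assumes "(T has_derivative L) (at z)" "open S" "T z \<in> S" "Ck_on 1 S U"
  shows "dir_deriv v (\<lambda>z. U (T z)) z = dir_deriv (L v) U (T z)"
proof (rule dir_deriv_eq)
  have "(U has_derivative (\<lambda>v. dir_deriv v U (T z))) (at (T z))" using has_dir_deriv[of S 0 U] assms by simp
  from has_derivative_compose[OF assms(1) this]
  show "((\<lambda>z. U (T z)) has_derivative (\<lambda>v. dir_deriv (L v) U (T z))) (at z)" .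
qed

lemma grad_matrix_pullback:
  fixes T :: "complex^'n::finite \<Rightarrow> complex^'n" and U W :: "complex^'n \<Rightarrow> real"
  assumes O: "open O'" "z \<in> O'" and S: "open S" "T ` O' \<subseteq> S"
    and U: "Ck_on 1 S U" and UT: "Ck_on 1 O' (\<lambda>z. U (T z))"
    and W: "Ck_on 1 S W" and WT: "Ck_on 1 O' (\<lambda>z. W (T z))"
    and L: "(T has_derivative (\<lambda>v. J *v v)) (at z)"
  shows "grad_matrix (\<lambda>z. U (T z)) (\<lambda>z. W (T z)) z = transpose J ** grad_matrix U W (T z) ** cnj_mat J"
proof (rule sesq_eq_imp_matrix_eq)
  have Tz: "T z \<in> S" using O S by auto
  have "dolb (\<lambda>z. F (T z)) z v = dolb F (T z) (J *v v)"
    if "Ck_on 1 S F" "Ck_on 1 O' (\<lambda>z. F (T z))" for F v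
    unfolding dolb_eq[OF O that(2)] dolb_eq[OF S(1) Tz that(1)] dir_deriv_compose_map[OF L S(1) Tz that(1)]
    by (simp add: vector_scalar_commute)
  then show "sesq (grad_matrix (\<lambda>z. U (T z)) (\<lambda>z. W (T z)) z) v w
      = sesq (transpose J ** grad_matrix U W (T z) ** cnj_mat J) v w" for v w
    unfolding sesq_matrix[symmetric] sesq_grad_matrix[OF O UT WT] sesq_grad_matrix[OF S(1) Tz U W]
    using U UT W WT by simp
qed

section \<open>Compact Hermitian manifolds\<close>

text \<open>The polarisation of \<open>grad_norm_sq\<close>.\<close>

definition grad_inner ::
  "('a, 'n::finite) chart set \<Rightarrow> ('a, 'n) metric \<Rightarrow> ('a \<Rightarrow> real) \<Rightarrow> ('a \<Rightarrow> real) \<Rightarrow> 'a \<Rightarrow> real" where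
  "grad_inner A g u w x = (let c = chart_at A x in
     Re (trace (matrix_inv (g c x) ** grad_matrix (u \<circ> chart_inv c) (w \<circ> chart_inv c) (snd c x))))"

definition chart_coef :: "('a, 'n::finite) metric \<Rightarrow> ('a, 'n) chart \<Rightarrow> 'n \<times> bool \<Rightarrow> 'n \<times> bool \<Rightarrow> complex^'n \<Rightarrow> real" where
  "chart_coef g c i l z = hcoef (matrix_inv (g c (chart_inv c z))) i l"

lemma grad_norm_sq_eq: "grad_norm_sq A g u x = grad_inner A g u u x"
  by (simp add: grad_norm_sq_def grad_inner_def Let_def trace_def matrix_matrix_mult_def grad_matrix_def
      dolb_def local_rep_def o_def mult.assoc)

lemma laplacian_eq: "laplacian A g u x = (let c = chart_at A x in
     Re (trace (matrix_inv (g c x) ** levi_matrix (u \<circ> chart_inv c) (snd c x))))"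
  by (simp add: laplacian_def levi_matrix_def local_rep_def o_def Let_def)

lemma levi_matrix_cong:
  assumes S: "open S" "z \<in> S" and W: "Ck_on 2 S W" and eq: "\<And>x. x \<in> S \<Longrightarrow> U x = W x"
  shows "levi_matrix U z = levi_matrix W z"
proof -
  have U: "Ck_on 2 S U" using Ck_on_cong[of S U W 2, OF eq] W by blast
  have W1: "Ck_on 1 S W" using Ck_on_mono[of 1 2 S W] W by simp
  have DW: "Ck_on 1 S (dir_deriv v W)" for v
    using Ck_on_dir_deriv[OF S(1), of 1 W v] W by (simp add: numeral_2_eq_2)
  have "dir_deriv v (dir_deriv w U) z = dir_deriv v (dir_deriv w W) z" for v w
    by (rule dir_deriv_cong[OF S DW]) (rule dir_deriv_cong[OF S(1) _ W1 eq])
  then show ?thesis unfolding vec_eq_iff levi_matrix_eq[OF S U] levi_matrix_eq[OF S W] by simp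
qed

lemma grad_matrix_cong:
  assumes S: "open S" "z \<in> S" and "Ck_on 1 S U'" "\<And>x. x \<in> S \<Longrightarrow> U x = U' x"
    and "Ck_on 1 S W'" "\<And>x. x \<in> S \<Longrightarrow> W x = W' x"
  shows "grad_matrix U W z = grad_matrix U' W' z"
proof -
  have d: "dolb F z v = dolb F' z v" if F': "Ck_on 1 S F'" and eq: "\<And>x. x \<in> S \<Longrightarrow> F x = F' x" for F F' v
  proof -
    have F: "Ck_on 1 S F" using Ck_on_cong[of S F F' 1, OF eq] F' by blast
    have e: "dir_deriv w F z = dir_deriv w F' z" for w by (rule dir_deriv_cong[OF S F' eq])
    show ?thesis unfolding dolb_eq[OF S F] dolb_eq[OF S F'] e ..
  qed
  have "dolb U z v = dolb U' z v" "dolb W z v = dolb W' z v" for v by (rule d; fact)+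
  then show ?thesis unfolding grad_matrix_def by simp
qed

lemma Ck_on_det:
  fixes M :: "_ \<Rightarrow> complex^'n^'n"
  assumes "\<And>i j. Ck_on k S (\<lambda>z. M z $ i $ j)"
  shows "Ck_on k S (\<lambda>z. det (M z))"
  unfolding det_def by (intro Ck_on_sum Ck_on_mult Ck_on_prod Ck_on_const assms finite_permutations finite)

text \<open>By Cramer's rule, the entries of the inverse are quotients of determinants.\<close>

lemma Ck_on_matrix_inv:
  fixes M :: "_ \<Rightarrow> complex^'n^'n"
  assumes M: "\<And>i j. Ck_on k S (\<lambda>z. M z $ i $ j)" and inv: "\<And>z. z \<in> S \<Longrightarrow> invertible (M z)"
  shows "Ck_on k S (\<lambda>z. matrix_inv (M z) $ i $ j)"
proof -
  define D where "D = (\<lambda>z. det (\<chi> r s. if s = i then axis j 1 $ r else M z $ r $ s))"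
  have eq: "matrix_inv (M z) $ i $ j = D z * inverse (det (M z))" if "z \<in> S" for z
  proof -
    have nz: "det (M z) \<noteq> 0" using inv[OF that] by (simp add: invertible_det_nz)
    have "M z *v (matrix_inv (M z) *v axis j 1) = axis j 1"
      by (simp add: matrix_vector_mul_assoc matrix_inv_right[OF inv[OF that]])
    then have e: "matrix_inv (M z) *v axis j 1 = (\<chi> k. det (\<chi> r s. if s = k then axis j 1 $ r else M z $ r $ s) / det (M z))"
      using cramer[OF nz] by blast
    have "(matrix_inv (M z) *v axis j 1) $ i = D z * inverse (det (M z))"
      unfolding e D_def by (simp add: divide_inverse)
    then show ?thesis by (simp add: matrix_vector_mult_def axis_def if_distrib[of "\<lambda>x. _ * x"] cong: if_cong)
  qed
  have C: "Ck_on k S (\<lambda>z. D z * inverse (det (M z)))"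
  proof (intro Ck_on_mult Ck_on_inverse)
    show "Ck_on k S D" unfolding D_def
    proof (rule Ck_on_det)
      show "Ck_on k S (\<lambda>z. (\<chi> r s. if s = i then axis j 1 $ r else M z $ r $ s) $ r $ s)" for r s
        by (cases "s = i") (simp_all add: M Ck_on_const)
    qed
    show "det (M z) \<noteq> 0" if "z \<in> S" for z using inv[OF that] by (simp add: invertible_det_nz)
  qed (rule Ck_on_det[OF M])
  show ?thesis by (rule iffD2[OF Ck_on_cong[OF eq] C])
qed

locale hermitian_manifold =
  fixes A :: "('a::t2_space, 'n::finite) chart set" and g :: "('a, 'n) metric"
  assumes manifold: "compact_hermitian_manifold A g"
begin

lemma atlas: "complex_atlas A" and metric: "hermitian_metric A g" and compact_UNIV: "compact (UNIV :: 'a set)"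
  using manifold by (simp_all only: compact_hermitian_manifold_def)

lemma chart_exists: "\<exists>c\<in>A. x \<in> fst c"
  using atlas unfolding complex_atlas_def by blast

lemma chart_at: "chart_at A x \<in> A" "x \<in> fst (chart_at A x)"
  using someI_ex[of "\<lambda>c. c \<in> A \<and> x \<in> fst c"] chart_exists[of x] unfolding chart_at_def by blast+

lemma
  assumes "c \<in> A"
  shows open_dom: "open (fst c)" and open_img: "open (chart_image c)"
    and homeo: "homeomorphism (fst c) (chart_image c) (snd c) (chart_inv c)"
  using atlas assms unfolding complex_atlas_def by blast+

lemma chart_inv_left: "c \<in> A \<Longrightarrow> x \<in> fst c \<Longrightarrow> chart_inv c (snd c x) = x"
  and chart_inv_right: "c \<in> A \<Longrightarrow> z \<in> chart_image c \<Longrightarrow> snd c (chart_inv c z) = z"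
  and chart_inv_mem: "c \<in> A \<Longrightarrow> z \<in> chart_image c \<Longrightarrow> chart_inv c z \<in> fst c"
  and chart_mem: "x \<in> fst c \<Longrightarrow> snd c x \<in> chart_image c"
  using homeo[of c] unfolding homeomorphism_def chart_image_def by auto

lemma pos_hermitian_metric: "c \<in> A \<Longrightarrow> x \<in> fst c \<Longrightarrow> pos_hermitian (g c x)"
  using metric unfolding hermitian_metric_def pos_hermitian_def by blast

lemma open_overlap:
  assumes "c \<in> A" "d \<in> A"
  shows "open (snd c ` (fst c \<inter> fst d))"
proof -
  have "snd c ` (fst c \<inter> fst d) = chart_image c \<inter> chart_inv c -` fst d"
    using chart_inv_left[OF assms(1)] chart_inv_right[OF assms(1)] chart_inv_mem[OF assms(1)]
    by (auto simp: chart_image_def image_iff)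
  moreover have "continuous_on (chart_image c) (chart_inv c)"
    using homeo[OF assms(1)] by (simp add: homeomorphism_def)
  ultimately show ?thesis
    using continuous_open_preimage[OF _ open_img[OF assms(1)] open_dom[OF assms(2)]] by simp
qed

lemma transition:
  assumes c: "c \<in> A" and d: "d \<in> A" and x: "x \<in> fst c" "x \<in> fst d"
  defines "T \<equiv> snd d \<circ> chart_inv c" and "O' \<equiv> snd c ` (fst c \<inter> fst d)"
  shows "\<exists>J. (T has_derivative (\<lambda>v. J *v v)) (at (snd c x)) \<and>
      g c x = transpose J ** g d x ** cnj_mat J"
    and "holomorphic_map_on O' T" and "T ` O' \<subseteq> chart_image d" and "snd c x \<in> O'" and "T (snd c x) = snd d x"
    and "\<And>z. z \<in> O' \<Longrightarrow> chart_inv d (T z) = chart_inv c z" and "O' \<subseteq> chart_image c"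
proof -
  show hol: "holomorphic_map_on O' T" using atlas c d unfolding complex_atlas_def T_def O'_def by blast
  show z: "snd c x \<in> O'" using x by (auto simp: O'_def)
  show sub: "O' \<subseteq> chart_image c" by (auto simp: O'_def chart_image_def)
  have inv: "chart_inv c (snd c y) = y" if "y \<in> fst c" for y by (rule chart_inv_left[OF c that])
  show "T ` O' \<subseteq> chart_image d" using inv by (auto simp: T_def O'_def intro!: chart_mem)
  show "T (snd c x) = snd d x" using inv x by (simp add: T_def)
  show "chart_inv d (T z) = chart_inv c z" if "z \<in> O'" for z
    using that inv chart_inv_left[OF d] by (auto simp: T_def O'_def)
  obtain L where L: "(T has_derivative L) (at (snd c x))" "\<And>r v. L (r *s v) = r *s L v"
    using hol z unfolding holomorphic_map_on_def by blast
  define J where "J = (\<chi> l j. L (axis j 1) $ l)"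
  have LJ: "L v = J *v v" for v
    unfolding J_def by (rule complex_linear_matrix) (use L has_derivative_linear in auto)
  then have "L = (\<lambda>v. J *v v)" by auto
  with L have der: "(T has_derivative (\<lambda>v. J *v v)) (at (snd c x))" by simp
  have "\<forall>v w. sesq (g c x) v w = sesq (g d x) (J *v v) (J *v w)"
  proof -
    have "frechet_derivative T (at (snd c x)) = (\<lambda>v. J *v v)" using frechet_derivative_at[OF der] by simp
    moreover have "let L = frechet_derivative T (at (snd c x)) in \<forall>v w. sesq (g c x) v w = sesq (g d x) (L v) (L w)"
      using metric c d x unfolding hermitian_metric_def T_def by blast
    ultimately show ?thesis by (simp add: Let_def)
  qed
  then have "g c x = transpose J ** g d x ** cnj_mat J"
    unfolding sesq_matrix by (intro sesq_eq_imp_matrix_eq) blast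
  with der show "\<exists>J. (T has_derivative (\<lambda>v. J *v v)) (at (snd c x)) \<and> g c x = transpose J ** g d x ** cnj_mat J"
    by blast
qed

lemma trace_levi_chart_independent:
  assumes c: "c \<in> A" and d: "d \<in> A" and x: "x \<in> fst c" "x \<in> fst d"
    and Uc: "Ck_on 2 (chart_image c) (u \<circ> chart_inv c)" and Ud: "Ck_on 2 (chart_image d) (u \<circ> chart_inv d)"
  shows "trace (matrix_inv (g c x) ** levi_matrix (u \<circ> chart_inv c) (snd c x))
    = trace (matrix_inv (g d x) ** levi_matrix (u \<circ> chart_inv d) (snd d x))"
proof -
  define T where "T = snd d \<circ> chart_inv c"
  define O' where "O' = snd c ` (fst c \<inter> fst d)"
  note tr = transition[OF c d x, folded T_def O'_def]
  obtain J where J: "(T has_derivative (\<lambda>v. J *v v)) (at (snd c x))" "g c x = transpose J ** g d x ** cnj_mat J"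
    using tr(1) by blast
  have O: "open O'" unfolding O'_def by (rule open_overlap[OF c d])
  have eq: "(u \<circ> chart_inv c) z = (u \<circ> chart_inv d) (T z)" if "z \<in> O'" for z
    using tr(6)[OF that] by simp
  have UT: "Ck_on 2 O' (\<lambda>z. (u \<circ> chart_inv d) (T z))"
    using Ck_on_cong[of O' "u \<circ> chart_inv c" "\<lambda>z. (u \<circ> chart_inv d) (T z)" 2, OF eq]
      Ck_on_subset[OF Uc tr(7)] by blast
  have "levi_matrix (u \<circ> chart_inv c) (snd c x) = levi_matrix (\<lambda>z. (u \<circ> chart_inv d) (T z)) (snd c x)"
    by (rule levi_matrix_cong[OF O tr(4) UT eq])
  also have "\<dots> = transpose J ** levi_matrix (u \<circ> chart_inv d) (snd d x) ** cnj_mat J"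
    using levi_matrix_pullback[OF O tr(4) tr(2) open_img[OF d] tr(3) Ud UT J(1)] by (simp only: tr(5))
  finally show ?thesis
    by (rule trace_inverse_pullback[OF J(2) _ pos_hermitian_invertible pos_hermitian_invertible])
       (use pos_hermitian_metric c d x in auto)
qed

lemma trace_grad_chart_independent:
  assumes c: "c \<in> A" and d: "d \<in> A" and x: "x \<in> fst c" "x \<in> fst d"
    and Uc: "Ck_on 1 (chart_image c) (u \<circ> chart_inv c)" and Ud: "Ck_on 1 (chart_image d) (u \<circ> chart_inv d)"
    and Wc: "Ck_on 1 (chart_image c) (w \<circ> chart_inv c)" and Wd: "Ck_on 1 (chart_image d) (w \<circ> chart_inv d)"
  shows "trace (matrix_inv (g c x) ** grad_matrix (u \<circ> chart_inv c) (w \<circ> chart_inv c) (snd c x))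
    = trace (matrix_inv (g d x) ** grad_matrix (u \<circ> chart_inv d) (w \<circ> chart_inv d) (snd d x))"
proof -
  define T where "T = snd d \<circ> chart_inv c"
  define O' where "O' = snd c ` (fst c \<inter> fst d)"
  note tr = transition[OF c d x, folded T_def O'_def]
  obtain J where J: "(T has_derivative (\<lambda>v. J *v v)) (at (snd c x))" "g c x = transpose J ** g d x ** cnj_mat J"
    using tr(1) by blast
  have O: "open O'" unfolding O'_def by (rule open_overlap[OF c d])
  have eq: "(f \<circ> chart_inv c) z = (f \<circ> chart_inv d) (T z)" if "z \<in> O'" for z and f :: "'a \<Rightarrow> real"
    using tr(6)[OF that] by simp
  have UT: "Ck_on 1 O' (\<lambda>z. (f \<circ> chart_inv d) (T z))" if "Ck_on 1 (chart_image c) (f \<circ> chart_inv c)" for f :: "'a \<Rightarrow> real"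
    using Ck_on_cong[of O' "f \<circ> chart_inv c" "\<lambda>z. (f \<circ> chart_inv d) (T z)" 1, OF eq]
      Ck_on_subset[OF that tr(7)] by blast
  have "grad_matrix (u \<circ> chart_inv c) (w \<circ> chart_inv c) (snd c x)
      = grad_matrix (\<lambda>z. (u \<circ> chart_inv d) (T z)) (\<lambda>z. (w \<circ> chart_inv d) (T z)) (snd c x)"
    by (rule grad_matrix_cong[OF O tr(4) UT[OF Uc] eq UT[OF Wc] eq])
  also have "\<dots> = transpose J ** grad_matrix (u \<circ> chart_inv d) (w \<circ> chart_inv d) (snd d x) ** cnj_mat J"
    using grad_matrix_pullback[OF O tr(4) open_img[OF d] tr(3) Ud UT[OF Uc] Wd UT[OF Wc] J(1)] by (simp only: tr(5))
  finally show ?thesis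
    by (rule trace_inverse_pullback[OF J(2) _ pos_hermitian_invertible pos_hermitian_invertible])
       (use pos_hermitian_metric c d x in auto)
qed

lemma laplacian_in_chart:
  assumes c: "c \<in> A" and x: "x \<in> fst c" and u: "\<And>d. d \<in> A \<Longrightarrow> Ck_on 2 (chart_image d) (u \<circ> chart_inv d)"
  shows "laplacian A g u x = loc_lap cdir (chart_coef g c) (u \<circ> chart_inv c) (snd c x)"
proof -
  have "laplacian A g u x = Re (trace (matrix_inv (g c x) ** levi_matrix (u \<circ> chart_inv c) (snd c x)))"
    unfolding laplacian_eq Let_def
    using trace_levi_chart_independent[OF chart_at(1) c chart_at(2) x u[OF chart_at(1)] u[OF c]] by simp
  also have "\<dots> = loc_lap cdir (chart_coef g c) (u \<circ> chart_inv c) (snd c x)"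
    by (rule Re_trace_levi[OF open_img[OF c] chart_mem[OF x] u[OF c]])
       (simp add: chart_coef_def chart_inv_left[OF c x])
  finally show ?thesis .
qed

lemma grad_inner_in_chart:
  assumes c: "c \<in> A" and x: "x \<in> fst c"
    and u: "\<And>d. d \<in> A \<Longrightarrow> Ck_on 1 (chart_image d) (u \<circ> chart_inv d)"
    and w: "\<And>d. d \<in> A \<Longrightarrow> Ck_on 1 (chart_image d) (w \<circ> chart_inv d)"
  shows "grad_inner A g u w x = loc_grad cdir (chart_coef g c) (u \<circ> chart_inv c) (w \<circ> chart_inv c) (snd c x)"
proof -
  have "grad_inner A g u w x
      = Re (trace (matrix_inv (g c x) ** grad_matrix (u \<circ> chart_inv c) (w \<circ> chart_inv c) (snd c x)))"
    unfolding grad_inner_def Let_def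
    using trace_grad_chart_independent[OF chart_at(1) c chart_at(2) x u[OF chart_at(1)] u[OF c]
        w[OF chart_at(1)] w[OF c]] by simp
  also have "\<dots> = loc_grad cdir (chart_coef g c) (u \<circ> chart_inv c) (w \<circ> chart_inv c) (snd c x)"
    by (rule Re_trace_grad[OF open_img[OF c] chart_mem[OF x] u[OF c] w[OF c]])
       (simp add: chart_coef_def chart_inv_left[OF c x])
  finally show ?thesis .
qed

lemma Ck_chart_coef:
  assumes c: "c \<in> A" shows "Ck_on k (chart_image c) (chart_coef g c i l)"
proof -
  have sm: "Ck_on k (chart_image c) (g c \<circ> chart_inv c)"
    using metric c unfolding hermitian_metric_def smooth_on_def by blast
  have ent: "Ck_on k (chart_image c) (\<lambda>z. g c (chart_inv c z) $ r $ s)" for r s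
  proof -
    have "bounded_linear (\<lambda>M :: complex^'n^'n. M $ r $ s)"
      by (rule bounded_linear_compose[OF bounded_linear_vec_nth bounded_linear_vec_nth])
    from Ck_on_bounded_linear[OF this sm] show ?thesis by simp
  qed
  obtain j s m r where il: "i = (j, s)" "l = (m, r)" by (metis surj_pair)
  have inv: "Ck_on k (chart_image c) (\<lambda>z. matrix_inv (g c (chart_inv c z)) $ m $ j)"
    by (rule Ck_on_matrix_inv[OF ent])
       (use pos_hermitian_invertible pos_hermitian_metric[OF c chart_inv_mem[OF c]] in blast)
  have "bounded_linear (\<lambda>q. Re (q * (eps s * cnj (eps r) / 4)))"
    by (rule bounded_linear_compose[OF bounded_linear_Re bounded_linear_mult_left])
  from Ck_on_bounded_linear[OF this inv] show ?thesis
    unfolding il chart_coef_def hcoef_def by (simp add: mult.assoc)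
qed

lemma chart_coef_sym: "c \<in> A \<Longrightarrow> z \<in> chart_image c \<Longrightarrow> chart_coef g c i l z = chart_coef g c l i z"
  unfolding chart_coef_def
  by (rule hcoef_sym) (rule pos_hermitian_inverse_hermitian[OF pos_hermitian_metric[OF _ chart_inv_mem]])

lemma chart_coef_pos: "c \<in> A \<Longrightarrow> z \<in> chart_image c \<Longrightarrow> x \<noteq> (\<lambda>i. 0) \<Longrightarrow>
    0 < (\<Sum>i\<in>UNIV. \<Sum>l\<in>UNIV. chart_coef g c i l z * x i * x l)"
  unfolding chart_coef_def by (rule hcoef_pos[OF pos_hermitian_metric[OF _ chart_inv_mem]])

lemma chart_coef_nonneg: "c \<in> A \<Longrightarrow> z \<in> chart_image c \<Longrightarrow>
    0 \<le> (\<Sum>i\<in>UNIV. \<Sum>l\<in>UNIV. chart_coef g c i l z * x i * x l)"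
  unfolding chart_coef_def by (rule hcoef_nonneg[OF pos_hermitian_metric[OF _ chart_inv_mem]])

end

section \<open>Cylinders over charts\<close>

context local_operator begin

lemma loc_grad_cong:
  assumes p: "p \<in> S" and "Ck_on 1 S f'" "\<And>x. x \<in> S \<Longrightarrow> f x = f' x" "Ck_on 1 S h'" "\<And>x. x \<in> S \<Longrightarrow> h x = h' x"
  shows "loc_grad e a f h p = loc_grad e a f' h' p"
proof -
  have "D i f p = D i f' p" "D i h p = D i h' p" for i
    by (rule dir_deriv_cong[OF open_S p]; fact)+
  then show ?thesis by (simp add: loc_grad_def)
qed

lemma loc_lap_cong:
  assumes p: "p \<in> S" and f': "Ck_on 2 S f'" and eq: "\<And>x. x \<in> S \<Longrightarrow> f x = f' x"
  shows "loc_lap e a f p = loc_lap e a f' p"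
proof -
  have "D i (D j f) p = D i (D j f') p" for i j
    by (rule dir_deriv_cong[OF open_S p Ck_D2[OF f']]) (rule dir_deriv_cong[OF open_S _ Ck_21[OF f'] eq])
  then show ?thesis by (simp add: loc_lap_def)
qed

end

definition edir :: "'n::finite \<times> bool \<Rightarrow> (complex^'n) \<times> real" where "edir i = (cdir i, 0)"

abbreviation time :: "(complex^'n::finite) \<times> real" where "time \<equiv> (0, 1)"

context hermitian_manifold begin

text \<open>Over a chart, the operators on slices become an operator on an open set of \<open>\<complex>\<^sup>n \<times> \<real>\<close> with coefficients that do
  not depend on time. In this way derivatives in space and in time are derivatives of one function.\<close>

definition cyl :: "('a, 'n) chart \<Rightarrow> ((complex^'n) \<times> real) set" where
  "cyl c = chart_image c \<times> {0<..<1}"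

definition rep :: "('a, 'n) chart \<Rightarrow> ('a \<Rightarrow> real \<Rightarrow> real) \<Rightarrow> (complex^'n) \<times> real \<Rightarrow> real" where
  "rep c f = (\<lambda>p. f (chart_inv c (fst p)) (snd p))"

definition ecoef :: "('a, 'n) chart \<Rightarrow> 'n \<times> bool \<Rightarrow> 'n \<times> bool \<Rightarrow> (complex^'n) \<times> real \<Rightarrow> real" where
  "ecoef c i l p = chart_coef g c i l (fst p)"

definition Ck_int :: "nat \<Rightarrow> ('a \<Rightarrow> real \<Rightarrow> real) \<Rightarrow> bool" where
  "Ck_int k f \<longleftrightarrow> (\<forall>c\<in>A. Ck_on k (cyl c) (rep c f))"

lemma Ck_intD: "Ck_int k f \<Longrightarrow> c \<in> A \<Longrightarrow> Ck_on k (cyl c) (rep c f)"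
  by (simp add: Ck_int_def)

lemma open_cyl: "c \<in> A \<Longrightarrow> open (cyl c)"
  unfolding cyl_def by (intro open_Times open_img open_greaterThanLessThan)

lemma Ck_fst: "Ck_on k (chart_image c) F \<Longrightarrow> Ck_on k (cyl c) (\<lambda>p. F (fst p))"
  using Ck_on_affine[OF bounded_linear_fst, of 0 "cyl c" "chart_image c" k F] by (auto simp: cyl_def)

lemma dir_deriv_fst:
  assumes c: "c \<in> A" and p: "p \<in> cyl c" and F: "Ck_on 1 (chart_image c) F"
  shows "dir_deriv v (\<lambda>p. F (fst p)) p = dir_deriv (fst v) F (fst p)"
proof (rule dir_deriv_eq)
  have "(F has_derivative (\<lambda>v. dir_deriv v F (fst p))) (at (fst p))"
    using has_dir_deriv[OF open_img[OF c], of 0 F "fst p"] F p by (auto simp: cyl_def)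
  then show "((\<lambda>p. F (fst p)) has_derivative (\<lambda>v. dir_deriv (fst v) F (fst p))) (at p)"
    by (rule has_derivative_compose[OF bounded_linear_imp_has_derivative[OF bounded_linear_fst]])
qed

lemma local_operator_cyl: "c \<in> A \<Longrightarrow> local_operator (cyl c) (ecoef c)"
proof
  assume c: "c \<in> A"
  show "open (cyl c)" by (rule open_cyl[OF c])
  show "ecoef c i j p = ecoef c j i p" if "p \<in> cyl c" for i j p
    unfolding ecoef_def by (rule chart_coef_sym[OF c]) (use that in \<open>auto simp: cyl_def\<close>)
  show "Ck_on k (cyl c) (ecoef c i j)" for k i j
    unfolding ecoef_def[abs_def] by (rule Ck_fst[OF Ck_chart_coef[OF c]])
  show "0 \<le> (\<Sum>i\<in>UNIV. \<Sum>j\<in>UNIV. ecoef c i j p * x i * x j)" if "p \<in> cyl c" for p x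
    unfolding ecoef_def by (rule chart_coef_nonneg[OF c]) (use that in \<open>auto simp: cyl_def\<close>)
qed

lemma ecoef_time: "c \<in> A \<Longrightarrow> p \<in> cyl c \<Longrightarrow> dir_deriv time (ecoef c i j) p = 0"
proof -
  assume c: "c \<in> A" and p: "p \<in> cyl c"
  have F: "Ck_on 1 (chart_image c) (chart_coef g c i j)" by (rule Ck_chart_coef[OF c])
  have "fst p \<in> chart_image c" using p by (auto simp: cyl_def)
  from linear_0[OF dir_deriv_linear[OF open_img[OF c] this F]]
  show ?thesis unfolding ecoef_def[abs_def] dir_deriv_fst[OF c p F] by simp
qed

lemma Ck_slice:
  assumes "Ck_on k (cyl c) F" "0 < t" "t < 1"
  shows "Ck_on k (chart_image c) (\<lambda>z. F (z, t))"
proof -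
  have L: "bounded_linear (\<lambda>z :: complex^'n. (z, 0 :: real))"
    by (intro bounded_linear_Pair bounded_linear_ident bounded_linear_zero)
  have "(\<lambda>z. (z, 0) + (0, t)) ` chart_image c \<subseteq> cyl c" using assms by (auto simp: cyl_def)
  from Ck_on_affine[OF L this assms(1)] show ?thesis by simp
qed

lemma dir_deriv_slice:
  assumes c: "c \<in> A" and F: "Ck_on 1 (cyl c) F" and t: "0 < t" "t < 1" and z: "z \<in> chart_image c"
  shows "dir_deriv v (\<lambda>z. F (z, t)) z = dir_deriv (v, 0) F (z, t)"
proof (rule dir_deriv_eq)
  have "(F has_derivative (\<lambda>v. dir_deriv v F (z, t))) (at (z, t))"
    using has_dir_deriv[OF open_cyl[OF c], of 0 F "(z, t)"] F t z by (auto simp: cyl_def)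
  moreover have "((\<lambda>z. (z, t)) has_derivative (\<lambda>v. (v, 0))) (at z)"
    by (intro has_derivative_Pair has_derivative_ident has_derivative_const)
  ultimately show "((\<lambda>z. F (z, t)) has_derivative (\<lambda>v. dir_deriv (v, 0) F (z, t))) (at z)"
    by (rule has_derivative_compose[rotated])
qed

lemma loc_grad_slice:
  assumes "c \<in> A" "Ck_on 1 (cyl c) F" "Ck_on 1 (cyl c) H" "0 < t" "t < 1" "z \<in> chart_image c"
  shows "loc_grad cdir (chart_coef g c) (\<lambda>z. F (z, t)) (\<lambda>z. H (z, t)) z = loc_grad edir (ecoef c) F H (z, t)"
  using assms by (simp add: loc_grad_def dir_deriv_slice edir_def ecoef_def)

lemma loc_lap_slice:
  assumes c: "c \<in> A" and F: "Ck_on 2 (cyl c) F" and t: "0 < t" "t < 1" and z: "z \<in> chart_image c"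
  shows "loc_lap cdir (chart_coef g c) (\<lambda>z. F (z, t)) z = loc_lap edir (ecoef c) F (z, t)"
proof -
  have F1: "Ck_on 1 (cyl c) F" using Ck_on_mono[of 1 2 "cyl c" F] F by simp
  have DF: "Ck_on 1 (cyl c) (dir_deriv v F)" for v
    using Ck_on_dir_deriv[OF open_cyl[OF c], of 1 F v] F by (simp add: numeral_2_eq_2)
  have "dir_deriv v (dir_deriv w (\<lambda>z. F (z, t))) z = dir_deriv (v, 0) (dir_deriv (w, 0) F) (z, t)" for v w
  proof -
    have "dir_deriv v (dir_deriv w (\<lambda>z. F (z, t))) z = dir_deriv v (\<lambda>z. dir_deriv (w, 0) F (z, t)) z"
      by (rule dir_deriv_cong[OF open_img[OF c] z Ck_slice[OF DF t]]) (rule dir_deriv_slice[OF c F1 t])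
    also have "\<dots> = dir_deriv (v, 0) (dir_deriv (w, 0) F) (z, t)" by (rule dir_deriv_slice[OF c DF t z])
    finally show ?thesis .
  qed
  then show ?thesis by (simp add: loc_lap_def edir_def ecoef_def)
qed

lemma rep_slice: "(\<lambda>y. f y t) \<circ> chart_inv c = (\<lambda>z. rep c f (z, t))"
  by (simp add: rep_def fun_eq_iff)

lemma Ck_rep_slice: "Ck_int k f \<Longrightarrow> 0 < t \<Longrightarrow> t < 1 \<Longrightarrow> d \<in> A \<Longrightarrow>
    Ck_on k (chart_image d) ((\<lambda>y. f y t) \<circ> chart_inv d)"
  unfolding rep_slice by (rule Ck_slice[OF Ck_intD])

lemma laplacian_rep:
  assumes f: "Ck_int 2 f" and t: "0 < t" "t < 1" and c: "c \<in> A" and x: "x \<in> fst c"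
  shows "laplacian A g (\<lambda>y. f y t) x = loc_lap edir (ecoef c) (rep c f) (snd c x, t)"
proof -
  have "laplacian A g (\<lambda>y. f y t) x = loc_lap cdir (chart_coef g c) ((\<lambda>y. f y t) \<circ> chart_inv c) (snd c x)"
    by (rule laplacian_in_chart[OF c x Ck_rep_slice[OF f t]])
  then show ?thesis unfolding rep_slice using loc_lap_slice[OF c Ck_intD[OF f c] t chart_mem[OF x]] by simp
qed

lemma grad_inner_rep:
  assumes f: "Ck_int 1 f" and h: "Ck_int 1 h" and t: "0 < t" "t < 1" and c: "c \<in> A" and x: "x \<in> fst c"
  shows "grad_inner A g (\<lambda>y. f y t) (\<lambda>y. h y t) x = loc_grad edir (ecoef c) (rep c f) (rep c h) (snd c x, t)"
proof -
  have "grad_inner A g (\<lambda>y. f y t) (\<lambda>y. h y t) x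
      = loc_grad cdir (chart_coef g c) ((\<lambda>y. f y t) \<circ> chart_inv c) ((\<lambda>y. h y t) \<circ> chart_inv c) (snd c x)"
    by (rule grad_inner_in_chart[OF c x Ck_rep_slice[OF f t] Ck_rep_slice[OF h t]])
  then show ?thesis unfolding rep_slice
    using loc_grad_slice[OF c Ck_intD[OF f c] Ck_intD[OF h c] t chart_mem[OF x]] by simp
qed

lemma has_dt_rep:
  assumes f: "Ck_int 1 f" and t: "0 < t" "t < 1" and c: "c \<in> A" and x: "x \<in> fst c"
  shows "(f x has_real_derivative dir_deriv time (rep c f) (snd c x, t)) (at t)"
    and "dt f x t = dir_deriv time (rep c f) (snd c x, t)"
proof -
  have "((\<lambda>s. rep c f ((snd c x, 0) + s *\<^sub>R time)) has_real_derivative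
      dir_deriv time (rep c f) ((snd c x, 0) + t *\<^sub>R time)) (at t)"
    by (rule has_real_derivative_along_line[OF open_cyl[OF c] _ Ck_intD[OF f c]])
       (use t chart_mem[OF x] in \<open>simp add: cyl_def\<close>)
  then show der: "(f x has_real_derivative dir_deriv time (rep c f) (snd c x, t)) (at t)"
    by (simp add: rep_def chart_inv_left[OF c x])
  then show "dt f x t = dir_deriv time (rep c f) (snd c x, t)"
    using t unfolding dt_def
    by (simp add: at_within_Icc_at has_real_derivative_iff_has_vector_derivative vector_derivative_at)
qed

lemma cyl_point: "c \<in> A \<Longrightarrow> p \<in> cyl c \<Longrightarrow> chart_inv c (fst p) \<in> fst c \<and> snd c (chart_inv c (fst p)) = fst p
    \<and> 0 < snd p \<and> snd p < 1"
  using chart_inv_mem[of c "fst p"] chart_inv_right[of c "fst p"] by (auto simp: cyl_def)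

lemma rep_laplacian:
  "Ck_int 2 f \<Longrightarrow> c \<in> A \<Longrightarrow> p \<in> cyl c \<Longrightarrow>
    rep c (\<lambda>x t. laplacian A g (\<lambda>y. f y t) x) p = loc_lap edir (ecoef c) (rep c f) p"
  using laplacian_rep[of f "snd p" c "chart_inv c (fst p)"] cyl_point[of c p] by (simp add: rep_def)

lemma rep_grad_inner:
  "Ck_int 1 f \<Longrightarrow> Ck_int 1 h \<Longrightarrow> c \<in> A \<Longrightarrow> p \<in> cyl c \<Longrightarrow>
    rep c (\<lambda>x t. grad_inner A g (\<lambda>y. f y t) (\<lambda>y. h y t) x) p = loc_grad edir (ecoef c) (rep c f) (rep c h) p"
  using grad_inner_rep[of f h "snd p" c "chart_inv c (fst p)"] cyl_point[of c p] by (simp add: rep_def)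

lemma rep_dt:
  "Ck_int 1 f \<Longrightarrow> c \<in> A \<Longrightarrow> p \<in> cyl c \<Longrightarrow> rep c (dt f) p = dir_deriv time (rep c f) p"
  using has_dt_rep(2)[of f "snd p" c "chart_inv c (fst p)"] cyl_point[of c p] by (simp add: rep_def)

lemma Ck_int_mono: "j \<le> k \<Longrightarrow> Ck_int k f \<Longrightarrow> Ck_int j f"
  unfolding Ck_int_def using Ck_on_mono by blast

lemma Ck_int_laplacian:
  assumes f: "Ck_int (Suc (Suc k)) f" shows "Ck_int k (\<lambda>x t. laplacian A g (\<lambda>y. f y t) x)"
  unfolding Ck_int_def
proof
  fix c assume c: "c \<in> A"
  interpret local_operator "cyl c" edir "ecoef c" by (rule local_operator_cyl[OF c])
  have f2: "Ck_int 2 f" using Ck_int_mono[OF _ f, of 2] by simp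
  show "Ck_on k (cyl c) (rep c (\<lambda>x t. laplacian A g (\<lambda>y. f y t) x))"
    by (rule iffD2[OF Ck_on_cong[OF rep_laplacian[OF f2 c]] Ck_loc_lap[OF Ck_intD[OF f c]]])
qed

lemma Ck_int_grad_inner:
  assumes f: "Ck_int (Suc k) f" and h: "Ck_int (Suc k) h"
  shows "Ck_int k (\<lambda>x t. grad_inner A g (\<lambda>y. f y t) (\<lambda>y. h y t) x)"
  unfolding Ck_int_def
proof
  fix c assume c: "c \<in> A"
  interpret local_operator "cyl c" edir "ecoef c" by (rule local_operator_cyl[OF c])
  have f1: "Ck_int 1 f" "Ck_int 1 h" using Ck_int_mono[OF _ f, of 1] Ck_int_mono[OF _ h, of 1] by auto
  show "Ck_on k (cyl c) (rep c (\<lambda>x t. grad_inner A g (\<lambda>y. f y t) (\<lambda>y. h y t) x))"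
    by (rule iffD2[OF Ck_on_cong[OF rep_grad_inner[OF f1 c]] Ck_loc_grad[OF Ck_intD[OF f c] Ck_intD[OF h c]]])
qed

lemma Ck_int_dt:
  assumes f: "Ck_int (Suc k) f" shows "Ck_int k (dt f)"
  unfolding Ck_int_def
proof
  fix c assume c: "c \<in> A"
  have f1: "Ck_int 1 f" using Ck_int_mono[OF _ f, of 1] by simp
  show "Ck_on k (cyl c) (rep c (dt f))"
    by (rule iffD2[OF Ck_on_cong[OF rep_dt[OF f1 c]] Ck_on_dir_deriv[OF open_cyl[OF c] Ck_intD[OF f c]]])
qed

lemma Ck_int_space: "smooth_fun A u \<Longrightarrow> Ck_int k (\<lambda>x t. u x)"
  unfolding Ck_int_def rep_def smooth_fun_def smooth_on_def
  using Ck_fst[of k _ "u \<circ> chart_inv _"] by auto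

text \<open>These are the constants in the Bochner inequality of the chart. The lower bound for the quadratic form is its
  minimum over a closed ball times the unit sphere.\<close>

lemma local_coefficient_bounds:
  assumes c: "c \<in> A" and z0: "z0 \<in> chart_image c"
  shows "\<exists>r>0. \<exists>B lam. 0 < lam \<and> cball z0 r \<subseteq> chart_image c \<and> (\<forall>z\<in>cball z0 r.
    (\<forall>x. lam * (\<Sum>i\<in>UNIV. (x i)\<^sup>2) \<le> (\<Sum>i\<in>UNIV. \<Sum>l\<in>UNIV. chart_coef g c i l z * x i * x l)) \<and>
    (\<forall>i l. \<bar>chart_coef g c i l z\<bar> \<le> B) \<and>
    (\<forall>k i l. \<bar>dir_deriv (cdir k) (chart_coef g c i l) z\<bar> \<le> B) \<and>
    (\<forall>m k i l. \<bar>dir_deriv (cdir m) (dir_deriv (cdir k) (chart_coef g c i l)) z\<bar> \<le> B))"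
proof -
  obtain r where r: "0 < r" "cball z0 r \<subseteq> chart_image c"
    using open_img[OF c] z0 open_contains_cball by blast
  define a where "a = chart_coef g c"
  define Q where "Q = cball z0 r"
  have compQ: "compact Q" and neQ: "Q \<noteq> {}" using r by (auto simp: Q_def)
  have C0: "continuous_on Q (a i l)" for i l
    using Ck_on_imp_continuous[OF Ck_chart_coef[OF c]] r continuous_on_subset unfolding a_def Q_def by blast
  have CD: "Ck_on k (chart_image c) (dir_deriv v (a i l))" for k v i l
    unfolding a_def by (rule Ck_on_dir_deriv[OF open_img[OF c] Ck_chart_coef[OF c]])
  have C1: "continuous_on Q (dir_deriv v (a i l))" for v i l
    using Ck_on_imp_continuous[OF CD] r continuous_on_subset unfolding Q_def by blast
  have C2: "continuous_on Q (dir_deriv w (dir_deriv v (a i l)))" for w v i l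
    using Ck_on_imp_continuous[OF Ck_on_dir_deriv[OF open_img[OF c] CD]] r continuous_on_subset unfolding Q_def by blast
  have bound: "\<exists>B. \<forall>z\<in>Q. \<forall>j. \<bar>F j z\<bar> \<le> B" if F: "\<And>j. continuous_on Q (F j)" for F :: "'j::finite \<Rightarrow> complex^'n \<Rightarrow> real"
  proof -
    have "continuous_on Q (\<lambda>z. \<Sum>j\<in>UNIV. \<bar>F j z\<bar>)" by (intro continuous_intros F)
    then obtain z1 where z1: "\<forall>z\<in>Q. (\<Sum>j\<in>UNIV. \<bar>F j z\<bar>) \<le> (\<Sum>j\<in>UNIV. \<bar>F j z1\<bar>)"
      using continuous_attains_sup[OF compQ neQ] by blast
    have "\<bar>F j z\<bar> \<le> (\<Sum>j\<in>UNIV. \<bar>F j z1\<bar>)" if "z \<in> Q" for j z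
      using member_le_sum[of j UNIV "\<lambda>j. \<bar>F j z\<bar>"] z1 that by fastforce
    then show ?thesis by blast
  qed
  obtain B0 where B0: "\<forall>z\<in>Q. \<forall>j. \<bar>(case j of (i, l) \<Rightarrow> a i l) z\<bar> \<le> B0"
    using bound[of "\<lambda>j. case j of (i, l) \<Rightarrow> a i l"] C0 by (auto simp: split_beta)
  obtain B1 where B1: "\<forall>z\<in>Q. \<forall>j. \<bar>(case j of (k, i, l) \<Rightarrow> dir_deriv (cdir k) (a i l)) z\<bar> \<le> B1"
    using bound[of "\<lambda>j. case j of (k, i, l) \<Rightarrow> dir_deriv (cdir k) (a i l)"] C1 by (auto simp: split_beta)
  obtain B2 where B2: "\<forall>z\<in>Q. \<forall>j. \<bar>(case j of (m, k, i, l) \<Rightarrow> dir_deriv (cdir m) (dir_deriv (cdir k) (a i l))) z\<bar> \<le> B2"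
    using bound[of "\<lambda>j. case j of (m, k, i, l) \<Rightarrow> dir_deriv (cdir m) (dir_deriv (cdir k) (a i l))"] C2
    by (auto simp: split_beta)
  define B where "B = max B0 (max B1 B2)"
  have Ball: "\<bar>a i l z\<bar> \<le> B" "\<bar>dir_deriv (cdir k) (a i l) z\<bar> \<le> B"
      "\<bar>dir_deriv (cdir m) (dir_deriv (cdir k) (a i l)) z\<bar> \<le> B" if "z \<in> Q" for z i l k m
    using bspec[OF B0 that, THEN spec, of "(i, l)"] bspec[OF B1 that, THEN spec, of "(k, i, l)"]
      bspec[OF B2 that, THEN spec, of "(m, k, i, l)"] by (auto simp: B_def)
  define q where "q = (\<lambda>(z, y :: real^('n \<times> bool)). \<Sum>i\<in>UNIV. \<Sum>l\<in>UNIV. a i l z * y $ i * y $ l)"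
  define P where "P = Q \<times> sphere (0 :: real^('n \<times> bool)) 1"
  have "continuous_on P (\<lambda>p. a i l (fst p))" for i l
    by (rule continuous_on_compose2[OF C0]) (auto simp: P_def intro!: continuous_intros)
  then have "continuous_on P q" unfolding q_def split_beta by (intro continuous_intros)
  moreover have "compact P" unfolding P_def by (intro compact_Times compQ compact_sphere)
  moreover have "P \<noteq> {}"
  proof -
    have "(axis undefined 1 :: real^('n \<times> bool)) \<in> sphere 0 1" by (simp add: norm_axis_1)
    then show ?thesis using neQ unfolding P_def by blast
  qed
  ultimately obtain p0 where p0: "p0 \<in> P" "\<forall>p\<in>P. q p0 \<le> q p"
    using continuous_attains_inf[of P q] by blast
  have lam: "0 < q p0"
  proof -
    obtain z y where zy: "p0 = (z, y)" by (cases p0)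
    have y: "norm y = 1" and z: "z \<in> Q" using p0 by (auto simp: zy P_def)
    have "(\<lambda>i. y $ i) \<noteq> (\<lambda>i. 0)"
    proof
      assume "(\<lambda>i. y $ i) = (\<lambda>i. 0)"
      then have "y $ i = 0" for i by (rule fun_cong)
      then have "y = 0" by (simp add: vec_eq_iff)
      then show False using y by simp
    qed
    from chart_coef_pos[OF c _ this] z r show ?thesis unfolding zy q_def a_def Q_def by auto
  qed
  have ell: "q p0 * (\<Sum>i\<in>UNIV. (x i)\<^sup>2) \<le> (\<Sum>i\<in>UNIV. \<Sum>l\<in>UNIV. a i l z * x i * x l)" if z: "z \<in> Q" for z x
  proof (cases "x = (\<lambda>i. 0)")
    case False
    define y :: "real^('n \<times> bool)" where "y = (\<chi> i. x i)"
    define N where "N = norm y"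
    have "y \<noteq> 0" using False by (auto simp: y_def vec_eq_iff fun_eq_iff)
    then have N: "0 < N" by (simp add: N_def)
    have Nsq: "(\<Sum>i\<in>UNIV. (x i)\<^sup>2) = N\<^sup>2"
      unfolding N_def norm_vec_def L2_set_def y_def by (simp add: sum_nonneg)
    have "(z, y /\<^sub>R N) \<in> P" using z N by (simp add: P_def N_def)
    then have "q p0 \<le> (\<Sum>i\<in>UNIV. \<Sum>l\<in>UNIV. a i l z * (x i / N) * (x l / N))"
      using p0(2) by (force simp: q_def y_def divide_inverse mult.commute)
    also have "\<dots> = (\<Sum>i\<in>UNIV. \<Sum>l\<in>UNIV. a i l z * x i * x l) / N\<^sup>2"
      by (simp add: sum_divide_distrib power2_eq_square)
    finally show ?thesis unfolding Nsq using N by (simp add: field_simps)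
  qed simp
  show ?thesis
    using r lam Ball ell unfolding a_def Q_def
    by (intro exI[of _ r] conjI exI[of _ B] exI[of _ "q p0"]) auto
qed

lemma bochner_near:
  "\<exists>N K. open N \<and> x0 \<in> N \<and> 0 \<le> K \<and> (\<forall>f w x t \<kappa>. x \<in> N \<longrightarrow> Ck_int 3 f \<longrightarrow> Ck_int 2 w \<longrightarrow> 0 < t \<longrightarrow> t < 1 \<longrightarrow>
    - K * grad_inner A g (\<lambda>y. f y t) (\<lambda>y. f y t) x \<le>
      laplacian A g (\<lambda>z. grad_inner A g (\<lambda>y. f y t) (\<lambda>y. f y t) z) x / 2
      - grad_inner A g (\<lambda>y. f y t) (\<lambda>z. laplacian A g (\<lambda>y. f y t) z) x
      - \<kappa> * (2 * grad_inner A g (\<lambda>y. w y t) (\<lambda>z. grad_inner A g (\<lambda>y. f y t) (\<lambda>y. w y t) z) x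
             - grad_inner A g (\<lambda>y. f y t) (\<lambda>z. grad_inner A g (\<lambda>y. w y t) (\<lambda>y. w y t) z) x)
      + \<kappa>\<^sup>2 * (grad_inner A g (\<lambda>y. w y t) (\<lambda>y. w y t) x)\<^sup>2)"
proof -
  define c where "c = chart_at A x0"
  have c: "c \<in> A" and x0: "x0 \<in> fst c" unfolding c_def by (rule chart_at)+
  interpret local_operator "cyl c" edir "ecoef c" by (rule local_operator_cyl[OF c])
  obtain r B lam where r: "0 < r" and lam: "0 < lam" and sub: "cball (snd c x0) r \<subseteq> chart_image c"
    and bd: "\<forall>z\<in>cball (snd c x0) r.
      (\<forall>x. lam * (\<Sum>i\<in>UNIV. (x i)\<^sup>2) \<le> (\<Sum>i\<in>UNIV. \<Sum>l\<in>UNIV. chart_coef g c i l z * x i * x l)) \<and>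
      (\<forall>i l. \<bar>chart_coef g c i l z\<bar> \<le> B) \<and>
      (\<forall>k i l. \<bar>dir_deriv (cdir k) (chart_coef g c i l) z\<bar> \<le> B) \<and>
      (\<forall>m k i l. \<bar>dir_deriv (cdir m) (dir_deriv (cdir k) (chart_coef g c i l)) z\<bar> \<le> B)"
    using local_coefficient_bounds[OF c chart_mem[OF x0]] by (elim exE conjE) blast
  define m where "m = real CARD('n \<times> bool)"
  define K where "K = (9 / 4 * B ^ 4 * m ^ 5 / lam\<^sup>2 + B\<^sup>2 * m ^ 3 / 2) / lam"
  define N where "N = fst c \<inter> snd c -` ball (snd c x0) r"
  have "continuous_on (fst c) (snd c)" using homeo[OF c] by (simp add: homeomorphism_def)
  then have "open N" unfolding N_def by (rule continuous_open_preimage[OF _ open_dom[OF c] open_ball])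
  moreover have "x0 \<in> N" using x0 r by (simp add: N_def)
  moreover have "0 \<le> K" using lam by (simp add: K_def m_def)
  moreover have "- K * grad_inner A g (\<lambda>y. f y t) (\<lambda>y. f y t) x \<le>
      laplacian A g (\<lambda>z. grad_inner A g (\<lambda>y. f y t) (\<lambda>y. f y t) z) x / 2
      - grad_inner A g (\<lambda>y. f y t) (\<lambda>z. laplacian A g (\<lambda>y. f y t) z) x
      - \<kappa> * (2 * grad_inner A g (\<lambda>y. w y t) (\<lambda>z. grad_inner A g (\<lambda>y. f y t) (\<lambda>y. w y t) z) x
             - grad_inner A g (\<lambda>y. f y t) (\<lambda>z. grad_inner A g (\<lambda>y. w y t) (\<lambda>y. w y t) z) x)
      + \<kappa>\<^sup>2 * (grad_inner A g (\<lambda>y. w y t) (\<lambda>y. w y t) x)\<^sup>2"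
    if x: "x \<in> N" and f: "Ck_int 3 f" and w: "Ck_int 2 w" and t: "0 < t" "t < 1" for f w x t \<kappa>
  proof -
    have xc: "x \<in> fst c" and zb: "snd c x \<in> cball (snd c x0) r" using x by (auto simp: N_def)
    define p where "p = (snd c x, t)"
    have p: "p \<in> cyl c" using chart_mem[OF xc] t by (simp add: p_def cyl_def)
    have f12: "Ck_int 1 f" "Ck_int 2 f" "Ck_int 1 w"
      using Ck_int_mono[OF _ f, of 1] Ck_int_mono[OF _ f, of 2] Ck_int_mono[OF _ w, of 1] by auto
    note Cf = Ck_intD[OF f c] and Cf1 = Ck_intD[OF f12(1) c] and Cf2 = Ck_intD[OF f12(2) c]
      and Cw = Ck_intD[OF w c] and Cw1 = Ck_intD[OF f12(3) c]
    have Gff: "Ck_int 2 (\<lambda>x t. grad_inner A g (\<lambda>y. f y t) (\<lambda>y. f y t) x)"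
      using Ck_int_grad_inner[of 2 f f] f by simp
    have Gfw: "Ck_int 1 (\<lambda>x t. grad_inner A g (\<lambda>y. f y t) (\<lambda>y. w y t) x)"
      using Ck_int_grad_inner[of 1 f w] f12 w by (simp add: numeral_2_eq_2)
    have Gww: "Ck_int 1 (\<lambda>x t. grad_inner A g (\<lambda>y. w y t) (\<lambda>y. w y t) x)"
      using Ck_int_grad_inner[of 1 w w] w by (simp add: numeral_2_eq_2)
    have Lf: "Ck_int 1 (\<lambda>x t. laplacian A g (\<lambda>y. f y t) x)"
      using Ck_int_laplacian[of 1 f] f by (simp add: numeral_3_eq_3)
    have lff: "Ck_on 2 (cyl c) (loc_grad edir (ecoef c) (rep c f) (rep c f))"
      using Ck_loc_grad[of 2 "rep c f" "rep c f"] Cf by (simp add: numeral_3_eq_3 numeral_2_eq_2)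
    have lfw: "Ck_on 1 (cyl c) (loc_grad edir (ecoef c) (rep c f) (rep c w))"
      "Ck_on 1 (cyl c) (loc_grad edir (ecoef c) (rep c w) (rep c w))"
      using Ck_loc_grad[of 1] Cf2 Cw by (auto simp: numeral_2_eq_2)
    have llf: "Ck_on 1 (cyl c) (loc_lap edir (ecoef c) (rep c f))"
      using Ck_loc_lap[of 1] Cf by (simp add: numeral_3_eq_3)
    have e1: "grad_inner A g (\<lambda>y. f y t) (\<lambda>y. f y t) x = loc_grad edir (ecoef c) (rep c f) (rep c f) p"
      unfolding p_def by (rule grad_inner_rep[OF f12(1,1) t c xc])
    have e2: "grad_inner A g (\<lambda>y. w y t) (\<lambda>y. w y t) x = loc_grad edir (ecoef c) (rep c w) (rep c w) p"
      unfolding p_def by (rule grad_inner_rep[OF f12(3,3) t c xc])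
    have e3: "laplacian A g (\<lambda>z. grad_inner A g (\<lambda>y. f y t) (\<lambda>y. f y t) z) x
        = loc_lap edir (ecoef c) (loc_grad edir (ecoef c) (rep c f) (rep c f)) p"
      unfolding laplacian_rep[OF Gff t c xc, folded p_def]
      by (rule loc_lap_cong[OF p lff rep_grad_inner[OF f12(1,1) c]])
    have e4: "grad_inner A g (\<lambda>y. f y t) (\<lambda>z. laplacian A g (\<lambda>y. f y t) z) x
        = loc_grad edir (ecoef c) (rep c f) (loc_lap edir (ecoef c) (rep c f)) p"
      unfolding grad_inner_rep[OF f12(1) Lf t c xc, folded p_def]
      by (rule loc_grad_cong[OF p Cf1 refl llf rep_laplacian[OF f12(2) c]])
    have e5: "grad_inner A g (\<lambda>y. w y t) (\<lambda>z. grad_inner A g (\<lambda>y. f y t) (\<lambda>y. w y t) z) x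
        = loc_grad edir (ecoef c) (rep c w) (loc_grad edir (ecoef c) (rep c f) (rep c w)) p"
      unfolding grad_inner_rep[OF f12(3) Gfw t c xc, folded p_def]
      by (rule loc_grad_cong[OF p Cw1 refl lfw(1) rep_grad_inner[OF f12(1,3) c]])
    have e6: "grad_inner A g (\<lambda>y. f y t) (\<lambda>z. grad_inner A g (\<lambda>y. w y t) (\<lambda>y. w y t) z) x
        = loc_grad edir (ecoef c) (rep c f) (loc_grad edir (ecoef c) (rep c w) (rep c w)) p"
      unfolding grad_inner_rep[OF f12(1) Gww t c xc, folded p_def]
      by (rule loc_grad_cong[OF p Cf1 refl lfw(2) rep_grad_inner[OF f12(3,3) c]])
    note bz = bspec[OF bd zb]
    have D1: "dir_deriv (edir k) (ecoef c i l) q = dir_deriv (cdir k) (chart_coef g c i l) (fst q)"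
      if "q \<in> cyl c" for k i l q
      unfolding ecoef_def[abs_def] by (subst dir_deriv_fst[OF c that Ck_chart_coef[OF c]]) (simp add: edir_def)
    have D2: "dir_deriv (edir k') (dir_deriv (edir k) (ecoef c i l)) p
        = dir_deriv (cdir k') (dir_deriv (cdir k) (chart_coef g c i l)) (fst p)" for k k' i l
    proof -
      have C: "Ck_on 1 (chart_image c) (dir_deriv (cdir k) (chart_coef g c i l))"
        by (rule Ck_on_dir_deriv[OF open_img[OF c] Ck_chart_coef[OF c]])
      have "dir_deriv (edir k') (dir_deriv (edir k) (ecoef c i l)) p
          = dir_deriv (edir k') (\<lambda>q. dir_deriv (cdir k) (chart_coef g c i l) (fst q)) p"
        by (rule dir_deriv_cong[OF open_cyl[OF c] p Ck_fst[OF C] D1])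
      also have "\<dots> = dir_deriv (cdir k') (dir_deriv (cdir k) (chart_coef g c i l)) (fst p)"
        unfolding dir_deriv_fst[OF c p C] by (simp add: edir_def)
      finally show ?thesis .
    qed
    show ?thesis unfolding e1 e2 e3 e4 e5 e6
    proof (rule local_bochner[OF p Cf Cw lam])
      show "lam * (\<Sum>i\<in>UNIV. (x i)\<^sup>2) \<le> (\<Sum>i\<in>UNIV. \<Sum>j\<in>UNIV. ecoef c i j p * x i * x j)" for x
        using bz unfolding ecoef_def p_def fst_conv by blast
      show "\<bar>ecoef c i j p\<bar> \<le> B" for i j using bz unfolding ecoef_def p_def fst_conv by blast
      show "\<bar>dir_deriv (edir k) (ecoef c i j) p\<bar> \<le> B" for k i j using bz unfolding D1[OF p] unfolding p_def fst_conv by blast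
      show "\<bar>dir_deriv (edir k) (dir_deriv (edir l) (ecoef c i j)) p\<bar> \<le> B" for k l i j
        using bz unfolding D2 unfolding p_def fst_conv by blast
    qed (simp add: K_def m_def)
  qed
  ultimately show ?thesis by (intro exI[of _ N] exI[of _ K] conjI allI impI)
qed

section \<open>The calculus of the Laplacian on a compact Hermitian manifold\<close>

lemma Ck_int_const: "Ck_int k (\<lambda>x t. r)"
  unfolding Ck_int_def rep_def by (auto intro: Ck_on_const)

lemma Ck_int_time: "Ck_int k (\<lambda>x t. t)"
  unfolding Ck_int_def rep_def by (auto intro: Ck_on_linear bounded_linear_snd)

lemma Ck_int_add: "Ck_int k f \<Longrightarrow> Ck_int k h \<Longrightarrow> Ck_int k (\<lambda>x t. f x t + h x t)"
  unfolding Ck_int_def rep_def by (auto intro: Ck_on_add)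

lemma Ck_int_mult: "Ck_int k f \<Longrightarrow> Ck_int k h \<Longrightarrow> Ck_int k (\<lambda>x t. f x t * h x t)"
  unfolding Ck_int_def rep_def by (auto intro: Ck_on_mult)

lemma Ck_int_compose:
  assumes f: "Ck_int 2 f" and T: "\<And>x t. 0 < t \<Longrightarrow> t < 1 \<Longrightarrow> f x t \<in> T"
    and q: "\<And>y. y \<in> T \<Longrightarrow> (q has_real_derivative q' y) (at y)"
      "\<And>y. y \<in> T \<Longrightarrow> (q' has_real_derivative q'' y) (at y)"
    and cont: "continuous_on T q''"
  shows "Ck_int 2 (\<lambda>x t. q (f x t))"
  unfolding Ck_int_def
proof
  fix c assume c: "c \<in> A"
  have "Ck_on 2 (cyl c) (\<lambda>p. q (rep c f p))"
    by (rule Ck_on_2_compose[OF Ck_intD[OF f c] _ q cont]) (auto simp: rep_def cyl_def T)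
  then show "Ck_on 2 (cyl c) (rep c (\<lambda>x t. q (f x t)))" by (simp add: rep_def)
qed

lemma point_in_cyl: "x \<in> fst c \<Longrightarrow> 0 < t \<Longrightarrow> t < 1 \<Longrightarrow> (snd c x, t) \<in> cyl c"
  using chart_mem by (simp add: cyl_def)

lemma rep_at: "c \<in> A \<Longrightarrow> x \<in> fst c \<Longrightarrow> rep c f (snd c x, t) = f x t"
  by (simp add: rep_def chart_inv_left)

lemma grad_inner_nonneg:
  assumes f: "Ck_int 1 f" and t: "0 < t" "t < 1"
  shows "0 \<le> grad_inner A g (\<lambda>y. f y t) (\<lambda>y. f y t) x"
proof -
  interpret local_operator "cyl (chart_at A x)" edir "ecoef (chart_at A x)" by (rule local_operator_cyl[OF chart_at(1)])
  show ?thesis unfolding grad_inner_rep[OF f f t chart_at]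
    by (rule loc_grad_nonneg[OF point_in_cyl[OF chart_at(2) t]])
qed

text \<open>Enlarging the constant preserves the inequality because \<open>|\<nabla>f|\<^sup>2 \<ge> 0\<close>, so the sum of the constants of a finite
  subcover serves everywhere.\<close>

lemma bochner_uniform:
  "\<exists>K\<ge>0. \<forall>f w x t \<kappa>. Ck_int 3 f \<longrightarrow> Ck_int 2 w \<longrightarrow> 0 < t \<longrightarrow> t < 1 \<longrightarrow>
    - K * grad_inner A g (\<lambda>y. f y t) (\<lambda>y. f y t) x \<le>
      laplacian A g (\<lambda>z. grad_inner A g (\<lambda>y. f y t) (\<lambda>y. f y t) z) x / 2
      - grad_inner A g (\<lambda>y. f y t) (\<lambda>z. laplacian A g (\<lambda>y. f y t) z) x
      - \<kappa> * (2 * grad_inner A g (\<lambda>y. w y t) (\<lambda>z. grad_inner A g (\<lambda>y. f y t) (\<lambda>y. w y t) z) x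
             - grad_inner A g (\<lambda>y. f y t) (\<lambda>z. grad_inner A g (\<lambda>y. w y t) (\<lambda>y. w y t) z) x)
      + \<kappa>\<^sup>2 * (grad_inner A g (\<lambda>y. w y t) (\<lambda>y. w y t) x)\<^sup>2"
proof -
  define rhs where "rhs = (\<lambda>f w x (t :: real) \<kappa>.
      laplacian A g (\<lambda>z. grad_inner A g (\<lambda>y. f y t) (\<lambda>y. f y t) z) x / 2
      - grad_inner A g (\<lambda>y. f y t) (\<lambda>z. laplacian A g (\<lambda>y. f y t) z) x
      - \<kappa> * (2 * grad_inner A g (\<lambda>y. w y t) (\<lambda>z. grad_inner A g (\<lambda>y. f y t) (\<lambda>y. w y t) z) x
             - grad_inner A g (\<lambda>y. f y t) (\<lambda>z. grad_inner A g (\<lambda>y. w y t) (\<lambda>y. w y t) z) x)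
      + \<kappa>\<^sup>2 * (grad_inner A g (\<lambda>y. w y t) (\<lambda>y. w y t) x)\<^sup>2)"
  define P where "P = (\<lambda>K x. \<forall>f w t \<kappa>. Ck_int 3 f \<longrightarrow> Ck_int 2 w \<longrightarrow> 0 < t \<longrightarrow> t < 1 \<longrightarrow>
    - K * grad_inner A g (\<lambda>y. f y t) (\<lambda>y. f y t) x \<le> rhs f w x t \<kappa>)"
  define \<N> where "\<N> = {N. open N \<and> (\<exists>K\<ge>0. \<forall>x\<in>N. P K x)}"
  have "\<exists>N\<in>\<N>. x0 \<in> N" for x0
  proof -
    obtain N K where "open N" "x0 \<in> N" "0 \<le> K" and N: "\<forall>f w x t \<kappa>. x \<in> N \<longrightarrow> Ck_int 3 f \<longrightarrow> Ck_int 2 w \<longrightarrow>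
        0 < t \<longrightarrow> t < 1 \<longrightarrow> - K * grad_inner A g (\<lambda>y. f y t) (\<lambda>y. f y t) x \<le> rhs f w x t \<kappa>"
      using bochner_near[of x0] unfolding rhs_def by (elim exE conjE)
    moreover have "\<forall>x\<in>N. P K x" unfolding P_def using N by simp
    ultimately show ?thesis unfolding \<N>_def by blast
  qed
  then have "UNIV \<subseteq> \<Union>\<N>" by blast
  moreover have "\<forall>N\<in>\<N>. open N" by (simp add: \<N>_def)
  ultimately obtain D where D: "D \<subseteq> \<N>" "finite D" "UNIV \<subseteq> \<Union>D"
    using compact_UNIV unfolding compact_eq_Heine_Borel by metis
  have "\<forall>N\<in>D. \<exists>K\<ge>0. \<forall>x\<in>N. P K x" using D(1) unfolding \<N>_def by blast
  then obtain k where k: "\<And>N. N \<in> D \<Longrightarrow> 0 \<le> k N" "\<And>N x. N \<in> D \<Longrightarrow> x \<in> N \<Longrightarrow> P (k N) x" by metis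
  have "P (sum k D) x" for x
  proof -
    obtain N where N: "N \<in> D" "x \<in> N" using D(3) by blast
    have le: "k N \<le> sum k D" by (rule member_le_sum[OF N(1)]) (use k(1) D(2) in auto)
    show ?thesis unfolding P_def
    proof (intro allI impI)
      fix f w and t \<kappa> :: real assume f: "Ck_int 3 f" and w: "Ck_int 2 w" and t: "0 < t" "t < 1"
      have "Ck_int 1 f" using Ck_int_mono[OF _ f, of 1] by simp
      from mult_right_mono[OF le grad_inner_nonneg[OF this t]]
      have "- sum k D * grad_inner A g (\<lambda>y. f y t) (\<lambda>y. f y t) x \<le> - k N * grad_inner A g (\<lambda>y. f y t) (\<lambda>y. f y t) x"
        by simp
      also have "\<dots> \<le> rhs f w x t \<kappa>" using k(2)[OF N] f w t unfolding P_def by blast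
      finally show "- sum k D * grad_inner A g (\<lambda>y. f y t) (\<lambda>y. f y t) x \<le> rhs f w x t \<kappa>" .
    qed
  qed
  moreover have "0 \<le> sum k D" by (rule sum_nonneg) (rule k(1))
  ultimately show ?thesis unfolding P_def rhs_def by blast
qed

lemma laplacian_const: "laplacian A g (\<lambda>y. r) x = 0"
proof -
  interpret local_operator "cyl (chart_at A x)" edir "ecoef (chart_at A x)" by (rule local_operator_cyl[OF chart_at(1)])
  show ?thesis using laplacian_rep[OF Ck_int_const[of 2 r] _ _ chart_at, of "1/2" x]
    by (simp add: rep_def loc_lap_const)
qed

lemma grad_inner_const: "grad_inner A g (\<lambda>y. r) v x = 0"
  by (simp add: grad_inner_def grad_matrix_def dolb_def wirt_def o_def trace_def matrix_matrix_mult_def Let_def)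

lemma laplacian_add:
  assumes f: "Ck_int 2 f" and h: "Ck_int 2 h" and t: "0 < t" "t < 1"
  shows "laplacian A g (\<lambda>y. f y t + h y t) x = laplacian A g (\<lambda>y. f y t) x + laplacian A g (\<lambda>y. h y t) x"
proof -
  define c where "c = chart_at A x"
  have c: "c \<in> A" and x: "x \<in> fst c" unfolding c_def by (rule chart_at)+
  interpret local_operator "cyl c" edir "ecoef c" by (rule local_operator_cyl[OF c])
  show ?thesis
    unfolding laplacian_rep[OF f t c x] laplacian_rep[OF h t c x] laplacian_rep[OF Ck_int_add[OF f h] t c x]
    using loc_lap_add[OF point_in_cyl[OF x t] Ck_intD[OF f c] Ck_intD[OF h c]] by (simp add: rep_def)
qed

lemma laplacian_mult:
  assumes f: "Ck_int 2 f" and h: "Ck_int 2 h" and t: "0 < t" "t < 1"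
  shows "laplacian A g (\<lambda>y. f y t * h y t) x = f x t * laplacian A g (\<lambda>y. h y t) x
    + h x t * laplacian A g (\<lambda>y. f y t) x + 2 * grad_inner A g (\<lambda>y. f y t) (\<lambda>y. h y t) x"
proof -
  define c where "c = chart_at A x"
  have c: "c \<in> A" and x: "x \<in> fst c" unfolding c_def by (rule chart_at)+
  interpret local_operator "cyl c" edir "ecoef c" by (rule local_operator_cyl[OF c])
  have f1: "Ck_int 1 f" "Ck_int 1 h" using Ck_int_mono[OF _ f, of 1] Ck_int_mono[OF _ h, of 1] by auto
  have "loc_lap edir (ecoef c) (rep c (\<lambda>x t. f x t * h x t)) (snd c x, t)
      = loc_lap edir (ecoef c) (\<lambda>p. rep c f p * rep c h p) (snd c x, t)" by (simp add: rep_def)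
  then show ?thesis
    unfolding laplacian_rep[OF f t c x] laplacian_rep[OF h t c x] laplacian_rep[OF Ck_int_mult[OF f h] t c x]
      grad_inner_rep[OF f1 t c x]
    using loc_lap_mult[OF point_in_cyl[OF x t] Ck_intD[OF f c] Ck_intD[OF h c]] by (simp add: rep_at[OF c x])
qed

lemma laplacian_compose:
  assumes f: "Ck_int 2 f" and t: "0 < t" "t < 1"
    and q: "\<And>y. (q has_real_derivative q' y) (at y)"
      "\<And>y. (q' has_real_derivative q'' y) (at y)"
    and cont: "continuous_on UNIV q''"
  shows "laplacian A g (\<lambda>y. q (f y t)) x
    = q' (f x t) * laplacian A g (\<lambda>y. f y t) x + q'' (f x t) * grad_inner A g (\<lambda>y. f y t) (\<lambda>y. f y t) x"
proof -
  define c where "c = chart_at A x"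
  have c: "c \<in> A" and x: "x \<in> fst c" unfolding c_def by (rule chart_at)+
  interpret local_operator "cyl c" edir "ecoef c" by (rule local_operator_cyl[OF c])
  have f1: "Ck_int 1 f" using Ck_int_mono[OF _ f, of 1] by simp
  have qf: "Ck_int 2 (\<lambda>x t. q (f x t))" by (rule Ck_int_compose[OF f _ q cont]) simp
  have "rep c (\<lambda>x t. q (f x t)) = (\<lambda>p. q (rep c f p))" by (simp add: rep_def)
  then show ?thesis
    unfolding laplacian_rep[OF f t c x] laplacian_rep[OF qf t c x] grad_inner_rep[OF f1 f1 t c x]
    using loc_lap_compose[OF point_in_cyl[OF x t] Ck_intD[OF f c] open_UNIV _ q] by (simp add: rep_at[OF c x])
qed

lemma grad_inner_compose:
  assumes f: "Ck_int 1 f" and qf: "Ck_int 1 (\<lambda>x t. q (f x t))" and w: "Ck_int 1 w" and t: "0 < t" "t < 1"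
    and q: "(q has_real_derivative d) (at (f x t))"
  shows "grad_inner A g (\<lambda>y. q (f y t)) (\<lambda>y. w y t) x = d * grad_inner A g (\<lambda>y. f y t) (\<lambda>y. w y t) x"
proof -
  define c where "c = chart_at A x"
  have c: "c \<in> A" and x: "x \<in> fst c" unfolding c_def by (rule chart_at)+
  interpret local_operator "cyl c" edir "ecoef c" by (rule local_operator_cyl[OF c])
  have "rep c (\<lambda>x t. q (f x t)) = (\<lambda>p. q (rep c f p))" by (simp add: rep_def)
  then show ?thesis
    unfolding grad_inner_rep[OF f w t c x] grad_inner_rep[OF qf w t c x]
    using loc_grad_compose[OF point_in_cyl[OF x t] Ck_intD[OF f c], of q d] q by (simp add: rep_at[OF c x])
qed

lemma grad_inner_sym:
  assumes f: "Ck_int 1 f" and h: "Ck_int 1 h" and t: "0 < t" "t < 1"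
  shows "grad_inner A g (\<lambda>y. f y t) (\<lambda>y. h y t) x = grad_inner A g (\<lambda>y. h y t) (\<lambda>y. f y t) x"
proof -
  interpret local_operator "cyl (chart_at A x)" edir "ecoef (chart_at A x)" by (rule local_operator_cyl[OF chart_at(1)])
  show ?thesis unfolding grad_inner_rep[OF f h t chart_at] grad_inner_rep[OF h f t chart_at]
    by (rule loc_grad_sym[OF point_in_cyl[OF chart_at(2) t]])
qed

lemma grad_inner_add:
  assumes f: "Ck_int 1 f" and h: "Ck_int 1 h" and w: "Ck_int 1 w" and t: "0 < t" "t < 1"
  shows "grad_inner A g (\<lambda>y. f y t + h y t) (\<lambda>y. w y t) x
    = grad_inner A g (\<lambda>y. f y t) (\<lambda>y. w y t) x + grad_inner A g (\<lambda>y. h y t) (\<lambda>y. w y t) x"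
proof -
  define c where "c = chart_at A x"
  have c: "c \<in> A" and x: "x \<in> fst c" unfolding c_def by (rule chart_at)+
  interpret local_operator "cyl c" edir "ecoef c" by (rule local_operator_cyl[OF c])
  have "rep c (\<lambda>x t. f x t + h x t) = (\<lambda>p. rep c f p + rep c h p)" by (simp add: rep_def)
  then show ?thesis
    unfolding grad_inner_rep[OF f w t c x] grad_inner_rep[OF h w t c x] grad_inner_rep[OF Ck_int_add[OF f h] w t c x]
    using loc_grad_add[OF point_in_cyl[OF x t] Ck_intD[OF f c] Ck_intD[OF h c]] by simp
qed

lemma grad_inner_mult:
  assumes f: "Ck_int 1 f" and h: "Ck_int 1 h" and w: "Ck_int 1 w" and t: "0 < t" "t < 1"
  shows "grad_inner A g (\<lambda>y. f y t * h y t) (\<lambda>y. w y t) x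
    = f x t * grad_inner A g (\<lambda>y. h y t) (\<lambda>y. w y t) x + h x t * grad_inner A g (\<lambda>y. f y t) (\<lambda>y. w y t) x"
proof -
  define c where "c = chart_at A x"
  have c: "c \<in> A" and x: "x \<in> fst c" unfolding c_def by (rule chart_at)+
  interpret local_operator "cyl c" edir "ecoef c" by (rule local_operator_cyl[OF c])
  have "rep c (\<lambda>x t. f x t * h x t) = (\<lambda>p. rep c f p * rep c h p)" by (simp add: rep_def)
  then show ?thesis
    unfolding grad_inner_rep[OF f w t c x] grad_inner_rep[OF h w t c x] grad_inner_rep[OF Ck_int_mult[OF f h] w t c x]
    using loc_grad_mult[OF point_in_cyl[OF x t] Ck_intD[OF f c] Ck_intD[OF h c]] by (simp add: rep_at[OF c x])
qed

text \<open>Third derivatives commute, and the coefficients in a chart do not depend on time.\<close>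

lemma dt_laplacian:
  assumes f: "Ck_int 3 f" and t: "0 < t" "t < 1"
  shows "dt (\<lambda>x t. laplacian A g (\<lambda>y. f y t) x) x t = laplacian A g (\<lambda>y. dt f y t) x"
proof -
  define c where "c = chart_at A x"
  have c: "c \<in> A" and x: "x \<in> fst c" unfolding c_def by (rule chart_at)+
  interpret local_operator "cyl c" edir "ecoef c" by (rule local_operator_cyl[OF c])
  note p = point_in_cyl[OF x t]
  have f2: "Ck_int 2 f" and f1: "Ck_int 1 f" using Ck_int_mono[OF _ f, of 2] Ck_int_mono[OF _ f, of 1] by auto
  have Lf: "Ck_int 1 (\<lambda>x t. laplacian A g (\<lambda>y. f y t) x)"
    using Ck_int_laplacian[of 1 f] f by (simp add: numeral_3_eq_3)
  have df: "Ck_int 2 (dt f)" using Ck_int_dt[of 2 f] f by (simp add: numeral_3_eq_3 numeral_2_eq_2)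
  have llf: "Ck_on 1 (cyl c) (loc_lap edir (ecoef c) (rep c f))"
    using Ck_loc_lap[of 1 "rep c f"] Ck_intD[OF f c] by (simp add: numeral_3_eq_3)
  have Ddf: "Ck_on 2 (cyl c) (dir_deriv time (rep c f))"
    using Ck_on_dir_deriv[OF open_cyl[OF c], of 2 "rep c f" time] Ck_intD[OF f c] by (simp add: numeral_3_eq_3 numeral_2_eq_2)
  have "dt (\<lambda>x t. laplacian A g (\<lambda>y. f y t) x) x t
      = dir_deriv time (rep c (\<lambda>x t. laplacian A g (\<lambda>y. f y t) x)) (snd c x, t)"
    by (rule has_dt_rep(2)[OF Lf t c x])
  also have "\<dots> = dir_deriv time (loc_lap edir (ecoef c) (rep c f)) (snd c x, t)"
    by (rule dir_deriv_cong[OF open_cyl[OF c] p llf rep_laplacian[OF f2 c]])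
  also have "\<dots> = loc_lap edir (ecoef c) (dir_deriv time (rep c f)) (snd c x, t)"
    by (rule dir_deriv_loc_lap_parallel[OF p Ck_intD[OF f c] ecoef_time[OF c p]])
  also have "\<dots> = loc_lap edir (ecoef c) (rep c (dt f)) (snd c x, t)"
    by (rule loc_lap_cong[OF p Ddf rep_dt[OF f1 c], symmetric])
  also have "\<dots> = laplacian A g (\<lambda>y. dt f y t) x" by (rule laplacian_rep[OF df t c x, symmetric])
  finally show ?thesis .
qed

lemma dt_grad_inner:
  assumes f: "Ck_int 2 f" and h: "Ck_int 2 h" and t: "0 < t" "t < 1"
  shows "dt (\<lambda>x t. grad_inner A g (\<lambda>y. f y t) (\<lambda>y. h y t) x) x t
    = grad_inner A g (\<lambda>y. dt f y t) (\<lambda>y. h y t) x + grad_inner A g (\<lambda>y. f y t) (\<lambda>y. dt h y t) x"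
proof -
  define c where "c = chart_at A x"
  have c: "c \<in> A" and x: "x \<in> fst c" unfolding c_def by (rule chart_at)+
  interpret local_operator "cyl c" edir "ecoef c" by (rule local_operator_cyl[OF c])
  note p = point_in_cyl[OF x t]
  have f1: "Ck_int 1 f" "Ck_int 1 h" using Ck_int_mono[OF _ f, of 1] Ck_int_mono[OF _ h, of 1] by auto
  note Cf1 = Ck_intD[OF f1(1) c] and Ch1 = Ck_intD[OF f1(2) c]
  have Gf: "Ck_int 1 (\<lambda>x t. grad_inner A g (\<lambda>y. f y t) (\<lambda>y. h y t) x)"
    using Ck_int_grad_inner[of 1 f h] f h by (simp add: numeral_2_eq_2)
  have df: "Ck_int 1 (dt f)" "Ck_int 1 (dt h)"
    using Ck_int_dt[of 1 f] Ck_int_dt[of 1 h] f h by (auto simp: numeral_2_eq_2)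
  have lg: "Ck_on 1 (cyl c) (loc_grad edir (ecoef c) (rep c f) (rep c h))"
    using Ck_loc_grad[of 1 "rep c f" "rep c h"] Ck_intD[OF f c] Ck_intD[OF h c] by (simp add: numeral_2_eq_2)
  have D: "Ck_on 1 (cyl c) (dir_deriv time (rep c f))" "Ck_on 1 (cyl c) (dir_deriv time (rep c h))"
    using Ck_on_dir_deriv[OF open_cyl[OF c], of 1 _ time] Ck_intD[OF f c] Ck_intD[OF h c] by (auto simp: numeral_2_eq_2)
  have "dt (\<lambda>x t. grad_inner A g (\<lambda>y. f y t) (\<lambda>y. h y t) x) x t
      = dir_deriv time (rep c (\<lambda>x t. grad_inner A g (\<lambda>y. f y t) (\<lambda>y. h y t) x)) (snd c x, t)"
    by (rule has_dt_rep(2)[OF Gf t c x])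
  also have "\<dots> = dir_deriv time (loc_grad edir (ecoef c) (rep c f) (rep c h)) (snd c x, t)"
    by (rule dir_deriv_cong[OF open_cyl[OF c] p lg rep_grad_inner[OF f1 c]])
  also have "\<dots> = loc_grad edir (ecoef c) (dir_deriv time (rep c f)) (rep c h) (snd c x, t)
      + loc_grad edir (ecoef c) (rep c f) (dir_deriv time (rep c h)) (snd c x, t)"
    by (rule dir_deriv_loc_grad_parallel[OF p Ck_intD[OF f c] Ck_intD[OF h c] ecoef_time[OF c p]])
  also have "loc_grad edir (ecoef c) (dir_deriv time (rep c f)) (rep c h) (snd c x, t)
      = loc_grad edir (ecoef c) (rep c (dt f)) (rep c h) (snd c x, t)"
    by (rule loc_grad_cong[OF p D(1) rep_dt[OF f1(1) c] Ch1 refl, symmetric])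
  also have "loc_grad edir (ecoef c) (rep c f) (dir_deriv time (rep c h)) (snd c x, t)
      = loc_grad edir (ecoef c) (rep c f) (rep c (dt h)) (snd c x, t)"
    by (rule loc_grad_cong[OF p Cf1 refl D(2) rep_dt[OF f1(2) c], symmetric])
  finally show ?thesis
    unfolding grad_inner_rep[OF df(1) f1(2) t c x] grad_inner_rep[OF f1(1) df(2) t c x] .
qed

lemma rep_max:
  assumes c: "c \<in> A" and x: "x \<in> fst c" and max: "\<And>y s. 0 < s \<Longrightarrow> s < 1 \<Longrightarrow> f y s \<le> f x t" and p: "p \<in> cyl c"
  shows "rep c f p \<le> rep c f (snd c x, t)"
  using p max unfolding rep_at[OF c x] by (auto simp: rep_def cyl_def)

lemma grad_inner_at_max:
  assumes f: "Ck_int 2 f" and t: "0 < t" "t < 1" and max: "\<And>y s. 0 < s \<Longrightarrow> s < 1 \<Longrightarrow> f y s \<le> f x t"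
    and w: "Ck_int 1 w"
  shows "grad_inner A g (\<lambda>y. f y t) (\<lambda>y. w y t) x = 0"
proof -
  define c where "c = chart_at A x"
  have c: "c \<in> A" and x: "x \<in> fst c" unfolding c_def by (rule chart_at)+
  interpret local_operator "cyl c" edir "ecoef c" by (rule local_operator_cyl[OF c])
  have f1: "Ck_int 1 f" using Ck_int_mono[OF _ f, of 1] by simp
  have "dir_deriv v (rep c f) (snd c x, t) = 0" for v
    by (rule dir_deriv_at_max(1)[OF point_in_cyl[OF x t] Ck_intD[OF f c]]) (rule rep_max[OF c x], erule (1) max)
  then show ?thesis unfolding grad_inner_rep[OF f1 w t c x] by (simp add: loc_grad_def)
qed

lemma second_order_at_max:
  assumes f: "Ck_int 2 f" and t: "0 < t" "t < 1" and max: "\<And>y s. 0 < s \<Longrightarrow> s < 1 \<Longrightarrow> f y s \<le> f x t"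
    and w: "Ck_int 1 w" and R: "0 < R" "grad_inner A g (\<lambda>y. w y t) (\<lambda>y. w y t) x \<le> R * B"
  shows "B * dt (dt f) x t + R * laplacian A g (\<lambda>y. f y t) x
    - 2 * grad_inner A g (\<lambda>y. w y t) (\<lambda>y. dt f y t) x \<le> 0"
proof -
  define c where "c = chart_at A x"
  have c: "c \<in> A" and x: "x \<in> fst c" unfolding c_def by (rule chart_at)+
  interpret local_operator "cyl c" edir "ecoef c" by (rule local_operator_cyl[OF c])
  note p = point_in_cyl[OF x t]
  have f1: "Ck_int 1 f" using Ck_int_mono[OF _ f, of 1] by simp
  have df: "Ck_int 1 (dt f)" using Ck_int_dt[of 1 f] f by (simp add: numeral_2_eq_2)
  have D: "Ck_on 1 (cyl c) (dir_deriv time (rep c f))"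
    using Ck_on_dir_deriv[OF open_cyl[OF c], of 1 _ time] Ck_intD[OF f c] by (auto simp: numeral_2_eq_2)
  have e1: "dt (dt f) x t = dir_deriv time (dir_deriv time (rep c f)) (snd c x, t)"
    unfolding has_dt_rep(2)[OF df t c x] by (rule dir_deriv_cong[OF open_cyl[OF c] p D rep_dt[OF f1 c]])
  have e2: "grad_inner A g (\<lambda>y. w y t) (\<lambda>y. dt f y t) x
      = loc_grad edir (ecoef c) (rep c w) (dir_deriv time (rep c f)) (snd c x, t)"
    unfolding grad_inner_rep[OF w df t c x]
    by (rule loc_grad_cong[OF p Ck_intD[OF w c] refl D rep_dt[OF f1 c]])
  show ?thesis unfolding e1 e2 laplacian_rep[OF f t c x]
  proof (rule loc_second_order_at_max[OF p Ck_intD[OF f c] _ R(1)])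
    show "rep c f q \<le> rep c f (snd c x, t)" if "q \<in> cyl c" for q
      by (rule rep_max[OF c x _ that]) (rule max)
    show "loc_grad edir (ecoef c) (rep c w) (rep c w) (snd c x, t) \<le> R * B"
      using R(2) by (simp add: grad_inner_rep[OF w w t c x])
  qed
qed

lemma diffusion_cylinder_exists: "\<exists>K. diffusion_cylinder Ck_int (laplacian A g) (grad_inner A g) K"
proof -
  obtain K where K: "0 \<le> K" and bochner: "\<forall>f w x t \<kappa>. Ck_int 3 f \<longrightarrow> Ck_int 2 w \<longrightarrow> 0 < t \<longrightarrow> t < 1 \<longrightarrow>
    - K * grad_inner A g (\<lambda>y. f y t) (\<lambda>y. f y t) x \<le>
      laplacian A g (\<lambda>z. grad_inner A g (\<lambda>y. f y t) (\<lambda>y. f y t) z) x / 2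
      - grad_inner A g (\<lambda>y. f y t) (\<lambda>z. laplacian A g (\<lambda>y. f y t) z) x
      - \<kappa> * (2 * grad_inner A g (\<lambda>y. w y t) (\<lambda>z. grad_inner A g (\<lambda>y. f y t) (\<lambda>y. w y t) z) x
             - grad_inner A g (\<lambda>y. f y t) (\<lambda>z. grad_inner A g (\<lambda>y. w y t) (\<lambda>y. w y t) z) x)
      + \<kappa>\<^sup>2 * (grad_inner A g (\<lambda>y. w y t) (\<lambda>y. w y t) x)\<^sup>2"
    using bochner_uniform by blast
  have "diffusion_cylinder Ck_int (laplacian A g) (grad_inner A g) K"
  proof
    show "compact (UNIV :: 'a set)" by (rule compact_UNIV)
    show "0 \<le> K" by (rule K)
    show "Ck_int k f" if "Ck_int (Suc k) f" for k f using Ck_int_mono[OF _ that, of k] by simp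
    show "Ck_int k (\<lambda>x t. r)" for k r by (rule Ck_int_const)
    show "Ck_int k (\<lambda>x t. t)" for k by (rule Ck_int_time)
    show "(f x has_real_derivative dt f x t) (at t)" if "Ck_int (Suc 0) f" "0 < t" "t < 1" for f x t
      using has_dt_rep[of f t _ x, OF _ that(2,3) chart_at] that(1) by simp
  qed (fact Ck_int_add Ck_int_mult Ck_int_compose Ck_int_dt Ck_int_laplacian Ck_int_grad_inner
      laplacian_const laplacian_add laplacian_mult laplacian_compose grad_inner_const grad_inner_compose grad_inner_sym grad_inner_add
      grad_inner_mult grad_inner_nonneg dt_laplacian dt_grad_inner bochner[rule_format] grad_inner_at_max
      second_order_at_max)+
  then show ?thesis ..
qed

end

section \<open>Continuity up to the ends of the cylinder\<close>

text \<open>For \<open>t = 0\<close> and \<open>t = 1\<close> the derivatives within \<open>U \<times> {0..1}\<close> in space directions are the derivatives of the slices,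
  which are two-sided.\<close>

lemma Ck_on_slice_dir_deriv:
  fixes F :: "'e::real_normed_vector \<times> real \<Rightarrow> real"
  assumes U: "open U" and F: "Ck_on (Suc k) (U \<times> {0..1}) F"
  shows "Ck_on k (U \<times> {0..1}) (\<lambda>p. dir_deriv v (\<lambda>z. F (z, snd p)) (fst p))"
proof -
  obtain F' where F': "\<And>p. p \<in> U \<times> {0..1} \<Longrightarrow> (F has_derivative F' p) (at p within U \<times> {0..1})"
    "\<And>v. Ck_on k (U \<times> {0..1}) (\<lambda>p. F' p v)" using F by (auto simp: Ck_on.simps(2))
  have "dir_deriv v (\<lambda>z. F (z, snd p)) (fst p) = F' p (v, 0)" if p: "p \<in> U \<times> {0..1}" for p
  proof (rule dir_deriv_eq)
    have pz: "fst p \<in> U" and pt: "snd p \<in> {0..1}" using p by auto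
    have "((\<lambda>z. F (z, snd p)) has_derivative (\<lambda>v. F' p (v, 0))) (at (fst p) within U)"
    proof (rule has_derivative_in_compose2[of "U \<times> {0..1}" F F' "\<lambda>z. (z, snd p)" U "fst p", unfolded prod.collapse])
      show "((\<lambda>z. (z, snd p)) has_derivative (\<lambda>v. (v, 0))) (at (fst p) within U)"
        by (intro has_derivative_Pair has_derivative_ident has_derivative_const)
    qed (use F'(1) pz pt in auto)
    then show "((\<lambda>z. F (z, snd p)) has_derivative (\<lambda>v. F' p (v, 0))) (at (fst p))"
      by (simp only: at_within_open[OF pz U])
  qed
  from iffD2[OF Ck_on_cong[OF this] F'(2)] show ?thesis .
qed

lemma Ck_on_slice_time_deriv:
  fixes F :: "'e::real_normed_vector \<times> real \<Rightarrow> real"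
  assumes F: "Ck_on (Suc k) (U \<times> {0..1}) F"
  shows "Ck_on k (U \<times> {0..1}) (\<lambda>p. vector_derivative (\<lambda>s. F (fst p, s)) (at (snd p) within {0..1}))"
proof -
  obtain F' where F': "\<And>p. p \<in> U \<times> {0..1} \<Longrightarrow> (F has_derivative F' p) (at p within U \<times> {0..1})"
    "\<And>v. Ck_on k (U \<times> {0..1}) (\<lambda>p. F' p v)" using F by (auto simp: Ck_on.simps(2))
  have "vector_derivative (\<lambda>s. F (fst p, s)) (at (snd p) within {0..1}) = F' p (0, 1)"
    if p: "p \<in> U \<times> {0..1}" for p
  proof -
    have pz: "fst p \<in> U" and pt: "snd p \<in> {0..1}" using p by auto
    have "((\<lambda>s. F (fst p, s)) has_derivative (\<lambda>h. F' p (0, h))) (at (snd p) within {0..1})"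
    proof (rule has_derivative_in_compose2[of "U \<times> {0..1}" F F' "\<lambda>s. (fst p, s)" "{0..1}" "snd p", unfolded prod.collapse])
      show "((\<lambda>s. (fst p, s)) has_derivative (\<lambda>h. (0, h))) (at (snd p) within {0..1})"
        by (intro has_derivative_Pair has_derivative_ident has_derivative_const)
    qed (use F'(1) pz pt in auto)
    moreover have "(\<lambda>h. F' p (0, h)) = (\<lambda>h. h *\<^sub>R F' p (0, 1))"
    proof
      fix h
      show "F' p (0, h) = h *\<^sub>R F' p (0, 1)"
        using linear_scale[OF has_derivative_linear[OF F'(1)[OF p]], of h "(0, 1)"] by simp
    qed
    ultimately have "((\<lambda>s. F (fst p, s)) has_vector_derivative F' p (0, 1)) (at (snd p) within {0..1})"
      unfolding has_vector_derivative_def by (simp only:)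
    then show ?thesis by (intro vector_derivative_within_closed_interval[OF _ pt]) auto
  qed
  from iffD2[OF Ck_on_cong[OF this] F'(2)] show ?thesis .
qed

context hermitian_manifold begin

definition Ck_closed :: "nat \<Rightarrow> ('a \<Rightarrow> real \<Rightarrow> real) \<Rightarrow> bool" where
  "Ck_closed k f \<longleftrightarrow> (\<forall>c\<in>A. Ck_on k (chart_image c \<times> {0..1}) (rep c f))"

lemma Ck_closed_cylinder: "Ck_cylinder k A f \<longleftrightarrow> Ck_closed k f"
  by (simp add: Ck_cylinder_def Ck_closed_def rep_def case_prod_unfold)

lemma Ck_closed_mono: "j \<le> k \<Longrightarrow> Ck_closed k f \<Longrightarrow> Ck_closed j f"
  unfolding Ck_closed_def using Ck_on_mono by blast

lemma Ck_closed_imp_int: "Ck_closed k f \<Longrightarrow> Ck_int k f"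
  unfolding Ck_closed_def Ck_int_def cyl_def by (auto elim!: Ck_on_subset)

lemma Ck_closed_space:
  assumes "smooth_fun A u" shows "Ck_closed k (\<lambda>x t. u x)"
  unfolding Ck_closed_def
proof
  fix c assume c: "c \<in> A"
  then have "Ck_on k (chart_image c) (u \<circ> chart_inv c)"
    using assms unfolding smooth_fun_def smooth_on_def by blast
  moreover have "(\<lambda>p. fst p + 0) ` (chart_image c \<times> {0..1 :: real}) \<subseteq> chart_image c" by auto
  ultimately have "Ck_on k (chart_image c \<times> {0..1 :: real}) (\<lambda>p. (u \<circ> chart_inv c) (fst p + 0))"
    by (intro Ck_on_affine[OF bounded_linear_fst])
  then show "Ck_on k (chart_image c \<times> {0..1}) (rep c (\<lambda>x t. u x))" by (simp add: rep_def)
qed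

lemma Ck_closed_slice:
  assumes f: "Ck_closed k f" and t: "t \<in> {0..1}" and c: "c \<in> A"
  shows "Ck_on k (chart_image c) ((\<lambda>y. f y t) \<circ> chart_inv c)"
proof -
  have L: "bounded_linear (\<lambda>z :: complex^'n. (z, 0 :: real))"
    by (intro bounded_linear_Pair bounded_linear_ident bounded_linear_zero)
  have "(\<lambda>z. (z, 0) + (0, t)) ` chart_image c \<subseteq> chart_image c \<times> {0..1}" using t by auto
  from Ck_on_affine[OF L this, of k "rep c f"] f c show ?thesis unfolding rep_slice by (simp add: Ck_closed_def)
qed

lemma continuous_on_cylinder:
  assumes "Ck_closed 0 f"
  shows "continuous_on (UNIV \<times> {0..1}) (\<lambda>(x, t). f x t)"
  unfolding continuous_on_eq_continuous_within
proof
  fix p :: "'a \<times> real" assume p: "p \<in> UNIV \<times> {0..1}"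
  define c where "c = chart_at A (fst p)"
  have c: "c \<in> A" and x: "fst p \<in> fst c" unfolding c_def by (rule chart_at)+
  have "continuous_on (fst c) (snd c)" using homeo[OF c] by (simp add: homeomorphism_def)
  then have m: "continuous_on (fst c \<times> {0..1}) (\<lambda>q. (snd c (fst q), snd q))"
    by (intro continuous_on_Pair continuous_on_compose2[OF _ continuous_on_fst[OF continuous_on_id]]
        continuous_on_snd continuous_on_id) auto
  have "continuous_on (chart_image c \<times> {0..1}) (rep c f)" using assms c by (simp add: Ck_closed_def)
  then have "continuous_on (fst c \<times> {0..1}) (\<lambda>q. rep c f (snd c (fst q), snd q))"
    by (rule continuous_on_compose2[OF _ m]) (use chart_mem[of _ c] in auto)
  moreover have "rep c f (snd c (fst q), snd q) = (case q of (x, t) \<Rightarrow> f x t)" if "q \<in> fst c \<times> {0..1}" for q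
    using that chart_inv_left[OF c] by (auto simp: rep_def split_beta)
  ultimately have "continuous_on (fst c \<times> {0..1}) (\<lambda>(x, t). f x t)" by (simp cong: continuous_on_cong)
  then have "continuous (at p within fst c \<times> {0..1}) (\<lambda>(x, t). f x t)"
    unfolding continuous_on_eq_continuous_within by (rule bspec) (use p x in \<open>simp add: mem_Times_iff\<close>)
  moreover have "at p within UNIV \<times> {0..1} = at p within fst c \<times> {0..1}"
    by (rule at_within_nhd[of _ "fst c \<times> UNIV"]) (use x open_dom[OF c] in \<open>auto intro: open_Times simp: mem_Times_iff\<close>)
  ultimately show "continuous (at p within UNIV \<times> {0..1}) (\<lambda>(x, t). f x t)" by simp
qed

lemma continuous_on_coef:
  assumes c: "c \<in> A" shows "continuous_on (chart_image c \<times> {0..1}) (\<lambda>p. chart_coef g c i l (fst p))"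
  by (rule continuous_on_compose2[OF Ck_on_imp_continuous[OF Ck_chart_coef[OF c]]])
     (auto intro!: continuous_intros)

lemma Ck_closed_laplacian:
  assumes f: "Ck_closed 2 f" shows "Ck_closed 0 (\<lambda>x t. laplacian A g (\<lambda>y. f y t) x)"
  unfolding Ck_closed_def Ck_on.simps(1)
proof
  fix c assume c: "c \<in> A"
  have F: "Ck_on (Suc (Suc 0)) (chart_image c \<times> {0..1}) (rep c f)"
    using f c by (simp add: Ck_closed_def numeral_2_eq_2)
  have "continuous_on (chart_image c \<times> {0..1})
      (\<lambda>p. dir_deriv v (dir_deriv w (\<lambda>z. rep c f (z, snd p))) (fst p))" for v w
    using Ck_on_slice_dir_deriv[OF open_img[OF c] Ck_on_slice_dir_deriv[OF open_img[OF c] F], of v w] by simp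
  then have "continuous_on (chart_image c \<times> {0..1})
      (\<lambda>p. loc_lap cdir (chart_coef g c) (\<lambda>z. rep c f (z, snd p)) (fst p))"
    unfolding loc_lap_def by (intro continuous_intros continuous_on_coef[OF c])
  moreover have "rep c (\<lambda>x t. laplacian A g (\<lambda>y. f y t) x) p
      = loc_lap cdir (chart_coef g c) (\<lambda>z. rep c f (z, snd p)) (fst p)" if p: "p \<in> chart_image c \<times> {0..1}" for p
  proof -
    have z: "fst p \<in> chart_image c" and t: "snd p \<in> {0..1}" using p by auto
    show ?thesis
      using laplacian_in_chart[OF c chart_inv_mem[OF c z] Ck_closed_slice[OF f t]]
      unfolding rep_slice chart_inv_right[OF c z] by (simp add: rep_def)
  qed
  ultimately show "continuous_on (chart_image c \<times> {0..1}) (rep c (\<lambda>x t. laplacian A g (\<lambda>y. f y t) x))"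
    by (simp cong: continuous_on_cong)
qed

lemma Ck_closed_grad_inner:
  assumes f: "Ck_closed 1 f" shows "Ck_closed 0 (\<lambda>x t. grad_inner A g (\<lambda>y. f y t) (\<lambda>y. f y t) x)"
  unfolding Ck_closed_def Ck_on.simps(1)
proof
  fix c assume c: "c \<in> A"
  have F: "Ck_on (Suc 0) (chart_image c \<times> {0..1}) (rep c f)" using f c by (simp add: Ck_closed_def)
  have "continuous_on (chart_image c \<times> {0..1}) (\<lambda>p. dir_deriv v (\<lambda>z. rep c f (z, snd p)) (fst p))" for v
    using Ck_on_slice_dir_deriv[OF open_img[OF c] F, of v] by simp
  then have "continuous_on (chart_image c \<times> {0..1})
      (\<lambda>p. loc_grad cdir (chart_coef g c) (\<lambda>z. rep c f (z, snd p)) (\<lambda>z. rep c f (z, snd p)) (fst p))"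
    unfolding loc_grad_def by (intro continuous_intros continuous_on_coef[OF c])
  moreover have "rep c (\<lambda>x t. grad_inner A g (\<lambda>y. f y t) (\<lambda>y. f y t) x) p
      = loc_grad cdir (chart_coef g c) (\<lambda>z. rep c f (z, snd p)) (\<lambda>z. rep c f (z, snd p)) (fst p)"
    if p: "p \<in> chart_image c \<times> {0..1}" for p
  proof -
    have z: "fst p \<in> chart_image c" and t: "snd p \<in> {0..1}" using p by auto
    show ?thesis
      using grad_inner_in_chart[OF c chart_inv_mem[OF c z] Ck_closed_slice[OF f t] Ck_closed_slice[OF f t]]
      unfolding rep_slice chart_inv_right[OF c z] by (simp add: rep_def)
  qed
  ultimately show "continuous_on (chart_image c \<times> {0..1}) (rep c (\<lambda>x t. grad_inner A g (\<lambda>y. f y t) (\<lambda>y. f y t) x))"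
    by (simp cong: continuous_on_cong)
qed

lemma Ck_closed_dt:
  assumes f: "Ck_closed (Suc k) f" shows "Ck_closed k (dt f)"
  unfolding Ck_closed_def
proof
  fix c assume "c \<in> A"
  then have "Ck_on (Suc k) (chart_image c \<times> {0..1}) (rep c f)" using f unfolding Ck_closed_def by blast
  from Ck_on_slice_time_deriv[OF this] show "Ck_on k (chart_image c \<times> {0..1}) (rep c (dt f))"
    unfolding rep_def dt_def fst_conv snd_conv .
qed

lemma continuous_extrema:
  fixes f :: "'a \<Rightarrow> real \<Rightarrow> real"
  assumes "continuous_on (UNIV \<times> {0..1}) (\<lambda>(x, t). f x t :: real)"
  shows "\<exists>B. \<forall>x. \<forall>t\<in>{0..1}. \<bar>f x t\<bar> \<le> B"
    and "(\<And>x t. t \<in> {0..1} \<Longrightarrow> 0 < f x t) \<Longrightarrow> \<exists>c>0. \<forall>x. \<forall>t\<in>{0..1}. c \<le> f x t"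
proof -
  have comp: "compact (UNIV \<times> {0..1} :: ('a \<times> real) set)" by (intro compact_Times compact_UNIV) simp
  have "(undefined, 0) \<in> (UNIV \<times> {0..1} :: ('a \<times> real) set)" by simp
  then have ne: "(UNIV \<times> {0..1} :: ('a \<times> real) set) \<noteq> {}" by blast
  have "continuous_on (UNIV \<times> {0..1}) (\<lambda>p. \<bar>case p of (x, t) \<Rightarrow> f x t\<bar>)" by (intro continuous_intros assms)
  from continuous_attains_sup[OF comp ne this]
  show "\<exists>B. \<forall>x. \<forall>t\<in>{0..1}. \<bar>f x t\<bar> \<le> B" by auto
  show "\<exists>c>0. \<forall>x. \<forall>t\<in>{0..1}. c \<le> f x t" if "\<And>x t. t \<in> {0..1} \<Longrightarrow> 0 < f x t"
  proof -
    obtain p where "p \<in> UNIV \<times> {0..1}" "\<forall>q\<in>UNIV \<times> {0..1}. (\<lambda>(x, t). f x t) p \<le> (\<lambda>(x, t). f x t) q"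
      using continuous_attains_inf[OF comp ne assms] by blast
    with that show ?thesis by (intro exI[of _ "(\<lambda>(x, t). f x t) p"]) auto
  qed
qed

end

section \<open>The estimate on a compact Hermitian manifold\<close>

lemma smooth_fun_cmult: "smooth_fun A u \<Longrightarrow> smooth_fun A (\<lambda>x. r * u x)"
  unfolding smooth_fun_def smooth_on_def o_def by (auto intro: Ck_on_cmult)

context hermitian_manifold begin

lemma smooth_bounds:
  assumes "smooth_fun A u"
  shows "\<exists>B. \<forall>x. \<bar>u x\<bar> \<le> B \<and> \<bar>laplacian A g u x\<bar> \<le> B \<and> grad_inner A g u u x \<le> B"
proof -
  note C = Ck_closed_space[OF assms]
  obtain B0 where B0: "\<forall>x. \<forall>t\<in>{0..1 :: real}. \<bar>u x\<bar> \<le> B0"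
    using continuous_extrema(1)[OF continuous_on_cylinder[OF C]] by blast
  obtain B1 where B1: "\<forall>x. \<forall>t\<in>{0..1 :: real}. \<bar>laplacian A g u x\<bar> \<le> B1"
    using continuous_extrema(1)[OF continuous_on_cylinder[OF Ck_closed_laplacian[OF C]]] by blast
  obtain B2 where B2: "\<forall>x. \<forall>t\<in>{0..1 :: real}. \<bar>grad_inner A g u u x\<bar> \<le> B2"
    using continuous_extrema(1)[OF continuous_on_cylinder[OF Ck_closed_grad_inner[OF C]]] by blast
  have "\<bar>u x\<bar> \<le> B0" "\<bar>laplacian A g u x\<bar> \<le> B1" "\<bar>grad_inner A g u u x\<bar> \<le> B2" for x
    using B0[rule_format, of 0 x] B1[rule_format, of 0 x] B2[rule_format, of 0 x] by auto
  then have "\<bar>u x\<bar> \<le> max B0 (max B1 B2) \<and> \<bar>laplacian A g u x\<bar> \<le> max B0 (max B1 B2)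
      \<and> grad_inner A g u u x \<le> max B0 (max B1 B2)" for x
    by (meson abs_ge_self le_max_iff_disj order_trans)
  then show ?thesis by blast
qed

lemma continuous_on_linearised:
  assumes a: "smooth_fun A a" and f: "Ck_closed 2 f"
  shows "continuous_on (UNIV \<times> {0..1}) (\<lambda>(x, t). n - 2 * a x * f x t + laplacian A g (\<lambda>y. f y t) x)"
proof -
  have "continuous_on (UNIV \<times> {0..1}) (\<lambda>(x, t :: real). a x)"
    by (rule continuous_on_cylinder[OF Ck_closed_space[OF a]])
  moreover have "continuous_on (UNIV \<times> {0..1}) (\<lambda>(x, t). f x t)"
    by (rule continuous_on_cylinder[OF Ck_closed_mono[OF _ f]]) simp
  moreover have "continuous_on (UNIV \<times> {0..1}) (\<lambda>(x, t). laplacian A g (\<lambda>y. f y t) x)"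
    by (rule continuous_on_cylinder[OF Ck_closed_laplacian[OF f]])
  ultimately show ?thesis unfolding case_prod_unfold by (intro continuous_intros)
qed

lemma smooth_lower_bounds:
  assumes a: "smooth_fun A a" and u: "smooth_fun A u" and pos: "\<And>x. 0 < n - 2 * a x * u x + laplacian A g u x"
  shows "\<exists>c>0. \<exists>B. \<forall>x. c \<le> n - 2 * a x * u x + laplacian A g u x \<and> n - 2 * a x * u x + laplacian A g u x \<le> B"
proof -
  have C: "continuous_on (UNIV \<times> {0..1}) (\<lambda>(x, t :: real). n - 2 * a x * u x + laplacian A g u x)"
    by (rule continuous_on_linearised[OF a Ck_closed_space[OF u]])
  obtain B where B: "\<forall>x. \<forall>t\<in>{0..1 :: real}. \<bar>n - 2 * a x * u x + laplacian A g u x\<bar> \<le> B"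
    using continuous_extrema(1)[OF C] by blast
  obtain c where c: "0 < c" "\<forall>x. \<forall>t\<in>{0..1 :: real}. c \<le> n - 2 * a x * u x + laplacian A g u x"
    using continuous_extrema(2)[OF C pos] by blast
  have "c \<le> n - 2 * a x * u x + laplacian A g u x \<and> n - 2 * a x * u x + laplacian A g u x \<le> B" for x
    using bspec[OF spec[OF B], of 0 x] bspec[OF spec[OF c(2)], of 0 x] by auto
  with c(1) show ?thesis by blast
qed

lemma mixed_geodesic_solution:
  assumes dc: "diffusion_cylinder Ck_int (laplacian A g) (grad_inner A g) K"
    and X: "smooth_fun A X" "\<And>x. X x \<le> 0" and psi: "smooth_fun A \<psi>" "\<And>x. 0 < \<psi> x"
    and phi: "Ck_cylinder 4 A \<phi>" and sol: "is_solution A g X \<psi> \<phi>0 \<phi>1 \<phi>"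
    and pos: "\<And>x. 0 < real CARD('n) + real CARD('n) * X x * \<phi>0 x + laplacian A g \<phi>0 x"
      "\<And>x. 0 < real CARD('n) + real CARD('n) * X x * \<phi>1 x + laplacian A g \<phi>1 x"
  shows "mixed_geodesic Ck_int (laplacian A g) (grad_inner A g) K (real CARD('n))
    (\<lambda>x. - (real CARD('n) / 2) * X x) \<psi> \<phi>"
proof -
  define n where "n = real CARD('n)"
  define a where "a = (\<lambda>x. - (n / 2) * X x)"
  have sa: "smooth_fun A a" unfolding a_def by (rule smooth_fun_cmult[OF X(1)])
  have C4: "Ck_closed 4 \<phi>" using phi by (simp only: Ck_closed_cylinder)
  have bd: "\<phi> x 0 = \<phi>0 x" "\<phi> x 1 = \<phi>1 x" for x using sol by (auto simp: is_solution_def Let_def)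
  interpret diffusion_cylinder Ck_int "laplacian A g" "grad_inner A g" K by (rule dc)
  have "mixed_geodesic Ck_int (laplacian A g) (grad_inner A g) K n a \<psi> \<phi>"
  proof
    show "Ck_int k (\<lambda>x t. a x)" for k by (rule Ck_int_space[OF sa])
    show "Ck_int k (\<lambda>x t. \<psi> x)" for k by (rule Ck_int_space[OF psi(1)])
    show "Ck_int 4 \<phi>" by (rule Ck_closed_imp_int[OF C4])
    show "0 \<le> a x" for x using X(2)[of x] by (simp add: a_def n_def mult_nonneg_nonpos)
    show "0 < \<psi> x" for x by (rule psi(2))
    show "dt (dt \<phi>) x t * (n - 2 * a x * \<phi> x t + laplacian A g (\<lambda>y. \<phi> y t) x)
        - grad_inner A g (\<lambda>y. dt \<phi> y t) (\<lambda>y. dt \<phi> y t) x = \<psi> x + a x * (dt \<phi> x t)\<^sup>2"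
      if "0 < t" "t < 1" for t x
    proof -
      have "dt (dt \<phi>) x t * (n + n * X x * \<phi> x t + laplacian A g (\<lambda>y. \<phi> y t) x)
          - grad_norm_sq A g (\<lambda>y. dt \<phi> y t) x = \<psi> x - n * X x * (dt \<phi> x t)\<^sup>2 / 2"
        using sol that unfolding is_solution_def n_def Let_def by auto
      then show ?thesis by (simp add: grad_norm_sq_eq a_def)
    qed
    show "continuous_on (UNIV \<times> {0..1}) (\<lambda>(x, t). \<phi> x t)"
      by (rule continuous_on_cylinder[OF Ck_closed_mono[OF _ C4]]) simp
    show "continuous_on (UNIV \<times> {0..1}) (\<lambda>(x, t). dt \<phi> x t)"
      by (rule continuous_on_cylinder[OF Ck_closed_dt[OF Ck_closed_mono[OF _ C4]]]) simp
    show "continuous_on (UNIV \<times> {0..1}) (\<lambda>(x, t). n - 2 * a x * \<phi> x t + laplacian A g (\<lambda>y. \<phi> y t) x)"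
      by (rule continuous_on_linearised[OF sa Ck_closed_mono[OF _ C4]]) simp
    show "continuous_on (UNIV \<times> {0..1}) (\<lambda>(x, t). grad_inner A g (\<lambda>y. \<phi> y t) (\<lambda>y. \<phi> y t) x)"
      by (rule continuous_on_cylinder[OF Ck_closed_grad_inner[OF Ck_closed_mono[OF _ C4]]]) simp
    show "0 < n - 2 * a x * \<phi> x 0 + laplacian A g (\<lambda>y. \<phi> y 0) x"
      "0 < n - 2 * a x * \<phi> x 1 + laplacian A g (\<lambda>y. \<phi> y 1) x" for x
      using pos[of x] by (simp_all add: bd a_def n_def)
  qed
  then show ?thesis by (simp add: a_def n_def)
qed

end

theorem theorem1p1:
  fixes A :: "('a::t2_space, 'n::finite) chart set"
    and g :: "('a, 'n) metric"
    and p :: nat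
    and X \<psi> \<phi>0 \<phi>1 :: "'a \<Rightarrow> real"
  assumes "compact_hermitian_manifold A g"
    and "1 \<le> p" and "p \<le> CARD('n)"
    and "torsion_function A g p X"
    and "\<forall>x. X x \<le> 0"
    and "smooth_fun A \<psi>" and "\<forall>x. \<psi> x > 0"
    and "\<phi>0 \<in> mixed_volume_forms A g p" and "\<phi>1 \<in> mixed_volume_forms A g p"
    and "\<forall>x. real CARD('n) + real CARD('n) * X x * \<phi>0 x + laplacian A g \<phi>0 x > 0"
    and "\<forall>x. real CARD('n) + real CARD('n) * X x * \<phi>1 x + laplacian A g \<phi>1 x > 0"
  shows "\<exists>C::real. \<forall>\<phi> :: 'a \<Rightarrow> real \<Rightarrow> real.
           Ck_cylinder 4 A \<phi> \<and> is_solution A g X \<psi> \<phi>0 \<phi>1 \<phi> \<longrightarrow>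
           (SUP (x, t) \<in> UNIV \<times> {0..1}. ereal \<bar>laplacian A g (\<lambda>y. \<phi> y t) x\<bar>) +
           (SUP (x, t) \<in> UNIV \<times> {0..1}. ereal (grad_norm A g (\<lambda>y. \<phi> y t) x)) \<le> ereal C"
proof -
  interpret hermitian_manifold A g by (rule hermitian_manifold.intro) (rule assms(1))
  define n where "n = real CARD('n)"
  define a where "a = (\<lambda>x. - (n / 2) * X x)"
  have X: "smooth_fun A X" and phi: "smooth_fun A \<phi>0" "smooth_fun A \<phi>1"
    using assms(4,8,9) by (auto simp: torsion_function_def mixed_volume_forms_def)
  have sa: "smooth_fun A a" unfolding a_def by (rule smooth_fun_cmult[OF X])
  have pos: "0 < n - 2 * a x * \<phi>0 x + laplacian A g \<phi>0 x" "0 < n - 2 * a x * \<phi>1 x + laplacian A g \<phi>1 x" for x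
    using assms(10,11) by (simp_all add: a_def n_def)
  obtain Ba where Ba: "\<forall>x. \<bar>a x\<bar> \<le> Ba \<and> \<bar>laplacian A g a x\<bar> \<le> Ba \<and> grad_inner A g a a x \<le> Ba"
    using smooth_bounds[OF sa] by blast
  obtain Bp where Bp: "\<forall>x. \<bar>\<psi> x\<bar> \<le> Bp \<and> \<bar>laplacian A g \<psi> x\<bar> \<le> Bp \<and> grad_inner A g \<psi> \<psi> x \<le> Bp"
    using smooth_bounds[OF assms(6)] by blast
  obtain B0 where B0: "\<forall>x. \<bar>\<phi>0 x\<bar> \<le> B0 \<and> \<bar>laplacian A g \<phi>0 x\<bar> \<le> B0 \<and> grad_inner A g \<phi>0 \<phi>0 x \<le> B0"
    using smooth_bounds[OF phi(1)] by blast
  obtain B1 where B1: "\<forall>x. \<bar>\<phi>1 x\<bar> \<le> B1 \<and> \<bar>laplacian A g \<phi>1 x\<bar> \<le> B1 \<and> grad_inner A g \<phi>1 \<phi>1 x \<le> B1"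
    using smooth_bounds[OF phi(2)] by blast
  obtain c0 E0 where c0: "0 < c0" "\<forall>x. c0 \<le> n - 2 * a x * \<phi>0 x + laplacian A g \<phi>0 x \<and>
      n - 2 * a x * \<phi>0 x + laplacian A g \<phi>0 x \<le> E0"
    using smooth_lower_bounds[OF sa phi(1) pos(1)] by blast
  obtain c1 E1 where c1: "0 < c1" "\<forall>x. c1 \<le> n - 2 * a x * \<phi>1 x + laplacian A g \<phi>1 x \<and>
      n - 2 * a x * \<phi>1 x + laplacian A g \<phi>1 x \<le> E1"
    using smooth_lower_bounds[OF sa phi(2) pos(2)] by blast
  obtain \<psi>0 where psi0: "0 < \<psi>0" "\<forall>x. \<forall>t\<in>{0..1 :: real}. \<psi>0 \<le> \<psi> x"
    using continuous_extrema(2)[OF continuous_on_cylinder[OF Ck_closed_space[OF assms(6)]]] assms(7) by blast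
  have psi0': "\<psi>0 \<le> \<psi> x" for x using bspec[OF spec[OF psi0(2)], of 0 x] by simp
  define B where "B = max (max Ba Bp) (max (max B0 B1) (max E0 E1))"
  have le: "Ba \<le> B" "Bp \<le> B" "B0 \<le> B" "B1 \<le> B" "E0 \<le> B" "E1 \<le> B" by (auto simp: B_def)
  obtain K where K: "diffusion_cylinder Ck_int (laplacian A g) (grad_inner A g) K"
    using diffusion_cylinder_exists by blast
  interpret diffusion_cylinder Ck_int "laplacian A g" "grad_inner A g" K by (rule K)
  have "\<exists>M1 M2. \<forall>u. mixed_geodesic Ck_int (laplacian A g) (grad_inner A g) K n a \<psi> u
      \<and> (\<forall>x. u x 0 = \<phi>0 x \<and> u x 1 = \<phi>1 x) \<longrightarrow>
    (\<forall>x. \<forall>t\<in>{0..1}. \<bar>laplacian A g (\<lambda>y. u y t) x\<bar> \<le> M1 \<and> grad_inner A g (\<lambda>y. u y t) (\<lambda>y. u y t) x \<le> M2)"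
  proof (rule a_priori_estimate[where \<Psi> = Bp and abar = "max 1 Ba" and c = "min c0 c1" and B = B])
    show "0 < \<psi>0" by (rule psi0(1))
    show "\<psi>0 \<le> \<psi> x" for x by (rule psi0')
    show "\<psi> x \<le> Bp" for x using Bp[rule_format, of x] by linarith
    show "1 \<le> max 1 Ba" by simp
    show "a x \<le> max 1 Ba" for x using Ba[rule_format, of x] by linarith
    show "0 < min c0 c1" using c0(1) c1(1) by simp
    show "min c0 c1 \<le> n - 2 * a x * \<phi>0 x + laplacian A g \<phi>0 x" for x using c0(2)[rule_format, of x] by linarith
    show "min c0 c1 \<le> n - 2 * a x * \<phi>1 x + laplacian A g \<phi>1 x" for x using c1(2)[rule_format, of x] by linarith
    show "\<bar>\<phi>0 x\<bar> \<le> B" "grad_inner A g \<phi>0 \<phi>0 x \<le> B" for x using B0[rule_format, of x] le by linarith+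
    show "\<bar>\<phi>1 x\<bar> \<le> B" "grad_inner A g \<phi>1 \<phi>1 x \<le> B" for x using B1[rule_format, of x] le by linarith+
    show "\<bar>laplacian A g \<psi> x\<bar> \<le> B" "grad_inner A g \<psi> \<psi> x \<le> B" for x using Bp[rule_format, of x] le by linarith+
    show "\<bar>laplacian A g a x\<bar> \<le> B" "grad_inner A g a a x \<le> B" for x using Ba[rule_format, of x] le by linarith+
    show "n - 2 * a x * \<phi>0 x + laplacian A g \<phi>0 x \<le> B" for x using c0(2)[rule_format, of x] le by linarith
    show "n - 2 * a x * \<phi>1 x + laplacian A g \<phi>1 x \<le> B" for x using c1(2)[rule_format, of x] le by linarith
    show "Ck_int k (\<lambda>x t. \<phi>0 x)" "Ck_int k (\<lambda>x t. \<phi>1 x)" for k by (rule Ck_int_space; fact phi)+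
  qed
  then obtain M1 M2 where M: "\<And>u x t. mixed_geodesic Ck_int (laplacian A g) (grad_inner A g) K n a \<psi> u \<Longrightarrow>
      (\<forall>x. u x 0 = \<phi>0 x \<and> u x 1 = \<phi>1 x) \<Longrightarrow> t \<in> {0..1} \<Longrightarrow>
      \<bar>laplacian A g (\<lambda>y. u y t) x\<bar> \<le> M1 \<and> grad_inner A g (\<lambda>y. u y t) (\<lambda>y. u y t) x \<le> M2"
    by blast
  show ?thesis
  proof (intro exI[of _ "M1 + sqrt M2"] allI impI, elim conjE)
    fix \<phi> :: "'a \<Rightarrow> real \<Rightarrow> real"
    assume C: "Ck_cylinder 4 A \<phi>" and sol: "is_solution A g X \<psi> \<phi>0 \<phi>1 \<phi>"
    have geo: "mixed_geodesic Ck_int (laplacian A g) (grad_inner A g) K n a \<psi> \<phi>"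
      unfolding a_def n_def
      by (rule mixed_geodesic_solution[OF K X _ assms(6) _ C sol]) (use assms(5,7,10,11) in auto)
    have bd: "\<forall>x. \<phi> x 0 = \<phi>0 x \<and> \<phi> x 1 = \<phi>1 x" using sol by (simp add: is_solution_def Let_def)
    have "(SUP (x, t) \<in> UNIV \<times> {0..1}. ereal \<bar>laplacian A g (\<lambda>y. \<phi> y t) x\<bar>) \<le> ereal M1"
      by (rule SUP_least) (use M[OF geo bd] in auto)
    moreover have "(SUP (x, t) \<in> UNIV \<times> {0..1}. ereal (grad_norm A g (\<lambda>y. \<phi> y t) x)) \<le> ereal (sqrt M2)"
      by (rule SUP_least) (use M[OF geo bd] in \<open>auto simp: grad_norm_def grad_norm_sq_eq\<close>)
    ultimately show "(SUP (x, t) \<in> UNIV \<times> {0..1}. ereal \<bar>laplacian A g (\<lambda>y. \<phi> y t) x\<bar>) +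
        (SUP (x, t) \<in> UNIV \<times> {0..1}. ereal (grad_norm A g (\<lambda>y. \<phi> y t) x)) \<le> ereal (M1 + sqrt M2)"
      using add_mono by fastforce
  qed
qed

end
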